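(* Let $H$ be a graph such that either (i) $H$ is a ladder of length at least $71$, or (ii) $H$ is a subcubic tree (a tree of maximum degree at most $3$) of pathwidth at least $19$. Then the family of $H$-expansions does not have the edge-Erdős–Pósa property.
   Context: A graph is an $H$-expansion if the graph $H$ is a minor of it. A family $\mathcal F$ of graphs has the edge-Erdős–Pósa property if there exists a function $f\colon\mathbb N\to\mathbb R$ such that for every graph $G$ and every integer $k$, either there are $k$ pairwise edge-disjoint subgraphs of $G$ each isomorphic to a member of $\mathcal F$, or there is a set $X$ of at most $f(k)$ edges of $G$ that meets (contains an edge of) every subgraph of $G$ isomorphic to a member of $\mathcal F$. A ladder of length $\ell\in\mathbb N$ is a graph with vertex set $\{u_i,v_i : i\in[\ell]\}$ and edge set $\{u_iu_{i+1},v_iv_{i+1} : i\in[\ell-1]\}\cup\{u_iv_i : i\in[\ell]\}$; its length is the number $\ell$ of its rungs $u_iv_i$. All graphs are finite. *)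

theory Defs
  imports Complex_Main
begin

text \<open>Finite simple undirected graphs; an edge is the two-element set of its ends.\<close>

record 'a ugraph =
  verts :: "'a set"
  edges :: "'a set set"

definition graph :: "'a ugraph \<Rightarrow> bool" where
  "graph G \<longleftrightarrow> finite (verts G) \<and> (\<forall>e\<in>edges G. e \<subseteq> verts G \<and> card e = 2)"

definition subgraph :: "'a ugraph \<Rightarrow> 'a ugraph \<Rightarrow> bool" where
  "subgraph S G \<longleftrightarrow> graph S \<and> verts S \<subseteq> verts G \<and> edges S \<subseteq> edges G"

definition isomorphic :: "'a ugraph \<Rightarrow> 'b ugraph \<Rightarrow> bool" where
  "isomorphic G H \<longleftrightarrow>
     (\<exists>f. bij_betw f (verts G) (verts H) \<and> edges H = (\<lambda>e. f ` e) ` edges G)"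

definition induced_subgraph :: "'a ugraph \<Rightarrow> 'a set \<Rightarrow> 'a ugraph" where
  "induced_subgraph G U = \<lparr>verts = verts G \<inter> U, edges = {e \<in> edges G. e \<subseteq> U}\<rparr>"

definition degree :: "'a ugraph \<Rightarrow> 'a \<Rightarrow> nat" where
  "degree G v = card {e \<in> edges G. v \<in> e}"

definition subcubic :: "'a ugraph \<Rightarrow> bool" where
  "subcubic G \<longleftrightarrow> (\<forall>v\<in>verts G. degree G v \<le> 3)"

definition connected_graph :: "'a ugraph \<Rightarrow> bool" where
  "connected_graph G \<longleftrightarrow>
     verts G \<noteq> {} \<and>
     (\<forall>u\<in>verts G. \<forall>v\<in>verts G. (u, v) \<in> {(x, y). {x, y} \<in> edges G}\<^sup>*)"

text \<open>A cycle is given by the list of its distinct vertices, in cyclic order.\<close>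

definition is_cycle :: "'a ugraph \<Rightarrow> 'a list \<Rightarrow> bool" where
  "is_cycle G c \<longleftrightarrow>
     length c \<ge> 3 \<and> distinct c \<and>
     (\<forall>i < length c. {c ! i, c ! (Suc i mod length c)} \<in> edges G)"

definition tree :: "'a ugraph \<Rightarrow> bool" where
  "tree G \<longleftrightarrow> graph G \<and> connected_graph G \<and> \<not> (\<exists>c. is_cycle G c)"

definition is_ladder :: "nat \<Rightarrow> 'a ugraph \<Rightarrow> bool" where
  "is_ladder l G \<longleftrightarrow>
     (\<exists>u v. inj_on u {1..l} \<and> inj_on v {1..l} \<and> u ` {1..l} \<inter> v ` {1..l} = {} \<and>
        verts G = u ` {1..l} \<union> v ` {1..l} \<and>
        edges G = {{u i, u (i + 1)} | i. i \<in> {1..<l}} \<union>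
                  {{v i, v (i + 1)} | i. i \<in> {1..<l}} \<union>
                  {{u i, v i} | i. i \<in> {1..l}})"

definition path_decomposition :: "'a ugraph \<Rightarrow> 'a set list \<Rightarrow> bool" where
  "path_decomposition G B \<longleftrightarrow>
     B \<noteq> [] \<and> \<Union> (set B) = verts G \<and>
     (\<forall>e\<in>edges G. \<exists>i < length B. e \<subseteq> B ! i) \<and>
     (\<forall>i j k. i \<le> j \<and> j \<le> k \<and> k < length B \<longrightarrow> B ! i \<inter> B ! k \<subseteq> B ! j)"

text \<open>Only for the graph without vertices does the truncated subtraction
  differ from the usual convention (width \<open>0\<close> instead of \<open>-1\<close>).\<close>

definition decomposition_width :: "'a set list \<Rightarrow> nat" where
  "decomposition_width B = Max (card ` set B) - 1"

definition pathwidth :: "'a ugraph \<Rightarrow> nat" where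
  "pathwidth G = (LEAST w. \<exists>B. path_decomposition G B \<and> decomposition_width B = w)"

text \<open>\<open>H\<close> is a minor of \<open>G\<close>: every vertex \<open>x\<close> of \<open>H\<close> has a branch set \<open>\<beta> x\<close>.\<close>

definition minor :: "'a ugraph \<Rightarrow> 'b ugraph \<Rightarrow> bool" where
  "minor H G \<longleftrightarrow>
     (\<exists>\<beta>. (\<forall>x\<in>verts H. \<beta> x \<subseteq> verts G \<and> connected_graph (induced_subgraph G (\<beta> x))) \<and>
          (\<forall>x\<in>verts H. \<forall>y\<in>verts H. x \<noteq> y \<longrightarrow> \<beta> x \<inter> \<beta> y = {}) \<and>
          (\<forall>x y. {x, y} \<in> edges H \<longrightarrow> (\<exists>a\<in>\<beta> x. \<exists>b\<in>\<beta> y. {a, b} \<in> edges G)))"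

text \<open>Every finite graph has an isomorphic copy with vertices in \<^typ>\<open>nat\<close>, so
  families and host graphs are taken over this type.\<close>

definition expansions :: "'a ugraph \<Rightarrow> nat ugraph set" where
  "expansions H = {G. graph G \<and> minor H G}"

definition member_subgraph :: "nat ugraph set \<Rightarrow> nat ugraph \<Rightarrow> nat ugraph \<Rightarrow> bool" where
  "member_subgraph \<F> G S \<longleftrightarrow> subgraph S G \<and> (\<exists>F\<in>\<F>. isomorphic S F)"

definition edge_erdos_posa :: "nat ugraph set \<Rightarrow> bool" where
  "edge_erdos_posa \<F> \<longleftrightarrow>
     (\<exists>f :: nat \<Rightarrow> real. \<forall>G k. graph G \<longrightarrow>
        (\<exists>\<S>. finite \<S> \<and> card \<S> = k \<and> (\<forall>S\<in>\<S>. member_subgraph \<F> G S) \<and>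
             (\<forall>S\<in>\<S>. \<forall>T\<in>\<S>. S \<noteq> T \<longrightarrow> edges S \<inter> edges T = {})) \<or>
        (\<exists>X. X \<subseteq> edges G \<and> real (card X) \<le> f k \<and>
             (\<forall>S. member_subgraph \<F> G S \<longrightarrow> X \<inter> edges S \<noteq> {})))"

end

theory Submission
  imports Defs
begin

text \<open>Fix two edges of \<open>H\<close>. The host graph consists of many copies of \<open>H\<close> without these edges, glued
  together at the set \<open>Q\<close> of vertices of degree at least three, and of a wall that offers a substitute
  for the first edge between its terminals \<open>TA\<close>, \<open>TB\<close> and one for the second between \<open>Z 0\<close>, \<open>Z r\<close>.
  Using both substitutes takes a linkage of the wall: two disjoint connected subgraphs, one joining \<open>TA\<close>
  to \<open>TB\<close> and one joining \<open>Z 0\<close> to \<open>Z r\<close>. The first must follow a whole row of some layer, and the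
  second part of any other linkage has to cross that layer, so two linkages share an edge. On the other
  hand, deleting few edges leaves a copy of \<open>H\<close> and a linkage intact. It remains to choose the two
  edges such that every expansion of \<open>H\<close> in the host graph uses a linkage. All copies collapse to
  one when \<open>H\<close> is contracted onto \<open>Q\<close>, so this is a statement about models of a single graph.

  In a ladder the two edges lie on the same rail, \<open>27\<close> columns from its ends. The wall contains no ladder
  with six columns, so a long ladder has to leave the wall, and counting columns shows that it visits
  both outer parts of the original ladder; the only way to do so is along a linkage.

  A tree of large pathwidth has a vertex \<open>h\<close> with three branches that contain high ternary trees. The
  wall contains no ternary tree of height six, so packings of such trees in branches serve as a measure.
  One edge joins \<open>h\<close> to a branch, and the other cuts off a light part of a branch with the smallest
  measure. Counting the parts of the model that carry the measure forces it to reconnect both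
  edges through the wall.\<close>

section \<open>Connected sets of vertices\<close>

text \<open>The property fails already for \<open>k = 2\<close>. The obstacle is that an expansion
  of H need not follow one copy: it may be scattered over many of them and use the wall in its own
  way. Two facts tame this. Outside \<open>Q\<close> and the wall the host has degree at most two,
  so a branch set of a vertex of \<open>Q\<close> must contain a shared vertex or a wall vertex;
  this makes the collapse onto one copy possible. And the images of a connected set and of its
  connected complement are again disjoint and connected, so behind a single gate vertex such sets
  cannot become more numerous; for trees this replaces locating individual vertices of H.

  Constants: an outer part of the ladder has 27 = 6 + 20 + 1 columns, one more than can contain
  gates or disappear in the wall, and the contraction consumes one column at each end. For trees,
  six is the bag size of a path decomposition of the wall, two further levels give nine disjoint
  trees where five suffice, and one level is lost on passing to \<open>Q\<close>. Without a vertex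
  with three branches of the resulting height nine, H would have pathwidth at most 10.\<close>

definition conn :: "('v \<Rightarrow> 'v \<Rightarrow> bool) \<Rightarrow> 'v set \<Rightarrow> bool" where
  "conn E U \<longleftrightarrow> U \<noteq> {} \<and>
     (\<forall>P. U \<inter> P \<noteq> {} \<longrightarrow> U - P \<noteq> {} \<longrightarrow> (\<exists>p\<in>U \<inter> P. \<exists>q\<in>U - P. E p q))"

definition adj :: "('v \<Rightarrow> 'v \<Rightarrow> bool) \<Rightarrow> 'v set \<Rightarrow> 'v set \<Rightarrow> bool" where
  "adj E A B \<longleftrightarrow> (\<exists>a\<in>A. \<exists>b\<in>B. E a b)"

lemma connI:
  assumes "U \<noteq> {}"
    and "\<And>P x y. x \<in> U \<Longrightarrow> x \<in> P \<Longrightarrow> y \<in> U \<Longrightarrow> y \<notin> P \<Longrightarrow> \<exists>p\<in>U \<inter> P. \<exists>q\<in>U - P. E p q"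
  shows "conn E U"
  unfolding conn_def using assms by blast

lemma conn_nonempty: "conn E U \<Longrightarrow> U \<noteq> {}"
  unfolding conn_def by blast

text \<open>Almost every argument below uses connectedness through cuts instead of paths: the set
  \<open>P\<close> is chosen so that the crossing edge is the wanted one. The complement of
  \<open>P\<close> yields a crossing edge in the other direction.\<close>

lemma conn_cut:
  assumes "conn E U" "x \<in> U" "x \<in> P" "y \<in> U" "y \<notin> P"
  obtains p q where "p \<in> U" "p \<in> P" "q \<in> U" "q \<notin> P" "E p q"
proof -
  have "U \<inter> P \<noteq> {}" "U - P \<noteq> {}" using assms by auto
  then show ?thesis using assms(1) that unfolding conn_def by blast
qed

lemma conn_singleton [simp]: "conn E {x}"
  by (rule connI) auto

lemma conn_mono:
  assumes "conn E U" "\<And>x y. x \<in> U \<Longrightarrow> y \<in> U \<Longrightarrow> E x y \<Longrightarrow> F x y"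
  shows "conn F U"
proof (rule connI)
  show "U \<noteq> {}" using assms(1) by (rule conn_nonempty)
next
  fix P x y assume "x \<in> U" "x \<in> P" "y \<in> U" "y \<notin> P"
  then obtain p q where "p \<in> U" "p \<in> P" "q \<in> U" "q \<notin> P" "E p q"
    using conn_cut[OF assms(1)] by metis
  then show "\<exists>p\<in>U \<inter> P. \<exists>q\<in>U - P. F p q" using assms(2) by blast
qed

lemma adj_sym: "symp E \<Longrightarrow> adj E A B \<Longrightarrow> adj E B A"
  unfolding adj_def symp_def by blast

lemma adj_mono: "adj E A B \<Longrightarrow> A \<subseteq> A' \<Longrightarrow> B \<subseteq> B' \<Longrightarrow> adj E A' B'"
  unfolding adj_def by blast

text \<open>A cut that splits no member induces a cut of the index set, and then an adjacency
  between members on different sides crosses it.\<close>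

lemma conn_UN:
  assumes I: "conn R I" and f: "\<And>i. i \<in> I \<Longrightarrow> conn E (f i)"
    and a: "\<And>i j. i \<in> I \<Longrightarrow> j \<in> I \<Longrightarrow> R i j \<Longrightarrow> adj E (f i) (f j)"
  shows "conn E (\<Union>i\<in>I. f i)"
proof (rule connI)
  obtain i where "i \<in> I" using conn_nonempty[OF I] by auto
  then show "(\<Union>i\<in>I. f i) \<noteq> {}" using conn_nonempty[OF f] by blast
next
  fix P x y assume xy: "x \<in> (\<Union>i\<in>I. f i)" "x \<in> P" "y \<in> (\<Union>i\<in>I. f i)" "y \<notin> P"
  obtain i j where ij: "i \<in> I" "x \<in> f i" "j \<in> I" "y \<in> f j" using xy by auto
  show "\<exists>p\<in>(\<Union>i\<in>I. f i) \<inter> P. \<exists>q\<in>(\<Union>i\<in>I. f i) - P. E p q"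
  proof (cases "\<exists>k\<in>I. \<exists>z\<in>f k. \<exists>w\<in>f k. z \<in> P \<and> w \<notin> P")
    case True
    then obtain k z w where k: "k \<in> I" "z \<in> f k" "w \<in> f k" "z \<in> P" "w \<notin> P" by blast
    obtain p q where "p \<in> f k" "p \<in> P" "q \<in> f k" "q \<notin> P" "E p q"
      using conn_cut[OF f[OF k(1)] k(2) k(4) k(3) k(5)] by metis
    then show ?thesis using k(1) by blast
  next
    case False
    have i: "i \<in> {k. f k \<subseteq> P}" using False ij xy by blast
    have j: "j \<notin> {k. f k \<subseteq> P}" using False ij xy by blast
    obtain k l where kl: "k \<in> I" "f k \<subseteq> P" "l \<in> I" "\<not> f l \<subseteq> P" "R k l"
      using conn_cut[OF I ij(1) i ij(3) j] by (metis mem_Collect_eq)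
    obtain p q where "p \<in> f k" "q \<in> f l" "E p q" using a[OF kl(1,3,5)] unfolding adj_def by blast
    moreover have "q \<notin> P" using False kl \<open>q \<in> f l\<close> by blast
    ultimately show ?thesis using kl by blast
  qed
qed

lemma conn_Un_adj:
  assumes "symp E" "conn E A" "conn E B" "adj E A B"
  shows "conn E (A \<union> B)"
proof (rule connI)
  show "A \<union> B \<noteq> {}" using conn_nonempty[OF assms(2)] by simp
next
  fix P x y assume xy: "x \<in> A \<union> B" "x \<in> P" "y \<in> A \<union> B" "y \<notin> P"
  obtain a b where ab: "a \<in> A" "b \<in> B" "E a b" "E b a"
    using assms(1,4) unfolding adj_def by (meson sympD)
  show "\<exists>p\<in>(A \<union> B) \<inter> P. \<exists>q\<in>A \<union> B - P. E p q"
  proof (rule ccontr)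
    assume n: "\<not> ?thesis"
    have A: "u \<in> P \<longleftrightarrow> v \<in> P" if "u \<in> A" "v \<in> A" for u v
      using conn_cut[OF assms(2), of u P v] conn_cut[OF assms(2), of v P u] that n by (metis DiffI IntI UnI1)
    have B: "u \<in> P \<longleftrightarrow> v \<in> P" if "u \<in> B" "v \<in> B" for u v
      using conn_cut[OF assms(3), of u P v] conn_cut[OF assms(3), of v P u] that n by (metis DiffI IntI UnI2)
    have "a \<in> P \<longleftrightarrow> b \<in> P" using ab n by blast
    then show False using xy A B ab(1,2) by (metis UnE)
  qed
qed

lemma conn_star:
  assumes "symp E" "x \<in> U" and "\<And>w. w \<in> U \<Longrightarrow> \<exists>C. C \<subseteq> U \<and> conn E C \<and> x \<in> C \<and> w \<in> C"
  shows "conn E U"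
proof (rule connI)
  show "U \<noteq> {}" using assms(2) by blast
next
  fix P y z assume yz: "y \<in> U" "y \<in> P" "z \<in> U" "z \<notin> P"
  show "\<exists>p\<in>U \<inter> P. \<exists>q\<in>U - P. E p q"
  proof (cases "x \<in> P")
    case True
    obtain C where C: "C \<subseteq> U" "conn E C" "x \<in> C" "z \<in> C" using assms(3)[OF yz(3)] by blast
    obtain p q where "p \<in> C" "p \<in> P" "q \<in> C" "q \<notin> P" "E p q" by (rule conn_cut[OF C(2,3) True C(4) yz(4)])
    then show ?thesis using C(1) by blast
  next
    case False
    obtain C where C: "C \<subseteq> U" "conn E C" "x \<in> C" "y \<in> C" using assms(3)[OF yz(1)] by blast
    obtain p q where "p \<in> C" "p \<in> P" "q \<in> C" "q \<notin> P" "E p q" by (rule conn_cut[OF C(2,4) yz(2) C(3) False])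
    then show ?thesis using C(1) by blast
  qed
qed

lemma conn_Un_overlap:
  assumes "symp E" "conn E A" "conn E B" "A \<inter> B \<noteq> {}"
  shows "conn E (A \<union> B)"
proof -
  obtain x where x: "x \<in> A" "x \<in> B" using assms(4) by auto
  show ?thesis by (rule conn_star[OF assms(1), of x]) (use x assms in blast)+
qed

lemma conn_insert:
  assumes "symp E" "conn E A" "a \<in> A" "E a x \<or> E x a"
  shows "conn E (insert x A)"
proof -
  have "adj E {x} A" using assms(1,3,4) unfolding adj_def symp_def by blast
  then have "conn E ({x} \<union> A)" by (rule conn_Un_adj[OF assms(1) conn_singleton assms(2)])
  then show ?thesis by simp
qed

lemma conn_hub:
  assumes "symp E" "conn E A" "\<And>x. x \<in> X \<Longrightarrow> \<exists>a\<in>A. E a x \<or> E x a"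
  shows "conn E (A \<union> X)"
proof -
  obtain a where a: "a \<in> A" using conn_nonempty[OF assms(2)] by auto
  show ?thesis
  proof (rule conn_star[OF assms(1), of a])
    fix w assume "w \<in> A \<union> X"
    then show "\<exists>C\<subseteq>A \<union> X. conn E C \<and> a \<in> C \<and> w \<in> C"
      using assms(2) a assms(3)[of w] conn_insert[OF assms(1,2), of _ w] by blast
  qed (use a in auto)
qed

text \<open>A cut of \<open>U - P\<close> extends to a cut of \<open>U\<close> by placing
  \<open>P\<close> on the side of \<open>z\<close>. The crossing edge cannot touch \<open>P\<close>,
  whose only contact in \<open>U - P\<close> is \<open>z\<close>. This rule trims away whatever
  hangs behind a single vertex.\<close>

lemma conn_retract:
  assumes E: "symp E" and U: "conn E U" and ne: "U - P \<noteq> {}"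
    and z: "\<And>p q. p \<in> U \<Longrightarrow> p \<in> P \<Longrightarrow> q \<in> U \<Longrightarrow> q \<notin> P \<Longrightarrow> E p q \<Longrightarrow> q = z"
  shows "conn E (U - P)"
proof (rule connI)
  fix R x y assume xy: "x \<in> U - P" "x \<in> R" "y \<in> U - P" "y \<notin> R"
  show "\<exists>p\<in>(U - P) \<inter> R. \<exists>q\<in>U - P - R. E p q"
  proof (cases "z \<in> R")
    case True
    have yy: "y \<in> U - P - R" "x \<notin> U - P - R" using xy by auto
    obtain p q where pq: "p \<in> U - P - R" "q \<in> U" "q \<notin> U - P - R" "E p q"
      using conn_cut[OF U _ yy(1) _ yy(2)] xy by (metis DiffD1)
    have "E q p" using pq E by (meson sympD)
    have "q \<notin> P" using z[of q p] \<open>E q p\<close> pq True by blast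
    then show ?thesis using pq \<open>E q p\<close> by blast
  next
    case False
    have yy: "x \<in> (U - P) \<inter> R" "y \<notin> (U - P) \<inter> R" using xy by auto
    obtain p q where pq: "p \<in> (U - P) \<inter> R" "q \<in> U" "q \<notin> (U - P) \<inter> R" "E p q"
      using conn_cut[OF U _ yy(1) _ yy(2)] xy by (metis DiffD1)
    have "E q p" using pq E by (meson sympD)
    have "q \<notin> P" using z[of q p] \<open>E q p\<close> pq False by blast
    then show ?thesis using pq by blast
  qed
qed (rule ne)

lemma conn_subset_of:
  assumes "conn E U" "x \<in> U" "x \<in> P" "\<And>p q. p \<in> U \<Longrightarrow> p \<in> P \<Longrightarrow> q \<in> U \<Longrightarrow> E p q \<Longrightarrow> q \<in> P"
  shows "U \<subseteq> P"
  using conn_cut[OF assms(1,2,3)] assms(4) by (metis subsetI)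

lemma conn_const:
  assumes "conn E U" "\<And>p q. p \<in> U \<Longrightarrow> q \<in> U \<Longrightarrow> E p q \<Longrightarrow> f p = f q" "x \<in> U" "y \<in> U"
  shows "f x = f y"
proof -
  have "U \<subseteq> {z. f z = f x}"
    by (rule conn_subset_of[OF assms(1,3)]) (use assms(2) in force)+
  then show ?thesis using assms(4) by auto
qed

section \<open>Components of induced subgraphs\<close>

definition comp_of :: "('v \<Rightarrow> 'v \<Rightarrow> bool) \<Rightarrow> 'v set \<Rightarrow> 'v \<Rightarrow> 'v set" where
  "comp_of E U x = \<Union>{C. C \<subseteq> U \<and> conn E C \<and> x \<in> C}"

lemma comp_of_subset: "comp_of E U x \<subseteq> U"
  unfolding comp_of_def by blast

lemma comp_of_self: "x \<in> U \<Longrightarrow> x \<in> comp_of E U x"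
  unfolding comp_of_def using conn_singleton[of E x] by blast

lemma comp_of_max: "conn E C \<Longrightarrow> C \<subseteq> U \<Longrightarrow> x \<in> C \<Longrightarrow> C \<subseteq> comp_of E U x"
  unfolding comp_of_def by blast

lemma conn_comp_of: "symp E \<Longrightarrow> x \<in> U \<Longrightarrow> conn E (comp_of E U x)"
proof (rule conn_star[of E x])
  fix w assume "w \<in> comp_of E U x"
  then obtain C where "C \<subseteq> U" "conn E C" "x \<in> C" "w \<in> C" unfolding comp_of_def by blast
  then show "\<exists>C\<subseteq>comp_of E U x. conn E C \<and> x \<in> C \<and> w \<in> C" using comp_of_max by metis
qed (auto intro: comp_of_self)

lemma comp_of_closed:
  assumes "symp E" "x \<in> U" "y \<in> comp_of E U x" "z \<in> U" "E y z"
  shows "z \<in> comp_of E U x"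
proof -
  have "conn E (insert z (comp_of E U x))"
    by (rule conn_insert[OF assms(1) conn_comp_of[OF assms(1,2)] assms(3)]) (use assms(5) in blast)
  then show ?thesis
    using comp_of_max[of E "insert z (comp_of E U x)" U x] assms comp_of_subset[of E U x] comp_of_self[OF assms(2)]
    by blast
qed

lemma comp_of_eq:
  assumes "symp E" "x \<in> U" "y \<in> comp_of E U x"
  shows "comp_of E U y = comp_of E U x"
proof
  have y: "y \<in> U" using assms comp_of_subset by fast
  have c: "conn E (comp_of E U x \<union> comp_of E U y)"
    using conn_Un_overlap[OF assms(1) conn_comp_of[OF assms(1,2)] conn_comp_of[OF assms(1) y]]
      assms(3) comp_of_self[OF y] by blast
  have s: "comp_of E U x \<union> comp_of E U y \<subseteq> U" by (simp add: comp_of_subset)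
  show "comp_of E U y \<subseteq> comp_of E U x" using comp_of_max[OF c s, of x] comp_of_self[OF assms(2)] by blast
  show "comp_of E U x \<subseteq> comp_of E U y" using comp_of_max[OF c s, of y] comp_of_self[OF y] by blast
qed

section \<open>Minor models\<close>

definition model :: "'k set \<Rightarrow> ('k \<Rightarrow> 'k \<Rightarrow> bool) \<Rightarrow> ('v \<Rightarrow> 'v \<Rightarrow> bool) \<Rightarrow> ('k \<Rightarrow> 'v set) \<Rightarrow> bool" where
  "model V R E \<gamma> \<longleftrightarrow> (\<forall>x\<in>V. conn E (\<gamma> x)) \<and>
     (\<forall>x\<in>V. \<forall>y\<in>V. x \<noteq> y \<longrightarrow> \<gamma> x \<inter> \<gamma> y = {}) \<and>
     (\<forall>x\<in>V. \<forall>y\<in>V. R x y \<longrightarrow> adj E (\<gamma> x) (\<gamma> y))"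

lemma model_conn: "model V R E \<gamma> \<Longrightarrow> x \<in> V \<Longrightarrow> conn E (\<gamma> x)"
  unfolding model_def by blast

lemma model_disj: "model V R E \<gamma> \<Longrightarrow> x \<in> V \<Longrightarrow> y \<in> V \<Longrightarrow> z \<in> \<gamma> x \<Longrightarrow> z \<in> \<gamma> y \<Longrightarrow> x = y"
  unfolding model_def by blast

lemma model_adj: "model V R E \<gamma> \<Longrightarrow> x \<in> V \<Longrightarrow> y \<in> V \<Longrightarrow> R x y \<Longrightarrow> adj E (\<gamma> x) (\<gamma> y)"
  unfolding model_def by blast

lemma model_subset: "model V R E \<gamma> \<Longrightarrow> U \<subseteq> V \<Longrightarrow> model U R E \<gamma>"
  unfolding model_def by (meson subsetD)

lemma model_conn_UN:
  assumes "model V R E \<gamma>" "U \<subseteq> V" "conn R U"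
  shows "conn E (\<Union>x\<in>U. \<gamma> x)"
proof (rule conn_UN[OF assms(3)])
  fix i assume "i \<in> U"
  then show "conn E (\<gamma> i)" using model_conn[OF assms(1), of i] assms(2) by blast
next
  fix i j assume "i \<in> U" "j \<in> U" "R i j"
  then show "adj E (\<gamma> i) (\<gamma> j)" using model_adj[OF assms(1), of i j] assms(2) by blast
qed

lemma model_UN_disj:
  assumes "model V R E \<gamma>" "A \<subseteq> V" "B \<subseteq> V" "A \<inter> B = {}"
  shows "(\<Union>x\<in>A. \<gamma> x) \<inter> (\<Union>x\<in>B. \<gamma> x) = {}"
  using assms model_disj[OF assms(1)] by blast

lemma model_UN_adj:
  assumes "model V R E \<gamma>" "A \<subseteq> V" "B \<subseteq> V" "adj R A B"
  shows "adj E (\<Union>x\<in>A. \<gamma> x) (\<Union>x\<in>B. \<gamma> x)"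
proof -
  obtain a b where "a \<in> A" "b \<in> B" "R a b" using assms(4) unfolding adj_def by blast
  moreover from this have "adj E (\<gamma> a) (\<gamma> b)" using model_adj[OF assms(1), of a b] assms(2,3) by blast
  ultimately show ?thesis unfolding adj_def by blast
qed

text \<open>Grow \<open>D\<close> along an edge \<open>p q\<close> that leaves it. This edge is used
  up, and \<open>q\<close> has at most one neighbour besides \<open>p\<close>, so the number of
  leaving edges does not increase.\<close>

lemma out_edges_grow:
  assumes E: "symp E" and C: "conn E C" "finite C"
    and d: "\<And>w. w \<in> C \<Longrightarrow> finite {y. E w y} \<and> card {y. E w y} \<le> 2"
    and n: "n < card C"
  shows "\<exists>D\<subseteq>C. card D = Suc n \<and> finite {(p, q). p \<in> D \<and> q \<notin> D \<and> E p q} \<and>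
           card {(p, q). p \<in> D \<and> q \<notin> D \<and> E p q} \<le> 2"
  using n
proof (induction n)
  case 0
  obtain x where x: "x \<in> C" using conn_nonempty[OF C(1)] by auto
  have "{(p, q). p \<in> {x} \<and> q \<notin> {x} \<and> E p q} \<subseteq> Pair x ` {y. E x y}" by auto
  moreover have "card (Pair x ` {y. E x y}) \<le> 2" using d[OF x] card_image_le[of "{y. E x y}" "Pair x"] by linarith
  ultimately have "finite {(p, q). p \<in> {x} \<and> q \<notin> {x} \<and> E p q} \<and> card {(p, q). p \<in> {x} \<and> q \<notin> {x} \<and> E p q} \<le> 2"
    using d[OF x] by (meson card_mono finite_imageI le_trans rev_finite_subset)
  then show ?case using x by (intro exI[of _ "{x}"]) auto
next
  case (Suc n)
  then obtain D where D: "D \<subseteq> C" "card D = Suc n" "finite {(p, q). p \<in> D \<and> q \<notin> D \<and> E p q}"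
      "card {(p, q). p \<in> D \<and> q \<notin> D \<and> E p q} \<le> 2" by auto
  obtain x where x: "x \<in> D" using D(2) by fastforce
  have "D \<noteq> C" using D(2) Suc.prems by auto
  then obtain y where y: "y \<in> C" "y \<notin> D" using D(1) by auto
  obtain p q where pq: "p \<in> C" "p \<in> D" "q \<in> C" "q \<notin> D" "E p q"
    using conn_cut[OF C(1) _ x y] D(1) x by blast
  let ?O = "{(p, q). p \<in> D \<and> q \<notin> D \<and> E p q}"
  let ?N = "Pair q ` ({y. E q y} - {p})"
  have qp: "p \<in> {y. E q y}" using pq(5) E by (auto dest: sympD)
  have sub: "{(p', q'). p' \<in> insert q D \<and> q' \<notin> insert q D \<and> E p' q'} \<subseteq> (?O - {(p, q)}) \<union> ?N"
    using pq by auto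
  have cN: "card ?N \<le> 1"
  proof -
    have "card ({y. E q y} - {p}) \<le> 1" using d[OF pq(3)] card_Diff_singleton[OF qp] by linarith
    then show ?thesis using d[OF pq(3)] card_image_le[of "{y. E q y} - {p}" "Pair q"] by simp
  qed
  have "card (?O - {(p, q)}) \<le> 1" using D(3,4) pq by (simp add: card_Diff_singleton)
  then have c2: "card ((?O - {(p, q)}) \<union> ?N) \<le> 2"
    using cN card_Un_le[of "?O - {(p, q)}" ?N] by linarith
  have f2: "finite ((?O - {(p, q)}) \<union> ?N)" using D(3) d[OF pq(3)] by blast
  have "finite D" using D(1) C(2) finite_subset by blast
  then have "card (insert q D) = Suc (Suc n)" using D(2) pq(4) by simp
  moreover have "insert q D \<subseteq> C" using D(1) pq(3) by simp
  ultimately show ?case using sub c2 f2 by (meson card_mono finite_subset le_trans)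
qed

lemma out_edges_le_2:
  assumes E: "symp E" and C: "conn E C" "finite C"
    and d: "\<And>w. w \<in> C \<Longrightarrow> finite {y. E w y} \<and> card {y. E w y} \<le> 2"
  shows "finite {(p, q). p \<in> C \<and> q \<notin> C \<and> E p q} \<and> card {(p, q). p \<in> C \<and> q \<notin> C \<and> E p q} \<le> 2"
proof -
  have "card C - 1 < card C" using C conn_nonempty[OF C(1)] by (simp add: card_gt_0_iff)
  then obtain D where D: "D \<subseteq> C" "card D = Suc (card C - 1)" "finite {(p, q). p \<in> D \<and> q \<notin> D \<and> E p q}"
       "card {(p, q). p \<in> D \<and> q \<notin> D \<and> E p q} \<le> 2" using out_edges_grow[OF assms] by blast
  have "D = C" using D(1,2) C \<open>card C - 1 < card C\<close> by (metis Suc_pred' card_subset_eq gr_implies_not0 neq0_conv)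
  then show ?thesis using D by blast
qed

text \<open>Used in two ways: a branch set with three neighbouring branch sets contains a vertex of
  degree three, and a component of vertices of degree at most two is attached to the rest by at most
  two edges.\<close>

lemma no_three_out_edges:
  assumes E: "symp E" and C: "conn E C" "finite C"
    and d: "\<And>w. w \<in> C \<Longrightarrow> finite {y. E w y} \<and> card {y. E w y} \<le> 2"
    and "w1 \<in> C" "w2 \<in> C" "w3 \<in> C" "x1 \<notin> C" "x2 \<notin> C" "x3 \<notin> C" "E w1 x1" "E w2 x2" "E w3 x3"
  shows "(w1, x1) = (w2, x2) \<or> (w1, x1) = (w3, x3) \<or> (w2, x2) = (w3, x3)"
proof (rule ccontr)
  assume n: "\<not> ?thesis"
  let ?O = "{(p, q). p \<in> C \<and> q \<notin> C \<and> E p q}"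
  have "{(w1, x1), (w2, x2), (w3, x3)} \<subseteq> ?O" using assms by auto
  then have "card {(w1, x1), (w2, x2), (w3, x3)} \<le> 2" using out_edges_le_2[OF E C d] by (meson card_mono le_trans)
  then show False using n by auto
qed

text \<open>The trace of a connected set on the vertices \<open>q ` S\<close>: vertices outside \<open>q ` S\<close> carry a
  set \<open>att\<close> of attachments, constant along edges and pairwise adjacent in the relation \<open>R\<close>.\<close>

locale trace =
  fixes E :: "'g \<Rightarrow> 'g \<Rightarrow> bool" and R :: "'s \<Rightarrow> 's \<Rightarrow> bool" and q :: "'s \<Rightarrow> 'g" and S :: "'s set"
    and att :: "'g \<Rightarrow> 's set" and V :: "'g set"
  assumes symE: "symp E" and symR: "symp R" and inj: "inj_on q S"
    and att_eq: "\<And>g h. g \<in> V \<Longrightarrow> h \<in> V \<Longrightarrow> E g h \<Longrightarrow> g \<notin> q ` S \<Longrightarrow> h \<notin> q ` S \<Longrightarrow> att g = att h"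
    and att_in: "\<And>g s. g \<in> V \<Longrightarrow> E g (q s) \<Longrightarrow> g \<notin> q ` S \<Longrightarrow> s \<in> S \<Longrightarrow> s \<in> att g"
    and att_R: "\<And>g s t. g \<in> V \<Longrightarrow> g \<notin> q ` S \<Longrightarrow> s \<in> att g \<Longrightarrow> t \<in> att g \<Longrightarrow> s \<in> S \<Longrightarrow> t \<in> S \<Longrightarrow> s \<noteq> t \<Longrightarrow> R s t"
    and dir: "\<And>s t. s \<in> S \<Longrightarrow> t \<in> S \<Longrightarrow> E (q s) (q t) \<Longrightarrow> s \<noteq> t \<Longrightarrow> R s t"
begin

definition "tr U = {s \<in> S. q s \<in> U}"

text \<open>A vertex is represented by itself or by one of its attachments. Representatives of the
  two ends of an edge agree or are related by \<open>R\<close>, so moving in the graph becomes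
  moving in the trace.\<close>

definition "near g t \<longleftrightarrow> (if g \<in> q ` S then g = q t else t \<in> att g)"

lemma near_step:
  assumes "g \<in> V" "h \<in> V" "E g h" "near g s" "near h t" "s \<in> S" "t \<in> S" "s \<noteq> t"
  shows "R s t"
proof -
  have Ehg: "E h g" using assms(3) symE by (auto dest: sympD)
  show ?thesis
  proof (cases "g \<in> q ` S")
    case True
    note g = this
    show ?thesis
    proof (cases "h \<in> q ` S")
      case True then show ?thesis using g assms dir unfolding near_def by auto
    next
      case False then show ?thesis using g assms att_in[of h s] att_R[of h s t] Ehg unfolding near_def by auto
    qed
  next
    case False
    note g = this
    show ?thesis
    proof (cases "h \<in> q ` S")
      case True then show ?thesis using g assms att_in[of g t] att_R[of g s t] unfolding near_def by auto
    next
      case False then show ?thesis using g assms att_eq[of g h] att_R[of g s t] unfolding near_def by auto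
    qed
  qed
qed

text \<open>A detour of \<open>U\<close> could be attached only to trace vertices that
  \<open>U\<close> avoids. This does not happen, since attachments are constant along the detour and
  include the trace vertex from which it started.\<close>

lemma near_ex:
  assumes "conn E U" "U \<subseteq> V" "tr U \<noteq> {}" "g \<in> U"
  shows "\<exists>t\<in>tr U. near g t"
proof -
  obtain s where s: "s \<in> S" "q s \<in> U" using assms(3) unfolding tr_def by auto
  have "U \<subseteq> {g. g \<in> U \<and> (\<exists>t\<in>tr U. near g t)}"
  proof (rule conn_subset_of[OF assms(1) s(2)])
    show "q s \<in> {g. g \<in> U \<and> (\<exists>t\<in>tr U. near g t)}" using s unfolding tr_def near_def by auto
  next
    fix g h assume gh: "g \<in> U" "g \<in> {g. g \<in> U \<and> (\<exists>t\<in>tr U. near g t)}" "h \<in> U" "E g h"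
    then obtain t where t: "t \<in> tr U" "near g t" by auto
    show "h \<in> {g. g \<in> U \<and> (\<exists>t\<in>tr U. near g t)}"
    proof (cases "h \<in> q ` S")
      case True
      then show ?thesis using gh unfolding tr_def near_def by auto
    next
      case False
      have "t \<in> att h"
      proof (cases "g \<in> q ` S")
        case True
        then have "g = q t" using t(2) unfolding near_def by simp
        moreover have "E h g" using gh(4) symE by (auto dest: sympD)
        ultimately show ?thesis using att_in[of h t] False gh assms(2) t(1) unfolding tr_def by auto
      next
        case g: False
        then show ?thesis using t(2) att_eq[of g h] False gh assms(2) unfolding near_def by auto
      qed
      then show ?thesis using False gh t unfolding near_def by auto
    qed
  qed
  then show ?thesis using assms(4) by auto
qed

lemma tr_conn:
  assumes "conn E U" "U \<subseteq> V" "tr U \<noteq> {}"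
  shows "conn R (tr U)"
proof (rule connI)
  show "tr U \<noteq> {}" by fact
next
  fix P x y assume xy: "x \<in> tr U" "x \<in> P" "y \<in> tr U" "y \<notin> P"
  show "\<exists>p\<in>tr U \<inter> P. \<exists>q\<in>tr U - P. R p q"
  proof (rule ccontr)
    assume n: "\<not> ?thesis"
    \<comment> \<open>If no relation of \<open>R\<close> led from \<open>P\<close> to the rest of
      the trace, the vertices represented by \<open>P\<close> would be closed under edges and
      include \<open>q y\<close>, whose only representative is \<open>y\<close>.\<close>
    let ?B = "{g. \<exists>t\<in>tr U. t \<in> P \<and> near g t}"
    have "U \<subseteq> ?B"
    proof (rule conn_subset_of[OF assms(1), of "q x"])
      show "q x \<in> U" using xy unfolding tr_def by auto
      show "q x \<in> ?B" using xy unfolding tr_def near_def by auto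
    next
      fix g h assume gh: "g \<in> U" "g \<in> ?B" "h \<in> U" "E g h"
      then obtain s where s: "s \<in> tr U" "s \<in> P" "near g s" by auto
      obtain t where t: "t \<in> tr U" "near h t" using near_ex[OF assms gh(3)] by auto
      have "s \<in> S" "t \<in> S" using s t unfolding tr_def by auto
      then have "s = t \<or> R s t" using near_step[of g h s t] gh s t assms(2) by blast
      then show "h \<in> ?B" using n s t by blast
    qed
    moreover have "q y \<in> U" using xy unfolding tr_def by auto
    ultimately obtain t where "t \<in> tr U" "t \<in> P" "near (q y) t" by auto
    then have "q y = q t" "t \<in> S" "y \<in> S" using xy unfolding near_def tr_def by auto
    then have "t = y" using inj by (auto dest: inj_onD)
    then show False using \<open>t \<in> P\<close> xy by simp
  qed
qed

lemma tr_adj: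
  assumes "conn E U" "U \<subseteq> V" "tr U \<noteq> {}" "conn E W" "W \<subseteq> V" "tr W \<noteq> {}" "U \<inter> W = {}" "adj E U W"
  shows "adj R (tr U) (tr W)"
proof -
  obtain g h where gh: "g \<in> U" "h \<in> W" "E g h" using assms(8) unfolding adj_def by blast
  obtain s where s: "s \<in> tr U" "near g s" using near_ex[OF assms(1-3) gh(1)] by auto
  obtain t where t: "t \<in> tr W" "near h t" using near_ex[OF assms(4-6) gh(2)] by auto
  have "s \<noteq> t" using s t assms(7) unfolding tr_def by auto
  then have "R s t" using near_step[of g h s t] gh s t assms unfolding tr_def by auto
  then show ?thesis using s t unfolding adj_def by blast
qed

end

section \<open>Ladder graphs\<close>

text \<open>The ladder is infinite in one direction, with natural numbers as columns and truth
  values as rails; finite ladders are its intervals of columns.\<close>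

definition lad :: "nat \<times> bool \<Rightarrow> nat \<times> bool \<Rightarrow> bool" where
  "lad x y \<longleftrightarrow> snd x = snd y \<and> (fst y = Suc (fst x) \<or> fst x = Suc (fst y)) \<or> fst x = fst y \<and> snd x \<noteq> snd y"

lemma symp_lad: "symp lad"
  unfolding lad_def by (auto intro: sympI)

lemma conn_rail: "a < b \<Longrightarrow> conn lad ({a..<b} \<times> {s})"
proof (induction b)
  case (Suc b)
  show ?case
  proof (cases "a < b")
    case True
    have "conn lad (insert (b, s) ({a..<b} \<times> {s}))"
      by (rule conn_insert[OF symp_lad Suc.IH[OF True], of "(b - 1, s)"]) (use True in \<open>auto simp: lad_def\<close>)
    moreover have "insert (b, s) ({a..<b} \<times> {s}) = {a..<Suc b} \<times> {s}" using True by auto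
    ultimately show ?thesis by simp
  next
    case False
    then have "{a..<Suc b} \<times> {s} = {(b, s)}" using Suc.prems by auto
    then show ?thesis by simp
  qed
qed simp

text \<open>The rail without the removed vertex is connected, and rungs join the rest of the other
  rail to it.\<close>

lemma conn_lad_minus:
  assumes "a < b"
  shows "conn lad ({a..<b} \<times> UNIV - {x})"
proof -
  obtain c s where x: "x = (c, s)" by (cases x)
  have "conn lad ({a..<b} \<times> {\<not> s} \<union> ({a..<b} - {c}) \<times> {s})"
    by (rule conn_hub[OF symp_lad conn_rail[OF assms]]) (auto simp: lad_def)
  moreover have "{a..<b} \<times> {\<not> s} \<union> ({a..<b} - {c}) \<times> {s} = {a..<b} \<times> UNIV - {x}"
    unfolding x by auto
  ultimately show ?thesis by simp
qed

lemma conn_lad: "a < b \<Longrightarrow> conn lad ({a..<b} \<times> UNIV)"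
  using conn_lad_minus[of a b "(b, True)"] by simp

text \<open>A discrete intermediate value theorem: within a connected set \<open>h\<close> cannot
  jump over \<open>m\<close>.\<close>

lemma conn_interval:
  assumes "conn E S" "\<And>x y. x \<in> S \<Longrightarrow> y \<in> S \<Longrightarrow> E x y \<Longrightarrow> h y \<le> Suc (h x)"
    and "x \<in> S" "z \<in> S" "h x \<le> m" "m \<le> h z"
  shows "\<exists>y\<in>S. h y = (m :: nat)"
proof (cases "h x = m")
  case False
  then have "h x < m" using assms by simp
  then obtain p q where pq: "p \<in> S" "h p < m" "q \<in> S" "\<not> h q < m" "E p q"
    using conn_cut[OF assms(1,3), of "{y. h y < m}" z] assms(4,6) by auto
  then have "h q = m" using assms(2)[of p q] by simp
  then show ?thesis using pq by blast
qed (use assms in blast)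

text \<open>\<open>h\<close> numbers \<open>A\<close> like a path, so disjoint connected sets are
  separate intervals. The set that starts first can touch another one only at the successor of its
  own last number, and a single vertex has that number.\<close>

lemma interval_two_neighbours:
  assumes E: "symp E" and h: "inj_on h A" "\<And>x y. x \<in> A \<Longrightarrow> y \<in> A \<Longrightarrow> E x y \<Longrightarrow> h y \<le> Suc (h x)"
    and S: "S \<subseteq> A" "T \<subseteq> A" "U \<subseteq> A" and c: "conn E S" "conn E T" "conn E U"
    and d: "S \<inter> T = {}" "S \<inter> U = {}" "T \<inter> U = {}" and a: "adj E S T" "adj E S U"
    and m: "x0 \<in> S" "\<And>y. y \<in> S \<union> T \<union> U \<Longrightarrow> h x0 \<le> (h y :: nat)"
  shows False
proof -
  have hS: "h y \<le> Suc (h x)" if "x \<in> S" "y \<in> S" "E x y" for x y using h(2) S(1) that by blast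
  have key: "\<exists>w\<in>T'. \<exists>x\<in>S. h w = Suc (h x) \<and> (\<forall>y\<in>S. h y \<le> h x)"
    if T': "T' \<subseteq> A" "conn E T'" "S \<inter> T' = {}" "adj E S T'" "\<And>y. y \<in> T' \<Longrightarrow> h x0 \<le> h y" for T'
  proof -
    obtain x w where xw: "x \<in> S" "w \<in> T'" "E x w" using T'(4) unfolding adj_def by blast
    have e: "h w \<le> Suc (h x)" using h(2)[of x w] xw S T' by blast
    have above: "h y < h w'" if "y \<in> S" "w' \<in> T'" for y w'
    proof (rule ccontr)
      assume n: "\<not> h y < h w'"
      have "\<exists>u\<in>S. h u = h w'"
        by (rule conn_interval[OF c(1) hS m(1) that(1)]) (use n T'(5)[OF that(2)] in auto)
      then obtain u where "u \<in> S" "h u = h w'" by auto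
      then have "u = w'" using h(1) S T' that by (metis inj_onD subsetD)
      then show False using \<open>u \<in> S\<close> that T' by blast
    qed
    have "h w = Suc (h x)" using e above[OF xw(1,2)] by simp
    moreover have "\<forall>y\<in>S. h y \<le> h x" using above xw(2) \<open>h w = Suc (h x)\<close> by fastforce
    ultimately show ?thesis using xw by blast
  qed
  obtain w x where w: "w \<in> T" "x \<in> S" "h w = Suc (h x)" "\<forall>y\<in>S. h y \<le> h x"
    using key[OF S(2) c(2) d(1) a(1)] m(2) by blast
  obtain w' x' where w': "w' \<in> U" "x' \<in> S" "h w' = Suc (h x')" "\<forall>y\<in>S. h y \<le> h x'"
    using key[OF S(3) c(3) d(2) a(2)] m(2) by blast
  have "h x = h x'" using w w' by (metis le_antisym)
  then have "w = w'" using w w' h(1) S by (metis inj_onD subsetD)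
  then show False using w w' d(3) by blast
qed

text \<open>The branch set containing the vertex with the least number would have to touch the
  branch sets of both its neighbours in the square.\<close>

lemma no_four_cycle_in_path:
  assumes E: "symp E" and h: "inj_on h A" "\<And>x y. x \<in> A \<Longrightarrow> y \<in> A \<Longrightarrow> E x y \<Longrightarrow> h y \<le> Suc (h x :: nat)"
    and m: "model ({c, Suc c} \<times> UNIV) lad E \<gamma>" and A: "\<And>x. x \<in> {c, Suc c} \<times> UNIV \<Longrightarrow> \<gamma> x \<subseteq> A"
  shows False
proof -
  let ?V = "{c, Suc c} \<times> (UNIV :: bool set)"
  let ?U = "\<Union>x\<in>?V. \<gamma> x"
  have "conn E (\<gamma> (c, True))" using model_conn[OF m] by simp
  then have "?U \<noteq> {}" using conn_nonempty by fastforce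
  then have "\<exists>y. y \<in> ?U" by blast
  then obtain x0 where x0: "x0 \<in> ?U" "\<And>y. y \<in> ?U \<Longrightarrow> h x0 \<le> h y"
    using ex_has_least_nat[of "\<lambda>y. y \<in> ?U" _ h] by metis
  obtain d s where ds: "d = c \<or> d = Suc c" "x0 \<in> \<gamma> (d, s)" using x0(1) by auto
  define d' where "d' = (if d = c then Suc c else c)"
  have V: "(d, s) \<in> ?V" "(d', s) \<in> ?V" "(d, \<not> s) \<in> ?V" using ds unfolding d'_def by auto
  have ne: "d \<noteq> d'" unfolding d'_def by auto
  have adjs: "lad (d, s) (d', s)" "lad (d, s) (d, \<not> s)" using ds unfolding d'_def lad_def by auto
  have dj: "\<gamma> x \<inter> \<gamma> y = {}" if "x \<in> ?V" "y \<in> ?V" "x \<noteq> y" for x y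
    using model_disj[OF m that(1,2)] that(3) by blast
  show False
  proof (rule interval_two_neighbours[OF E h, of "\<gamma> (d, s)" "\<gamma> (d', s)" "\<gamma> (d, \<not> s)" x0])
    show "\<gamma> (d, s) \<subseteq> A" "\<gamma> (d', s) \<subseteq> A" "\<gamma> (d, \<not> s) \<subseteq> A" using A V by blast+
    show "conn E (\<gamma> (d, s))" "conn E (\<gamma> (d', s))" "conn E (\<gamma> (d, \<not> s))" using model_conn[OF m] V by blast+
    show "\<gamma> (d, s) \<inter> \<gamma> (d', s) = {}" "\<gamma> (d, s) \<inter> \<gamma> (d, \<not> s) = {}" "\<gamma> (d', s) \<inter> \<gamma> (d, \<not> s) = {}"
      using dj V ne by simp_all
    show "adj E (\<gamma> (d, s)) (\<gamma> (d', s))" "adj E (\<gamma> (d, s)) (\<gamma> (d, \<not> s))" using model_adj[OF m] V adjs by blast+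
  next
    fix y assume "y \<in> \<gamma> (d, s) \<union> \<gamma> (d', s) \<union> \<gamma> (d, \<not> s)"
    then have "y \<in> ?U" using V by blast
    then show "h x0 \<le> h y" by (rule x0(2))
  qed (use ds in auto)
qed

section \<open>The condensed wall\<close>

text \<open>Layer \<open>j\<close> of the wall joins the cut vertices \<open>Z j\<close> and \<open>Z (Suc j)\<close> by an edge and by the row
  \<open>Rw j 0\<close>, \<open>Rw j 1\<close> and so on, whose vertices are adjacent to them alternately. The terminals \<open>TA\<close> and
  \<open>TB\<close> are adjacent to the first and to the last vertex of every row.\<close>

datatype wv = TA | TB | Z nat | Rw nat nat

fun wall0 :: "nat \<Rightarrow> wv \<Rightarrow> wv \<Rightarrow> bool" where
  "wall0 r (Z j) (Z k) = (k = Suc j \<and> j < r)"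
| "wall0 r (Rw j i) (Rw k h) = (k = j \<and> h = Suc i \<and> j < r \<and> h < 2 * r)"
| "wall0 r (Z k) (Rw j i) = (j < r \<and> i < 2 * r \<and> k = (if even i then j else Suc j))"
| "wall0 r TA (Rw j i) = (j < r \<and> i = 0)"
| "wall0 r TB (Rw j i) = (j < r \<and> Suc i = 2 * r)"
| "wall0 r _ _ = False"

definition wall :: "nat \<Rightarrow> wv \<Rightarrow> wv \<Rightarrow> bool" where
  "wall r x y \<longleftrightarrow> wall0 r x y \<or> wall0 r y x"

lemma symp_wall: "symp (wall r)"
  unfolding wall_def by (auto intro: sympI)

definition linkage :: "nat \<Rightarrow> (wv \<Rightarrow> wv \<Rightarrow> bool) \<Rightarrow> bool" where
  "linkage r E \<longleftrightarrow> (\<exists>P Q. conn E P \<and> conn E Q \<and> P \<inter> Q = {} \<and> TA \<in> P \<and> TB \<in> P \<and> Z 0 \<in> Q \<and> Z r \<in> Q)"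

text \<open>With \<open>after j\<close>, the two sides of the cut vertex \<open>Z j\<close> in the
  wall without \<open>TA\<close> and \<open>TB\<close>.\<close>

definition before :: "nat \<Rightarrow> wv set" where
  "before j = {Z i |i. i < j} \<union> {Rw k i |k i. k < j}"

definition after :: "nat \<Rightarrow> wv set" where
  "after j = {Z i |i. j < i} \<union> {Rw k i |k i. j \<le> k}"

lemma before_simps [simp]:
  "Z i \<in> before j \<longleftrightarrow> i < j" "Rw k i \<in> before j \<longleftrightarrow> k < j" "TA \<notin> before j" "TB \<notin> before j"
  unfolding before_def by auto

lemma after_simps [simp]:
  "Z i \<in> after j \<longleftrightarrow> j < i" "Rw k i \<in> after j \<longleftrightarrow> j \<le> k" "TA \<notin> after j" "TB \<notin> after j"
  unfolding after_def by auto

lemma wall_before: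
  assumes "wall r p q" "p \<in> before j" "q \<notin> before j" "q \<noteq> TA" "q \<noteq> TB"
  shows "q = Z j"
  using assms by (cases p; cases q) (auto simp: wall_def split: if_splits)

lemma wall_after:
  assumes "wall r p q" "p \<in> after j" "q \<notin> after j" "q \<noteq> TA" "q \<noteq> TB"
  shows "q = Z j"
  using assms by (cases p; cases q) (auto simp: wall_def split: if_splits)

text \<open>\<open>Q\<close> avoids \<open>TA\<close> and \<open>TB\<close>, so it contains every
  cut vertex. This leaves only the rows to \<open>P\<close>, which has to run through one of them
  completely. That row blocks all detours of \<open>Q\<close> in its layer.\<close>

lemma linkage_layer:
  assumes l: "linkage r E" and E: "\<And>x y. E x y \<Longrightarrow> wall r x y"
  shows "\<exists>j. (\<forall>i. Suc i < 2 * r \<longrightarrow> E (Rw j i) (Rw j (Suc i))) \<and> E (Z j) (Z (Suc j))"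
proof -
  obtain P Q where PQ: "conn E P" "conn E Q" "P \<inter> Q = {}" "TA \<in> P" "TB \<in> P" "Z 0 \<in> Q" "Z r \<in> Q"
    using l unfolding linkage_def by blast
  have T: "TA \<notin> Q" "TB \<notin> Q" using PQ by auto
  have ZQ: "Z k \<in> Q" if "k \<le> r" for k
  proof (cases "k = 0")
    case False
    have "Z 0 \<in> before k" "Z r \<notin> before k" using False that by auto
    then obtain p q where pq: "p \<in> Q" "p \<in> before k" "q \<in> Q" "q \<notin> before k" "E p q"
      using conn_cut[OF PQ(2,6) _ PQ(7)] by metis
    then have "q = Z k" using wall_before[OF E[OF pq(5)] pq(2,4)] T by auto
    then show ?thesis using pq by simp
  qed (use PQ in simp)
  have row: "\<exists>j<r. \<forall>i. Suc i < 2 * r \<longrightarrow> Rw j i \<in> P \<and> Rw j (Suc i) \<in> P \<and> E (Rw j i) (Rw j (Suc i))"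
  proof (rule ccontr)
    assume "\<not> ?thesis"
    then obtain g where g: "\<And>j. j < r \<Longrightarrow> Suc (g j) < 2 * r \<and>
        \<not> (Rw j (g j) \<in> P \<and> Rw j (Suc (g j)) \<in> P \<and> E (Rw j (g j)) (Rw j (Suc (g j))))" by metis
    \<comment> \<open>If every row breaks at some \<open>g j\<close>, then \<open>TA\<close> and the
      initial parts of the rows up to the breaks form a cut that \<open>P\<close> cannot
      cross.\<close>
    let ?S = "{TA} \<union> {Rw j i |j i. j < r \<and> i \<le> g j}"
    obtain p q where pq: "p \<in> P" "p \<in> ?S" "q \<in> P" "q \<notin> ?S" "E p q"
      using conn_cut[OF PQ(1,4) _ PQ(5), of ?S] by auto
    have W: "wall r p q" using pq E by blast
    have nZ: "q \<noteq> Z k" if "k \<le> r" for k using ZQ[OF that] pq PQ(3) by auto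
    from pq(2) consider "p = TA" | j i where "p = Rw j i" "j < r" "i \<le> g j" by blast
    then show False
    proof cases
      case 1
      then have "\<exists>j<r. q = Rw j 0" using W unfolding wall_def by (cases q) auto
      then show False using pq(4) by auto
    next
      case 2
      note gj = g[OF 2(2)]
      show False
      proof (cases q)
        case TA then show False using pq(4) by simp
      next
        case TB then show False using W 2 gj unfolding wall_def by simp
      next
        case (Z k)
        then have "k \<le> r" using W 2 unfolding wall_def by (auto split: if_splits)
        then show False using nZ Z by blast
      next
        case (Rw j' h)
        then have h: "j' = j" "h = Suc i \<or> i = Suc h" using W 2 unfolding wall_def by auto
        then have "g j < h" using pq(4) Rw 2 by auto
        then have "i = g j" "h = Suc i" using h 2 by auto
        then show False using gj pq 2 h(1) Rw by blast
      qed
    qed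
  qed
  then obtain j where j: "j < r" "\<And>i. Suc i < 2 * r \<Longrightarrow> Rw j i \<in> P \<and> Rw j (Suc i) \<in> P \<and> E (Rw j i) (Rw j (Suc i))"
    by blast
  have UP: "Rw j i \<in> P" if "i < 2 * r" for i
    using j(2)[of i] j(2)[of "i - 1"] that j(1) by (cases i) auto
  have "Z 0 \<in> before j \<union> {Z j}" "Z r \<notin> before j \<union> {Z j}" using j(1) by auto
  then obtain p q where pq: "p \<in> Q" "p \<in> before j \<union> {Z j}" "q \<in> Q" "q \<notin> before j \<union> {Z j}" "E p q"
    using conn_cut[OF PQ(2,6) _ PQ(7)] by metis
  have pZ: "p = Z j" using wall_before[OF E[OF pq(5)], of j] pq T by auto
  have "q = Z (Suc j)"
  proof -
    have "q \<noteq> Rw j i" if "i < 2 * r" for i using UP[OF that] pq PQ(3) by auto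
    then show ?thesis using E[OF pq(5)] pq(4) unfolding pZ wall_def
      by (cases q) (auto split: if_splits)
  qed
  then have "E (Z j) (Z (Suc j))" using pq(5) pZ by simp
  then show ?thesis using j(2) by blast
qed

lemma linkages_share_edge:
  assumes l: "linkage r E" "linkage r F"
    and E: "\<And>x y. E x y \<Longrightarrow> wall r x y" and F: "\<And>x y. F x y \<Longrightarrow> wall r x y" "symp F"
  shows "\<exists>x y. E x y \<and> F x y"
proof (rule ccontr)
  assume n: "\<not> ?thesis"
  obtain j where j: "\<And>i. Suc i < 2 * r \<Longrightarrow> F (Rw j i) (Rw j (Suc i))" "F (Z j) (Z (Suc j))"
    using linkage_layer[OF l(2) F(1)] by blast
  have jr: "j < r" using F(1)[OF j(2)] unfolding wall_def by auto
  obtain P Q where PQ: "conn E P" "conn E Q" "P \<inter> Q = {}" "TA \<in> P" "TB \<in> P" "Z 0 \<in> Q" "Z r \<in> Q"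
    using l(1) unfolding linkage_def by blast
  have T: "TA \<notin> Q" "TB \<notin> Q" using PQ by auto
  \<comment> \<open>In the wall without \<open>TA\<close> and \<open>TB\<close>, exactly the edges
    of row \<open>j\<close> and the edge from \<open>Z j\<close> to \<open>Z (Suc j)\<close> leave
    this set, and \<open>F\<close> contains all of them. Even row vertices are included because they
    are the neighbours of \<open>Z j\<close>.\<close>
  let ?S = "before j \<union> {Z j} \<union> {Rw j i |i. even i}"
  have S: "Z 0 \<in> ?S" "Z r \<notin> ?S" using jr by auto
  obtain p q where pq: "p \<in> Q" "p \<in> ?S" "q \<in> Q" "q \<notin> ?S" "E p q"
    by (rule conn_cut[OF PQ(2,6) S(1) PQ(7) S(2)])
  have T': "p \<noteq> TA" "p \<noteq> TB" "q \<noteq> TA" "q \<noteq> TB" using T pq by auto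
  have "F p q \<or> F q p"
    using E[OF pq(5)] pq(2,4) T' j
    by (cases p; cases q) (auto simp: wall_def split: if_splits)
  then show False using n pq(5) F(2) by (auto dest: sympD)
qed

lemma pigeonhole_disjoint:
  assumes "finite X" "card X < n" and d: "\<And>i j x. i < n \<Longrightarrow> j < n \<Longrightarrow> x \<in> A i \<Longrightarrow> x \<in> A j \<Longrightarrow> i = j"
  shows "\<exists>i<n. A i \<inter> X = {}"
proof (rule ccontr)
  assume "\<not> ?thesis"
  then have "\<forall>i\<in>{..<n}. \<exists>y. y \<in> A i \<inter> X" by blast
  then have "\<exists>f. \<forall>i\<in>{..<n}. f i \<in> A i \<inter> X" by (rule bchoice)
  then obtain f where "\<forall>i\<in>{..<n}. f i \<in> A i \<inter> X" by blast
  then have f: "f i \<in> A i \<inter> X" if "i < n" for i using that by simp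
  have "inj_on f {..<n}"
  proof (rule inj_onI)
    fix i j assume ij: "i \<in> {..<n}" "j \<in> {..<n}" "f i = f j"
    have "f i \<in> A i" "f i \<in> A j" using f[of i] f[of j] ij by auto
    then show "i = j" using d[of i j "f i"] ij by simp
  qed
  moreover have "f ` {..<n} \<subseteq> X" using f by blast
  ultimately have "n \<le> card X" using card_mono[OF assms(1)] by (metis card_image card_lessThan)
  then show False using assms(2) by simp
qed

definition layer_edges :: "nat \<Rightarrow> nat \<Rightarrow> wv set set" where
  "layer_edges r j = {{Rw j i, Rw j (Suc i)} |i. Suc i < 2 * r} \<union>
     {{TA, Rw j 0}, {TB, Rw j (2 * r - 1)}, {Z j, Z (Suc j)}}"

lemma layer_edges_disjoint:
  assumes "x \<in> layer_edges r i" "x \<in> layer_edges r j"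
  shows "i = j"
proof -
  have p: "(\<forall>k m. Rw k m \<in> x \<longrightarrow> k = l) \<and> ((\<exists>m. Rw l m \<in> x) \<or> x = {Z l, Z (Suc l)})"
    if "x \<in> layer_edges r l" for l using that unfolding layer_edges_def by blast
  have "i = j \<or> {Z i, Z (Suc i)} = {Z j, Z (Suc j)}" using p[OF assms(1)] p[OF assms(2)] by metis
  then show ?thesis by (auto simp: doubleton_eq_iff)
qed

text \<open>A way around the direct edge from \<open>Z j\<close> to \<open>Z (Suc j)\<close> over
  two consecutive row vertices. A layer has \<open>r\<close> of them, pairwise
  edge-disjoint.\<close>

definition detour_edges :: "nat \<Rightarrow> nat \<Rightarrow> wv set set" where
  "detour_edges j i = {{Z j, Rw j (2 * i)}, {Rw j (2 * i), Rw j (2 * i + 1)}, {Rw j (2 * i + 1), Z (Suc j)}}"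

lemma detour_edges_disjoint:
  assumes "x \<in> detour_edges j i" "x \<in> detour_edges j k"
  shows "i = k"
proof -
  have p: "(\<forall>m. Rw j m \<in> x \<longrightarrow> m div 2 = l) \<and> (\<exists>m. Rw j m \<in> x)"
    if "x \<in> detour_edges j l" for l using that unfolding detour_edges_def by force
  show ?thesis using p[OF assms(1)] p[OF assms(2)] by blast
qed

text \<open>Fewer than \<open>r\<close> deleted edges spare some layer \<open>j\<close> with its
  row, the end edges of the row and the direct edge. The first path takes this row; the second takes
  the direct edge there and, in each other layer, one of the \<open>r\<close> disjoint detours that
  is spared.\<close>

lemma linkage_robust:
  assumes X: "finite X" "card X < r"
  shows "linkage r (\<lambda>x y. wall r x y \<and> {x, y} \<notin> X)"
proof -
  let ?E = "\<lambda>x y. wall r x y \<and> {x, y} \<notin> X"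
  have sE: "symp ?E" using symp_wall[of r] by (auto simp: symp_def insert_commute)
  have r: "0 < r" using X by simp
  obtain j where j: "j < r" "layer_edges r j \<inter> X = {}"
    using pigeonhole_disjoint[OF X, of "layer_edges r"] layer_edges_disjoint by metis
  let ?R = "\<lambda>i. Rw j ` {..<Suc i}"
  have rows: "conn ?E (?R i)" if "i < 2 * r" for i
    using that
  proof (induction i)
    case (Suc i)
    have "conn ?E (insert (Rw j (Suc i)) (?R i))"
    proof (rule conn_insert[OF sE Suc.IH, of "Rw j i"])
      have "{Rw j i, Rw j (Suc i)} \<in> layer_edges r j" using Suc.prems unfolding layer_edges_def by auto
      then show "?E (Rw j i) (Rw j (Suc i)) \<or> ?E (Rw j (Suc i)) (Rw j i)"
        using j Suc.prems unfolding wall_def by auto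
    qed (use Suc.prems in auto)
    then show ?case by (simp add: lessThan_Suc)
  qed (simp add: lessThan_Suc)
  have P: "conn ?E (insert TA (insert TB (?R (2 * r - 1))))"
  proof (rule conn_insert[OF sE, of _ "Rw j 0"])
    show "conn ?E (insert TB (?R (2 * r - 1)))"
    proof (rule conn_insert[OF sE rows, of _ "Rw j (2 * r - 1)"])
      have "{TB, Rw j (2 * r - 1)} \<in> layer_edges r j" unfolding layer_edges_def by auto
      then have "{TB, Rw j (2 * r - 1)} \<notin> X" using j by blast
      then show "?E (Rw j (2 * r - 1)) TB \<or> ?E TB (Rw j (2 * r - 1))"
        using j r unfolding wall_def by auto
    qed (use r in auto)
    have "{TA, Rw j 0} \<in> layer_edges r j" unfolding layer_edges_def by auto
    then have "{TA, Rw j 0} \<notin> X" using j by blast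
    then show "?E (Rw j 0) TA \<or> ?E TA (Rw j 0)" using j r unfolding wall_def by auto
  qed (use r in auto)
  have step: "\<exists>C. conn ?E C \<and> Z k \<in> C \<and> Z (Suc k) \<in> C \<and> C \<subseteq> {Z k, Z (Suc k)} \<union> {Rw l i |l i. l \<noteq> j}"
    if "k < r" for k
  proof (cases "k = j")
    case True
    have "{Z j, Z (Suc j)} \<in> layer_edges r j" unfolding layer_edges_def by auto
    then have "?E (Z k) (Z (Suc k))" using j True unfolding wall_def by auto
    then have "conn ?E (insert (Z (Suc k)) {Z k})" by (intro conn_insert[OF sE conn_singleton]) auto
    then show ?thesis by (intro exI[of _ "{Z k, Z (Suc k)}"]) (simp add: insert_commute)
  next
    case False
    obtain i where i: "i < r" "detour_edges k i \<inter> X = {}"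
      using pigeonhole_disjoint[OF X, of "detour_edges k"] detour_edges_disjoint by metis
    have e: "?E (Z k) (Rw k (2 * i))" "?E (Rw k (2 * i)) (Rw k (2 * i + 1))" "?E (Rw k (2 * i + 1)) (Z (Suc k))"
      using i \<open>k < r\<close> unfolding detour_edges_def wall_def by auto
    have c1: "conn ?E {Rw k (2 * i), Z k}" using conn_insert[OF sE conn_singleton, of "Z k" "Z k"] e(1) by simp
    have c2: "conn ?E {Rw k (2 * i + 1), Rw k (2 * i), Z k}"
      using conn_insert[OF sE c1, of "Rw k (2 * i)"] e(2) by simp
    have "conn ?E {Z (Suc k), Rw k (2 * i + 1), Rw k (2 * i), Z k}"
      using conn_insert[OF sE c2, of "Rw k (2 * i + 1)"] e(3) by simp
    then show ?thesis using False by (intro exI[of _ "{Z (Suc k), Rw k (2 * i + 1), Rw k (2 * i), Z k}"]) auto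
  qed
  have "\<exists>Q. conn ?E Q \<and> Z 0 \<in> Q \<and> Z k \<in> Q \<and> Q \<subseteq> range Z \<union> {Rw l i |l i. l \<noteq> j}" if "k \<le> r" for k
    using that
  proof (induction k)
    case 0
    show ?case by (intro exI[of _ "{Z 0}"]) auto
  next
    case (Suc k)
    obtain Q where Q: "conn ?E Q" "Z 0 \<in> Q" "Z k \<in> Q" "Q \<subseteq> range Z \<union> {Rw l i |l i. l \<noteq> j}" using Suc by auto
    obtain C where C: "conn ?E C" "Z k \<in> C" "Z (Suc k) \<in> C" "C \<subseteq> {Z k, Z (Suc k)} \<union> {Rw l i |l i. l \<noteq> j}"
      using step[of k] Suc.prems by auto
    have "conn ?E (Q \<union> C)" by (rule conn_Un_overlap[OF sE Q(1) C(1)]) (use Q C in blast)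
    moreover have "{Z k, Z (Suc k)} \<subseteq> range Z" by auto
    ultimately show ?case using Q C by (intro exI[of _ "Q \<union> C"]) blast
  qed
  then obtain Q where Q: "conn ?E Q" "Z 0 \<in> Q" "Z r \<in> Q" "Q \<subseteq> range Z \<union> {Rw l i |l i. l \<noteq> j}" by auto
  have "insert TA (insert TB (?R (2 * r - 1))) \<inter> Q = {}" using Q(4) by auto
  then show ?thesis unfolding linkage_def using P Q by blast
qed

text \<open>Of two consecutive cut vertices of the wall one leaves all but one branch set on its right
  and the other all but one on its left; this confines a square of the ladder to one row.\<close>

lemma no_ladder6_in_wall:
  assumes E: "symp E" "\<And>x y. E x y \<Longrightarrow> wall r x y"
    and m: "model ({k..<k+6} \<times> UNIV) lad E \<gamma>"
    and T: "\<And>x. x \<in> {k..<k+6} \<times> UNIV \<Longrightarrow> TA \<notin> \<gamma> x \<and> TB \<notin> \<gamma> x"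
  shows False
proof -
  let ?V = "{k..<k+6} \<times> (UNIV :: bool set)"
  define V where "V j = {x \<in> ?V. Z j \<notin> \<gamma> x}" for j
  define U where "U j = (\<Union>x\<in>V j. \<gamma> x)" for j
  have Vm: "\<exists>x. V j = ?V - {x}" for j
  proof (cases "\<exists>x\<in>?V. Z j \<in> \<gamma> x")
    case True
    then obtain x where x: "x \<in> ?V" "Z j \<in> \<gamma> x" by blast
    have "y = x" if "y \<in> ?V" "Z j \<in> \<gamma> y" for y using model_disj[OF m that(1) x(1) that(2) x(2)] .
    then have "V j = ?V - {x}" unfolding V_def using x by blast
    then show ?thesis by blast
  next
    case False
    \<comment> \<open>Removing a vertex outside the ladder changes nothing and gives both cases the
      same form.\<close>
    then have "V j = ?V - {(k+6, True)}" unfolding V_def by auto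
    then show ?thesis by blast
  qed
  have cU: "conn E (U j)" for j
  proof -
    have "conn lad (V j)" using Vm[of j] conn_lad_minus[of k "k+6"] by auto
    then show ?thesis unfolding U_def by (intro model_conn_UN[OF m]) (auto simp: V_def)
  qed
  have side: "U j \<subseteq> before j \<or> U j \<subseteq> after j" for j
  proof -
    obtain p where p: "p \<in> U j" using conn_nonempty[OF cU] by blast
    have n: "q \<noteq> TA" "q \<noteq> TB" "q \<noteq> Z j" if "q \<in> U j" for q using that T unfolding U_def V_def by auto
    have "p \<in> before j \<or> p \<in> after j" using n[OF p] by (cases p) auto
    then show ?thesis
    proof
      assume "p \<in> before j"
      then have "U j \<subseteq> before j" using conn_subset_of[OF cU p] wall_before[OF E(2)] n by metis
      then show ?thesis ..
    next
      assume "p \<in> after j"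
      then have "U j \<subseteq> after j" using conn_subset_of[OF cU p] wall_after[OF E(2)] n by metis
      then show ?thesis ..
    qed
  qed
  \<comment> \<open>There is no wall edge beyond \<open>Z r\<close>, but \<open>U r\<close> contains
    two adjacent branch sets.\<close>
  have "\<not> U r \<subseteq> after r"
  proof
    assume s: "U r \<subseteq> after r"
    obtain x where x: "V r = ?V - {x}" using Vm by blast
    define s where "s \<longleftrightarrow> \<not> snd x"
    have "(k, s) \<in> V r" "(Suc k, s) \<in> V r" unfolding x s_def by (cases x; auto)+
    moreover have "lad (k, s) (Suc k, s)" unfolding lad_def by simp
    ultimately obtain p q where pq: "p \<in> U r" "q \<in> U r" "E p q"
      using model_adj[OF m, of "(k, s)" "(Suc k, s)"] unfolding adj_def U_def V_def by blast
    then have "p \<in> after r" "q \<in> after r" "wall r p q" using s E by auto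
    then show False by (cases p; cases q) (auto simp: wall_def split: if_splits)
  qed
  then have r: "U r \<subseteq> before r" using side by blast
  \<comment> \<open>The first cut vertex that has its \<open>U j\<close> on the left. The cut vertex
    before it has its set on the right, so every branch set that avoids both lies in the row between
    them.\<close>
  define j where "j = (LEAST j. U j \<subseteq> before j)"
  have j: "U j \<subseteq> before j" unfolding j_def using r by (rule LeastI)
  have "j \<noteq> 0" using j conn_nonempty[OF cU[of 0]] unfolding before_def by fastforce
  then obtain i where i: "j = Suc i" by (cases j) auto
  have "\<not> U i \<subseteq> before i" using not_less_Least[of i "\<lambda>j. U j \<subseteq> before j"] i unfolding j_def by auto
  then have i': "U i \<subseteq> after i" using side by blast
  have row: "\<gamma> x \<subseteq> range (Rw i)" if "x \<in> ?V" "Z i \<notin> \<gamma> x" "Z (Suc i) \<notin> \<gamma> x" for x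
  proof -
    have "\<gamma> x \<subseteq> U i" "\<gamma> x \<subseteq> U j" using that i unfolding U_def V_def by auto
    then have "\<gamma> x \<subseteq> after i \<inter> before (Suc i)" using i' j i by blast
    moreover have "w \<in> after i \<inter> before (Suc i) \<Longrightarrow> w \<in> range (Rw i)" for w by (cases w) auto
    ultimately show ?thesis by blast
  qed
  \<comment> \<open>Six columns contain three disjoint squares, of which two cut vertices spoil at
    most two.\<close>
  have "\<exists>s<3. \<forall>x\<in>{k+2*s, Suc (k+2*s)} \<times> UNIV. Z i \<notin> \<gamma> x \<and> Z (Suc i) \<notin> \<gamma> x"
  proof (rule ccontr)
    assume n: "\<not> ?thesis"
    have ex: "\<exists>x\<in>{k+2*s, Suc (k+2*s)} \<times> UNIV. Z i \<in> \<gamma> x \<or> Z (Suc i) \<in> \<gamma> x" if "s < 3" for s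
      using n that by blast
    obtain x where x: "x \<in> {k, Suc k} \<times> UNIV" "Z i \<in> \<gamma> x \<or> Z (Suc i) \<in> \<gamma> x" using ex[of 0] by auto
    obtain y where y: "y \<in> {k+2, Suc (k+2)} \<times> UNIV" "Z i \<in> \<gamma> y \<or> Z (Suc i) \<in> \<gamma> y" using ex[of 1] by auto
    obtain z where z: "z \<in> {k+4, Suc (k+4)} \<times> UNIV" "Z i \<in> \<gamma> z \<or> Z (Suc i) \<in> \<gamma> z" using ex[of 2] by auto
    have V: "x \<in> ?V" "y \<in> ?V" "z \<in> ?V" using x(1) y(1) z(1) by auto
    have "x \<noteq> y" "x \<noteq> z" "y \<noteq> z" using x(1) y(1) z(1) by auto
    then show False using x(2) y(2) z(2) model_disj[OF m V(1,2)] model_disj[OF m V(1,3)] model_disj[OF m V(2,3)] by blast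
  qed
  then obtain s where s: "s < 3" "\<And>x. x \<in> {k+2*s, Suc (k+2*s)} \<times> UNIV \<Longrightarrow> Z i \<notin> \<gamma> x \<and> Z (Suc i) \<notin> \<gamma> x" by blast
  have sub: "{k+2*s, Suc (k+2*s)} \<times> UNIV \<subseteq> ?V" using s(1) by auto
  define h where "h = (\<lambda>w. case w of Rw a b \<Rightarrow> b | _ \<Rightarrow> 0)"
  show False
  proof (rule no_four_cycle_in_path[OF E(1), of h "range (Rw i)" "k+2*s" \<gamma>])
    show "inj_on h (range (Rw i))" unfolding h_def by (auto intro: inj_onI)
  next
    fix x y assume "x \<in> range (Rw i)" "y \<in> range (Rw i)" "E x y"
    then show "h y \<le> Suc (h x)" using E(2)[of x y] unfolding h_def wall_def by auto
  next
    show "model ({k+2*s, Suc (k+2*s)} \<times> UNIV) lad E \<gamma>" by (rule model_subset[OF m sub])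
  next
    fix x :: "nat \<times> bool" assume x: "x \<in> {k+2*s, Suc (k+2*s)} \<times> UNIV"
    show "\<gamma> x \<subseteq> range (Rw i)" by (rule row) (use x sub s(2)[OF x] in blast)+
  qed
qed

section \<open>Ternary tree minors\<close>

text \<open>The centre \<open>Y0\<close> may be adjacent to any vertex of a subtree, not only to its
  root; this is the recursive shape of the classical tree obstructions to small pathwidth. It makes
  the notion stable under connected supersets and under maps as in \<open>tern_map\<close>.\<close>

primrec tern :: "('v \<Rightarrow> 'v \<Rightarrow> bool) \<Rightarrow> nat \<Rightarrow> 'v set \<Rightarrow> bool" where
  "tern E 0 U = conn E U"
| "tern E (Suc k) U = (conn E U \<and> (\<exists>Y0 Y1 Y2 Y3. Y0 \<union> Y1 \<union> Y2 \<union> Y3 \<subseteq> U \<and> conn E Y0 \<and>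
     tern E k Y1 \<and> tern E k Y2 \<and> tern E k Y3 \<and>
     Y0 \<inter> Y1 = {} \<and> Y0 \<inter> Y2 = {} \<and> Y0 \<inter> Y3 = {} \<and> Y1 \<inter> Y2 = {} \<and> Y1 \<inter> Y3 = {} \<and> Y2 \<inter> Y3 = {} \<and>
     adj E Y0 Y1 \<and> adj E Y0 Y2 \<and> adj E Y0 Y3))"

lemma tern_conn: "tern E k U \<Longrightarrow> conn E U"
  by (cases k) auto

declare tern.simps(2) [simp del]

lemma tern_SucI:
  assumes "conn E U" "Y0 \<union> Y1 \<union> Y2 \<union> Y3 \<subseteq> U" "conn E Y0" "tern E k Y1" "tern E k Y2" "tern E k Y3"
    "Y0 \<inter> Y1 = {}" "Y0 \<inter> Y2 = {}" "Y0 \<inter> Y3 = {}" "Y1 \<inter> Y2 = {}" "Y1 \<inter> Y3 = {}" "Y2 \<inter> Y3 = {}"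
    "adj E Y0 Y1" "adj E Y0 Y2" "adj E Y0 Y3"
  shows "tern E (Suc k) U"
  unfolding tern.simps by (intro conjI exI[of _ Y0] exI[of _ Y1] exI[of _ Y2] exI[of _ Y3]) (fact assms)+

lemma tern_SucE:
  assumes "tern E (Suc k) U"
  obtains Y0 Y1 Y2 Y3 where "conn E U" "Y0 \<subseteq> U" "Y1 \<subseteq> U" "Y2 \<subseteq> U" "Y3 \<subseteq> U"
    "conn E Y0" "tern E k Y1" "tern E k Y2" "tern E k Y3"
    "Y0 \<inter> Y1 = {}" "Y0 \<inter> Y2 = {}" "Y0 \<inter> Y3 = {}" "Y1 \<inter> Y2 = {}" "Y1 \<inter> Y3 = {}" "Y2 \<inter> Y3 = {}"
    "adj E Y0 Y1" "adj E Y0 Y2" "adj E Y0 Y3"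
  using assms unfolding tern.simps Un_subset_iff by (elim conjE exE) (rule that; assumption)

lemma tern_superset: "tern E k U \<Longrightarrow> U \<subseteq> U' \<Longrightarrow> conn E U' \<Longrightarrow> tern E k U'"
proof (cases k)
  case (Suc l)
  assume a: "tern E k U" "U \<subseteq> U'" "conn E U'"
  from a(1)[unfolded Suc] show ?thesis
  proof (rule tern_SucE)
    fix Y0 Y1 Y2 Y3 assume Y: "Y0 \<subseteq> U" "Y1 \<subseteq> U" "Y2 \<subseteq> U" "Y3 \<subseteq> U" "conn E Y0" "tern E l Y1" "tern E l Y2" "tern E l Y3"
      "Y0 \<inter> Y1 = {}" "Y0 \<inter> Y2 = {}" "Y0 \<inter> Y3 = {}" "Y1 \<inter> Y2 = {}" "Y1 \<inter> Y3 = {}" "Y2 \<inter> Y3 = {}"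
      "adj E Y0 Y1" "adj E Y0 Y2" "adj E Y0 Y3"
    have "Y0 \<union> Y1 \<union> Y2 \<union> Y3 \<subseteq> U'" using Y(1-4) a(2) by blast
    then show ?thesis unfolding Suc using Y(5-) by (intro tern_SucI[OF a(3)])
  qed
qed simp

text \<open>\<open>F\<close> maps vertex sets to vertex sets like taking branch sets or traces does.\<close>

lemma tern_map:
  assumes c: "\<And>A. A \<subseteq> U \<Longrightarrow> conn E A \<Longrightarrow> conn R (F A)"
    and s: "\<And>A B. A \<subseteq> B \<Longrightarrow> B \<subseteq> U \<Longrightarrow> F A \<subseteq> F B"
    and d: "\<And>A B. A \<subseteq> U \<Longrightarrow> B \<subseteq> U \<Longrightarrow> A \<inter> B = {} \<Longrightarrow> F A \<inter> F B = {}"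
    and a: "\<And>A B. A \<subseteq> U \<Longrightarrow> B \<subseteq> U \<Longrightarrow> A \<inter> B = {} \<Longrightarrow> conn E A \<Longrightarrow> conn E B \<Longrightarrow> adj E A B \<Longrightarrow> adj R (F A) (F B)"
  shows "tern E k A \<Longrightarrow> A \<subseteq> U \<Longrightarrow> tern R k (F A)"
proof (induction k arbitrary: A)
  case (Suc k)
  from Suc.prems(1) show ?case
  proof (rule tern_SucE)
    fix Y0 Y1 Y2 Y3 assume Y: "conn E A" "Y0 \<subseteq> A" "Y1 \<subseteq> A" "Y2 \<subseteq> A" "Y3 \<subseteq> A"
      "conn E Y0" "tern E k Y1" "tern E k Y2" "tern E k Y3"
      "Y0 \<inter> Y1 = {}" "Y0 \<inter> Y2 = {}" "Y0 \<inter> Y3 = {}" "Y1 \<inter> Y2 = {}" "Y1 \<inter> Y3 = {}" "Y2 \<inter> Y3 = {}"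
      "adj E Y0 Y1" "adj E Y0 Y2" "adj E Y0 Y3"
    have sub: "Y0 \<subseteq> U" "Y1 \<subseteq> U" "Y2 \<subseteq> U" "Y3 \<subseteq> U" using Y(2-5) Suc.prems(2) by auto
    note cn = tern_conn[OF Y(7)] tern_conn[OF Y(8)] tern_conn[OF Y(9)]
    show ?thesis
      by (rule tern_SucI[OF c[OF Suc.prems(2) Y(1)], of "F Y0" "F Y1" "F Y2" "F Y3"])
        (use sub Y cn Suc.IH c d a s[OF Y(2) Suc.prems(2)] s[OF Y(3) Suc.prems(2)]
          s[OF Y(4) Suc.prems(2)] s[OF Y(5) Suc.prems(2)] in auto)
  qed
qed (use c in simp)

section \<open>Ternary trees against path decompositions\<close>

locale bags =
  fixes E :: "'v \<Rightarrow> 'v \<Rightarrow> bool" and A :: "'v set" and bag :: "nat \<Rightarrow> 'v set"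
  assumes symE: "symp E"
    and edge: "\<And>x y. x \<in> A \<Longrightarrow> y \<in> A \<Longrightarrow> E x y \<Longrightarrow> \<exists>t. x \<in> bag t \<and> y \<in> bag t"
    and convex: "\<And>x s t u. x \<in> bag s \<Longrightarrow> x \<in> bag u \<Longrightarrow> s \<le> t \<Longrightarrow> t \<le> u \<Longrightarrow> x \<in> bag t"
    and fin: "\<And>t. finite (bag t)"
begin

text \<open>Take an edge from the vertices in bags before \<open>t\<close> to the rest of
  \<open>Y\<close>. Its common bag is not before \<open>t\<close>, so by convexity its first end
  lies in bag \<open>t\<close>.\<close>

lemma conn_meets_bag:
  assumes Y: "conn E Y" "Y \<subseteq> A" and x: "x \<in> Y" "x \<in> bag s" and y: "y \<in> Y" "y \<in> bag u" and t: "s \<le> t" "t \<le> u"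
  shows "Y \<inter> bag t \<noteq> {}"
proof
  assume n: "Y \<inter> bag t = {}"
  let ?P = "{z. \<exists>v<t. z \<in> bag v}"
  have xP: "x \<in> ?P" using x t n by (metis (mono_tags, lifting) disjoint_iff le_neq_implies_less mem_Collect_eq)
  have yP: "y \<notin> ?P"
  proof
    assume "y \<in> ?P"
    then obtain v where "v < t" "y \<in> bag v" by blast
    then have "y \<in> bag t" using convex[of y v u t] y t by simp
    then show False using n y by blast
  qed
  obtain p q where pq: "p \<in> Y" "p \<in> ?P" "q \<in> Y" "q \<notin> ?P" "E p q"
    by (rule conn_cut[OF Y(1) x(1) xP y(1) yP])
  obtain v where v: "p \<in> bag v" "q \<in> bag v" using edge[of p q] pq Y(2) by blast
  have tv: "t \<le> v"
  proof (rule ccontr)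
    assume "\<not> t \<le> v"
    then have "v < t" by simp
    then have "q \<in> ?P" using v(2) by blast
    then show False using pq(4) by blast
  qed
  obtain w where w: "w < t" "p \<in> bag w" using pq(2) by blast
  have "p \<in> bag t" using convex[of p w v t] w v(1) tv by simp
  then show False using n pq(1) by blast
qed

text \<open>Each subtree has a bag with \<open>Suc k\<close> of its vertices. Order the three bags:
  the outer two subtrees and the centre form a connected set disjoint from the middle subtree, which
  meets the middle bag and supplies one more vertex. As bags need to cover edges only, some bag is
  required to meet \<open>Y\<close>.\<close>

lemma tern_bag:
  "tern E k Y \<Longrightarrow> Y \<subseteq> A \<Longrightarrow> \<exists>t. bag t \<inter> Y \<noteq> {} \<Longrightarrow> \<exists>t. Suc k \<le> card (bag t \<inter> Y)"
proof (induction k arbitrary: Y)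
  case 0
  then obtain t where "bag t \<inter> Y \<noteq> {}" by blast
  then have "0 < card (bag t \<inter> Y)" using fin by (simp add: card_gt_0_iff)
  then show ?case by (metis Suc_leI)
next
  case (Suc k)
  from Suc.prems(1) show ?case
  proof (rule tern_SucE)
    fix Y0 Y1 Y2 Y3 assume Y: "conn E Y" "Y0 \<subseteq> Y" "Y1 \<subseteq> Y" "Y2 \<subseteq> Y" "Y3 \<subseteq> Y"
      "conn E Y0" "tern E k Y1" "tern E k Y2" "tern E k Y3"
      "Y0 \<inter> Y1 = {}" "Y0 \<inter> Y2 = {}" "Y0 \<inter> Y3 = {}" "Y1 \<inter> Y2 = {}" "Y1 \<inter> Y3 = {}" "Y2 \<inter> Y3 = {}"
      "adj E Y0 Y1" "adj E Y0 Y2" "adj E Y0 Y3"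
    have ex: "\<exists>t. Suc k \<le> card (bag t \<inter> W)" if W: "tern E k W" "W \<subseteq> Y" "adj E Y0 W" for W
    proof -
      obtain p q where pq: "p \<in> Y0" "q \<in> W" "E p q" using W(3) unfolding adj_def by blast
      obtain t where "q \<in> bag t" using edge[of p q] pq Y(2) W(2) Suc.prems(2) by blast
      then show ?thesis using Suc.IH[OF W(1)] W(2) Suc.prems(2) pq(2) by blast
    qed
    have main: ?thesis
      if m: "s \<le> t" "t \<le> u" and W: "Suc k \<le> card (bag s \<inter> W1)" "Suc k \<le> card (bag t \<inter> W2)" "Suc k \<le> card (bag u \<inter> W3)"
        and sub: "W1 \<subseteq> Y" "W2 \<subseteq> Y" "W3 \<subseteq> Y" and c: "conn E W1" "conn E W3" and aj: "adj E Y0 W1" "adj E Y0 W3"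
        and d: "Y0 \<inter> W2 = {}" "W1 \<inter> W2 = {}" "W3 \<inter> W2 = {}" for s t u W1 W2 W3
    proof -
      have c1: "conn E (Y0 \<union> W1)" by (rule conn_Un_adj[OF symE Y(6) c(1) aj(1)])
      have "conn E (Y0 \<union> W1 \<union> W3)" by (rule conn_Un_adj[OF symE c1 c(2)]) (use aj(2) in \<open>auto intro: adj_mono\<close>)
      moreover have "bag s \<inter> W1 \<noteq> {}" "bag u \<inter> W3 \<noteq> {}" using W(1,3) by auto
      then obtain x y where "x \<in> bag s" "x \<in> W1" "y \<in> bag u" "y \<in> W3" by auto
      ultimately have "(Y0 \<union> W1 \<union> W3) \<inter> bag t \<noteq> {}"
        using conn_meets_bag[of "Y0 \<union> W1 \<union> W3" x s y u t] m sub Y(2) Suc.prems(2) by blast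
      then obtain w where w: "w \<in> Y0 \<union> W1 \<union> W3" "w \<in> bag t" by blast
      have "w \<notin> bag t \<inter> W2" "finite (bag t \<inter> W2)" using w d fin by auto
      then have "card (insert w (bag t \<inter> W2)) = Suc (card (bag t \<inter> W2))" by simp
      moreover have "insert w (bag t \<inter> W2) \<subseteq> bag t \<inter> Y" using w sub Y(2) by blast
      then have "card (insert w (bag t \<inter> W2)) \<le> card (bag t \<inter> Y)" using fin by (meson card_mono finite_Int)
      ultimately have "Suc (Suc k) \<le> card (bag t \<inter> Y)" using W(2) by linarith
      then show ?thesis by blast
    qed
    obtain t1 t2 t3 where t: "Suc k \<le> card (bag t1 \<inter> Y1)" "Suc k \<le> card (bag t2 \<inter> Y2)" "Suc k \<le> card (bag t3 \<inter> Y3)"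
      using ex Y by metis
    note cn = tern_conn[OF Y(7)] tern_conn[OF Y(8)] tern_conn[OF Y(9)]
    consider "t1 \<le> t2" "t2 \<le> t3" | "t1 \<le> t3" "t3 \<le> t2" | "t2 \<le> t1" "t1 \<le> t3" | "t2 \<le> t3" "t3 \<le> t1"
      | "t3 \<le> t1" "t1 \<le> t2" | "t3 \<le> t2" "t2 \<le> t1" by linarith
    then show ?thesis
    proof cases
      case 1 then show ?thesis using main[OF 1 t(1,2,3)] Y cn by blast
    next
      case 2 then show ?thesis using main[OF 2 t(1,3,2)] Y cn by blast
    next
      case 3 then show ?thesis using main[OF 3 t(2,1,3)] Y cn by blast
    next
      case 4 then show ?thesis using main[OF 4 t(2,3,1)] Y cn by blast
    next
      case 5 then show ?thesis using main[OF 5 t(3,1,2)] Y cn by blast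
    next
      case 6 then show ?thesis using main[OF 6 t(3,2,1)] Y cn by blast
    qed
  qed
qed

lemma tern_bag_bound:
  assumes "\<And>t. card (bag t) \<le> k" "tern E k Y" "Y \<subseteq> A" "0 < k"
  shows False
proof -
  obtain l where l: "k = Suc l" using assms(4) by (cases k) auto
  obtain Y0 Y1 where "Y0 \<subseteq> Y" "Y1 \<subseteq> Y" "adj E Y0 Y1" using assms(2) unfolding l by (elim tern_SucE) blast
  then obtain p q where "p \<in> Y" "q \<in> Y" "E p q" unfolding adj_def by blast
  then have "\<exists>t. bag t \<inter> Y \<noteq> {}" using edge[of p q] assms(3) by blast
  then obtain t where "Suc k \<le> card (bag t \<inter> Y)" using tern_bag[OF assms(2,3)] by blast
  also have "card (bag t \<inter> Y) \<le> card (bag t)" using fin by (simp add: card_mono)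
  finally show False using assms(1)[of t] by simp
qed

end

lemma no_tern6_in_wall:
  assumes E: "symp E" "\<And>x y. E x y \<Longrightarrow> wall r x y"
  shows "\<not> tern E 6 Y"
proof
  assume Y: "tern E 6 Y"
  \<comment> \<open>A sweep through the rows, layer by layer: \<open>t div (2*r)\<close> is the
    layer and \<open>t mod (2*r)\<close> the position. Both terminals, two cut vertices and two
    consecutive row vertices make six, whence the height six.\<close>
  define bag where "bag t = {TA, TB, Z (t div (2*r)), Z (Suc (t div (2*r))),
      Rw (t div (2*r)) (t mod (2*r)), Rw (t div (2*r)) (Suc (t mod (2*r)))}" for t
  have mono: "s div (2*r) \<le> t div (2*r)" if "s \<le> t" for s t using that by (rule div_le_mono)
  interpret bags E UNIV bag
  proof
    show "symp E" by fact
  next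
    fix x y assume "E x y"
    have w0: "\<exists>t. x \<in> bag t \<and> y \<in> bag t" if w: "wall0 r x y" for x y
    proof -
      have dm: "(j * (2*r) + i) div (2*r) = j \<and> (j * (2*r) + i) mod (2*r) = i" if "i < 2*r" for i j
        using that by simp
      show ?thesis
      proof (cases "(r, x, y)" rule: wall0.cases)
        case (1 r' j k)
        then show ?thesis using w dm[of 0 j] unfolding bag_def by (intro exI[of _ "j * (2*r)"]) auto
      next
        case (2 r' j i k h)
        then show ?thesis using w dm[of i j] unfolding bag_def by (intro exI[of _ "j * (2*r) + i"]) auto
      next
        case (3 r' k j i)
        then show ?thesis using w dm[of i j] unfolding bag_def by (intro exI[of _ "j * (2*r) + i"]) (auto split: if_splits)
      next
        case (4 r' j i)
        then show ?thesis using w dm[of 0 j] unfolding bag_def by (intro exI[of _ "j * (2*r)"]) auto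
      next
        case (5 r' j i)
        then show ?thesis using w dm[of i j] unfolding bag_def by (intro exI[of _ "j * (2*r) + i"]) auto
      qed (use w in auto)
    qed
    show "\<exists>t. x \<in> bag t \<and> y \<in> bag t" using E(2)[OF \<open>E x y\<close>] w0[of x y] w0[of y x] unfolding wall_def by blast
  next
    fix x s t u assume x: "x \<in> bag s" "x \<in> bag u" "s \<le> t" "t \<le> u"
    have d: "s div (2*r) \<le> t div (2*r)" "t div (2*r) \<le> u div (2*r)" using x mono by auto
    show "x \<in> bag t"
    proof (cases x)
      case (Z i)
      then show ?thesis using x d unfolding bag_def by auto
    next
      case (Rw j i)
      then have e: "s div (2*r) = j" "u div (2*r) = j" "t div (2*r) = j" using x d unfolding bag_def by auto
      have i: "s mod (2*r) = i \<or> Suc (s mod (2*r)) = i" "u mod (2*r) = i \<or> Suc (u mod (2*r)) = i"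
        using x e Rw unfolding bag_def by auto
      have "s mod (2*r) \<le> t mod (2*r)" "t mod (2*r) \<le> u mod (2*r)"
        using x(3,4) e by (metis add_le_cancel_left mult_div_mod_eq)+
      then have "t mod (2*r) = i \<or> Suc (t mod (2*r)) = i" using i by auto
      then show ?thesis using e Rw unfolding bag_def by auto
    qed (auto simp: bag_def)
  next
    fix t show "finite (bag t)" unfolding bag_def by simp
  qed
  have "card (bag t) \<le> 6" for t
  proof -
    have "card (set [TA, TB, Z (t div (2*r)), Z (Suc (t div (2*r))),
      Rw (t div (2*r)) (t mod (2*r)), Rw (t div (2*r)) (Suc (t mod (2*r)))]) \<le> 6"
      by (rule order_trans[OF card_length]) simp
    then show ?thesis unfolding bag_def by simp
  qed
  then show False using tern_bag_bound[of 6 Y] Y by auto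
qed

section \<open>The host graph without multiplicities\<close>

text \<open>The graph \<open>R\<close> with its edges \<open>ab\<close> and \<open>cd\<close> rerouted through the wall. Its terminals \<open>Z 0\<close> and
  \<open>Z r\<close> are the end vertices of the chain of layers.\<close>

definition port :: "'a \<Rightarrow> 'a \<Rightarrow> 'a \<Rightarrow> 'a \<Rightarrow> nat \<Rightarrow> 'a \<Rightarrow> wv \<Rightarrow> bool" where
  "port a b c d r x w \<longleftrightarrow> x = a \<and> w = TA \<or> x = b \<and> w = TB \<or> x = c \<and> w = Z 0 \<or> x = d \<and> w = Z r"

fun gam :: "('a \<Rightarrow> 'a \<Rightarrow> bool) \<Rightarrow> 'a \<Rightarrow> 'a \<Rightarrow> 'a \<Rightarrow> 'a \<Rightarrow> nat \<Rightarrow> (wv \<Rightarrow> wv \<Rightarrow> bool) \<Rightarrow> 'a + wv \<Rightarrow> 'a + wv \<Rightarrow> bool" where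
  "gam R a b c d r E (Inl x) (Inl y) = (R x y \<and> {x, y} \<noteq> {a, b} \<and> {x, y} \<noteq> {c, d})"
| "gam R a b c d r E (Inl x) (Inr w) = port a b c d r x w"
| "gam R a b c d r E (Inr w) (Inl x) = port a b c d r x w"
| "gam R a b c d r E (Inr w) (Inr u) = E w u"

lemma symp_gam: "symp R \<Longrightarrow> symp E \<Longrightarrow> symp (gam R a b c d r E)"
proof (rule sympI)
  fix x y assume "symp R" "symp E" "gam R a b c d r E x y"
  then show "gam R a b c d r E y x" by (cases x; cases y) (auto dest: sympD simp: insert_commute)
qed

lemma conn_image:
  assumes "conn E A" "\<And>x y. x \<in> A \<Longrightarrow> y \<in> A \<Longrightarrow> E x y \<Longrightarrow> R (f x) (f y)"
  shows "conn R (f ` A)"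
proof -
  have "conn R (\<Union>x\<in>A. {f x})"
    by (rule conn_UN[OF assms(1)]) (use assms(2) in \<open>auto simp: adj_def\<close>)
  then show ?thesis by (simp add: UNION_singleton_eq_range)
qed

lemma conn_pull:
  assumes "conn E U" "inj_on f A" "U \<subseteq> f ` A" "\<And>x y. x \<in> A \<Longrightarrow> y \<in> A \<Longrightarrow> E (f x) (f y) \<Longrightarrow> R x y"
  shows "conn R {x \<in> A. f x \<in> U}"
proof (rule connI)
  obtain u where "u \<in> U" using conn_nonempty[OF assms(1)] by blast
  then show "{x \<in> A. f x \<in> U} \<noteq> {}" using assms(3) by blast
next
  fix P x y assume xy: "x \<in> {x \<in> A. f x \<in> U}" "x \<in> P" "y \<in> {x \<in> A. f x \<in> U}" "y \<notin> P"
  have "f x \<in> U" "f x \<in> f ` (A \<inter> P)" "f y \<in> U" "f y \<notin> f ` (A \<inter> P)"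
    using xy inj_onD[OF assms(2), of y] by auto
  then obtain p q where pq: "p \<in> U" "p \<in> f ` (A \<inter> P)" "q \<in> U" "q \<notin> f ` (A \<inter> P)" "E p q"
    using conn_cut[OF assms(1)] by metis
  obtain p' where p: "p' \<in> A" "p' \<in> P" "p = f p'" using pq by blast
  obtain q' where q: "q' \<in> A" "q = f q'" using pq(3) assms(3) by blast
  have "q' \<notin> P" using pq(4) q by blast
  then show "\<exists>p\<in>{x \<in> A. f x \<in> U} \<inter> P. \<exists>q\<in>{x \<in> A. f x \<in> U} - P. R p q"
    using pq(1,3,5) p q assms(4)[of p' q'] by blast
qed

lemma model_pull:
  assumes m: "model V R E \<beta>" and f: "inj_on f A" "\<And>x. x \<in> V \<Longrightarrow> \<beta> x \<subseteq> f ` A"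
    and E: "\<And>x y. x \<in> A \<Longrightarrow> y \<in> A \<Longrightarrow> E (f x) (f y) \<Longrightarrow> E' x y"
  shows "model V R E' (\<lambda>x. {g \<in> A. f g \<in> \<beta> x})"
  unfolding model_def
proof (intro conjI ballI impI)
  fix x y assume xy: "x \<in> V" "y \<in> V"
  show "conn E' {g \<in> A. f g \<in> \<beta> x}" by (rule conn_pull[OF model_conn[OF m xy(1)] f(1) f(2)[OF xy(1)]]) (rule E)
  show "{g \<in> A. f g \<in> \<beta> x} \<inter> {g \<in> A. f g \<in> \<beta> y} = {}" if "x \<noteq> y" using model_disj[OF m xy] that by blast
  assume "R x y"
  then obtain p q where pq: "p \<in> \<beta> x" "q \<in> \<beta> y" "E p q" using model_adj[OF m xy] unfolding adj_def by blast
  obtain p' q' where "p' \<in> A" "p = f p'" "q' \<in> A" "q = f q'" using pq f(2)[OF xy(1)] f(2)[OF xy(2)] by blast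
  then show "adj E' {g \<in> A. f g \<in> \<beta> x} {g \<in> A. f g \<in> \<beta> y}" using pq E unfolding adj_def by blast
qed

lemma conn_vimage:
  assumes "conn E A" "inj f" "A \<subseteq> range f" "\<And>x y. E (f x) (f y) \<Longrightarrow> R x y"
  shows "conn R (f -` A)"
  using conn_pull[of E A f UNIV R] assms by (simp add: vimage_def)

lemma tern_vimage:
  assumes t: "tern E k A" and f: "inj f" "A \<subseteq> range f" "\<And>x y. E (f x) (f y) \<Longrightarrow> R x y"
  shows "tern R k (f -` A)"
proof (rule tern_map[where F="\<lambda>A. f -` A" and U=A, OF _ _ _ _ t subset_refl])
  fix B assume "B \<subseteq> A" "conn E B"
  then show "conn R (f -` B)" using conn_vimage[of E B f R] f by blast
next
  fix B C assume "B \<subseteq> A" "C \<subseteq> A" "adj E B C"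
  then show "adj R (f -` B) (f -` C)" using f(2,3) unfolding adj_def by blast
qed auto

subsection \<open>Packings\<close>

definition pack :: "('v \<Rightarrow> 'v \<Rightarrow> bool) \<Rightarrow> 'v set \<Rightarrow> nat \<Rightarrow> bool" where
  "pack E U n \<longleftrightarrow> (\<exists>f. (\<forall>i<n. tern E 6 (f i) \<and> f i \<subseteq> U) \<and> (\<forall>i<n. \<forall>j<n. i \<noteq> j \<longrightarrow> f i \<inter> f j = {}))"

lemma pack_mono: "pack E U n \<Longrightarrow> U \<subseteq> W \<Longrightarrow> m \<le> n \<Longrightarrow> pack E W m"
proof -
  assume a: "pack E U n" "U \<subseteq> W" "m \<le> n"
  obtain f where f: "\<And>i. i < n \<Longrightarrow> tern E 6 (f i) \<and> f i \<subseteq> U" "\<And>i j. i < n \<Longrightarrow> j < n \<Longrightarrow> i \<noteq> j \<Longrightarrow> f i \<inter> f j = {}"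
    using a(1) unfolding pack_def by metis
  show ?thesis unfolding pack_def
  proof (intro exI[of _ f] conjI allI impI)
    fix i assume "i < m"
    then show "tern E 6 (f i)" "f i \<subseteq> W" using f(1)[of i] a(2,3) by auto
  next
    fix i j assume "i < m" "j < m" "i \<noteq> j"
    then show "f i \<inter> f j = {}" using f(2)[of i j] a(3) by auto
  qed
qed

lemma pack_image:
  assumes "pack E U n"
    and t: "\<And>Z. Z \<subseteq> U \<Longrightarrow> tern E 6 Z \<Longrightarrow> tern E' 6 (F Z) \<and> F Z \<subseteq> U'"
    and d: "\<And>Y Z. Y \<subseteq> U \<Longrightarrow> Z \<subseteq> U \<Longrightarrow> tern E 6 Y \<Longrightarrow> tern E 6 Z \<Longrightarrow> Y \<inter> Z = {} \<Longrightarrow> F Y \<inter> F Z = {}"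
  shows "pack E' U' n"
proof -
  obtain f where f: "\<And>i. i < n \<Longrightarrow> tern E 6 (f i) \<and> f i \<subseteq> U" "\<And>i j. i < n \<Longrightarrow> j < n \<Longrightarrow> i \<noteq> j \<Longrightarrow> f i \<inter> f j = {}"
    using assms(1) unfolding pack_def by metis
  show ?thesis unfolding pack_def by (rule exI[of _ "\<lambda>i. F (f i)"]) (use f t d in simp)
qed

lemma pack_add:
  assumes "pack E U n" "pack E W k" "U \<inter> W = {}"
  shows "pack E (U \<union> W) (n + k)"
proof -
  obtain f where f: "\<And>i. i < n \<Longrightarrow> tern E 6 (f i) \<and> f i \<subseteq> U" "\<And>i j. i < n \<Longrightarrow> j < n \<Longrightarrow> i \<noteq> j \<Longrightarrow> f i \<inter> f j = {}"
    using assms(1) unfolding pack_def by metis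
  obtain g where g: "\<And>i. i < k \<Longrightarrow> tern E 6 (g i) \<and> g i \<subseteq> W" "\<And>i j. i < k \<Longrightarrow> j < k \<Longrightarrow> i \<noteq> j \<Longrightarrow> g i \<inter> g j = {}"
    using assms(2) unfolding pack_def by metis
  define h where "h i = (if i < n then f i else g (i - n))" for i
  have "tern E 6 (h i) \<and> h i \<subseteq> U \<union> W" if "i < n + k" for i
  proof (cases "i < n")
    case True then show ?thesis using f(1)[OF True] unfolding h_def by auto
  next
    case False
    then have "i - n < k" using that by simp
    then show ?thesis using g(1)[of "i - n"] False unfolding h_def by auto
  qed
  moreover have "h i \<inter> h j = {}" if "i < n + k" "j < n + k" "i \<noteq> j" for i j
  proof (cases "i < n \<longleftrightarrow> j < n")
    case True
    have "i - n \<noteq> j - n" if "\<not> i < n" using that True \<open>i \<noteq> j\<close> by arith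
    then show ?thesis using True f(2)[of i j] g(2)[of "i - n" "j - n"] that unfolding h_def
      by (cases "i < n") (simp_all add: less_diff_conv2)
  next
    case False
    have "f i' \<inter> g j' = {}" if "i' < n" "j' < k" for i' j' using f(1)[OF that(1)] g(1)[OF that(2)] assms(3) by blast
    then have "f i' \<inter> g j' = {}" "g j' \<inter> f i' = {}" if "i' < n" "j' < k" for i' j'
      using that by (simp_all add: Int_commute)
    moreover have "i - n < k" "j - n < k" if "n \<le> i \<or> n \<le> j" using that False \<open>i < n + k\<close> \<open>j < n + k\<close> by arith+
    ultimately show ?thesis using False unfolding h_def by (cases "i < n") simp_all
  qed
  ultimately show ?thesis unfolding pack_def by blast
qed

text \<open>The members are disjoint, so \<open>x\<close> spoils at most one of them, and the new
  numbering skips it.\<close>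

lemma pack_remove:
  assumes "pack E U (Suc n)"
  shows "pack E (U - {x}) n"
proof -
  obtain f where f: "\<And>i. i < Suc n \<Longrightarrow> tern E 6 (f i) \<and> f i \<subseteq> U" "\<And>i j. i < Suc n \<Longrightarrow> j < Suc n \<Longrightarrow> i \<noteq> j \<Longrightarrow> f i \<inter> f j = {}"
    using assms unfolding pack_def by metis
  obtain k where k: "k < Suc n" "\<And>i. i < Suc n \<Longrightarrow> i \<noteq> k \<Longrightarrow> x \<notin> f i"
  proof (cases "\<exists>i<Suc n. x \<in> f i")
    case True
    then obtain k where k: "k < Suc n" "x \<in> f k" by blast
    show ?thesis by (rule that[OF k(1)]) (use f(2)[OF _ k(1)] k(2) in blast)
  next
    case False
    show ?thesis by (rule that[of 0]) (use False in auto)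
  qed
  define g where "g i = f (if i < k then i else Suc i)" for i
  have "tern E 6 (g i) \<and> g i \<subseteq> U - {x}" if "i < n" for i
    using f(1)[of "if i < k then i else Suc i"] k(2)[of "if i < k then i else Suc i"] that unfolding g_def by (auto split: if_splits)
  moreover have "g i \<inter> g j = {}" if "i < n" "j < n" "i \<noteq> j" for i j
    unfolding g_def by (rule f(2)) (use that in \<open>auto split: if_splits\<close>)
  ultimately show ?thesis unfolding pack_def by blast
qed

text \<open>A connected member cannot straddle \<open>P\<close>, and none fits outside. With the
  wall as the outside, this turns a packing in branch and wall into one in the branch, once the
  contacts have been removed.\<close>

lemma pack_confined:
  assumes "pack E U n" and sep: "\<And>p q. p \<in> U \<Longrightarrow> p \<in> P \<Longrightarrow> q \<in> U \<Longrightarrow> q \<notin> P \<Longrightarrow> \<not> E p q"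
    and no: "\<And>Z. Z \<subseteq> U - P \<Longrightarrow> \<not> tern E 6 Z"
  shows "pack E (U \<inter> P) n"
proof (rule pack_image[OF assms(1), where F="\<lambda>Z. Z"])
  fix Z assume Z: "Z \<subseteq> U" "tern E 6 Z"
  obtain z where z: "z \<in> Z" "z \<in> P" using no Z by (metis Diff_iff subset_eq)
  have "Z \<subseteq> P" by (rule conn_subset_of[OF tern_conn[OF Z(2)] z]) (use sep Z(1) in blast)
  then show "tern E 6 Z \<and> Z \<subseteq> U \<inter> P" using Z by blast
qed

lemma pack_model:
  assumes m: "model V R E \<gamma>" and p: "pack R U n" "U \<subseteq> V"
  shows "pack E (\<Union>x\<in>U. \<gamma> x) n"
proof (rule pack_image[OF p(1), where F="\<lambda>Z. \<Union>x\<in>Z. \<gamma> x"])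
  fix Z assume Z: "Z \<subseteq> U" "tern R 6 Z"
  have "tern E 6 (\<Union>x\<in>Z. \<gamma> x)"
  proof (rule tern_map[where U=V, OF _ _ _ _ Z(2)])
    show "conn E (\<Union>x\<in>A. \<gamma> x)" if "A \<subseteq> V" "conn R A" for A by (rule model_conn_UN[OF m that])
    show "(\<Union>x\<in>A. \<gamma> x) \<inter> (\<Union>x\<in>B. \<gamma> x) = {}" if "A \<subseteq> V" "B \<subseteq> V" "A \<inter> B = {}" for A B by (rule model_UN_disj[OF m that])
    show "adj E (\<Union>x\<in>A. \<gamma> x) (\<Union>x\<in>B. \<gamma> x)" if "A \<subseteq> V" "B \<subseteq> V" "adj R A B" for A B by (rule model_UN_adj[OF m that])
  qed (use Z p(2) in blast)+
  then show "tern E 6 (\<Union>x\<in>Z. \<gamma> x) \<and> (\<Union>x\<in>Z. \<gamma> x) \<subseteq> (\<Union>x\<in>U. \<gamma> x)" using Z by blast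
next
  fix Y Z assume "Y \<subseteq> U" "Z \<subseteq> U" "Y \<inter> Z = {}"
  then show "(\<Union>x\<in>Y. \<gamma> x) \<inter> (\<Union>x\<in>Z. \<gamma> x) = {}" using p(2) by (intro model_UN_disj[OF m]) auto
qed

text \<open>Each of the two top levels triples the number of disjoint subtrees.\<close>

lemma pack_tern8:
  assumes "tern E 8 U"
  shows "pack E U 9"
proof -
  have one: "pack E W 1" if "tern E 6 W" for W
    unfolding pack_def by (rule exI[of _ "\<lambda>_. W"]) (use that in simp)
  have step: "pack E W (3 * n)" if t: "tern E (Suc k) W" and s: "\<And>Y. tern E k Y \<Longrightarrow> pack E Y n" for k n W
    using t
  proof (rule tern_SucE)
    fix Y1 Y2 Y3 assume Y: "Y1 \<subseteq> W" "Y2 \<subseteq> W" "Y3 \<subseteq> W" "tern E k Y1" "tern E k Y2" "tern E k Y3"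
      "Y1 \<inter> Y2 = {}" "Y1 \<inter> Y3 = {}" "Y2 \<inter> Y3 = {}"
    have "pack E (Y1 \<union> Y2) (n + n)" by (rule pack_add[OF s[OF Y(4)] s[OF Y(5)] Y(7)])
    then have "pack E (Y1 \<union> Y2 \<union> Y3) (n + n + n)" by (rule pack_add[OF _ s[OF Y(6)]]) (use Y in blast)
    then show ?thesis by (rule pack_mono) (use Y in auto)
  qed
  have seven: "pack E W 3" if "tern E 7 W" for W
    using step[of 6 W 1] one that by simp
  show ?thesis using step[of 7 U 3] seven assms by simp
qed

subsection \<open>Ends\<close>

text \<open>These are sets that a model has to respect: the images of such a set and of its
  complement stay connected and disjoint. The complement is taken in all of \<open>V\<close>, so it
  reaches beyond the branch \<open>X\<close>.\<close>

definition ends :: "('v \<Rightarrow> 'v \<Rightarrow> bool) \<Rightarrow> 'v set \<Rightarrow> nat \<Rightarrow> 'v set \<Rightarrow> nat \<Rightarrow> bool" where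
  "ends R V m X n \<longleftrightarrow> (\<exists>f. (\<forall>i<n. f i \<subseteq> X \<and> conn R (f i) \<and> conn R (V - f i) \<and> pack R (f i) m) \<and>
     (\<forall>i<n. \<forall>j<n. i \<noteq> j \<longrightarrow> f i \<inter> f j = {}))"

lemma ends_le_card:
  assumes "ends R V m X n" "finite X"
  shows "n \<le> card X"
proof -
  obtain f where f: "\<And>i. i < n \<Longrightarrow> f i \<subseteq> X \<and> conn R (f i)" "\<And>i j. i < n \<Longrightarrow> j < n \<Longrightarrow> i \<noteq> j \<Longrightarrow> f i \<inter> f j = {}"
    using assms(1) unfolding ends_def by metis
  have "\<exists>i<n. f i \<inter> X = {}" if "card X < n"
    by (rule pigeonhole_disjoint[OF assms(2) that]) (use f(2) in blast)
  then show ?thesis using f(1) conn_nonempty by (metis inf.absorb1 not_le_imp_less)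
qed

lemma ends_maximal:
  assumes "ends R V m X 1" "finite X"
  shows "\<exists>n\<ge>1. ends R V m X n \<and> \<not> ends R V m X (Suc n)"
proof (rule ccontr)
  assume n: "\<not> ?thesis"
  have "ends R V m X (Suc k)" for k by (induction k) (use assms n in auto)
  then show False using ends_le_card[OF _ assms(2)] by (metis Suc_n_not_le_n)
qed

text \<open>A branch \<open>X\<close> of \<open>R\<close> sits in a host graph \<open>G\<close> behind the single vertex \<open>g\<close>. Disjoint sets
  with connected complements that meet it are then no more numerous than in \<open>R\<close> itself.\<close>

locale branch =
  fixes R :: "'a \<Rightarrow> 'a \<Rightarrow> bool" and V X :: "'a set" and g v :: 'a and m n N :: nat
    and G :: "'a + 'w \<Rightarrow> 'a + 'w \<Rightarrow> bool" and Zs Cs :: "nat \<Rightarrow> ('a + 'w) set"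
  assumes symR: "symp R" and symG: "symp G" and XV: "X \<subseteq> V" and gX: "g \<in> X" and v: "v \<in> V - X" "R g v"
    and cX: "conn R X" and cVX: "conn R (V - X)"
    and inner: "\<And>x y. x \<in> X \<Longrightarrow> y \<in> X \<Longrightarrow> G (Inl x) (Inl y) \<longleftrightarrow> R x y"
    and gate: "\<And>x q. x \<in> X \<Longrightarrow> q \<notin> Inl ` X \<Longrightarrow> G (Inl x) q \<Longrightarrow> x = g"
    and max: "\<not> ends R V m X (Suc n)" "1 \<le> n" and N: "n + 2 \<le> N"
    and Z: "\<And>i. i < N \<Longrightarrow> conn G (Zs i)" "\<And>i. i < N \<Longrightarrow> pack G (Zs i) m"
    and C: "\<And>i. i < N \<Longrightarrow> conn G (Cs i)" "\<And>i. i < N \<Longrightarrow> Zs i \<inter> Cs i = {}"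
    and ZC: "\<And>i j. i < N \<Longrightarrow> j < N \<Longrightarrow> i \<noteq> j \<Longrightarrow> Zs j \<subseteq> Cs i"
begin

abbreviation "X' \<equiv> Inl ` X"

text \<open>\<open>D\<close> keeps the complement and the gate together on one side of
  \<open>Zs i\<close>. This fails when the model turns the branch inside out.\<close>

definition good :: "nat \<Rightarrow> bool" where
  "good i \<longleftrightarrow> Zs i \<subseteq> X' \<and> (\<exists>D. conn G D \<and> D \<inter> Zs i = {} \<and> Cs i \<subseteq> D \<and> Inl g \<in> D)"

definition "A i = Inl -` Zs i"
text \<open>The part of \<open>V\<close> outside \<open>A i\<close> that \<open>v\<close> can reach.
  Hence \<open>V - Oc i\<close> is \<open>A i\<close> together with all holes that it cuts off from
  \<open>v\<close>.\<close>

definition "Oc i = comp_of R (V - A i) v"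

lemma pull:
  assumes "conn G D" "D \<subseteq> X'"
  shows "conn R (Inl -` D)"
proof -
  have "conn (\<lambda>x y. G x y \<and> x \<in> X' \<and> y \<in> X') D" by (rule conn_mono[OF assms(1)]) (use assms(2) in blast)
  then show ?thesis by (rule conn_vimage) (use assms(2) inner in auto)
qed

lemma conn_V: "conn R V"
proof -
  have "conn R (X \<union> (V - X))" by (rule conn_Un_adj[OF symR cX cVX]) (use v gX in \<open>auto simp: adj_def\<close>)
  then show ?thesis using XV by (simp add: Un_absorb1)
qed

lemma conn_X': "conn G X'"
proof -
  have "conn G (\<Union>x\<in>X. {Inl x})"
    by (rule conn_UN[OF cX]) (use inner in \<open>auto simp: adj_def\<close>)
  moreover have "(\<Union>x\<in>X. {Inl x :: 'a + 'w}) = X'" by blast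
  ultimately show ?thesis by (simp only:)
qed

context
  fixes i assumes i: "i < N" "good i"
begin

lemma A_sub: "A i \<subseteq> X" using i unfolding A_def good_def by auto

lemma v_O: "v \<in> V - A i" using A_sub v by blast

lemma conn_O: "conn R (Oc i)" unfolding Oc_def by (rule conn_comp_of[OF symR v_O])

lemma VX_O: "V - X \<subseteq> Oc i"
proof -
  have "V - X \<subseteq> V - A i" using A_sub by blast
  then show ?thesis unfolding Oc_def by (rule comp_of_max[OF cVX _ v(1)])
qed

lemma A_ne: "A i \<noteq> {}"
proof -
  obtain z where "z \<in> Zs i" using conn_nonempty[OF Z(1)[OF i(1)]] by blast
  moreover from this obtain x where "z = Inl x" using i(2) unfolding good_def by blast
  ultimately show ?thesis unfolding A_def by blast
qed

lemma conn_A: "conn R (A i)"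
proof -
  have "Zs i \<subseteq> X'" using i(2) unfolding good_def by blast
  then show ?thesis unfolding A_def by (rule pull[OF Z(1)[OF i(1)]])
qed

lemma O_sub: "Oc i \<subseteq> V - A i" unfolding Oc_def by (rule comp_of_subset)

text \<open>Since \<open>V\<close> is connected, each component of \<open>V - A i\<close> other than
  \<open>Oc i\<close> is adjacent to \<open>A i\<close>.\<close>

lemma conn_fill: "conn R (V - Oc i)"
proof -
  obtain a where a: "a \<in> A i" using A_ne by blast
  have AV: "A i \<subseteq> V - Oc i" using A_sub XV O_sub by blast
  show ?thesis
  proof (rule conn_star[OF symR, of a])
    fix w assume w: "w \<in> V - Oc i"
    show "\<exists>C\<subseteq>V - Oc i. conn R C \<and> a \<in> C \<and> w \<in> C"
    proof (cases "w \<in> A i")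
      case True then show ?thesis using conn_A AV a by blast
    next
      case False
      let ?C = "comp_of R (V - A i) w"
      have wV: "w \<in> V - A i" using w False by blast
      have cC: "conn R ?C" by (rule conn_comp_of[OF symR wV])
      have dis: "?C \<inter> Oc i = {}"
      proof (rule ccontr)
        assume "?C \<inter> Oc i \<noteq> {}"
        then obtain y where "y \<in> ?C" "y \<in> Oc i" by blast
        then have "?C = Oc i" using comp_of_eq[OF symR wV] comp_of_eq[OF symR v_O] unfolding Oc_def by metis
        then show False using comp_of_self[OF wV] w by blast
      qed
      have "a \<notin> ?C" using comp_of_subset[of R "V - A i" w] a by blast
      then obtain p q where pq: "p \<in> V" "p \<in> ?C" "q \<in> V" "q \<notin> ?C" "R p q"
        using conn_cut[OF conn_V _ comp_of_self[OF wV, of R]] a AV w by (metis DiffD1 subsetD)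
      have "q \<in> A i" using comp_of_closed[OF symR wV pq(2) _ pq(5)] pq by blast
      then have "conn R (?C \<union> A i)"
        by (intro conn_Un_adj[OF symR cC conn_A]) (use pq in \<open>auto simp: adj_def\<close>)
      moreover have "?C \<union> A i \<subseteq> V - Oc i" using dis AV comp_of_subset[of R "V - A i" w] by blast
      ultimately show ?thesis using a comp_of_self[OF wV, of R] by blast
    qed
  qed (use a AV in blast)
qed

lemma pack_fill: "pack R (V - Oc i) m"
proof (rule pack_image[OF Z(2)[OF i(1)], where F="\<lambda>Z. Inl -` Z"])
  fix Y assume Y: "Y \<subseteq> Zs i" "tern G 6 Y"
  have YX: "Y \<subseteq> X'" using Y i unfolding good_def by blast
  have "tern (\<lambda>x y. G x y \<and> x \<in> X' \<and> y \<in> X') 6 Y"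
  proof (rule tern_map[where F="\<lambda>A. A" and U=X', OF _ _ _ _ Y(2) YX])
    fix B assume B: "B \<subseteq> X'" "conn G B"
    show "conn (\<lambda>x y. G x y \<and> x \<in> X' \<and> y \<in> X') B"
      by (rule conn_mono[OF B(2)]) (simp add: subsetD[OF B(1)])
  next
    fix B D assume BD: "B \<subseteq> X'" "D \<subseteq> X'" "adj G B D"
    obtain b d where "b \<in> B" "d \<in> D" "G b d" using BD(3) unfolding adj_def by (elim bexE)
    then show "adj (\<lambda>x y. G x y \<and> x \<in> X' \<and> y \<in> X') B D"
      unfolding adj_def using subsetD[OF BD(1)] subsetD[OF BD(2)] by (intro bexI[of _ b] bexI[of _ d] conjI)
  qed
  then have "tern R 6 (Inl -` Y)" by (rule tern_vimage) (use YX inner in auto)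
  moreover have "Inl -` Y \<subseteq> A i" using Y unfolding A_def by blast
  ultimately show "tern R 6 (Inl -` Y) \<and> Inl -` Y \<subseteq> V - Oc i" using O_sub A_sub XV by blast
qed auto

text \<open>The set \<open>D\<close> from \<open>good i\<close> contains the other image and the
  gate but avoids \<open>Zs i\<close>. Its part inside the branch is still connected, as the gate is
  the only way out, and it is joined to \<open>v\<close> by the edge at the gate.\<close>

lemma other_in_O:
  assumes k: "k < N" "k \<noteq> i" "Zs k \<subseteq> X'"
  shows "A k \<subseteq> Oc i"
proof -
  obtain D where D: "conn G D" "D \<inter> Zs i = {}" "Cs i \<subseteq> D" "Inl g \<in> D" using i unfolding good_def by blast
  have "conn G (D - (- X'))"
  proof (rule conn_retract[OF symG D(1), where z="Inl g"])
    show "D - - X' \<noteq> {}" using D(4) gX by blast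
  next
    fix p q assume "p \<in> - X'" "q \<notin> - X'" "G p q"
    then show "q = Inl g" using gate symG by (auto dest: sympD)
  qed
  then have "conn R (Inl -` (D - (- X')))" by (rule pull) blast
  then have "conn R (insert v (Inl -` (D - (- X'))))"
    by (rule conn_insert[OF symR, of _ g]) (use D(4) gX v in auto)
  then have "insert v (Inl -` (D - (- X'))) \<subseteq> Oc i"
    unfolding Oc_def by (rule comp_of_max) (use v_O D(2) XV in \<open>auto simp: A_def\<close>)
  moreover have "A k \<subseteq> Inl -` (D - (- X'))" using ZC[OF i(1) k(1)] k D(3) unfolding A_def by blast
  ultimately show ?thesis by blast
qed

end

text \<open>From a common vertex the first filling leads to \<open>A i\<close>, which lies outside
  the second. The second filling can be left only from a vertex of \<open>A k\<close>, but
  \<open>A k\<close> lies in \<open>Oc i\<close> and so outside the first filling.\<close>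

lemma fill_disjoint:
  assumes i: "i < N" "good i" and k: "k < N" "good k" and ne: "i \<noteq> k"
  shows "(V - Oc i) \<inter> (V - Oc k) = {}"
proof (rule ccontr)
  assume "\<not> ?thesis"
  then obtain x where x: "x \<in> V - Oc i" "x \<in> V - Oc k" by blast
  have Ak: "A k \<subseteq> Oc i" using other_in_O[OF i k(1)] ne k(2) unfolding good_def by blast
  have Ai: "A i \<subseteq> Oc k" using other_in_O[OF k i(1)] ne i(2) unfolding good_def by blast
  obtain a where a: "a \<in> A i" using A_ne[OF i] by blast
  have "a \<in> V - Oc i" "a \<notin> V - Oc k" using a Ai O_sub[OF i] A_sub[OF i] XV by blast+
  then obtain p q where pq: "p \<in> V - Oc i" "p \<in> V - Oc k" "q \<in> V - Oc i" "q \<notin> V - Oc k" "R p q"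
    using conn_cut[OF conn_fill[OF i] x(1,2)] by metis
  have "q \<in> Oc k" using pq by blast
  have "p \<in> A k"
  proof (rule ccontr)
    assume "p \<notin> A k"
    then have "p \<in> V - A k" using pq by blast
    then have "p \<in> Oc k" using comp_of_closed[OF symR v_O[OF k], of q p] \<open>q \<in> Oc k\<close> pq(5) symR
      unfolding Oc_def by (auto dest: sympD)
    then show False using pq by blast
  qed
  then show False using Ak pq(1) by blast
qed

text \<open>The fillings of good sets are disjoint ends of \<open>X\<close> in \<open>R\<close>
  itself, where \<open>n\<close> is the maximum.\<close>

lemma card_good_le:
  assumes J: "J \<subseteq> {..<N}" "\<And>i. i \<in> J \<Longrightarrow> good i"
  shows "card J \<le> n"
proof (rule ccontr)
  assume "\<not> ?thesis"
  then obtain J' where J': "J' \<subseteq> J" "card J' = Suc n" "finite J'"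
    by (metis not_less_eq_eq obtain_subset_with_card_n)
  obtain h where h: "bij_betw h {..<Suc n} J'" using ex_bij_betw_nat_finite[OF J'(3)] J'(2) by (metis atLeast0LessThan)
  have hJ: "h i < N \<and> good (h i)" if "i < Suc n" for i
    using bij_betwE[OF h] that J'(1) J by blast
  have hi: "h i \<noteq> h j" if "i < Suc n" "j < Suc n" "i \<noteq> j" for i j
    using bij_betw_imp_inj_on[OF h] that by (auto dest: inj_onD)
  have "ends R V m X (Suc n)" unfolding ends_def
  proof (intro exI[of _ "\<lambda>i. V - Oc (h i)"] conjI allI impI)
    fix i assume i: "i < Suc n"
    note hh = conjunct1[OF hJ[OF i]] conjunct2[OF hJ[OF i]]
    show "V - Oc (h i) \<subseteq> X" using VX_O[OF hh] by blast
    show "conn R (V - Oc (h i))" by (rule conn_fill[OF hh])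
    show "pack R (V - Oc (h i)) m" by (rule pack_fill[OF hh])
    have "V - (V - Oc (h i)) = Oc (h i)" using O_sub[OF hh] by blast
    then show "conn R (V - (V - Oc (h i)))" using conn_O[OF hh] by simp
  next
    fix i j assume "i < Suc n" "j < Suc n" "i \<noteq> j"
    then show "(V - Oc (h i)) \<inter> (V - Oc (h j)) = {}" using fill_disjoint hJ hi by blast
  qed
  then show False using max(1) by blast
qed

lemma gate': "conn G D \<Longrightarrow> D \<inter> X' \<noteq> {} \<Longrightarrow> Inl g \<notin> D \<Longrightarrow> D \<subseteq> X'"
proof -
  assume D: "conn G D" "D \<inter> X' \<noteq> {}" "Inl g \<notin> D"
  obtain x where x: "x \<in> D" "x \<in> X'" using D(2) by blast
  show ?thesis by (rule conn_subset_of[OF D(1) x]) (use gate D(3) in blast)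
qed

text \<open>Suppose a bad set meets the branch. If its complement stays outside the branch, so do
  all other sets. Otherwise the complement, and with it all other sets, is confined to the branch;
  all of them turn out to be good, so \<open>N - 1 \<le> n\<close>, contradicting
  \<open>n + 2 \<le> N\<close>.\<close>

lemma card_meeting_le: "card {i. i < N \<and> Zs i \<inter> X' \<noteq> {}} \<le> n"
proof (cases "\<forall>i<N. Zs i \<inter> X' \<noteq> {} \<longrightarrow> good i")
  case True
  then show ?thesis by (intro card_good_le) auto
next
  case False
  then obtain i where i: "i < N" "Zs i \<inter> X' \<noteq> {}" "\<not> good i" by blast
  show ?thesis
  proof (cases "Cs i \<inter> X' = {}")
    case True
    have "{i. i < N \<and> Zs i \<inter> X' \<noteq> {}} \<subseteq> {i}"
    proof
      fix j assume j: "j \<in> {i. i < N \<and> Zs i \<inter> X' \<noteq> {}}"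
      show "j \<in> {i}" using ZC[OF i(1), of j] j True by blast
    qed
    then have "card {i. i < N \<and> Zs i \<inter> X' \<noteq> {}} \<le> card {i}" by (intro card_mono) auto
    then show ?thesis using max(2) by simp
  next
    case CX: False
    have gi: "Inl g \<in> Zs i \<or> Inl g \<notin> Zs i \<and> Inl g \<notin> Cs i \<and> Zs i \<subseteq> X'"
    proof (cases "Inl g \<in> Zs i")
      case False
      then have "Zs i \<subseteq> X'" using gate'[OF Z(1)[OF i(1)] i(2)] by blast
      then show ?thesis using False i(3) C[OF i(1)] unfolding good_def by blast
    qed simp
    then have gC: "Inl g \<notin> Cs i" using C(2)[OF i(1)] by blast
    have CiX: "Cs i \<subseteq> X'" by (rule gate'[OF C(1)[OF i(1)] CX gC])
    have all: "good j" if j: "j < N" "j \<noteq> i" for j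
    proof -
      have ZjX: "Zs j \<subseteq> X'" using ZC[OF i(1) j(1)] j CiX by blast
      have ij: "Zs i \<subseteq> Cs j" using ZC[OF j(1) i(1)] j by blast
      have gj: "Inl g \<notin> Zs j" using ZC[OF i(1) j(1)] j gC by blast
      show ?thesis
      proof (cases "Inl g \<in> Cs j")
        case True
        then show ?thesis using ZjX C[OF j(1)] unfolding good_def by blast
      next
        case False
        then have gi': "Inl g \<notin> Zs i" "Zs i \<subseteq> X'" using gi ij by blast+
        let ?D = "comp_of G (X' - Zs j) (Inl g)"
        have gD: "Inl g \<in> X' - Zs j" using gX gj by blast
        have cD: "conn G ?D" by (rule conn_comp_of[OF symG gD])
        show ?thesis
        proof (cases "?D \<inter> Cs j = {}")
          case False
          have "conn G (?D \<union> Cs j)" by (rule conn_Un_overlap[OF symG cD C(1)[OF j(1)] False])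
          moreover have "(?D \<union> Cs j) \<inter> Zs j = {}" using comp_of_subset[of G "X' - Zs j"] C(2)[OF j(1)] by blast
          ultimately show ?thesis using ZjX comp_of_self[OF gD, of G] unfolding good_def by blast
        next
          case True
          \<comment> \<open>Here \<open>?D\<close>, the part that the gate reaches without
            \<open>Zs j\<close>, misses \<open>Cs j\<close> and hence \<open>Zs i\<close>. But it
            extends up to \<open>Zs j\<close>, which is part of \<open>Cs i\<close>; so the gate
            reaches \<open>Cs i\<close> without \<open>Zs i\<close>, and \<open>i\<close> would be
            good.\<close>
          let ?F = "comp_of G (X' - Zs i) (Inl g)"
          have gF: "Inl g \<in> X' - Zs i" using gX gi' by blast
          have cF: "conn G ?F" by (rule conn_comp_of[OF symG gF])
          have FC: "?F \<inter> Cs i = {}"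
          proof (rule ccontr)
            assume n: "?F \<inter> Cs i \<noteq> {}"
            have "conn G (?F \<union> Cs i)" by (rule conn_Un_overlap[OF symG cF C(1)[OF i(1)] n])
            moreover have "(?F \<union> Cs i) \<inter> Zs i = {}" using comp_of_subset[of G "X' - Zs i"] C(2)[OF i(1)] by blast
            ultimately have "good i" using gi' comp_of_self[OF gF, of G] unfolding good_def by blast
            then show False using i(3) by blast
          qed
          have DF: "?D \<subseteq> ?F"
            by (rule comp_of_max[OF cD _ comp_of_self[OF gD]]) (use comp_of_subset[of G "X' - Zs j"] True ij in blast)
          obtain z where z: "z \<in> Zs j" using conn_nonempty[OF Z(1)[OF j(1)]] by blast
          have zD: "z \<notin> ?D" using comp_of_subset[of G "X' - Zs j"] z by blast
          have zX: "z \<in> X'" "Inl g \<in> X'" using z ZjX gX by auto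
          obtain p q where pq: "p \<in> X'" "p \<in> ?D" "q \<in> X'" "q \<notin> ?D" "G p q"
            by (rule conn_cut[OF conn_X' zX(2) comp_of_self[OF gD] zX(1) zD])
          have q: "q \<in> Zs j" using comp_of_closed[OF symG gD pq(2) _ pq(5)] pq by blast
          then have qC: "q \<in> Cs i" using ZC[OF i(1) j(1)] j by blast
          then have "q \<in> X' - Zs i" using pq C(2)[OF i(1)] by blast
          then have "q \<in> ?F" using comp_of_closed[OF symG gF _ _ pq(5)] pq(2) DF by blast
          then show ?thesis using FC qC by blast
        qed
      qed
    qed
    have "card ({..<N} - {i}) \<le> n" by (rule card_good_le) (use all in auto)
    then show ?thesis using N i(1) by simp
  qed
qed

end

section \<open>Forcing a linkage from a model of a tree\<close>

lemma no_tern6_gam: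
  assumes "symp E" "\<And>x y. E x y \<Longrightarrow> wall r x y" "Y \<subseteq> range Inr"
  shows "\<not> tern (gam R a b c d r E) 6 Y"
proof
  assume "tern (gam R a b c d r E) 6 Y"
  then have "tern E 6 (Inr -` Y)" by (rule tern_vimage) (use assms(3) in auto)
  then show False using no_tern6_in_wall[OF assms(1,2)] by blast
qed

lemma pack_gam_Inl:
  assumes "pack (gam R a b c d r E) U n" "U \<subseteq> Inl ` A"
  shows "pack R A n"
proof (rule pack_image[OF assms(1), where F="\<lambda>Z. Inl -` Z"])
  fix Z assume Z: "Z \<subseteq> U" "tern (gam R a b c d r E) 6 Z"
  have "tern R 6 (Inl -` Z)" by (rule tern_vimage[OF Z(2)]) (use Z(1) assms(2) in auto)
  then show "tern R 6 (Inl -` Z) \<and> Inl -` Z \<subseteq> A" using Z(1) assms(2) by blast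
qed auto

text \<open>The test sets are a maximal family of ends of \<open>R1\<close>, one of
  \<open>R2\<close>, and \<open>R3\<close>: one set more than the branches \<open>R1\<close> and
  \<open>R2\<close> of the host can hold. So one image avoids both and lives on \<open>R3\<close>
  and the wall, where there is room for only one. Its weight makes it use both sides of the cut
  \<open>c d\<close>, and its complement then has to connect \<open>R1\<close> with \<open>v\<close>
  through the wall.\<close>

lemma tree_linkage:
  assumes symR: "symp R" and symE: "symp E" and EW: "\<And>x y. E x y \<Longrightarrow> wall r x y" and r: "0 < r" and fin: "finite V"
    and RV: "\<And>x y. R x y \<Longrightarrow> x \<in> V \<and> y \<in> V"
    and V: "V = {v} \<union> R1 \<union> R2 \<union> R3" "v \<notin> R1 \<union> R2 \<union> R3" "R1 \<inter> R2 = {}" "R1 \<inter> R3 = {}" "R2 \<inter> R3 = {}"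
    and b: "b \<in> R1" "R b v" and b2: "b2 \<in> R2" "R b2 v"
    and out1: "\<And>x y. x \<in> R1 \<Longrightarrow> y \<notin> R1 \<Longrightarrow> R x y \<Longrightarrow> x = b \<and> y = v"
    and out2: "\<And>x y. x \<in> R2 \<Longrightarrow> y \<notin> R2 \<Longrightarrow> R x y \<Longrightarrow> x = b2 \<and> y = v"
    and out3: "\<And>x y. x \<in> R3 \<Longrightarrow> y \<notin> R3 \<Longrightarrow> R x y \<Longrightarrow> y = v"
    and T: "T \<subseteq> R3" "d \<in> T" "c \<in> R3 - T"
    and outT: "\<And>x y. x \<in> T \<Longrightarrow> y \<notin> T \<Longrightarrow> R x y \<Longrightarrow> x = d \<and> y = c"
    and cR: "conn R R1" "conn R R2" "conn R R3" "conn R (V - R1)" "conn R (V - R2)" "conn R (V - R3)"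
    and p: "pack R R1 m" "pack R R2 m" "pack R R3 m" "\<not> pack R R3 (Suc m)" "5 \<le> m"
    and pT: "pack R T 2" "\<not> pack R T 4"
    and m: "model V R (gam R v b c d r E) \<gamma>" and sub: "\<And>x. x \<in> V \<Longrightarrow> \<gamma> x \<subseteq> Inl ` V \<union> range Inr"
  shows "linkage r E"
proof -
  let ?G = "gam R v b c d r E"
  have symG: "symp ?G" by (rule symp_gam[OF symR symE])
  have ne: "b \<noteq> v" "c \<noteq> v" "d \<noteq> v" "b \<noteq> c" "b \<noteq> d" "c \<noteq> d" using V b T by auto
  have fR: "finite R1" "finite R2" using fin V by auto
  have G1: "x = b \<and> q = Inr TB" if "x \<in> R1" "q \<notin> Inl ` R1" "?G (Inl x) q" for x q
  proof (cases q)
    case (Inl y) then show ?thesis using that out1[of x y] by (auto simp: insert_commute)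
  next
    case (Inr w) then show ?thesis using that V T by (auto simp: port_def)
  qed
  have G2: "x = b2 \<and> q = Inl v" if "x \<in> R2" "q \<notin> Inl ` R2" "?G (Inl x) q" for x q
  proof (cases q)
    case (Inl y) then show ?thesis using that out2[of x y] by auto
  next
    case (Inr w) then show ?thesis using that V T b by (auto simp: port_def)
  qed
  have G3: "q = Inl v \<or> x = c \<and> q = Inr (Z 0)" if "x \<in> R3 - T" "q \<notin> Inl ` (R3 - T)" "?G (Inl x) q" for x q
  proof (cases q)
    case (Inl y)
    show ?thesis
    proof (cases "y \<in> T")
      case True
      have "R y x" using that Inl symR by (auto dest: sympD)
      then show ?thesis using that Inl outT[of y x] True by auto
    next
      case False then show ?thesis using that Inl out3[of x y] by auto
    qed
  next
    case (Inr w) then show ?thesis using that V T b by (auto simp: port_def)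
  qed
  have GT: "x = d \<and> q = Inr (Z r)" if "x \<in> T" "q \<notin> Inl ` T" "?G (Inl x) q" for x q
  proof (cases q)
    case (Inl y) then show ?thesis using that outT[of x y] by (auto simp: insert_commute)
  next
    case (Inr w) then show ?thesis using that V T b by (auto simp: port_def)
  qed
  have i1: "?G (Inl x) (Inl y) \<longleftrightarrow> R x y" if "x \<in> R1" "y \<in> R1" for x y
    using that V T by (auto simp: doubleton_eq_iff)
  have i2: "?G (Inl x) (Inl y) \<longleftrightarrow> R x y" if "x \<in> R2" "y \<in> R2" for x y
    using that V T by (auto simp: doubleton_eq_iff)
  have e1: "ends R V m R1 1" unfolding ends_def by (rule exI[of _ "\<lambda>_. R1"]) (use cR p in simp)
  have e2: "ends R V m R2 1" unfolding ends_def by (rule exI[of _ "\<lambda>_. R2"]) (use cR p in simp)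
  obtain n1 where n1: "1 \<le> n1" "ends R V m R1 n1" "\<not> ends R V m R1 (Suc n1)" using ends_maximal[OF e1 fR(1)] by blast
  obtain n2 where n2: "1 \<le> n2" "ends R V m R2 n2" "\<not> ends R V m R2 (Suc n2)" using ends_maximal[OF e2 fR(2)] by blast
  obtain f1 where f1: "\<And>i. i < n1 \<Longrightarrow> f1 i \<subseteq> R1 \<and> conn R (f1 i) \<and> conn R (V - f1 i) \<and> pack R (f1 i) m"
      "\<And>i j. i < n1 \<Longrightarrow> j < n1 \<Longrightarrow> i \<noteq> j \<Longrightarrow> f1 i \<inter> f1 j = {}" using n1(2) unfolding ends_def by metis
  obtain f2 where f2: "\<And>i. i < n2 \<Longrightarrow> f2 i \<subseteq> R2 \<and> conn R (f2 i) \<and> conn R (V - f2 i) \<and> pack R (f2 i) m"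
      "\<And>i j. i < n2 \<Longrightarrow> j < n2 \<Longrightarrow> i \<noteq> j \<Longrightarrow> f2 i \<inter> f2 j = {}" using n2(2) unfolding ends_def by metis
  define N where "N = n1 + n2 + 1"
  define f where "f i = (if i < n1 then f1 i else if i < n1 + n2 then f2 (i - n1) else R3)" for i
  have f: "f i \<subseteq> V" "conn R (f i)" "conn R (V - f i)" "pack R (f i) m" if "i < N" for i
  proof -
    have "f i \<subseteq> V \<and> conn R (f i) \<and> conn R (V - f i) \<and> pack R (f i) m"
    proof (cases "i < n1")
      case True then show ?thesis using f1(1)[OF True] V(1) unfolding f_def by auto
    next
      case i1: False
      show ?thesis
      proof (cases "i < n1 + n2")
        case True
        then have "i - n1 < n2" using i1 by simp
        then show ?thesis using f2(1)[of "i - n1"] V(1) i1 True unfolding f_def by auto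
      next
        case False then show ?thesis using cR p V(1) i1 unfolding f_def by auto
      qed
    qed
    then show "f i \<subseteq> V" "conn R (f i)" "conn R (V - f i)" "pack R (f i) m" by blast+
  qed
  have fR1: "f i \<subseteq> R1" if "i < n1" for i using f1(1)[OF that] that unfolding f_def by simp
  have fR2: "f i \<subseteq> R2" if "\<not> i < n1" "i < n1 + n2" for i using f2(1)[of "i - n1"] that unfolding f_def by simp
  have fR3: "f i = R3" if "\<not> i < n1 + n2" for i using that unfolding f_def by simp
  have fd0: "f i \<inter> f j = {}" if "i < j" "j < N" for i j
  proof (cases "j < n1")
    case True then show ?thesis using f1(2)[of i j] that unfolding f_def by simp
  next
    case j1: False
    show ?thesis
    proof (cases "j < n1 + n2")
      case True
      show ?thesis
      proof (cases "i < n1")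
        case i1: True then show ?thesis using fR1[OF i1] fR2[OF j1 True] V(3) by blast
      next
        case i1: False
        have "i - n1 \<noteq> j - n1" using i1 j1 that by arith
        then show ?thesis using f2(2)[of "i - n1" "j - n1"] i1 j1 True that unfolding f_def by simp
      qed
    next
      case j2: False
      then have "i < n1 + n2" using that unfolding N_def by simp
      then show ?thesis using fR3[OF j2] fR1[of i] fR2[of i] V(4,5) by blast
    qed
  qed
  have fd: "f i \<inter> f j = {}" if "i < N" "j < N" "i \<noteq> j" for i j
    using fd0[of i j] fd0[of j i] that by (cases "i < j") (auto simp: Int_commute)
  define Zs where "Zs i = (\<Union>x\<in>f i. \<gamma> x)" for i
  define Cs where "Cs i = (\<Union>x\<in>V - f i. \<gamma> x)" for i
  have Z: "conn ?G (Zs i)" "pack ?G (Zs i) m" if "i < N" for i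
    unfolding Zs_def using model_conn_UN[OF m f(1,2)[OF that]] pack_model[OF m f(4,1)[OF that]] by blast+
  have C: "conn ?G (Cs i)" "Zs i \<inter> Cs i = {}" if "i < N" for i
    unfolding Zs_def Cs_def using model_conn_UN[OF m Diff_subset f(3)[OF that]]
      model_UN_disj[OF m f(1)[OF that] Diff_subset, of "f i"] by blast+
  have ZC: "Zs j \<subseteq> Cs i" if "i < N" "j < N" "i \<noteq> j" for i j
  proof -
    have "f j \<subseteq> V - f i" using fd[OF that] f(1)[OF that(2)] by blast
    then show ?thesis unfolding Zs_def Cs_def by blast
  qed
  have Zsub: "Zs i \<subseteq> Inl ` V \<union> range Inr" if "i < N" for i unfolding Zs_def using sub f(1)[OF that] by blast
  have Csub: "Cs i \<subseteq> Inl ` V \<union> range Inr" for i unfolding Cs_def using sub by blast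
  interpret B1: branch R V R1 b v m n1 N ?G Zs Cs
  proof (unfold_locales)
    show "R1 \<subseteq> V" "v \<in> V - R1" using V by auto
    show "n1 + 2 \<le> N" using n2(1) unfolding N_def by simp
  qed (use symR symG b cR n1 i1 G1 Z C ZC in blast)+
  interpret B2: branch R V R2 b2 v m n2 N ?G Zs Cs
  proof (unfold_locales)
    show "R2 \<subseteq> V" "v \<in> V - R2" using V by auto
    show "n2 + 2 \<le> N" using n1(1) unfolding N_def by simp
  qed (use symR symG b2 cR n2 i2 G2 Z C ZC in blast)+
  define I1 where "I1 = {i. i < N \<and> Zs i \<inter> Inl ` R1 \<noteq> {}}"
  define I2 where "I2 = {i. i < N \<and> Zs i \<inter> Inl ` R2 \<noteq> {}}"
  define J where "J = {..<N} - I1 - I2"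
  have J: "Zs i \<subseteq> {Inl v} \<union> Inl ` R3 \<union> range Inr" if "i \<in> J" for i
  proof -
    have "i < N" "Zs i \<inter> Inl ` R1 = {}" "Zs i \<inter> Inl ` R2 = {}" using that unfolding J_def I1_def I2_def by auto
    then show ?thesis using Zsub[of i] V(1) by blast
  qed
  have inl: "\<exists>x\<in>R3. p = Inl x" if "p \<in> U" "p \<in> Inl ` V" "U \<subseteq> Inl ` R3 \<union> range Inr" for p and U :: "('a + wv) set"
    using that by auto
  have R3V: "R3 \<subseteq> V" using V(1) by blast
  have inr: "\<exists>w. q = Inr w" if "q \<in> U" "q \<notin> Inl ` V" "U \<subseteq> Inl ` R3 \<union> range Inr" for q and U :: "('a + wv) set"
    using that R3V by (cases q) auto
  have noW: "\<not> tern ?G 6 Y" if "Y \<subseteq> range Inr" for Y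
    by (rule no_tern6_gam[OF symE _ that]) (rule EW)
  have toR3: "pack R R3 n"
    if U: "U \<subseteq> Inl ` R3 \<union> range Inr" "Inr (Z 0) \<notin> U" "Inr (Z r) \<notin> U" and pk: "pack ?G U n" for U n
  proof -
    have "pack ?G (U \<inter> Inl ` V) n"
    proof (rule pack_confined[OF pk])
      fix p q assume pq: "p \<in> U" "p \<in> Inl ` V" "q \<in> U" "q \<notin> Inl ` V"
      obtain x w where xw: "p = Inl x" "x \<in> R3" "q = Inr w" using inl[OF pq(1,2) U(1)] inr[OF pq(3,4) U(1)] by blast
      then show "\<not> ?G p q" using pq(3) U V b by (auto simp: port_def)
    next
      fix Y assume "Y \<subseteq> U - Inl ` V"
      then have "Y \<subseteq> range Inr" using inr[OF _ _ U(1)] by blast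
      then show "\<not> tern ?G 6 Y" by (rule noW)
    qed
    then show ?thesis by (rule pack_gam_Inl) (use U in blast)
  qed
  have J1: "i = j" if ij: "i \<in> J" "j \<in> J" for i j
  proof (rule ccontr)
    assume ne: "i \<noteq> j"
    have iN: "i < N" "j < N" using ij unfolding J_def by auto
    have "Zs i \<inter> Zs j = {}" using ZC[OF iN ne] C(2)[OF iN(1)] by blast
    then have "pack ?G (Zs i \<union> Zs j) (m + m)" by (rule pack_add[OF Z(2)[OF iN(1)] Z(2)[OF iN(2)]])
    \<comment> \<open>Removing \<open>v\<close>, \<open>Z 0\<close> and \<open>Z r\<close>, the only
      contacts of \<open>R3\<close>, costs at most three members, and \<open>m + m - 3\<close> still
      exceeds \<open>m\<close>.\<close>
    moreover have "m + m = Suc (Suc (Suc (m + m - 3)))" using p(5) by simp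
    ultimately have "pack ?G (Zs i \<union> Zs j) (Suc (Suc (Suc (m + m - 3))))" by simp
    then have "pack ?G (Zs i \<union> Zs j - {Inl v} - {Inr (Z 0)} - {Inr (Z r)}) (m + m - 3)" by (intro pack_remove)
    then have "pack R R3 (m + m - 3)"
      by (rule toR3[rotated 3]) (use J[OF ij(1)] J[OF ij(2)] in blast)+
    then have "pack R R3 (Suc m)" by (rule pack_mono) (use p(5) in auto)
    then show False using p(4) by blast
  qed
  have cI: "card I1 \<le> n1" "card I2 \<le> n2" unfolding I1_def I2_def by (rule B1.card_meeting_le B2.card_meeting_le)+
  have cJ: "card J \<le> 1" 
  proof -
    have "finite J" unfolding J_def by simp
    then have "card J \<le> Suc 0" unfolding card_le_Suc0_iff_eq[OF \<open>finite J\<close>] by (intro ballI J1)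
    then show ?thesis by simp
  qed
  have N3: "N \<le> card I1 + card I2 + card J"
  proof -
    have "{..<N} = I1 \<union> I2 \<union> J" unfolding J_def I1_def I2_def by auto
    then have "card {..<N} \<le> card (I1 \<union> I2) + card J" by (metis card_Un_le)
    also have "card (I1 \<union> I2) \<le> card I1 + card I2" by (rule card_Un_le)
    finally show ?thesis by simp
  qed
  have "0 < card J" "0 < card I1" "0 < card I2" using N3 cI cJ n1(1) n2(1) unfolding N_def by linarith+
  then have "J \<noteq> {}" "I1 \<noteq> {}" "I2 \<noteq> {}" by (metis card.empty less_irrefl)+
  then obtain i i1 i2 where i: "i \<in> J" and i12: "i1 \<in> I1" "i2 \<in> I2" by blast
  have iN: "i < N" using i unfolding J_def by blast
  have i1: "i1 < N" "i \<noteq> i1" "Zs i1 \<inter> Inl ` R1 \<noteq> {}" using i i12 unfolding J_def I1_def by blast+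
  have i2: "i2 < N" "i \<noteq> i2" "Zs i2 \<inter> Inl ` R2 \<noteq> {}" using i i12 unfolding J_def I2_def by blast+
  let ?Z = "Zs i" and ?C = "Cs i"
  have C1: "?C \<inter> Inl ` R1 \<noteq> {}" using ZC[OF iN i1(1,2)] i1(3) by blast
  have C2: "?C \<inter> Inl ` R2 \<noteq> {}" using ZC[OF iN i2(1,2)] i2(3) by blast
  obtain x1 x2 where x: "x1 \<in> R1" "Inl x1 \<in> ?C" "x2 \<in> R2" "Inl x2 \<in> ?C" using C1 C2 by blast
  have vC: "Inl v \<in> ?C"
  proof -
    have "Inl x2 \<in> Inl ` R2" "Inl x1 \<notin> Inl ` R2" using x V(3) by auto
    then obtain p q where "p \<in> ?C" "p \<in> Inl ` R2" "q \<in> ?C" "q \<notin> Inl ` R2" "?G p q"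
      using conn_cut[OF C(1)[OF iN] x(4) _ x(2)] by metis
    then show ?thesis using G2 by blast
  qed
  have vC1: "Inl v \<notin> Inl ` R1" using V by auto
  have BC: "Inr TB \<in> ?C"
  proof -
    have "Inl x1 \<in> Inl ` R1" using x by auto
    then obtain p q where "p \<in> ?C" "p \<in> Inl ` R1" "q \<in> ?C" "q \<notin> Inl ` R1" "?G p q"
      using conn_cut[OF C(1)[OF iN] x(2) _ vC vC1] by metis
    then show ?thesis using G1 by blast
  qed
  have vZ: "Inl v \<notin> ?Z" using vC C(2)[OF iN] by blast
  then have Zi: "?Z \<subseteq> Inl ` R3 \<union> range Inr" using J[OF i] by blast
  \<comment> \<open>Otherwise all members but at most one, lost with \<open>Z 0\<close>, lie in
    \<open>R3 - T\<close>; together with two inside \<open>T\<close> they would be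
    \<open>m + 1\<close> members in \<open>R3\<close>.\<close>
  have meetT: "?Z \<inter> Inl ` T \<noteq> {}"
  proof
    assume n: "?Z \<inter> Inl ` T = {}"
    have "pack ?G ?Z (Suc (m - 1))" using Z(2)[OF iN] p(5) by simp
    then have pk: "pack ?G (?Z - {Inr (Z 0)}) (m - 1)" by (rule pack_remove)
    have "pack ?G ((?Z - {Inr (Z 0)}) \<inter> Inl ` V) (m - 1)"
    proof (rule pack_confined[OF pk])
      fix p q assume pq: "p \<in> ?Z - {Inr (Z 0)}" "p \<in> Inl ` V" "q \<in> ?Z - {Inr (Z 0)}" "q \<notin> Inl ` V"
      have pZ: "p \<in> ?Z" "q \<in> ?Z" using pq by blast+
      obtain x w where xw: "p = Inl x" "x \<in> R3" "q = Inr w" using inl[OF pZ(1) pq(2) Zi] inr[OF pZ(2) pq(4) Zi] by blast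
      have "x \<in> R3 - T" using xw(1,2) pZ(1) n by blast
      then have xw: "p = Inl x" "x \<in> R3 - T" "q = Inr w" using xw by blast+
      then show "\<not> ?G p q" using pq(3) V b T by (auto simp: port_def)
    next
      fix Y assume "Y \<subseteq> ?Z - {Inr (Z 0)} - Inl ` V"
      then have "Y \<subseteq> range Inr" using inr[OF _ _ Zi] by blast
      then show "\<not> tern ?G 6 Y" by (rule noW)
    qed
    then have "pack R (R3 - T) (m - 1)" by (rule pack_gam_Inl) (use Zi n in blast)
    then have "pack R (R3 - T \<union> T) (m - 1 + 2)" by (rule pack_add[OF _ pT(1)]) blast
    then have "pack R R3 (Suc m)" by (rule pack_mono) (use T p(5) in auto)
    then show False using p(4) by blast
  qed
  \<comment> \<open>Otherwise \<open>m - 1 \<ge> 4\<close> members lie in \<open>T\<close>, which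
    does not pack four.\<close>
  have meetR: "?Z \<inter> Inl ` (R3 - T) \<noteq> {}"
  proof
    assume n: "?Z \<inter> Inl ` (R3 - T) = {}"
    have "pack ?G ?Z (Suc (m - 1))" using Z(2)[OF iN] p(5) by simp
    then have pk: "pack ?G (?Z - {Inr (Z r)}) (m - 1)" by (rule pack_remove)
    have "pack ?G ((?Z - {Inr (Z r)}) \<inter> Inl ` V) (m - 1)"
    proof (rule pack_confined[OF pk])
      fix p q assume pq: "p \<in> ?Z - {Inr (Z r)}" "p \<in> Inl ` V" "q \<in> ?Z - {Inr (Z r)}" "q \<notin> Inl ` V"
      have pZ: "p \<in> ?Z" "q \<in> ?Z" using pq by blast+
      obtain x w where xw: "p = Inl x" "x \<in> R3" "q = Inr w" using inl[OF pZ(1) pq(2) Zi] inr[OF pZ(2) pq(4) Zi] by blast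
      have "x \<in> T" using xw(1,2) pZ(1) n by blast
      then have xw: "p = Inl x" "x \<in> T" "q = Inr w" using xw by blast+
      then show "\<not> ?G p q" using pq(3) V b T by (auto simp: port_def)
    next
      fix Y assume "Y \<subseteq> ?Z - {Inr (Z r)} - Inl ` V"
      then have "Y \<subseteq> range Inr" using inr[OF _ _ Zi] by blast
      then show "\<not> tern ?G 6 Y" by (rule noW)
    qed
    then have "pack R T (m - 1)" by (rule pack_gam_Inl) (use Zi n in blast)
    then have "pack R T 4" by (rule pack_mono) (use p(5) in auto)
    then show False using pT(2) by blast
  qed
  obtain y z where yz: "y \<in> T" "Inl y \<in> ?Z" "z \<in> R3 - T" "Inl z \<in> ?Z" using meetT meetR by blast
  have DZ: "Inr (Z r) \<in> ?Z"
  proof -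
    have "Inl y \<in> Inl ` T" "Inl z \<notin> Inl ` T" using yz by auto
    then obtain p q where "p \<in> ?Z" "p \<in> Inl ` T" "q \<in> ?Z" "q \<notin> Inl ` T" "?G p q"
      using conn_cut[OF Z(1)[OF iN] yz(2) _ yz(4)] by metis
    then show ?thesis using GT by blast
  qed
  have CZ: "Inr (Z 0) \<in> ?Z"
  proof -
    have "Inl z \<in> Inl ` (R3 - T)" "Inl y \<notin> Inl ` (R3 - T)" using yz by auto
    then obtain p q where "p \<in> ?Z" "p \<in> Inl ` (R3 - T)" "q \<in> ?Z" "q \<notin> Inl ` (R3 - T)" "?G p q"
      using conn_cut[OF Z(1)[OF iN] yz(4) _ yz(2)] by metis
    then show ?thesis using G3 vZ by blast
  qed
  have Q: "conn ?G (?Z - Inl ` T - Inl ` (R3 - T))"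
  proof (rule conn_retract[OF symG _ _, where z="Inr (Z 0)"])
    show "conn ?G (?Z - Inl ` T)"
      by (rule conn_retract[OF symG Z(1)[OF iN], where z="Inr (Z r)"]) (use DZ GT in blast)+
  next
    fix p q assume pq: "p \<in> ?Z - Inl ` T" "p \<in> Inl ` (R3 - T)" "q \<in> ?Z - Inl ` T" "q \<notin> Inl ` (R3 - T)" "?G p q"
    then show "q = Inr (Z 0)" using G3 vZ by blast
  qed (use CZ in blast)
  have Qsub: "?Z - Inl ` T - Inl ` (R3 - T) \<subseteq> range Inr" using Zi by blast
  have noZ: "Inr (Z 0) \<notin> ?C" "Inr (Z r) \<notin> ?C" using CZ DZ C(2)[OF iN] by blast+
  \<comment> \<open>\<open>R1\<close> hangs on the complement only at \<open>TB\<close>. Once it is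
    cut off, the only contact of the remaining vertices of \<open>V\<close> with the wall is the
    port of \<open>v\<close> at \<open>TA\<close>, since \<open>Z 0\<close> and \<open>Z r\<close>
    belong to the other set.\<close>
  let ?C' = "?C - Inl ` R1"
  have cC': "conn ?G ?C'"
    by (rule conn_retract[OF symG C(1)[OF iN], where z="Inr TB"]) (use BC G1 in blast)+
  have WX: "p = Inl v \<and> q = Inr TA" if h: "p \<in> ?C'" "p \<in> Inl ` V" "q \<in> ?C'" "q \<notin> Inl ` V" "?G p q" for p q
  proof -
    obtain x where x: "p = Inl x" "x \<notin> R1" using h(1,2) by blast
    obtain w where w: "q = Inr w" using h(3,4) Csub[of i] by (cases q) auto
    have "x \<noteq> b" "w \<noteq> Z 0" "w \<noteq> Z r" using x w h(3) noZ b by auto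
    then show ?thesis using h(5) x w by (auto simp: port_def)
  qed
  have cP: "conn ?G (?C' - Inl ` V)"
    by (rule conn_retract[OF symG cC', where z="Inr TA"]) (use BC WX in blast)+
  have Psub: "?C' - Inl ` V \<subseteq> range Inr" using Csub[of i] by blast
  have P: "conn E (Inr -` (?C' - Inl ` V))" by (rule conn_vimage[OF cP _ Psub]) auto
  have "Inr TA \<in> ?C'"
  proof -
    have "Inl v \<in> ?C'" "Inl v \<in> Inl ` V" "Inr TB \<in> ?C'" "Inr TB \<notin> Inl ` V" using vC vC1 BC V by auto
    then obtain p q where "p \<in> ?C'" "p \<in> Inl ` V" "q \<in> ?C'" "q \<notin> Inl ` V" "?G p q"
      using conn_cut[OF cC'] by metis
    then show ?thesis using WX by blast
  qed
  then have AB: "TA \<in> Inr -` (?C' - Inl ` V)" "TB \<in> Inr -` (?C' - Inl ` V)" using BC by auto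
  have Q': "conn E (Inr -` (?Z - Inl ` T - Inl ` (R3 - T)))" by (rule conn_vimage[OF Q _ Qsub]) auto
  have CD: "Z 0 \<in> Inr -` (?Z - Inl ` T - Inl ` (R3 - T))" "Z r \<in> Inr -` (?Z - Inl ` T - Inl ` (R3 - T))"
    using CZ DZ by auto
  have "Inr -` (?C' - Inl ` V) \<inter> Inr -` (?Z - Inl ` T - Inl ` (R3 - T)) = {}" using C(2)[OF iN] by blast
  then show ?thesis unfolding linkage_def using P Q' AB CD by blast
qed

section \<open>Ladders through the wall\<close>

definition lads :: "nat \<Rightarrow> nat \<times> bool \<Rightarrow> nat \<times> bool \<Rightarrow> bool" where
  "lads n x y \<longleftrightarrow> lad x y \<and> fst x \<in> {1..n} \<and> fst y \<in> {1..n}"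

lemma model_rel_mono:
  assumes "model V R E \<gamma>" "\<And>x y. x \<in> V \<Longrightarrow> y \<in> V \<Longrightarrow> R' x y \<Longrightarrow> R x y"
  shows "model V R' E \<gamma>"
  unfolding model_def
proof (intro conjI ballI impI)
  fix x y assume xy: "x \<in> V" "y \<in> V"
  show "conn E (\<gamma> x)" by (rule model_conn[OF assms(1) xy(1)])
  show "\<gamma> x \<inter> \<gamma> y = {}" if "x \<noteq> y" using model_disj[OF assms(1) xy] that by blast
  show "adj E (\<gamma> x) (\<gamma> y)" if "R' x y" by (rule model_adj[OF assms(1) xy assms(2)[OF xy that]])
qed

text \<open>\<open>A\<close> splits into runs of at most five columns, each preceded by
  \<open>0\<close> or an element of \<open>C\<close> and followed by an element of \<open>C\<close>
  or \<open>n + 1\<close>. More than 20 columns need all five possible beginnings. Then runs and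
  elements of \<open>C\<close> cover \<open>{1..n}\<close>, so
  \<open>n \<le> 25 + 4\<close>.\<close>

lemma runs_bound:
  fixes A C :: "nat set"
  assumes A: "A \<subseteq> {1..n}" and C: "C \<subseteq> {1..n}" "card C \<le> 4" and dis: "A \<inter> C = {}"
    and up: "\<And>i. i \<in> A \<Longrightarrow> i < n \<Longrightarrow> Suc i \<in> A \<union> C"
    and down: "\<And>i. i \<in> A \<Longrightarrow> 1 < i \<Longrightarrow> i - 1 \<in> A \<union> C"
    and six: "\<And>i. \<not> {i..<i+6} \<subseteq> A" and n: "30 \<le> n"
  shows "card A \<le> 20"
proof (rule ccontr)
  assume big: "\<not> card A \<le> 20"
  have fC: "finite C" and fA: "finite A" using A C finite_subset by blast+
  \<comment> \<open>\<open>T\<close> collects the positions directly after a run and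
    \<open>S\<close> those directly before one.\<close>
  define T where "T = {t \<in> insert (Suc n) C. t - 1 \<in> A}"
  define S where "S = {t \<in> insert 0 C. Suc t \<in> A}"
  have fT: "finite T" and fS: "finite S" unfolding T_def S_def using fC by auto
  have AT: "A \<subseteq> (\<Union>t\<in>T. {t - 5..<t})"
  proof
    fix i assume i: "i \<in> A"
    define t where "t = (LEAST t. i < t \<and> t \<notin> A)"
    obtain u where u: "i \<le> u" "u < i + 6" "u \<notin> A" using six[of i] by fastforce
    have "i < u" using u i by (metis le_neq_implies_less)
    then have ex: "i < u \<and> u \<notin> A" using u by simp
    have t: "i < t" "t \<notin> A" using LeastI[of "\<lambda>t. i < t \<and> t \<notin> A", OF ex] unfolding t_def by auto
    have tu: "t \<le> u" unfolding t_def by (rule Least_le) (rule ex)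
    have t1: "t - 1 \<in> A"
    proof (rule ccontr)
      assume n: "t - 1 \<notin> A"
      then have "i \<noteq> t - 1" using i by blast
      then have "i < t - 1 \<and> t - 1 \<notin> A" using t(1) n by simp
      then have "t \<le> t - 1" unfolding t_def by (rule Least_le)
      then show False using t(1) by simp
    qed
    have "t \<in> insert (Suc n) C"
    proof (cases "t - 1 < n")
      case True
      then show ?thesis using up[OF t1] t by auto
    next
      case False
      have "t - 1 \<le> n" using t1 A by auto
      then have "t = Suc n" using False t(1) by simp
      then show ?thesis by simp
    qed
    then have "t \<in> T" using t1 unfolding T_def by blast
    moreover have "i \<in> {t - 5..<t}" using t(1) tu u(2) by auto
    ultimately show "i \<in> (\<Union>t\<in>T. {t - 5..<t})" by blast
  qed
  have AS: "A \<subseteq> (\<Union>t\<in>S. {Suc t..<t + 6})"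
  proof
    fix i assume i: "i \<in> A"
    define P where "P t \<longleftrightarrow> t < i \<and> t \<notin> A" for t
    have i1: "1 \<le> i" using i A by auto
    have P0: "P 0" using i1 A unfolding P_def by auto
    define t where "t = (GREATEST t. P t)"
    have b: "\<And>y. P y \<Longrightarrow> y \<le> i" unfolding P_def by simp
    have t: "t < i" "t \<notin> A" using GreatestI_nat[of P, OF P0 b] unfolding t_def P_def by auto
    have mx: "y \<le> t" if "P y" for y unfolding t_def by (rule Greatest_le_nat[of P, OF that b])
    have between: "u \<in> A" if "t < u" "u \<le> i" for u
    proof (rule ccontr)
      assume "u \<notin> A"
      then have "P u" unfolding P_def using that i by (metis le_neq_implies_less)
      then show False using mx that by fastforce
    qed
    have "i < t + 6 + 1"
    proof (rule ccontr)
      assume "\<not> ?thesis"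
      then have "{Suc t..<Suc t + 6} \<subseteq> A" using between by auto
      then show False using six by blast
    qed
    moreover have "i \<noteq> t + 6"
    proof
      assume "i = t + 6"
      then have "{Suc t..<Suc t + 6} \<subseteq> A" using between by auto
      then show False using six by blast
    qed
    ultimately have it: "i < t + 6" by simp
    have s1: "Suc t \<in> A" using between[of "Suc t"] t by simp
    have "t \<in> insert 0 C"
    proof (cases "t = 0")
      case False
      then show ?thesis using down[OF s1] t by auto
    qed simp
    then have "t \<in> S" using s1 unfolding S_def by blast
    then show "i \<in> (\<Union>t\<in>S. {Suc t..<t + 6})" using t it by (intro UN_I[of t]) auto
  qed
  have cT: "card A \<le> 5 * card T"
  proof -
    have "card A \<le> card (\<Union>t\<in>T. {t - 5..<t})" by (rule card_mono[OF _ AT]) (use fT in simp)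
    also have "\<dots> \<le> (\<Sum>t\<in>T. card {t - 5..<t})" by (rule card_UN_le[OF fT])
    also have "\<dots> \<le> (\<Sum>t\<in>T. 5)" by (rule sum_mono) simp
    finally show ?thesis by simp
  qed
  have cS: "card A \<le> 5 * card S"
  proof -
    have "card A \<le> card (\<Union>t\<in>S. {Suc t..<t + 6})" by (rule card_mono[OF _ AS]) (use fS in simp)
    also have "\<dots> \<le> (\<Sum>t\<in>S. card {Suc t..<t + 6})" by (rule card_UN_le[OF fS])
    also have "\<dots> \<le> (\<Sum>t\<in>S. 5)" by (rule sum_mono) simp
    finally show ?thesis by simp
  qed
  have c5: "card (insert (Suc n) C) \<le> 5" "card (insert 0 C) \<le> 5" using C(2) fC by (auto simp: card_insert_if)
  have T: "T = insert (Suc n) C"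
    by (rule card_seteq) (use cT big c5 fC in \<open>auto simp: T_def\<close>)
  have S: "S = insert 0 C"
    by (rule card_seteq) (use cS big c5 fC in \<open>auto simp: S_def\<close>)
  have "Suc i \<in> A \<union> C" if "i < n" for i
    using that
  proof (induction i)
    case 0
    then show ?case using S unfolding S_def by auto
  next
    case (Suc i)
    then have "Suc i \<in> A \<union> C" by simp
    then show ?case
    proof
      assume "Suc i \<in> A" then show ?thesis using up[of "Suc i"] Suc.prems by simp
    next
      assume "Suc i \<in> C"
      then have "Suc i \<in> S" using S by simp
      then show ?thesis unfolding S_def by simp
    qed
  qed
  then have "{1..n} \<subseteq> A \<union> C" by (metis (no_types, lifting) Suc_le_D atLeastAtMost_iff Suc_le_lessD less_eq_Suc_le One_nat_def subsetI)
  then have "n \<le> card (A \<union> C)" using card_mono[of "A \<union> C" "{1..n}"] fA fC by simp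
  also have "\<dots> \<le> card A + card C" by (rule card_Un_le)
  also have "card T \<le> 5" using T c5 by simp
  then have "card A \<le> 25" using cT by simp
  finally show False using C(2) n \<open>card A \<le> 25\<close> by simp
qed

section \<open>Models of the ladder in its host graph\<close>

locale ladder_host =
  fixes n r :: nat and E :: "wv \<Rightarrow> wv \<Rightarrow> bool" and \<gamma> :: "nat \<times> bool \<Rightarrow> (nat \<times> bool + wv) set"
  assumes n: "69 \<le> n" and r: "0 < r" and symE: "symp E" and EW: "\<And>x y. E x y \<Longrightarrow> wall r x y"
    and m: "model ({1..n} \<times> UNIV) (lads n) (gam (lads n) (27, True) (28, True) (n - 27, True) (n - 26, True) r E) \<gamma>"
    and sub: "\<And>x. x \<in> {1..n} \<times> UNIV \<Longrightarrow> \<gamma> x \<subseteq> Inl ` ({1..n} \<times> UNIV) \<union> range Inr"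
begin

abbreviation "V \<equiv> {1..n} \<times> (UNIV :: bool set)"
abbreviation "G \<equiv> gam (lads n) (27, True) (28, True) (n - 27, True) (n - 26, True) r E"

lemma symL: "symp (lads n)"
  using symp_lad unfolding lads_def by (auto simp: symp_def)

lemma symG: "symp G"
  by (rule symp_gam[OF symL symE])

fun reg :: "nat \<times> bool + wv \<Rightarrow> nat" where
  "reg (Inl x) = (if fst x \<le> 27 then 1 else if fst x \<le> n - 27 then 2 else 3)"
| "reg (Inr w) = 4"

definition "g1 = (Inl (28, False) :: nat \<times> bool + wv)"
definition "g3 = (Inl (n - 27, False) :: nat \<times> bool + wv)"
text \<open>Every edge between different regions has an end among these six vertices, so a connected
  set without them stays in one region. \<open>g1\<close> and \<open>g3\<close> belong to the rail
  \<open>False\<close>, which keeps its edges at the two cuts.\<close>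

definition "gates = {Inr TA, Inr TB, Inr (Z 0), Inr (Z r), g1, g3}"

lemma edge_reg:
  assumes "G p q" "reg p \<noteq> reg q"
  shows "(p, q) \<in> {(Inl (27, True), Inr TA), (Inl (28, True), Inr TB), (Inl (n - 27, True), Inr (Z 0)),
      (Inl (n - 26, True), Inr (Z r)), (Inl (27, False), g1), (Inl (n - 26, False), g3)} \<or>
    (q, p) \<in> {(Inl (27, True), Inr TA), (Inl (28, True), Inr TB), (Inl (n - 27, True), Inr (Z 0)),
      (Inl (n - 26, True), Inr (Z r)), (Inl (27, False), g1), (Inl (n - 26, False), g3)}"
proof (cases p)
  case pl: (Inl x)
  show ?thesis
  proof (cases q)
    case (Inl y)
    obtain i s where x: "x = (i, s)" by (cases x)
    obtain j t where y: "y = (j, t)" by (cases y)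
    have e: "lad (i, s) (j, t)" "{(i, s), (j, t)} \<noteq> {(27, True), (28, True)}" "{(i, s), (j, t)} \<noteq> {(n - 27, True), (n - 26, True)}"
      using assms(1) pl Inl x y unfolding lads_def by auto
    have ij: "i \<noteq> j" using assms(2) pl Inl x y by (auto split: if_splits)
    then have st: "s = t" "j = Suc i \<or> i = Suc j" using e(1) unfolding lad_def by auto
    have "(i = 27 \<and> j = 28) \<or> (i = 28 \<and> j = 27) \<or> (i = n - 27 \<and> j = n - 26) \<or> (i = n - 26 \<and> j = n - 27)"
      using assms(2) pl Inl x y st(2) n by (auto split: if_splits)
    then show ?thesis using e(2,3) st(1) pl Inl x y unfolding g1_def g3_def
      by (cases t) (auto simp: insert_commute)
  next
    case (Inr w)
    then show ?thesis using assms(1) pl by (auto simp: port_def)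
  qed
next
  case pr: (Inr w)
  show ?thesis
  proof (cases q)
    case (Inl y)
    then show ?thesis using assms(1) pr by (auto simp: port_def)
  next
    case (Inr u)
    then show ?thesis using assms(2) pr by simp
  qed
qed

declare reg.simps(1) [simp del]
lemmas reg_Inl = reg.simps(1)

lemma reg_simps [simp]: "reg g1 = 2" "reg g3 = 2" "reg (Inl (27, s)) = 1" "reg (Inl (28, s)) = 2"
    "reg (Inl (n - 27, s)) = 2" "reg (Inl (n - 26, s)) = 3"
  using n unfolding g1_def g3_def by (auto simp: reg_Inl)

lemma g_distinct [simp]: "Inr w \<noteq> g1" "Inr w \<noteq> g3" "g1 \<noteq> Inr w" "g3 \<noteq> Inr w"
  unfolding g1_def g3_def by auto

lemma edge_gate: "G p q \<Longrightarrow> p \<notin> gates \<Longrightarrow> q \<notin> gates \<Longrightarrow> reg p = reg q"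
  using edge_reg[of p q] unfolding gates_def by (cases "reg p = reg q") auto

lemma exit1:
  assumes "G p q" "reg p = 1" "reg q \<noteq> 1"
  shows "q = Inr TA \<or> q = g1"
  using edge_reg[OF assms(1)] assms(2,3) by auto

lemma exit3:
  assumes "G p q" "reg p = 3" "reg q \<noteq> 3"
  shows "q = Inr (Z r) \<or> q = g3"
  using edge_reg[OF assms(1)] assms(2,3) by auto

lemma cross24:
  assumes "G p q" "reg p = 2" "reg q = 4"
  shows "p = Inl (28, True) \<and> q = Inr TB \<or> p = Inl (n - 27, True) \<and> q = Inr (Z 0)"
  using edge_reg[OF assms(1)] assms(2,3) by auto

lemma exit4:
  assumes "G p q" "reg p = 4" "reg q \<noteq> 4"
  shows "p \<in> {Inr TA, Inr TB, Inr (Z 0), Inr (Z r)}"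
  using edge_reg[OF assms(1)] assms(2,3) by auto

definition seg :: "nat \<Rightarrow> nat \<Rightarrow> (nat \<times> bool + wv) set" where
  "seg i j = (\<Union>x\<in>{i..j} \<times> UNIV. \<gamma> x)"

definition rail :: "bool \<Rightarrow> nat \<Rightarrow> nat \<Rightarrow> (nat \<times> bool + wv) set" where
  "rail s i j = (\<Union>x\<in>{i..j} \<times> {s}. \<gamma> x)"

lemma conn_lads: "conn lad U \<Longrightarrow> U \<subseteq> V \<Longrightarrow> conn (lads n) U"
proof -
  assume a: "conn lad U" "U \<subseteq> V"
  show ?thesis
  proof (rule conn_mono[OF a(1)])
    fix x y assume "x \<in> U" "y \<in> U" "lad x y"
    then show "lads n x y" using subsetD[OF a(2), of x] subsetD[OF a(2), of y] unfolding lads_def by (simp add: mem_Times_iff)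
  qed
qed

lemma conn_seg:
  assumes "1 \<le> i" "i \<le> j" "j \<le> n"
  shows "conn G (seg i j)"
proof -
  have s: "{i..j} \<times> UNIV \<subseteq> V" using assms by auto
  have "{i..<Suc j} = {i..j}" by auto
  then have "conn lad ({i..j} \<times> UNIV)" using conn_lad[of i "Suc j"] assms by simp
  then show ?thesis unfolding seg_def by (intro model_conn_UN[OF m s] conn_lads[OF _ s])
qed

lemma conn_rail': 
  assumes "1 \<le> i" "i \<le> j" "j \<le> n"
  shows "conn G (rail s i j)"
proof -
  have s: "{i..j} \<times> {s} \<subseteq> V" using assms by auto
  have "{i..<Suc j} = {i..j}" by auto
  then have "conn lad ({i..j} \<times> {s})" using conn_rail[of i "Suc j"] assms by simp
  then show ?thesis unfolding rail_def by (intro model_conn_UN[OF m s] conn_lads[OF _ s])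
qed

lemma seg_disj: "1 \<le> i \<Longrightarrow> l \<le> n \<Longrightarrow> j < k \<Longrightarrow> k \<le> l \<Longrightarrow> seg i j \<inter> seg k l = {}"
  unfolding seg_def by (rule model_UN_disj[OF m]) auto

lemma seg_mono: "i' \<le> i \<Longrightarrow> j \<le> j' \<Longrightarrow> seg i j \<subseteq> seg i' j'"
  unfolding seg_def by (intro UN_mono Sigma_mono) auto

lemma seg_col: "p \<in> seg i j \<Longrightarrow> \<exists>k. i \<le> k \<and> k \<le> j \<and> p \<in> seg k k"
  unfolding seg_def by auto

lemma seg_in: "p \<in> seg k k \<Longrightarrow> i \<le> k \<Longrightarrow> k \<le> j \<Longrightarrow> p \<in> seg i j"
  unfolding seg_def by auto

lemma seg_rails: "seg i j = rail True i j \<union> rail False i j"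
proof -
  have "{i..j} \<times> (UNIV :: bool set) = {i..j} \<times> {True} \<union> {i..j} \<times> {False}" by auto
  then show ?thesis unfolding seg_def rail_def by (simp only: UN_Un)
qed

lemma rail_disj: "1 \<le> i \<Longrightarrow> j \<le> n \<Longrightarrow> rail True i j \<inter> rail False i j = {}"
  unfolding rail_def by (rule model_UN_disj[OF m]) auto

lemma same_col: 
  assumes "p \<in> seg i i" "p \<in> seg j j" "i \<in> {1..n}" "j \<in> {1..n}"
  shows "i = j"
  using seg_disj[of i j i j] seg_disj[of j i j i] assms by (cases i j rule: linorder_cases) auto

lemma seg_ne: "i \<in> {1..n} \<Longrightarrow> \<exists>p. p \<in> seg i i"
  using conn_nonempty[OF conn_seg[of i i]] by auto

lemma gamma_seg: "\<gamma> (i, s) \<subseteq> seg i i"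
  unfolding seg_def by auto

definition clean :: "nat \<Rightarrow> bool" where "clean i \<longleftrightarrow> seg i i \<inter> gates = {}"
definition kind :: "nat \<Rightarrow> nat \<Rightarrow> bool" where "kind i k \<longleftrightarrow> clean i \<and> (\<forall>p\<in>seg i i. reg p = k)"

lemma clean_const:
  assumes "1 \<le> i" "i \<le> j" "j \<le> n" "seg i j \<inter> gates = {}" "p \<in> seg i j" "q \<in> seg i j"
  shows "reg p = reg q"
proof (rule conn_const[OF conn_seg[OF assms(1-3)] _ assms(5,6)])
  fix p q assume "p \<in> seg i j" "q \<in> seg i j" "G p q"
  then show "reg p = reg q" using assms(4) by (intro edge_gate) auto
qed

lemma clean_typ: "i \<in> {1..n} \<Longrightarrow> clean i \<Longrightarrow> \<exists>k. kind i k"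
proof -
  assume i: "i \<in> {1..n}" "clean i"
  obtain p where p: "p \<in> seg i i" using seg_ne[OF i(1)] by blast
  have "kind i (reg p)" unfolding kind_def
  proof (intro conjI ballI i(2))
    fix q assume "q \<in> seg i i"
    then show "reg q = reg p" by (rule clean_const[of i i, rotated 4]) (use i p in \<open>auto simp: clean_def\<close>)
  qed
  then show ?thesis by blast
qed

lemma typ_unique: "i \<in> {1..n} \<Longrightarrow> kind i k \<Longrightarrow> kind i l \<Longrightarrow> k = l"
  using seg_ne[of i] unfolding kind_def by auto

lemma reg_range: "reg p \<in> {1, 2, 3, 4}"
  by (cases p) (auto simp: reg_Inl)

lemma typ_range: "i \<in> {1..n} \<Longrightarrow> kind i k \<Longrightarrow> k \<in> {1, 2, 3, 4}"
proof -
  assume i: "i \<in> {1..n}" "kind i k"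
  obtain p where "p \<in> seg i i" using seg_ne[OF i(1)] by blast
  then have "reg p = k" using i(2) unfolding kind_def by blast
  then show ?thesis using reg_range[of p] by simp
qed

lemma card_hit:
  assumes "finite S"
  shows "card {i \<in> {1..n}. seg i i \<inter> S \<noteq> {}} \<le> card S"
proof -
  define h where "h i = (SOME p. p \<in> seg i i \<inter> S)" for i
  have h: "h i \<in> seg i i \<inter> S" if "seg i i \<inter> S \<noteq> {}" for i
  proof -
    have "\<exists>p. p \<in> seg i i \<inter> S" using that by blast
    then show ?thesis unfolding h_def by (rule someI_ex)
  qed
  have "inj_on h {i \<in> {1..n}. seg i i \<inter> S \<noteq> {}}"
  proof (rule inj_onI)
    fix i j assume ij: "i \<in> {i \<in> {1..n}. seg i i \<inter> S \<noteq> {}}" "j \<in> {i \<in> {1..n}. seg i i \<inter> S \<noteq> {}}" "h i = h j"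
    then have "h i \<in> seg i i" "h i \<in> seg j j" using h[of i] h[of j] by auto
    then show "i = j" by (rule same_col) (use ij in simp_all)
  qed
  moreover have "h ` {i \<in> {1..n}. seg i i \<inter> S \<noteq> {}} \<subseteq> S"
  proof (rule image_subsetI)
    fix i assume "i \<in> {i \<in> {1..n}. seg i i \<inter> S \<noteq> {}}"
    then show "h i \<in> S" using h[of i] by simp
  qed
  ultimately show ?thesis using assms by (rule card_inj_on_le)
qed

lemma card_dirty: "card {i \<in> {1..n}. \<not> clean i} \<le> 6"
proof -
  have "card {i \<in> {1..n}. seg i i \<inter> gates \<noteq> {}} \<le> card gates" by (rule card_hit) (simp add: gates_def)
  also have "card gates \<le> 6" unfolding gates_def
    using card_length[of "[Inr TA, Inr TB, Inr (Z 0), Inr (Z r), g1, g3]"] by simp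
  finally show ?thesis unfolding clean_def .
qed

lemma typ4_six: "\<not> (\<forall>i\<in>{k..<k+6}. i \<in> {1..n} \<and> kind i 4)"
proof
  assume a: "\<forall>i\<in>{k..<k+6}. i \<in> {1..n} \<and> kind i 4"
  let ?\<delta> = "\<lambda>x. Inr -` \<gamma> x"
  have s: "{k..<k+6} \<times> UNIV \<subseteq> V" using a by auto
  have W: "\<gamma> x \<subseteq> range Inr" if x: "x \<in> {k..<k+6} \<times> UNIV" for x
  proof
    fix p assume p: "p \<in> \<gamma> x"
    have "kind (fst x) 4" using a x by auto
    moreover have "p \<in> seg (fst x) (fst x)" using p gamma_seg[of "fst x" "snd x"] by auto
    ultimately have "reg p = 4" unfolding kind_def by blast
    then show "p \<in> range Inr" by (cases p) (auto simp: reg_Inl split: if_splits)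
  qed
  show False
  proof (rule no_ladder6_in_wall[OF symE _, of r k ?\<delta>])
    show "model ({k..<k+6} \<times> UNIV) lad E ?\<delta>"
      unfolding model_def
    proof (intro conjI ballI impI)
      fix x :: "nat \<times> bool" assume x: "x \<in> {k..<k+6} \<times> UNIV"
      show "conn E (?\<delta> x)" by (rule conn_vimage[OF model_conn[OF m] _ W[OF x]]) (use x s in auto)
    next
      fix x y :: "nat \<times> bool" assume xy: "x \<in> {k..<k+6} \<times> UNIV" "y \<in> {k..<k+6} \<times> UNIV" "x \<noteq> y"
      then show "?\<delta> x \<inter> ?\<delta> y = {}" using model_disj[OF m, of x y] s by blast
    next
      fix x y :: "nat \<times> bool" assume xy: "x \<in> {k..<k+6} \<times> UNIV" "y \<in> {k..<k+6} \<times> UNIV" "lad x y"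
      then have "lads n x y" using s unfolding lads_def by auto
      then obtain p q where pq: "p \<in> \<gamma> x" "q \<in> \<gamma> y" "G p q"
        using model_adj[OF m, of x y] xy s unfolding adj_def by blast
      obtain w u where "p = Inr w" "q = Inr u" using W[OF xy(1)] W[OF xy(2)] pq by blast
      then show "adj E (?\<delta> x) (?\<delta> y)" using pq unfolding adj_def by auto
    qed
  next
    fix x :: "nat \<times> bool" assume x: "x \<in> {k..<k+6} \<times> UNIV"
    have "kind (fst x) 4" using a x by auto
    then have "\<gamma> x \<inter> gates = {}" using gamma_seg[of "fst x" "snd x"] unfolding kind_def clean_def by auto
    then show "TA \<notin> ?\<delta> x \<and> TB \<notin> ?\<delta> x" unfolding gates_def by auto
  qed (rule EW)
qed

text \<open>The wall is left only through its four terminals, and neither of the two columns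
  contains one.\<close>

lemma typ4_step:
  assumes "i \<in> {1..n}" "j \<in> {1..n}" "j = Suc i \<or> i = Suc j" "kind i 4"
    and g: "seg j j \<inter> {Inr TA, Inr TB, Inr (Z 0), Inr (Z r)} = {}"
  shows "kind j 4"
proof -
  define l h where "l = min i j" and "h = max i j"
  have lh: "1 \<le> l" "l \<le> h" "h \<le> n" "seg l h = seg i i \<union> seg j j"
  proof -
    have e: "{l..h} = {i, j}" "l \<le> h" "1 \<le> l" "h \<le> n" using assms(1-3) unfolding l_def h_def by auto
    then show "1 \<le> l" "l \<le> h" "h \<le> n" by auto
    show "seg l h = seg i i \<union> seg j j" unfolding seg_def e(1) by auto
  qed
  obtain p where p: "p \<in> seg i i" using seg_ne[OF assms(1)] by blast
  have "seg l h \<subseteq> {p. reg p = 4}"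
  proof (rule conn_subset_of[OF conn_seg[OF lh(1-3)], of p])
    show "p \<in> seg l h" using p lh by blast
    show "p \<in> {p. reg p = 4}" using p assms(4) unfolding kind_def by blast
  next
    fix u v assume uv: "u \<in> seg l h" "u \<in> {p. reg p = 4}" "v \<in> seg l h" "G u v"
    have "u \<notin> {Inr TA, Inr TB, Inr (Z 0), Inr (Z r)}"
      using uv(1) lh(4) g assms(4) unfolding kind_def clean_def gates_def by blast
    then show "v \<in> {p. reg p = 4}" using exit4[OF uv(4)] uv(2) by auto
  qed
  then have "\<forall>p\<in>seg j j. reg p = 4" using lh(4) by blast
  moreover from this have "clean j" using g unfolding clean_def gates_def by (fastforce simp: disjoint_iff)
  ultimately show ?thesis unfolding kind_def by blast
qed

lemma card_typ4: "card {i \<in> {1..n}. kind i 4} \<le> 20"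
proof (rule runs_bound[where n=n and C="{i \<in> {1..n}. seg i i \<inter> {Inr TA, Inr TB, Inr (Z 0), Inr (Z r)} \<noteq> {}}"])
  have "card {i \<in> {1..n}. seg i i \<inter> {Inr TA, Inr TB, Inr (Z 0), Inr (Z r)} \<noteq> {}}
      \<le> card {Inr TA, Inr TB, Inr (Z 0), Inr (Z r) :: nat \<times> bool + wv}" by (rule card_hit) simp
  also have "\<dots> \<le> 4" using card_length[of "[Inr TA, Inr TB, Inr (Z 0), Inr (Z r) :: nat \<times> bool + wv]"] by simp
  finally show "card {i \<in> {1..n}. seg i i \<inter> {Inr TA, Inr TB, Inr (Z 0), Inr (Z r)} \<noteq> {}} \<le> 4" .
next
  show "{i \<in> {1..n}. kind i 4} \<inter> {i \<in> {1..n}. seg i i \<inter> {Inr TA, Inr TB, Inr (Z 0), Inr (Z r)} \<noteq> {}} = {}"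
    unfolding kind_def clean_def gates_def by auto
next
  fix i assume "i \<in> {i \<in> {1..n}. kind i 4}" "i < n"
  then show "Suc i \<in> {i \<in> {1..n}. kind i 4} \<union> {i \<in> {1..n}. seg i i \<inter> {Inr TA, Inr TB, Inr (Z 0), Inr (Z r)} \<noteq> {}}"
    using typ4_step[of i "Suc i"] by (cases "seg (Suc i) (Suc i) \<inter> {Inr TA, Inr TB, Inr (Z 0), Inr (Z r)} = {}") auto
next
  fix i assume i: "i \<in> {i \<in> {1..n}. kind i 4}" "1 < i"
  have "1 \<le> i - 1" "i = Suc (i - 1)" "i - 1 \<le> n" using i by auto
  then show "i - 1 \<in> {i \<in> {1..n}. kind i 4} \<union> {i \<in> {1..n}. seg i i \<inter> {Inr TA, Inr TB, Inr (Z 0), Inr (Z r)} \<noteq> {}}"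
    using typ4_step[of i "i - 1"] i by (cases "seg (i - 1) (i - 1) \<inter> {Inr TA, Inr TB, Inr (Z 0), Inr (Z r)} = {}") auto
next
  fix i show "\<not> {i..<i+6} \<subseteq> {i \<in> {1..n}. kind i 4}" using typ4_six[of i] by blast
qed (use n in auto)

text \<open>A column of the model consists of two disjoint nonempty branch sets, hence takes at
  least two vertices, while the region has only \<open>2 * card J\<close>.\<close>

lemma card_in_region:
  assumes I: "I \<subseteq> {1..n}" and J: "finite J" "\<And>i. i \<in> I \<Longrightarrow> seg i i \<subseteq> Inl ` (J \<times> UNIV)"
  shows "card I \<le> card J"
proof -
  define h where "h x = (SOME p. p \<in> \<gamma> x)" for x
  have h: "h x \<in> \<gamma> x" if "x \<in> V" for x
    unfolding h_def using conn_nonempty[OF model_conn[OF m that]] by (simp add: some_in_eq)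
  have IV: "I \<times> UNIV \<subseteq> V" using I by auto
  have "inj_on h (I \<times> UNIV)"
  proof (rule inj_onI)
    fix x y :: "nat \<times> bool" assume xy: "x \<in> I \<times> UNIV" "y \<in> I \<times> UNIV" "h x = h y"
    show "x = y" using model_disj[OF m, of x y "h x"] h[of x] h[of y] xy IV by (metis subsetD)
  qed
  moreover have "h ` (I \<times> UNIV) \<subseteq> Inl ` (J \<times> UNIV)"
  proof
    fix p assume "p \<in> h ` (I \<times> UNIV)"
    then obtain i s where x: "i \<in> I" "p = h (i, s)" by auto
    then have "p \<in> seg i i" using h[of "(i, s)"] subsetD[OF I x(1)] gamma_seg[of i s] by auto
    then show "p \<in> Inl ` (J \<times> UNIV)" using J(2)[OF x(1)] by blast
  qed
  moreover have "finite (Inl ` (J \<times> (UNIV :: bool set)) :: (nat \<times> bool + wv) set)" using J(1) by simp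
  ultimately have "card (I \<times> (UNIV :: bool set)) \<le> card (Inl ` (J \<times> (UNIV :: bool set)) :: (nat \<times> bool + wv) set)"
    by (rule card_inj_on_le)
  then show ?thesis using J(1) by (simp add: card_image card_cartesian_product)
qed

lemma seg_reg_sub:
  assumes "i \<in> {1..n}" "\<forall>p\<in>seg i i. reg p = k" "k \<noteq> 4"
  shows "seg i i \<subseteq> Inl ` ({j \<in> {1..n}. reg (Inl (j, True)) = k} \<times> UNIV)"
proof
  fix p assume p: "p \<in> seg i i"
  then obtain t where "p \<in> \<gamma> (i, t)" unfolding seg_def by auto
  then have U: "p \<in> Inl ` V \<union> range Inr" using sub[of "(i, t)"] assms(1) by blast
  have "reg p = k" using assms(2) p by blast
  then obtain j s where "p = Inl (j, s)" "j \<in> {1..n}" using U assms(3) by (cases p) auto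
  moreover from this have "reg (Inl (j, True)) = k" using \<open>reg p = k\<close> by (simp add: reg_Inl split: if_splits)
  ultimately show "p \<in> Inl ` ({j \<in> {1..n}. reg (Inl (j, True)) = k} \<times> UNIV)" by blast
qed

lemma region_cols: "{j \<in> {1..n}. reg (Inl (j, True)) = 1} = {1..27}"
    "{j \<in> {1..n}. reg (Inl (j, True)) = 2} = {28..n - 27}"
    "{j \<in> {1..n}. reg (Inl (j, True)) = 3} = {n - 26..n}"
  using n by (auto simp: reg_Inl split: if_splits)

lemma card_typ: "card {i \<in> {1..n}. kind i 1} \<le> 27" "card {i \<in> {1..n}. kind i 2} \<le> n - 54" "card {i \<in> {1..n}. kind i 3} \<le> 27"
proof -
  have c: "card {i \<in> {1..n}. kind i k} \<le> card {j \<in> {1..n}. reg (Inl (j, True)) = k}" if "k \<noteq> 4" for k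
    by (rule card_in_region) (use seg_reg_sub[of _ k] that in \<open>auto simp: kind_def\<close>)
  show "card {i \<in> {1..n}. kind i 1} \<le> 27" using c[of 1] unfolding region_cols by simp
  show "card {i \<in> {1..n}. kind i 2} \<le> n - 54" using c[of 2] unfolding region_cols by simp
  show "card {i \<in> {1..n}. kind i 3} \<le> 27" using c[of 3] n unfolding region_cols by simp
qed

text \<open>Without kind 1 there are at most 6 dirty columns, \<open>n - 54\<close> in the middle,
  27 in the other outer part and 20 in the wall: only \<open>n - 1\<close> in total. The same holds
  for kind 3.\<close>

lemma typ13_ex: "\<exists>i\<in>{1..n}. kind i 1" "\<exists>i\<in>{1..n}. kind i 3"
proof -
  let ?T = "\<lambda>k. {i \<in> {1..n}. kind i k}"
  have "{1..n} \<subseteq> {i \<in> {1..n}. \<not> clean i} \<union> (?T 1 \<union> (?T 2 \<union> (?T 3 \<union> ?T 4)))"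
    using clean_typ typ_range by fastforce
  then have "card {1..n} \<le> card ({i \<in> {1..n}. \<not> clean i} \<union> (?T 1 \<union> (?T 2 \<union> (?T 3 \<union> ?T 4))))"
    by (rule card_mono[rotated]) simp
  also have "\<dots> \<le> card {i \<in> {1..n}. \<not> clean i} + (card (?T 1) + (card (?T 2) + (card (?T 3) + card (?T 4))))"
    by (intro order_trans[OF card_Un_le] add_mono order_refl)
  finally have s: "n \<le> card {i \<in> {1..n}. \<not> clean i} + (card (?T 1) + (card (?T 2) + (card (?T 3) + card (?T 4))))" by simp
  have "0 < card (?T 1)" "0 < card (?T 3)" using s card_dirty card_typ card_typ4 n by linarith+
  then show "\<exists>i\<in>{1..n}. kind i 1" "\<exists>i\<in>{1..n}. kind i 3" by (auto simp: card_gt_0_iff)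
qed

text \<open>Each rail passes from column \<open>i\<close> inside \<open>L\<close> to column
  \<open>j\<close> outside it and needs an exit of its own; the rails are disjoint, so each has
  exactly one. Hence both stay connected after the removal of \<open>L\<close>, and column
  \<open>j\<close> joins them.\<close>

lemma two_exits:
  assumes ex: "\<And>p q. G p q \<Longrightarrow> p \<in> L \<Longrightarrow> q \<notin> L \<Longrightarrow> q = z1 \<or> q = z2"
    and lh: "1 \<le> l" "h \<le> n" "i \<in> {l..h}" "j \<in> {l..h}" and i: "seg i i \<subseteq> L" and j: "seg j j \<inter> L = {}"
  shows "z1 \<in> seg l h \<and> z2 \<in> seg l h \<and> conn G (seg l h - L)"
proof -
  have lh': "l \<le> h" using lh by auto
  have ne: "\<gamma> (k, s) \<noteq> {}" if "k \<in> {l..h}" for k s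
    using conn_nonempty[OF model_conn[OF m, of "(k, s)"]] that lh by auto
  have inr: "\<gamma> (k, s) \<subseteq> rail s l h" if "k \<in> {l..h}" for k s
    unfolding rail_def by (rule UN_upper) (use that in simp)
  have one: "\<exists>q\<in>rail s l h. q \<notin> L \<and> (q = z1 \<or> q = z2)" for s
  proof -
    obtain x y where xy: "x \<in> \<gamma> (i, s)" "y \<in> \<gamma> (j, s)" using ne[OF lh(3)] ne[OF lh(4)] by blast
    have "x \<in> rail s l h" "x \<in> L" "y \<in> rail s l h" "y \<notin> L"
      using xy inr lh gamma_seg i j by blast+
    then obtain p q where "p \<in> rail s l h" "p \<in> L" "q \<in> rail s l h" "q \<notin> L" "G p q"
      using conn_cut[OF conn_rail'[OF lh(1) lh' lh(2)]] by metis
    then show ?thesis using ex by blast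
  qed
  have dis: "rail True l h \<inter> rail False l h = {}" by (rule rail_disj[OF lh(1,2)])
  obtain s where s: "z1 \<in> rail s l h" "z2 \<in> rail (\<not> s) l h"
  proof (cases "z1 \<in> rail True l h")
    case True
    then have "z2 \<in> rail False l h" using one[of False] dis by blast
    then show ?thesis using that[of True] True by simp
  next
    case False
    then have z2: "z2 \<in> rail True l h" using one[of True] by blast
    then have "z1 \<in> rail False l h" using one[of False] dis by blast
    then show ?thesis using that[of False] z2 by simp
  qed
  have ns: "z2 \<notin> rail s l h" "z1 \<notin> rail (\<not> s) l h" using s dis by (cases s; auto)+
  have rne: "rail t l h - L \<noteq> {}" for t using one[of t] by blast
  have c1: "conn G (rail s l h - L)"
    by (rule conn_retract[OF symG conn_rail'[OF lh(1) lh' lh(2)] rne, where z=z1]) (use ex ns in blast)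
  have c2: "conn G (rail (\<not> s) l h - L)"
    by (rule conn_retract[OF symG conn_rail'[OF lh(1) lh' lh(2)] rne, where z=z2]) (use ex ns in blast)
  have "lads n (j, s) (j, \<not> s)" using lh unfolding lads_def lad_def by auto
  then have "adj G (\<gamma> (j, s)) (\<gamma> (j, \<not> s))" by (intro model_adj[OF m]) (use lh in auto)
  then have "adj G (rail s l h - L) (rail (\<not> s) l h - L)"
    by (rule adj_mono) (use inr[OF lh(4)] gamma_seg[of j] j in blast)+
  then have "conn G ((rail s l h - L) \<union> (rail (\<not> s) l h - L))" by (rule conn_Un_adj[OF symG c1 c2])
  moreover have "(rail s l h - L) \<union> (rail (\<not> s) l h - L) = seg l h - L" unfolding seg_rails by (cases s) auto
  moreover have "z1 \<in> seg l h" "z2 \<in> seg l h" using s unfolding seg_rails by (cases s; auto)+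
  ultimately show ?thesis by simp
qed

text \<open>The left piece of the model contains \<open>TA\<close> and \<open>g1\<close>, the right
  piece \<open>Z r\<close> and \<open>g3\<close>. Each piece needs a passage between the wall and
  the middle of the ladder, and there are only two, at \<open>TB\<close> and at \<open>Z 0\<close>.
  The straight assignment is a linkage. In the crossed one both pieces traverse the whole middle,
  which leaves no room for a square.\<close>

lemma ordered_linkage:
  assumes al: "\<alpha> \<in> {1..n}" "kind \<alpha> 1" and om: "\<omega> \<in> {1..n}" "kind \<omega> 3" and ao: "\<alpha> < \<omega>"
  shows "linkage r E"
proof -
  let ?L = "\<lambda>k. {p. reg p = k}"
  \<comment> \<open>The last column of kind 1 before \<open>\<omega>\<close>; \<open>y0\<close> is
    then the first column of kind 3 after it, so that clean columns strictly between are of kind 2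
    or 4.\<close>
  define x0 where "x0 = Max {i \<in> {1..n}. kind i 1 \<and> i < \<omega>}"
  have "x0 \<in> {i \<in> {1..n}. kind i 1 \<and> i < \<omega>}" unfolding x0_def by (rule Max_in) (use al ao in auto)
  then have x0: "x0 \<in> {1..n}" "kind x0 1" "x0 < \<omega>" by auto
  have x0max: "i \<le> x0" if "i \<in> {1..n}" "kind i 1" "i < \<omega>" for i unfolding x0_def by (rule Max_ge) (use that in auto)
  define y0 where "y0 = Min {i \<in> {1..n}. kind i 3 \<and> x0 < i}"
  have "y0 \<in> {i \<in> {1..n}. kind i 3 \<and> x0 < i}" unfolding y0_def by (rule Min_in) (use om x0 in auto)
  then have y0: "y0 \<in> {1..n}" "kind y0 3" "x0 < y0" by auto
  have y0min: "y0 \<le> i" if "i \<in> {1..n}" "kind i 3" "x0 < i" for i unfolding y0_def by (rule Min_le) (use that in auto)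
  have y0o: "y0 \<le> \<omega>" using y0min om x0 by auto
  have sx0: "seg x0 x0 \<subseteq> ?L 1" "seg x0 x0 \<inter> ?L 3 = {}" "seg x0 x0 \<inter> gates = {}" using x0(2) unfolding kind_def clean_def by auto
  have sy0: "seg y0 y0 \<subseteq> ?L 3" "seg y0 y0 \<inter> ?L 1 = {}" "seg y0 y0 \<inter> gates = {}" using y0(2) unfolding kind_def clean_def by auto
  have ex1: "q = Inr TA \<or> q = g1" if "G p q" "p \<in> ?L 1" "q \<notin> ?L 1" for p q using exit1 that by auto
  have ex3: "q = Inr (Z r) \<or> q = g3" if "G p q" "p \<in> ?L 3" "q \<notin> ?L 3" for p q using exit3 that by auto
  have gts: "Inr TA \<in> gates" "Inr TB \<in> gates" "Inr (Z 0) \<in> gates" "Inr (Z r) \<in> gates" "g1 \<in> gates" "g3 \<in> gates"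
    unfolding gates_def by auto
  have A1: "Inr TA \<in> seg x0 y0" "g1 \<in> seg x0 y0"
    using two_exits[of "?L 1" "Inr TA" g1 x0 y0 x0 y0, OF ex1] x0 y0 sx0 sy0 by auto
  have A3: "Inr (Z r) \<in> seg x0 y0" "g3 \<in> seg x0 y0"
    using two_exits[of "?L 3" "Inr (Z r)" g3 x0 y0 y0 x0, OF ex3] x0 y0 sx0 sy0 by auto
  have gate_mid: "\<exists>k. x0 < k \<and> k < y0 \<and> p \<in> seg k k" if pg: "p \<in> gates" "p \<in> seg x0 y0" for p
  proof -
    obtain k where k: "x0 \<le> k" "k \<le> y0" "p \<in> seg k k" using seg_col[OF pg(2)] by blast
    have "k \<noteq> x0" "k \<noteq> y0" using k(3) pg(1) sx0 sy0 by auto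
    then show ?thesis using k by (metis le_neq_implies_less)
  qed
  \<comment> \<open>Both exits of region 1 lie strictly between \<open>x0\<close> and
    \<open>y0\<close>, so the columns up to \<open>x0\<close> cannot leave it; counting vertices
    gives \<open>x0 \<le> 27\<close>. The right end is treated in the same way.\<close>
  have left1: "seg 1 x0 \<subseteq> ?L 1"
  proof -
    obtain p where p: "p \<in> seg x0 x0" using seg_ne[OF x0(1)] by blast
    have no: "Inr TA \<notin> seg 1 x0" "g1 \<notin> seg 1 x0"
    proof -
      have "z \<notin> seg 1 x0" if z: "z \<in> gates" "z \<in> seg x0 y0" for z
      proof -
        obtain k where k: "x0 < k" "k < y0" "z \<in> seg k k" using gate_mid[OF z] by blast
        then show ?thesis using seg_disj[of 1 k x0 k] y0 by auto
      qed
      then show "Inr TA \<notin> seg 1 x0" "g1 \<notin> seg 1 x0" using A1 gts by auto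
    qed
    have ps: "p \<in> seg 1 x0" using seg_in[OF p, of 1 x0] x0 by auto
    have c: "conn G (seg 1 x0)" by (rule conn_seg) (use x0 in auto)
    show ?thesis by (rule conn_subset_of[OF c ps]) (use p sx0 ex1 no in blast)+
  qed
  have right3: "seg y0 n \<subseteq> ?L 3"
  proof -
    obtain p where p: "p \<in> seg y0 y0" using seg_ne[OF y0(1)] by blast
    have no: "Inr (Z r) \<notin> seg y0 n" "g3 \<notin> seg y0 n"
    proof -
      have "z \<notin> seg y0 n" if z: "z \<in> gates" "z \<in> seg x0 y0" for z
      proof -
        obtain k where k: "x0 < k" "k < y0" "z \<in> seg k k" using gate_mid[OF z] by blast
        then show ?thesis using seg_disj[of k n k y0] x0 y0 by auto
      qed
      then show "Inr (Z r) \<notin> seg y0 n" "g3 \<notin> seg y0 n" using A3 gts by auto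
    qed
    have ps: "p \<in> seg y0 n" using seg_in[OF p, of y0 n] y0 by auto
    have c: "conn G (seg y0 n)" by (rule conn_seg) (use y0 in auto)
    show ?thesis by (rule conn_subset_of[OF c ps]) (use p sy0 ex3 no in blast)+
  qed
  have "card {1..x0} \<le> card {1..27::nat}"
  proof (rule card_in_region)
    fix i assume i: "i \<in> {1..x0}"
    have "\<forall>p\<in>seg i i. reg p = 1" using left1 seg_mono[of 1 i i x0] i by auto
    then show "seg i i \<subseteq> Inl ` ({1..27} \<times> UNIV)" using seg_reg_sub[of i 1] i x0 unfolding region_cols by auto
  qed (use x0 in auto)
  then have x27: "x0 \<le> 27" by simp
  have "card {y0..n} \<le> card {n - 26..n}"
  proof (rule card_in_region)
    fix i assume i: "i \<in> {y0..n}"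
    have "\<forall>p\<in>seg i i. reg p = 3" using right3 seg_mono[of y0 i i n] i by auto
    then show "seg i i \<subseteq> Inl ` ({n - 26..n} \<times> UNIV)" using seg_reg_sub[of i 3] i y0 unfolding region_cols by auto
  qed (use y0 in auto)
  then have y27: "n - 26 \<le> y0" using n y0(1) by auto
  define M where "M = {i. x0 < i \<and> i < y0 \<and> clean i}"
  have Mn: "M \<subseteq> {1..n}" using x0 y0 unfolding M_def by auto
  have fM: "finite M" using Mn finite_subset by blast
  \<comment> \<open>At least \<open>n - 54 \<ge> 15\<close> columns lie strictly between
    \<open>x0\<close> and \<open>y0\<close>, and at most six columns are dirty.\<close>
  have cM: "9 \<le> card M"
  proof -
    have "{x0<..<y0} \<subseteq> M \<union> {i \<in> {1..n}. \<not> clean i}" using x0 y0 unfolding M_def by auto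
    then have "card {x0<..<y0} \<le> card (M \<union> {i \<in> {1..n}. \<not> clean i})" using fM by (intro card_mono) auto
    also have "\<dots> \<le> card M + card {i \<in> {1..n}. \<not> clean i}" by (rule card_Un_le)
    finally have "y0 - x0 - 1 \<le> card M + 6" using card_dirty by simp
    then show ?thesis using x27 y27 n by simp
  qed
  then have Mne: "M \<noteq> {}" by auto
  define x1 y1 where "x1 = Min M" and "y1 = Max M"
  have x1: "x1 \<in> M" and y1: "y1 \<in> M" unfolding x1_def y1_def using Min_in Max_in fM Mne by auto
  have Mxy: "M \<subseteq> {x1..y1}" unfolding x1_def y1_def using fM by auto
  have xy1: "x1 + 8 \<le> y1"
  proof -
    have "card M \<le> card {x1..y1}" by (rule card_mono) (use Mxy in auto)
    then show ?thesis using cM by simp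
  qed
  have mid: "x0 < x1" "x1 < y0" "x0 < y1" "y1 < y0" "clean x1" "clean y1" "1 \<le> x0" "y0 \<le> n"
    using x1 y1 x0 y0 unfolding M_def by auto
  have typM: "kind i 2 \<or> kind i 4" if "i \<in> M" for i
  proof -
    have i: "i \<in> {1..n}" "x0 < i" "i < y0" "clean i" using that Mn unfolding M_def by auto
    obtain k where k: "kind i k" using clean_typ[OF i(1,4)] by blast
    have "k \<noteq> 1" using x0max[OF i(1)] i k y0o by auto
    moreover have "k \<noteq> 3" using y0min[OF i(1)] i k by auto
    ultimately show ?thesis using typ_range[OF i(1) k] k by auto
  qed
  have nx1: "seg x1 x1 \<inter> ?L 1 = {}" using typM[OF x1] unfolding kind_def by auto
  have ny1: "seg y1 y1 \<inter> ?L 3 = {}" using typM[OF y1] unfolding kind_def by auto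
  have B1: "Inr TA \<in> seg x0 x1" "g1 \<in> seg x0 x1" "conn G (seg x0 x1 - ?L 1)"
    using two_exits[of "?L 1" "Inr TA" g1 x0 x1 x0 x1, OF ex1] mid sx0 nx1 by auto
  have B3: "Inr (Z r) \<in> seg y1 y0" "g3 \<in> seg y1 y0" "conn G (seg y1 y0 - ?L 3)"
    using two_exits[of "?L 3" "Inr (Z r)" g3 y1 y0 y0 y1, OF ex3] mid sy0 ny1 by auto
  have before_x1: "\<exists>k. x0 < k \<and> k < x1 \<and> p \<in> seg k k" if pg: "p \<in> gates" "p \<in> seg x0 x1" for p
  proof -
    obtain k where k: "x0 \<le> k" "k \<le> x1" "p \<in> seg k k" using seg_col[OF pg(2)] by blast
    have "k \<noteq> x0" "k \<noteq> x1" using k(3) pg(1) sx0 mid unfolding clean_def by auto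
    then show ?thesis using k by (metis le_neq_implies_less)
  qed
  have after_y1: "\<exists>k. y1 < k \<and> k < y0 \<and> p \<in> seg k k" if pg: "p \<in> gates" "p \<in> seg y1 y0" for p
  proof -
    obtain k where k: "y1 \<le> k" "k \<le> y0" "p \<in> seg k k" using seg_col[OF pg(2)] by blast
    have "k \<noteq> y0" "k \<noteq> y1" using k(3) pg(1) sy0 mid unfolding clean_def by auto
    then show ?thesis using k by (metis le_neq_implies_less)
  qed
  have dLR: "seg x0 k \<inter> seg y1 y0 = {}" if "k < y1" for k using seg_disj[of x0 y0 k y1] that mid by auto
  define Pi where "Pi = seg y1 y0 - ?L 3"
  \<comment> \<open>\<open>k = x1\<close> is used for the passages and the straight case,
    \<open>k = Suc x1\<close> in the crossed case, where the left piece has to contain the square of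
    the columns \<open>x1\<close> and \<open>Suc x1\<close>. Any \<open>k < y1\<close> keeps it
    apart from \<open>Pi\<close>.\<close>
  define La where "La k = (seg x0 x1 - ?L 1) \<union> seg x1 k" for k
  have La_seg: "La k \<subseteq> seg x0 k" if "x1 \<le> k" for k
    unfolding La_def using seg_mono[of x0 x0 x1 k] seg_mono[of x0 x1 k k] that mid by auto
  have Pi_seg: "Pi \<subseteq> seg y1 y0" unfolding Pi_def by blast
  have LaPi: "La k \<inter> Pi = {}" if "x1 \<le> k" "k < y1" for k using La_seg[OF that(1)] Pi_seg dLR[OF that(2)] by blast
  have cLa: "conn G (La k)" if "x1 \<le> k" "k < y1" for k
  proof -
    have ne: "\<exists>p. p \<in> seg x1 x1" using seg_ne Mn x1 by blast
    have "seg x1 x1 \<subseteq> (seg x0 x1 - ?L 1) \<inter> seg x1 k"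
      using nx1 seg_mono[of x0 x1 x1 x1] seg_mono[of x1 x1 x1 k] mid that by auto
    then show ?thesis unfolding La_def
      by (intro conn_Un_overlap[OF symG B1(3)] conn_seg) (use ne that mid in auto)
  qed
  have segL1: "seg x1 k \<inter> ?L 1 = {}" if k: "x1 \<le> k" "k < y1" for k
  proof -
    obtain p where p: "p \<in> seg x1 x1" using seg_ne Mn x1 by blast
    have no: "z \<notin> seg x1 k" if z: "z \<in> gates" "z \<in> seg x0 x1" for z
    proof -
      obtain j where j: "x0 < j" "j < x1" "z \<in> seg j j" using before_x1[OF z] by blast
      then show ?thesis using seg_disj[of j k j x1] k mid by auto
    qed
    have "seg x1 k \<subseteq> - ?L 1"
    proof (rule conn_subset_of[of G _ p])
      show "conn G (seg x1 k)" by (rule conn_seg) (use k mid in auto)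
      show "p \<in> seg x1 k" using seg_in[OF p] k by auto
      show "p \<in> - ?L 1" using p nx1 by blast
    next
      fix u w assume uw: "u \<in> seg x1 k" "u \<in> - ?L 1" "w \<in> seg x1 k" "G u w"
      have "G w u" using uw(4) symG by (auto dest: sympD)
      then show "w \<in> - ?L 1" using ex1[of w u] uw(1,2) no B1(1,2) gts by blast
    qed
    then show ?thesis by blast
  qed
  have La24: "reg p = 2 \<or> reg p = 4" if k: "x1 \<le> k" "k < y1" and p: "p \<in> La k" for k p
  proof -
    have p1: "reg p \<noteq> 1" using p segL1[OF k] unfolding La_def by blast
    have no: "z \<notin> La k" if "z \<in> seg y1 y0" for z using La_seg[OF k(1)] dLR[OF k(2)] that by blast
    obtain u where u: "u \<in> seg x1 x1" using seg_ne Mn x1 by blast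
    have u3: "u \<in> - ?L 3" using u typM[OF x1] unfolding kind_def by auto
    have uk: "u \<in> La k" unfolding La_def using seg_in[OF u, of x1 k] k by auto
    have "La k \<subseteq> - ?L 3"
    proof (rule conn_subset_of[OF cLa[OF k] uk u3])
      fix u w assume uw: "u \<in> La k" "u \<in> - ?L 3" "w \<in> La k" "G u w"
      have "G w u" using uw(4) symG by (auto dest: sympD)
      then show "w \<in> - ?L 3" using ex3[of w u] uw(1,2) no B3(1,2) by blast
    qed
    then show ?thesis using p p1 reg_range[of p] by auto
  qed
  have Pi24: "reg p = 2 \<or> reg p = 4" if p: "p \<in> Pi" for p
  proof -
    have p1: "reg p \<noteq> 3" using p unfolding Pi_def by blast
    have no: "z \<notin> Pi" if "z \<in> seg x0 x1" for z using Pi_seg dLR[of x1] that xy1 by auto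
    obtain u where u: "u \<in> seg y1 y1" using seg_ne Mn y1 by blast
    have u3: "u \<in> - ?L 1" using u typM[OF y1] unfolding kind_def by auto
    have uk: "u \<in> Pi" unfolding Pi_def using seg_in[OF u, of y1 y0] mid ny1 u by auto
    have "Pi \<subseteq> - ?L 1"
    proof (rule conn_subset_of[OF _ uk u3])
      show "conn G Pi" using B3(3) unfolding Pi_def .
      fix u w assume uw: "u \<in> Pi" "u \<in> - ?L 1" "w \<in> Pi" "G u w"
      have "G w u" using uw(4) symG by (auto dest: sympD)
      then show "w \<in> - ?L 1" using ex1[of w u] uw(1,2) no B1(1,2) by blast
    qed
    then show ?thesis using p p1 reg_range[of p] by auto
  qed
  have cPi: "conn G Pi" using B3(3) unfolding Pi_def .
  have inLa: "Inr TA \<in> La k" "g1 \<in> La k" for k using B1(1,2) unfolding La_def by auto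
  have inPi: "Inr (Z r) \<in> Pi" "g3 \<in> Pi" using B3(1,2) unfolding Pi_def by auto
  have cross: "(Inl (28, True) \<in> U \<and> Inr TB \<in> U) \<or> (Inl (n - 27, True) \<in> U \<and> Inr (Z 0) \<in> U)"
    if U: "conn G U" "\<And>p. p \<in> U \<Longrightarrow> reg p = 2 \<or> reg p = 4" "g \<in> U" "reg g = 2" "w \<in> U" "reg w = 4" for U g w
  proof -
    obtain p q where pq: "p \<in> U" "p \<in> ?L 2" "q \<in> U" "q \<notin> ?L 2" "G p q"
      using conn_cut[OF U(1,3) _ U(5), of "?L 2"] U(4,6) by auto
    have "reg q = 4" using pq U(2) by blast
    then show ?thesis using cross24[OF pq(5)] pq by auto
  qed
  have xl: "x1 \<le> x1" "x1 < y1" using xy1 by auto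
  have crLa: "(Inl (28, True) \<in> La x1 \<and> Inr TB \<in> La x1) \<or> (Inl (n - 27, True) \<in> La x1 \<and> Inr (Z 0) \<in> La x1)"
    by (rule cross[OF cLa[OF xl] La24[OF xl] inLa(2) _ inLa(1)]) auto
  have crPi: "(Inl (28, True) \<in> Pi \<and> Inr TB \<in> Pi) \<or> (Inl (n - 27, True) \<in> Pi \<and> Inr (Z 0) \<in> Pi)"
    by (rule cross[OF cPi Pi24 inPi(2) _ inPi(1)]) auto
  have TZ: "Inr TB \<in> La x1 \<union> Pi" "Inr (Z 0) \<in> La x1 \<union> Pi" using crLa crPi LaPi[OF xl] by blast+
  have gates_out: "g \<in> seg x0 x1 \<union> seg y1 y0" if "g \<in> gates" for g
    using that TZ B1(1,2) B3(1,2) La_seg[OF xl(1)] Pi_seg unfolding gates_def by auto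
  \<comment> \<open>By now all six gates are located in the outer pieces. So the columns from
    \<open>x1\<close> to \<open>y1\<close> stay within one region, and this is not the wall, which
    has no six columns.\<close>
  have nog: "seg x1 y1 \<inter> gates = {}"
  proof (rule ccontr)
    assume "seg x1 y1 \<inter> gates \<noteq> {}"
    then obtain g where g: "g \<in> seg x1 y1" "g \<in> gates" by blast
    have "(\<exists>k. x0 < k \<and> k < x1 \<and> g \<in> seg k k) \<or> (\<exists>k. y1 < k \<and> k < y0 \<and> g \<in> seg k k)"
      using gates_out[OF g(2)] before_x1[OF g(2)] after_y1[OF g(2)] by blast
    then show False
    proof
      assume "\<exists>k. x0 < k \<and> k < x1 \<and> g \<in> seg k k"
      then obtain k where "x0 < k" "k < x1" "g \<in> seg k k" by blast
      then show False using seg_disj[of k y1 k x1] g mid xy1 by auto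
    next
      assume "\<exists>k. y1 < k \<and> k < y0 \<and> g \<in> seg k k"
      then obtain k where "y1 < k" "k < y0" "g \<in> seg k k" by blast
      then show False using seg_disj[of x1 k y1 k] g mid xy1 by auto
    qed
  qed
  have all2: "reg p = 2" if p: "p \<in> seg x1 y1" for p
  proof (rule ccontr)
    assume n2: "reg p \<noteq> 2"
    have const: "reg q = reg p" if "q \<in> seg x1 y1" for q
      by (rule clean_const[OF _ _ _ nog that p]) (use mid xy1 in auto)
    obtain u where u: "u \<in> seg x1 x1" using seg_ne Mn x1 by blast
    have "u \<in> seg x1 y1" using seg_in[OF u] xy1 by auto
    then have p4: "reg p = 4" using const[of u] n2 typM[OF x1] u unfolding kind_def by auto
    have "\<forall>i\<in>{x1..<x1+6}. i \<in> {1..n} \<and> kind i 4"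
    proof
      fix i assume i: "i \<in> {x1..<x1+6}"
      have s: "seg i i \<subseteq> seg x1 y1" using seg_mono[of x1 i i y1] i xy1 by auto
      then show "i \<in> {1..n} \<and> kind i 4" using const nog p4 i mid xy1 unfolding kind_def clean_def by auto
    qed
    then show False using typ4_six by blast
  qed
  consider "Inr TB \<in> La x1" "Inr (Z 0) \<in> Pi" | "Inl (n - 27, True) \<in> La x1" "Inr (Z 0) \<in> La x1" "Inl (28, True) \<in> Pi" "Inr TB \<in> Pi"
    using crLa crPi LaPi[OF xl] by blast
  then show ?thesis
  proof cases
    case 1
    have n1: "Inr (Z 0) \<notin> La x1" "Inr TB \<notin> Pi" using 1 LaPi[OF xl] by blast+
    have P: "conn G (La x1 - ?L 2)"
      by (rule conn_retract[OF symG cLa[OF xl], where z="Inr TB"])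
        (use 1 n1 cross24 La24[OF xl] in \<open>force+\<close>)
    have Q: "conn G (Pi - ?L 2)"
      by (rule conn_retract[OF symG cPi, where z="Inr (Z 0)"])
        (use 1 n1 cross24 Pi24 in \<open>force+\<close>)
    have w: "U - ?L 2 \<subseteq> range Inr" if "\<And>p. p \<in> U \<Longrightarrow> reg p = 2 \<or> reg p = 4" for U
    proof
      fix p assume "p \<in> U - ?L 2"
      then have "reg p = 4" using that by blast
      then show "p \<in> range Inr" by (cases p) (auto simp: reg_Inl split: if_splits)
    qed
    have "conn E (Inr -` (La x1 - ?L 2))" by (rule conn_vimage[OF P _ w[OF La24[OF xl]]]) auto
    moreover have "conn E (Inr -` (Pi - ?L 2))" by (rule conn_vimage[OF Q _ w[OF Pi24]]) auto
    moreover have "Inr -` (La x1 - ?L 2) \<inter> Inr -` (Pi - ?L 2) = {}" using LaPi[OF xl] by blast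
    moreover have "TA \<in> Inr -` (La x1 - ?L 2)" "TB \<in> Inr -` (La x1 - ?L 2)" "Z 0 \<in> Inr -` (Pi - ?L 2)" "Z r \<in> Inr -` (Pi - ?L 2)"
      using 1 inLa inPi by auto
    ultimately show ?thesis unfolding linkage_def by blast
  next
    case 2
    \<comment> \<open>The crossed case. In the middle region \<open>Pi\<close> connects
      \<open>(28, True)\<close> with \<open>g3\<close> and so visits every column. This leaves at
      most one vertex per column for \<open>La\<close>, whose part in the middle is thus numbered by
      \<open>h\<close> like a path and cannot contain a square.\<close>
    let ?k = "Suc x1"
    have kl: "x1 \<le> ?k" "?k < y1" using xy1 by auto
    have mono: "La x1 \<subseteq> La ?k" unfolding La_def using seg_mono[of x1 x1 x1 ?k] by auto
    have n1: "Inr TB \<notin> La ?k" "Inr (Z 0) \<notin> Pi" using 2 LaPi[OF kl] LaPi[OF xl] by blast+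
    have x24: "p = Inl (28, True) \<and> q = Inr TB \<or> p = Inl (n - 27, True) \<and> q = Inr (Z 0)"
      if "G q p" "q \<in> ?L 4" "p \<notin> ?L 4" "reg p = 2 \<or> reg p = 4" for p q
    proof -
      have "G p q" using that(1) symG by (auto dest: sympD)
      then show ?thesis using cross24[of p q] that by auto
    qed
    have P: "conn G (La ?k - ?L 4)"
    proof (rule conn_retract[OF symG cLa[OF kl], where z="Inl (n - 27, True)"])
      show "La ?k - ?L 4 \<noteq> {}" using inLa(2)[of ?k] by force
      fix p q assume "p \<in> La ?k" "p \<in> ?L 4" "q \<in> La ?k" "q \<notin> ?L 4" "G p q"
      then show "q = Inl (n - 27, True)" using x24[of p q] La24[OF kl, of q] n1 by blast
    qed
    have Q: "conn G (Pi - ?L 4)"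
    proof (rule conn_retract[OF symG cPi, where z="Inl (28, True)"])
      show "Pi - ?L 4 \<noteq> {}" using inPi(2) by force
      fix p q assume "p \<in> Pi" "p \<in> ?L 4" "q \<in> Pi" "q \<notin> ?L 4" "G p q"
      then show "q = Inl (28, True)" using x24[of p q] Pi24[of q] n1 by blast
    qed
    define h where "h p = (case p of Inl x \<Rightarrow> fst x | Inr w \<Rightarrow> 0)" for p :: "nat \<times> bool + wv"
    have hs: "h q \<le> Suc (h p)" if G: "G p q" "reg p = 2" "reg q = 2" for p q
    proof -
      obtain x where x: "p = Inl x" using G(2) by (cases p) simp_all
      obtain y where y: "q = Inl y" using G(3) by (cases q) simp_all
      have "lad x y" using G(1) unfolding x y by (simp add: lads_def)
      then have "fst y \<le> Suc (fst x)" unfolding lad_def by linarith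
      then show ?thesis unfolding h_def x y by simp
    qed
    have hh: "h g1 = 28" "h g3 = n - 27" "h (Inl x) = fst x" for x unfolding h_def g1_def g3_def by auto
    have r2: "reg p = 2" if "p \<in> La ?k - ?L 4 \<or> p \<in> Pi - ?L 4" for p using that La24[OF kl] Pi24 by blast
    have inP: "Inl (n - 27, True) \<in> La ?k - ?L 4" "g1 \<in> La ?k - ?L 4" using 2 mono inLa by auto
    have inQ: "Inl (28, True) \<in> Pi - ?L 4" "g3 \<in> Pi - ?L 4" using 2 inPi by auto
    have hitQ: "\<exists>y\<in>Pi - ?L 4. h y = l" if "28 \<le> l" "l \<le> n - 27" for l
    proof (rule conn_interval[OF Q _ inQ])
      fix x y assume xy: "x \<in> Pi - ?L 4" "y \<in> Pi - ?L 4" "G x y"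
      show "h y \<le> Suc (h x)" by (rule hs[OF xy(3)]) (use xy(1,2) r2 in blast)+
    next
      show "h (Inl (28, True)) \<le> l" "l \<le> h g3" using that by (simp_all add: hh)
    qed
    have inj: "inj_on h (La ?k - ?L 4)"
    proof (rule inj_onI)
      fix p q assume pq: "p \<in> La ?k - ?L 4" "q \<in> La ?k - ?L 4" "h p = h q"
      have rr: "reg p = 2" "reg q = 2" using pq r2 by blast+
      obtain i s where p: "p = Inl (i, s)" using rr(1) by (cases p) (auto simp: reg_Inl)
      obtain j t where q: "q = Inl (j, t)" using rr(2) by (cases q) (auto simp: reg_Inl)
      have ij: "i = j" using pq(3) p q hh by simp
      have "28 \<le> i" "i \<le> n - 27" using rr(1) p by (auto simp: reg_Inl split: if_splits)
      then obtain y where y: "y \<in> Pi - ?L 4" "h y = i" using hitQ by blast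
      have "reg y = 2" using y r2 by blast
      then obtain u where u: "y = Inl (i, u)" using y(2) hh(3) by (cases y) auto
      have "y \<noteq> p" "y \<noteq> q" using y pq LaPi[OF kl] by blast+
      then have "s = t" using u p q ij by auto
      then show "p = q" using p q ij by simp
    qed
    have "False"
    proof (rule no_four_cycle_in_path[OF symG inj, of x1 \<gamma>])
      fix x y assume "x \<in> La ?k - ?L 4" "y \<in> La ?k - ?L 4" "G x y"
      then show "h y \<le> Suc (h x)" by (intro hs r2) blast+
    next
      show "model ({x1, Suc x1} \<times> UNIV) lad G \<gamma>"
      proof -
        have s: "{x1, Suc x1} \<times> UNIV \<subseteq> V" using mid xy1 by auto
        have "model ({x1, Suc x1} \<times> UNIV) (lads n) G \<gamma>" by (rule model_subset[OF m s])
        moreover have "lads n x y" if "x \<in> {x1, Suc x1} \<times> UNIV" "y \<in> {x1, Suc x1} \<times> UNIV" "lad x y" for x y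
          using that mid xy1 unfolding lads_def by auto
        ultimately show ?thesis by (rule model_rel_mono)
      qed
    next
      fix x :: "nat \<times> bool" assume x: "x \<in> {x1, Suc x1} \<times> UNIV"
      have "\<gamma> x \<subseteq> seg x1 ?k" unfolding seg_def by (rule UN_upper) (use x in auto)
      moreover have "seg x1 ?k \<subseteq> seg x1 y1" by (rule seg_mono) (use xy1 in auto)
      moreover have "seg x1 y1 \<subseteq> - ?L 4" using all2 by auto
      moreover have "seg x1 ?k \<subseteq> La ?k" unfolding La_def by simp
      ultimately show "\<gamma> x \<subseteq> La ?k - ?L 4" by blast
    qed
    then show ?thesis ..
  qed
qed

end

lemma ladder_linkage:
  assumes "ladder_host n r E \<gamma>"
  shows "linkage r E"
proof -
  interpret ladder_host n r E \<gamma> by fact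
  obtain \<alpha> where al: "\<alpha> \<in> {1..n}" "kind \<alpha> 1" using typ13_ex(1) by blast
  obtain \<omega> where om: "\<omega> \<in> {1..n}" "kind \<omega> 3" using typ13_ex(2) by blast
  have "\<alpha> \<noteq> \<omega>" using typ_unique al om by fastforce
  show ?thesis
  proof (cases "\<alpha> < \<omega>")
    case True
    then show ?thesis using ordered_linkage[OF al om] by blast
  next
    case False
    \<comment> \<open>Reading the columns of the model from right to left exchanges the order of the
      two outer regions, while the host stays fixed.\<close>
    define \<mu> where "\<mu> x = (Suc n - fst x, snd x)" for x :: "nat \<times> bool"
    have \<mu>V: "\<mu> x \<in> V" if "x \<in> V" for x using that unfolding \<mu>_def by auto
    interpret M: ladder_host n r E "\<lambda>x. \<gamma> (\<mu> x)"
    proof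
      show "model V (lads n) G (\<lambda>x. \<gamma> (\<mu> x))"
        unfolding model_def
      proof (intro conjI ballI impI)
        fix x y assume xy: "x \<in> V" "y \<in> V"
        show "conn G (\<gamma> (\<mu> x))" by (rule model_conn[OF m \<mu>V[OF xy(1)]])
        show "\<gamma> (\<mu> x) \<inter> \<gamma> (\<mu> y) = {}" if "x \<noteq> y"
        proof -
          have "\<mu> x \<noteq> \<mu> y" using that xy unfolding \<mu>_def by (auto simp: prod_eq_iff)
          then show ?thesis using model_disj[OF m \<mu>V[OF xy(1)] \<mu>V[OF xy(2)]] by blast
        qed
        show "adj G (\<gamma> (\<mu> x)) (\<gamma> (\<mu> y))" if "lads n x y"
          by (rule model_adj[OF m \<mu>V[OF xy(1)] \<mu>V[OF xy(2)]])
            (use that xy in \<open>auto simp: \<mu>_def lads_def lad_def\<close>)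
      qed
      show "\<gamma> (\<mu> x) \<subseteq> Inl ` V \<union> range Inr" if "x \<in> V" for x by (rule sub[OF \<mu>V[OF that]])
    qed (use n r symE EW in auto)
    have seg: "M.seg (Suc n - i) (Suc n - i) = seg i i" if "i \<in> {1..n}" for i
    proof -
      have "\<mu> ` ({Suc n - i..Suc n - i} \<times> UNIV) = {i..i} \<times> UNIV" using that unfolding \<mu>_def by (auto simp: image_iff)
      then show ?thesis unfolding M.seg_def seg_def by (metis (no_types, lifting) SUP_cong image_image)
    qed
    have kind: "M.kind (Suc n - i) k" if "i \<in> {1..n}" "kind i k" for i k
      using that unfolding M.kind_def kind_def M.clean_def clean_def seg[OF that(1)] by simp
    show ?thesis
      by (rule M.ordered_linkage[OF _ kind[OF al] _ kind[OF om]] M.ordered_linkage[OF _ kind[OF al] _ kind[OF om]])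
        (use al om False \<open>\<alpha> \<noteq> \<omega>\<close> in auto)
  qed
qed

section \<open>The counterexample\<close>

text \<open>Vertices shared by all copies or lying in the wall, the other vertices of copy \<open>i\<close> of \<open>H\<close>,
  vertices subdividing its edges, and vertices subdividing its half edges into the wall.\<close>

datatype 'a gv = Qv "'a + wv" | Cp nat 'a | Sb nat "'a set" | Hf nat 'a

text \<open>\<open>Q\<close> are the vertices of degree at least three of \<open>H\<close>. Contracting every component of
  \<open>H - Q\<close> into the vertex \<open>own\<close> of \<open>Q\<close> gives the graph \<open>EK\<close> on \<open>Q\<close>.\<close>

locale contraction =
  fixes V :: "'a set" and EH :: "'a \<Rightarrow> 'a \<Rightarrow> bool" and Q :: "'a set" and own :: "'a \<Rightarrow> 'a"
  assumes finV: "finite V" and symH: "symp EH" and irr: "\<not> EH x x" and EV: "EH x y \<Longrightarrow> x \<in> V \<and> y \<in> V"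
    and Q: "Q = {x \<in> V. 3 \<le> card {y. EH x y}}"
    and own_Q: "x \<in> Q \<Longrightarrow> own x = x" and own_in: "x \<in> V \<Longrightarrow> own x \<in> Q"
    and own_edge: "EH x y \<Longrightarrow> x \<notin> Q \<Longrightarrow> y \<notin> Q \<Longrightarrow> own x = own y"
    and own_comp: "w \<in> V - Q \<Longrightarrow> \<exists>w'\<in>comp_of EH (V - Q) w. EH w' (own w)"
begin

definition EK :: "'a \<Rightarrow> 'a \<Rightarrow> bool" where
  "EK x y \<longleftrightarrow> x \<noteq> y \<and> (\<exists>p q. EH p q \<and> own p = x \<and> own q = y)"

definition fiber :: "'a \<Rightarrow> 'a set" where "fiber x = {w \<in> V. own w = x}"

lemma EH_sym: "EH x y \<Longrightarrow> EH y x" using symH by (rule sympD)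

lemma symK: "symp EK"
proof (rule sympI)
  fix x y assume "EK x y"
  then obtain p q where "x \<noteq> y" "EH p q" "own p = x" "own q = y" unfolding EK_def by blast
  then show "EK y x" unfolding EK_def using EH_sym[of p q] by blast
qed

lemma EK_Q: "EK x y \<Longrightarrow> x \<in> Q \<and> y \<in> Q"
  unfolding EK_def using EV own_in by blast

lemma QV: "Q \<subseteq> V" unfolding Q by blast

lemma finN: "finite {y. EH x y}"
  by (rule finite_subset[OF _ finV]) (use EV in blast)

lemma deg2: "w \<in> V - Q \<Longrightarrow> finite {y. EH w y} \<and> card {y. EH w y} \<le> 2"
  using finN unfolding Q by auto

lemma own_const: "conn EH C \<Longrightarrow> C \<subseteq> V - Q \<Longrightarrow> w \<in> C \<Longrightarrow> w' \<in> C \<Longrightarrow> own w = own w'"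
  by (rule conn_const[of EH C own]) (use own_edge in blast)+

text \<open>A vertex outside \<open>Q\<close> reaches its owner through its component of
  \<open>V - Q\<close>, on which \<open>own\<close> is constant.\<close>

lemma conn_fiber:
  assumes "x \<in> Q"
  shows "conn EH (fiber x)"
proof (rule conn_star[OF symH, of x])
  show x: "x \<in> fiber x" unfolding fiber_def using assms own_Q QV by auto
  fix w assume w: "w \<in> fiber x"
  show "\<exists>C\<subseteq>fiber x. conn EH C \<and> x \<in> C \<and> w \<in> C"
  proof (cases "w \<in> Q")
    case True
    then have "w = x" using w own_Q unfolding fiber_def by auto
    then show ?thesis using x by (intro exI[of _ "{x}"]) auto
  next
    case False
    then have wV: "w \<in> V - Q" and ow: "own w = x" using w unfolding fiber_def by auto
    let ?C = "comp_of EH (V - Q) w"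
    have cC: "conn EH ?C" by (rule conn_comp_of[OF symH wV])
    have CV: "?C \<subseteq> V - Q" by (rule comp_of_subset)
    have wC: "w \<in> ?C" by (rule comp_of_self[OF wV])
    obtain w' where "w' \<in> ?C" "EH w' x" using own_comp[OF wV] ow by blast
    then have "conn EH (insert x ?C)" by (intro conn_insert[OF symH cC]) auto
    moreover have "?C \<subseteq> fiber x"
    proof
      fix u assume u: "u \<in> ?C"
      have "own u = x" using own_const[OF cC CV u wC] ow by simp
      then show "u \<in> fiber x" using u CV unfolding fiber_def by blast
    qed
    ultimately show ?thesis using x wC by blast
  qed
qed

lemma fiber_model: "model Q EK EH fiber"
  unfolding model_def
proof (intro conjI ballI impI)
  fix x y assume "x \<in> Q" "y \<in> Q"
  show "conn EH (fiber x)" by (rule conn_fiber) fact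
  show "fiber x \<inter> fiber y = {}" if "x \<noteq> y" using that unfolding fiber_def by auto
  show "adj EH (fiber x) (fiber y)" if "EK x y" using that EV unfolding EK_def adj_def fiber_def by blast
qed

lemma comp_out:
  assumes C: "conn EH C" "C \<subseteq> V - Q"
    and "w1 \<in> C" "w2 \<in> C" "w3 \<in> C" "x1 \<notin> C" "x2 \<notin> C" "x3 \<notin> C" "EH w1 x1" "EH w2 x2" "EH w3 x3"
  shows "(w1, x1) = (w2, x2) \<or> (w1, x1) = (w3, x3) \<or> (w2, x2) = (w3, x3)"
proof (rule no_three_out_edges[OF symH C(1) _ _ assms(3-)])
  show "finite C" by (rule finite_subset[OF C(2)]) (simp add: finV)
  fix w assume "w \<in> C"
  then show "finite {y. EH w y} \<and> card {y. EH w y} \<le> 2" using C(2) by (intro deg2) auto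
qed

text \<open>At most two edges lead out of the component, and one of them goes to the owner. So
  passing through the component amounts to using an edge of \<open>EK\<close>.\<close>

lemma comp_attach:
  assumes C: "conn EH C" "C \<subseteq> V - Q" and w: "w1 \<in> C" "w2 \<in> C" "EH w1 x1" "EH w2 x2" "x1 \<in> Q" "x2 \<in> Q" "x1 \<noteq> x2"
    and max: "\<And>u v. u \<in> C \<Longrightarrow> v \<in> V - Q \<Longrightarrow> EH u v \<Longrightarrow> v \<in> C"
  shows "own w1 = x1 \<or> own w1 = x2"
proof -
  have w1: "w1 \<in> V - Q" using w C by blast
  have "comp_of EH (V - Q) w1 \<subseteq> C"
    by (rule conn_subset_of[OF conn_comp_of[OF symH w1] comp_of_self[OF w1] w(1)])
      (use max comp_of_subset[of EH "V - Q" w1] in blast)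
  then obtain w3 where w3: "w3 \<in> C" "EH w3 (own w1)" using own_comp[OF w1] by blast
  have "own w1 \<in> Q" using own_in w1 by blast
  then have "x1 \<notin> C" "x2 \<notin> C" "own w1 \<notin> C" using w C by blast+
  then show ?thesis using comp_out[OF C w(1,2) w3(1) _ _ _ w(3,4) w3(2)] w(7) by blast
qed

definition attH :: "'a \<Rightarrow> 'a set" where
  "attH w = {x \<in> Q. \<exists>w'\<in>comp_of EH (V - Q) w. EH w' x}"

sublocale TH: trace EH EK "\<lambda>x. x" Q attH V
proof
  show "symp EH" "symp EK" by (rule symH symK)+
next
  fix g h assume "g \<in> V" "h \<in> V" "EH g h" "g \<notin> (\<lambda>x. x) ` Q" "h \<notin> (\<lambda>x. x) ` Q"
  then have gh: "g \<in> V - Q" "h \<in> V - Q" "EH g h" by auto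
  have "h \<in> comp_of EH (V - Q) g" by (rule comp_of_closed[OF symH gh(1) comp_of_self[OF gh(1)] gh(2,3)])
  then show "attH g = attH h" unfolding attH_def using comp_of_eq[OF symH gh(1)] by simp
next
  fix g s assume "g \<in> V" "EH g s" "g \<notin> (\<lambda>x. x) ` Q" "s \<in> Q"
  then show "s \<in> attH g" unfolding attH_def using comp_of_self[of g "V - Q" EH] by auto
next
  fix g s t assume g: "g \<in> V" "g \<notin> (\<lambda>x. x) ` Q" and st: "s \<in> attH g" "t \<in> attH g" "s \<noteq> t"
  then have g': "g \<in> V - Q" by auto
  let ?C = "comp_of EH (V - Q) g"
  have cC: "conn EH ?C" "?C \<subseteq> V - Q" by (rule conn_comp_of[OF symH g'] comp_of_subset)+
  obtain w1 w2 where w: "w1 \<in> ?C" "EH w1 s" "w2 \<in> ?C" "EH w2 t" "s \<in> Q" "t \<in> Q"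
    using st unfolding attH_def by blast
  have "own w1 = s \<or> own w1 = t"
    by (rule comp_attach[OF cC w(1,3,2,4-6) st(3)]) (rule comp_of_closed[OF symH g'])
  moreover have "own w1 = own w2" by (rule own_const[OF cC w(1,3)])
  moreover have "own s = s" "own t = t" using own_Q w by auto
  ultimately show "EK s t" unfolding EK_def using w st(3) EH_sym by metis
next
  fix s t assume "s \<in> Q" "t \<in> Q" "EH s t" "s \<noteq> t"
  then show "EK s t" unfolding EK_def using own_Q by blast
qed auto

end

locale host = contraction V EH Q own
  for V :: "'a set" and EH Q own +
  fixes p1 q1 p2 q2 a b c d :: 'a and t r :: nat
  assumes e: "EH p1 q1" "EH p2 q2"
    and ends: "own p1 = a" "own q1 = b" "own p2 = c" "own q2 = d"
    and dist: "a \<noteq> b" "a \<noteq> c" "a \<noteq> d" "b \<noteq> c" "b \<noteq> d" "c \<noteq> d"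
    and uniq1: "\<And>p q. EH p q \<Longrightarrow> own p = a \<Longrightarrow> own q = b \<Longrightarrow> p = p1 \<and> q = q1"
    and uniq2: "\<And>p q. EH p q \<Longrightarrow> own p = c \<Longrightarrow> own q = d \<Longrightarrow> p = p2 \<and> q = q2"
    and r: "0 < r"
begin

definition EH' :: "'a \<Rightarrow> 'a \<Rightarrow> bool" where
  "EH' x y \<longleftrightarrow> EH x y \<and> {x, y} \<noteq> {p1, q1} \<and> {x, y} \<noteq> {p2, q2}"

definition loc :: "nat \<Rightarrow> 'a \<Rightarrow> 'a gv" where
  "loc i x = (if x \<in> Q then Qv (Inl x) else Cp i x)"

text \<open>The four ends are distinct, so among them the last alternative belongs to
  \<open>q2\<close>.\<close>

definition tm :: "'a \<Rightarrow> wv" where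
  "tm x = (if x = p1 then TA else if x = q1 then TB else if x = p2 then Z 0 else Z r)"

text \<open>Copy \<open>i\<close> of a subdivision of \<open>H\<close>, all copies sharing \<open>Q\<close>, with the edges \<open>p1 q1\<close> and \<open>p2 q2\<close>
  replaced by half edges into the wall. Each half edge passes through a vertex \<open>Hf\<close>.\<close>

definition GE0 :: "'a gv \<Rightarrow> 'a gv \<Rightarrow> bool" where
  "GE0 g h \<longleftrightarrow> (\<exists>i<t. \<exists>x y. EH' x y \<and> g = loc i x \<and> h = Sb i {x, y}) \<or>
     (\<exists>i<t. \<exists>z\<in>{p1, q1, p2, q2}. (g = loc i z \<or> g = Qv (Inr (tm z))) \<and> h = Hf i z) \<or>
     (\<exists>w u. wall r w u \<and> g = Qv (Inr w) \<and> h = Qv (Inr u))"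

definition GE :: "'a gv \<Rightarrow> 'a gv \<Rightarrow> bool" where
  "GE g h \<longleftrightarrow> GE0 g h \<or> GE0 h g"

definition wallV :: "wv set" where
  "wallV = {TA, TB} \<union> Z ` {..r} \<union> (\<lambda>(j, i). Rw j i) ` ({..<r} \<times> {..<2 * r})"

definition GV :: "'a gv set" where
  "GV = (\<lambda>(i, x). loc i x) ` ({..<t} \<times> V) \<union> (\<lambda>(i, x, y). Sb i {x, y}) ` ({..<t} \<times> {(x, y). EH' x y}) \<union>
     (\<lambda>(i, z). Hf i z) ` ({..<t} \<times> {p1, q1, p2, q2}) \<union> (\<lambda>w. Qv (Inr w)) ` wallV"

lemma symGE: "symp GE" unfolding GE_def by (auto intro: sympI)

lemma finGV: "finite GV"
proof -
  have "finite {(x, y). EH' x y}"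
    by (rule finite_subset[of _ "V \<times> V"]) (use finV EV EH'_def in auto)
  then show ?thesis unfolding GV_def wallV_def using finV by (intro finite_UnI finite_imageI finite_cartesian_product) auto
qed

lemma EH'_sym: "EH' x y \<Longrightarrow> EH' y x" unfolding EH'_def using EH_sym by (auto simp: insert_commute)

lemma endsV: "p1 \<in> V" "q1 \<in> V" "p2 \<in> V" "q2 \<in> V" using e EV by blast+

lemma end_distinct: "p1 \<noteq> q1" "p1 \<noteq> p2" "p1 \<noteq> q2" "q1 \<noteq> p2" "q1 \<noteq> q2" "p2 \<noteq> q2"
  using ends dist by auto

lemma wall_wallV: "wall r w u \<Longrightarrow> w \<in> wallV"
  unfolding wall_def wallV_def using r by (cases w; cases u) (auto split: if_splits)

lemma tmV: "tm z \<in> wallV"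
  unfolding tm_def wallV_def by auto

lemma locV: "i < t \<Longrightarrow> x \<in> V \<Longrightarrow> loc i x \<in> GV" unfolding GV_def by auto

lemma SbV: "i < t \<Longrightarrow> EH' x y \<Longrightarrow> Sb i {x, y} \<in> GV"
  unfolding GV_def by (intro UnI1 UnI2 image_eqI[of _ _ "(i, x, y)"]) auto

lemma HfV: "i < t \<Longrightarrow> z \<in> {p1, q1, p2, q2} \<Longrightarrow> Hf i z \<in> GV"
  unfolding GV_def by (intro UnI1 UnI2 image_eqI[of _ _ "(i, z)"]) auto

lemma wV: "w \<in> wallV \<Longrightarrow> Qv (Inr w) \<in> GV"
  unfolding GV_def by simp

lemma GE_GV: "GE g h \<Longrightarrow> g \<in> GV \<and> h \<in> GV"
proof -
  have "g \<in> GV \<and> h \<in> GV" if "GE0 g h" for g h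
    using that unfolding GE0_def
  proof (elim disjE exE conjE bexE)
    fix i x y assume h: "i < t" "EH' x y" "g = loc i x" "h = Sb i {x, y}"
    have "x \<in> V" using h(2) EV unfolding EH'_def by blast
    then show ?thesis using locV[OF h(1)] SbV[OF h(1,2)] h(3,4) by simp
  next
    fix i z assume h: "i < t" "z \<in> {p1, q1, p2, q2}" "h = Hf i z" "g = loc i z"
    have "z \<in> V" using h(2) endsV by blast
    then show ?thesis using locV[OF h(1)] HfV[OF h(1,2)] h(3,4) by simp
  next
    fix i z assume h: "i < t" "z \<in> {p1, q1, p2, q2}" "h = Hf i z" "g = Qv (Inr (tm z))"
    then show ?thesis using HfV[OF h(1,2)] wV[OF tmV] by simp
  next
    fix w u assume h: "wall r w u" "g = Qv (Inr w)" "h = Qv (Inr u)"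
    then have "wall r u w" unfolding wall_def by blast
    then show ?thesis using wV[OF wall_wallV] h by simp
  qed
  then show "GE g h \<Longrightarrow> g \<in> GV \<and> h \<in> GV" unfolding GE_def by blast
qed

lemma GE_irrefl: "\<not> GE g g"
proof
  assume "GE g g"
  then have "GE0 g g" unfolding GE_def by blast
  then show False unfolding GE0_def loc_def
    by (auto split: if_splits simp: wall_def) (metis (full_types) n_not_Suc_n wall0.simps wv.exhaust)+
qed

lemma loc_Qv: "loc i x = Qv s \<longleftrightarrow> x \<in> Q \<and> s = Inl x" unfolding loc_def by auto
lemma loc_simps [simp]: "loc i x \<noteq> Sb j e" "loc i x \<noteq> Hf j y" "Sb j e \<noteq> loc i x" "Hf j y \<noteq> loc i x" unfolding loc_def by auto

lemma GE_Sb: "GE (Sb i e) h \<longleftrightarrow> (\<exists>x y. i < t \<and> EH' x y \<and> h = loc i x \<and> e = {x, y})"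
  unfolding GE_def GE0_def by simp blast

lemma GE_Hf: "GE (Hf i z) h \<longleftrightarrow> i < t \<and> z \<in> {p1, q1, p2, q2} \<and> (h = loc i z \<or> h = Qv (Inr (tm z)))"
proof -
  define Z where "Z = {p1, q1, p2, q2}"
  show ?thesis unfolding GE_def GE0_def Z_def[symmetric] by simp
qed

lemma GE_Cp: "GE (Cp i w) h \<longleftrightarrow> i < t \<and> w \<notin> Q \<and> ((\<exists>y. EH' w y \<and> h = Sb i {w, y}) \<or> w \<in> {p1, q1, p2, q2} \<and> h = Hf i w)"
proof -
  define Z where "Z = {p1, q1, p2, q2}"
  have Cp: "Cp i w = loc j x \<longleftrightarrow> w \<notin> Q \<and> j = i \<and> x = w" for j x unfolding loc_def by auto
  show ?thesis unfolding GE_def GE0_def Z_def[symmetric] Cp by (simp add: Cp) blast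
qed

lemma GE_Qv: "GE (Qv s) (Qv s') \<longleftrightarrow> (\<exists>w u. wall r w u \<and> s = Inr w \<and> s' = Inr u)"
  unfolding GE_def GE0_def by simp (auto simp: wall_def)

text \<open>A vertex \<open>w\<close> of a copy keeps its neighbours up to subdivision: the half
  edge at \<open>w\<close> stands for the edge that was rerouted there.\<close>

lemma deg_GE:
  assumes "g \<in> GV" "g \<notin> range Qv"
  shows "finite {h. GE g h} \<and> card {h. GE g h} \<le> 2"
proof (cases g)
  case (Cp i w)
  show ?thesis
  proof (cases "w \<in> V - Q")
    case True
    let ?f = "\<lambda>y. if {w, y} = {p1, q1} \<or> {w, y} = {p2, q2} then Hf i w else Sb i {w, y}"
    have "{h. GE g h} \<subseteq> ?f ` {y. EH w y}"
    proof
      fix h assume "h \<in> {h. GE g h}"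
      then consider y where "EH' w y" "h = Sb i {w, y}" | "w \<in> {p1, q1, p2, q2}" "h = Hf i w"
        unfolding Cp GE_Cp by blast
      then show "h \<in> ?f ` {y. EH w y}"
      proof cases
        case (1 y)
        then show ?thesis unfolding EH'_def by (intro image_eqI[of _ _ y]) auto
      next
        case 2
        then obtain y where "EH w y" "{w, y} = {p1, q1} \<or> {w, y} = {p2, q2}"
          using e EH_sym by (metis empty_iff insert_commute insert_iff)
        then show ?thesis using 2 by (intro image_eqI[of _ _ y]) auto
      qed
    qed
    moreover have "finite {y. EH w y}" "card (?f ` {y. EH w y}) \<le> 2"
      using deg2[OF True] card_image_le[of "{y. EH w y}" ?f] by linarith+
    ultimately show ?thesis by (meson card_mono finite_imageI finite_subset le_trans)
  next
    case False
    then have "{h. GE g h} = {}" unfolding Cp GE_Cp EH'_def using EV endsV by blast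
    then show ?thesis by simp
  qed
next
  case (Sb i E)
  show ?thesis
  proof (cases "\<exists>x y. E = {x, y}")
    case True
    then obtain x y where "E = {x, y}" by blast
    then have "{h. GE g h} \<subseteq> {loc i x, loc i y}" unfolding Sb GE_Sb by (auto simp: doubleton_eq_iff)
    moreover have "card {loc i x, loc i y} \<le> 2" by (simp add: card_insert_if)
    ultimately show ?thesis by (meson card_mono finite.emptyI finite_insert finite_subset le_trans)
  next
    case False
    then have "{h. GE g h} = {}" unfolding Sb GE_Sb by auto
    then show ?thesis by simp
  qed
next
  case (Hf i z)
  have "{h. GE g h} \<subseteq> {loc i z, Qv (Inr (tm z))}" unfolding Hf GE_Hf by auto
  moreover have "card {loc i z, Qv (Inr (tm z))} \<le> 2" by (simp add: card_insert_if)
  ultimately show ?thesis by (meson card_mono finite.emptyI finite_insert finite_subset le_trans)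
qed (use assms in auto)

subsection \<open>Projecting models\<close>

definition cmp :: "'a \<Rightarrow> 'a set" where "cmp w = comp_of EH' (V - Q) w"

text \<open>Components are taken without the two rerouted edges, as they occur in a copy. The
  terminals behind half edges count as attachments, too.\<close>

definition attC :: "'a \<Rightarrow> ('a + wv) set" where
  "attC w = Inl ` {x \<in> Q. \<exists>w'\<in>cmp w. EH' w' x} \<union> (\<lambda>z. Inr (tm z)) ` ({p1, q1, p2, q2} \<inter> cmp w)"

text \<open>A subdividing vertex inherits the attachments of an end outside \<open>Q\<close>. If
  both ends are outside, the choice is immaterial by \<open>attC_edge\<close>.\<close>

fun att :: "'a gv \<Rightarrow> ('a + wv) set" where
  "att (Cp i w) = attC w"
| "att (Hf i z) = (if z \<in> Q then {Inl z, Inr (tm z)} else attC z)"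
| "att (Sb i e) = (if e \<subseteq> Q then Inl ` e else attC (SOME y. y \<in> e \<and> y \<notin> Q))"
| "att (Qv s) = {}"

lemma symH': "symp EH'" using EH'_sym by (rule sympI)

lemma attC_edge: "EH' x y \<Longrightarrow> x \<notin> Q \<Longrightarrow> y \<notin> Q \<Longrightarrow> attC x = attC y"
proof -
  assume a: "EH' x y" "x \<notin> Q" "y \<notin> Q"
  then have xy: "x \<in> V - Q" "y \<in> V - Q" using EV unfolding EH'_def by blast+
  have "y \<in> cmp x" unfolding cmp_def by (rule comp_of_closed[OF symH' xy(1) comp_of_self[OF xy(1)] xy(2) a(1)])
  then have "cmp y = cmp x" unfolding cmp_def by (rule comp_of_eq[OF symH' xy(1)])
  then show ?thesis unfolding attC_def by simp
qed

lemma att_Sb: "EH' x y \<Longrightarrow> x \<notin> Q \<Longrightarrow> att (Sb i {x, y}) = attC x"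
proof -
  assume a: "EH' x y" "x \<notin> Q"
  let ?s = "SOME z. z \<in> {x, y} \<and> z \<notin> Q"
  have "?s \<in> {x, y} \<and> ?s \<notin> Q" by (rule someI[of _ x]) (use a in simp)
  then have "attC ?s = attC x" using attC_edge[OF a(1,2)] by (metis empty_iff insert_iff)
  then show ?thesis using a by simp
qed

text \<open>By \<open>uniq1\<close> and \<open>uniq2\<close> the rerouted edges are the only ones
  between their fibers, so the image of any other edge is still present in
  \<open>gam\<close>.\<close>

lemma EK_of_EH':
  assumes "EH' u v" "own u = x" "own v = y" "x \<noteq> y"
  shows "gam EK a b c d r E (Inl x) (Inl y)"
proof -
  have uv: "EH u v" "EH v u" using assms(1) EH_sym unfolding EH'_def by blast+
  have "EK x y" unfolding EK_def using uv assms by blast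
  moreover have "{x, y} \<noteq> {a, b}"
    using uniq1[OF uv(1)] uniq1[OF uv(2)] assms unfolding EH'_def by (auto simp: doubleton_eq_iff)
  moreover have "{x, y} \<noteq> {c, d}"
    using uniq2[OF uv(1)] uniq2[OF uv(2)] assms unfolding EH'_def by (auto simp: doubleton_eq_iff)
  ultimately show ?thesis by simp
qed

lemma tm_simps: "tm p1 = TA" "tm q1 = TB" "tm p2 = Z 0" "tm q2 = Z r"
  unfolding tm_def using end_distinct by auto

lemma port_own: "z \<in> {p1, q1, p2, q2} \<Longrightarrow> port a b c d r (own z) (tm z)"
  by (elim insertE emptyE) (simp_all add: port_def ends tm_simps)

lemma port_mate:
  assumes "z \<in> {p1, q1, p2, q2}"
  obtains z' where "EH z z'" "own z' \<noteq> own z" "\<not> EH' z z'"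
proof -
  have "EH p1 q1 \<and> own q1 \<noteq> own p1 \<and> \<not> EH' p1 q1" "EH q1 p1 \<and> own p1 \<noteq> own q1 \<and> \<not> EH' q1 p1"
    "EH p2 q2 \<and> own q2 \<noteq> own p2 \<and> \<not> EH' p2 q2" "EH q2 p2 \<and> own p2 \<noteq> own q2 \<and> \<not> EH' q2 p2"
    using e e[THEN EH_sym] dist unfolding EH'_def ends by auto
  then show ?thesis using assms that by blast
qed

lemma own_port_inj: "z \<in> {p1, q1, p2, q2} \<Longrightarrow> z' \<in> {p1, q1, p2, q2} \<Longrightarrow> own z = own z' \<Longrightarrow> z = z'"
  using ends dist by auto

text \<open>At most two edges lead out of a component of \<open>V - Q\<close>, one of them to the
  owner. So two attachments in \<open>Q\<close> are joined in \<open>EK\<close>. At a terminal one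
  of the two edges is the rerouted one, which leaves only the owner as attachment in
  \<open>Q\<close>, and the owner has a port there. Different ends have different owners and lie in
  different components.\<close>

lemma attC_R:
  assumes w: "w \<in> V - Q" and st: "s \<in> attC w" "s' \<in> attC w" "s \<noteq> s'"
  shows "gam EK a b c d r E s s'"
proof -
  let ?C = "comp_of EH (V - Q) w"
  have cC: "conn EH ?C" "?C \<subseteq> V - Q" by (rule conn_comp_of[OF symH w] comp_of_subset)+
  have max: "v \<in> ?C" if "u \<in> ?C" "v \<in> V - Q" "EH u v" for u v by (rule comp_of_closed[OF symH w that])
  have sub: "cmp w \<subseteq> ?C"
  proof -
    have "conn EH (cmp w)" unfolding cmp_def
      by (rule conn_mono[OF conn_comp_of[OF symH' w]]) (simp add: EH'_def)
    then show ?thesis by (rule comp_of_max) (simp_all add: cmp_def comp_of_subset comp_of_self[OF w])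
  qed
  have const: "own u = own v" if "u \<in> ?C" "v \<in> ?C" for u v by (rule own_const[OF cC that])
  have mixed: "port a b c d r x (tm z)"
    if x: "x \<in> Q" "w' \<in> cmp w" "EH' w' x" and z: "z \<in> {p1, q1, p2, q2}" "z \<in> cmp w" for x w' z
  proof -
    obtain z' where z': "EH z z'" "own z' \<noteq> own z" "\<not> EH' z z'" using port_mate[OF z(1)] by blast
    have zC: "z \<in> ?C" "w' \<in> ?C" using z x sub by blast+
    have zQ': "z \<notin> Q" using zC cC by blast
    have z'C: "z' \<notin> ?C" using const[OF zC(1)] z'(2) by metis
    then have z'Q: "z' \<in> Q" using max[OF zC(1) _ z'(1)] EV[OF z'(1)] by blast
    have xw: "EH w' x" using x(3) unfolding EH'_def by blast
    have xC: "x \<notin> ?C" using x(1) cC by blast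
    have "z \<in> V - Q" using zC cC by blast
    have "comp_of EH (V - Q) z = ?C" by (rule comp_of_eq[OF symH w zC(1)])
    then obtain w3 where w3: "w3 \<in> ?C" "EH w3 (own z)" using own_comp[OF \<open>z \<in> V - Q\<close>] by auto
    have oz: "own z \<notin> ?C" using own_in[of z] zC cC by blast
    have "own z' = z'" by (rule own_Q[OF z'Q])
    then have ne: "z' \<noteq> own z" using z'(2) by simp
    have "(z, z') \<noteq> (w', x)" using x(3) z'(3) by auto
    then have "x = own z" using comp_out[OF cC zC w3(1) z'C xC oz z'(1) xw w3(2)] ne by auto
    then show ?thesis using port_own[OF z(1)] by simp
  qed
  from st(1) consider x w1 where "s = Inl x" "x \<in> Q" "w1 \<in> cmp w" "EH' w1 x" | z where "s = Inr (tm z)" "z \<in> {p1, q1, p2, q2}" "z \<in> cmp w"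
    unfolding attC_def by blast
  then show ?thesis
  proof cases
    case s: (1 x w1)
    from st(2) consider y w2 where "s' = Inl y" "y \<in> Q" "w2 \<in> cmp w" "EH' w2 y" | z where "s' = Inr (tm z)" "z \<in> {p1, q1, p2, q2}" "z \<in> cmp w"
      unfolding attC_def by blast
    then show ?thesis
    proof cases
      case t: (1 y w2)
      have wC: "w1 \<in> ?C" "w2 \<in> ?C" using s t sub by blast+
      have xy: "x \<noteq> y" using st(3) s t by auto
      have h: "EH w1 x" "EH w2 y" using s t unfolding EH'_def by blast+
      have "own w1 = x \<or> own w1 = y" by (rule comp_attach[OF cC wC h s(2) t(2) xy max])
      then show ?thesis
      proof
        assume "own w1 = x"
        then have "own w2 = x" using const[OF wC] by simp
        then show ?thesis using EK_of_EH'[OF t(4) _ own_Q[OF t(2)] xy] s t by simp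
      next
        assume "own w1 = y"
        then show ?thesis using EK_of_EH'[OF EH'_sym[OF s(4)] own_Q[OF s(2)] _ xy] s t by simp
      qed
    next
      case t: (2 z)
      then show ?thesis using mixed[OF s(2-4) t(2,3)] s by simp
    qed
  next
    case s: (2 z)
    from st(2) consider y w2 where "s' = Inl y" "y \<in> Q" "w2 \<in> cmp w" "EH' w2 y" | z' where "s' = Inr (tm z')" "z' \<in> {p1, q1, p2, q2}" "z' \<in> cmp w"
      unfolding attC_def by blast
    then show ?thesis
    proof cases
      case t: (1 y w2)
      then show ?thesis using mixed[OF t(2-4) s(2,3)] s by simp
    next
      case t: (2 z')
      have "own z = own z'" using const sub s(3) t(3) by blast
      then have "z = z'" using own_port_inj s(2) t(2) by blast
      then show ?thesis using st(3) s t by simp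
    qed
  qed
qed

text \<open>Merge the branch sets over each fiber and take the trace on the shared vertices and the
  wall. It is nonempty because a vertex of \<open>Q\<close> has three neighbouring branch sets. A
  passage through any copy becomes an edge of \<open>gam\<close>, so the number of the copy is
  forgotten.\<close>

lemma project:
  assumes ES: "symp ES" "\<And>g h. ES g h \<Longrightarrow> GE g h"
    and m: "model V EH ES \<beta>" and sub: "\<And>x. x \<in> V \<Longrightarrow> \<beta> x \<subseteq> GV"
  shows "\<exists>\<gamma>. model Q EK (gam EK a b c d r (\<lambda>w u. ES (Qv (Inr w)) (Qv (Inr u)))) \<gamma> \<and>
    (\<forall>x\<in>Q. \<gamma> x \<subseteq> Inl ` Q \<union> range Inr)"
proof -
  let ?W = "\<lambda>w u. ES (Qv (Inr w)) (Qv (Inr u))"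
  let ?G = "gam EK a b c d r ?W"
  have symW: "symp ?W" using ES(1) by (auto simp: symp_def)
  have symG: "symp ?G" by (rule symp_gam[OF symK symW])
  interpret T: trace ES ?G Qv "Inl ` Q \<union> range Inr" att GV
  proof
    show "symp ES" "symp ?G" by (rule ES(1) symG)+
    show "inj_on Qv (Inl ` Q \<union> range Inr)" by (auto intro: inj_onI)
  next
    fix g h assume gh: "g \<in> GV" "h \<in> GV" "ES g h" "g \<notin> Qv ` (Inl ` Q \<union> range Inr)" "h \<notin> Qv ` (Inl ` Q \<union> range Inr)"
    have nQ: "g \<noteq> Qv s" if "g \<in> GV" "g \<notin> Qv ` (Inl ` Q \<union> range Inr)" for g s
      using that unfolding GV_def by (auto simp: loc_def split: if_splits)
    have main: "att g = att h" if G: "GE0 g h" "\<And>s. g \<noteq> Qv s" "\<And>s. h \<noteq> Qv s" for g h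
      using G(1) unfolding GE0_def
    proof (elim disjE exE conjE bexE)
      fix i x y assume h: "EH' x y" "g = loc i x" "h = Sb i {x, y}"
      have "x \<notin> Q" using G(2)[of "Inl x"] h(2) unfolding loc_def by auto
      then show ?thesis using att_Sb[OF h(1)] h unfolding loc_def by simp
    next
      fix i z assume h: "h = Hf i z" "g = loc i z"
      have "z \<notin> Q" using G(2)[of "Inl z"] h(2) unfolding loc_def by auto
      then show ?thesis using h unfolding loc_def by simp
    qed (use G in auto)
    have "GE0 g h \<or> GE0 h g" using ES(2)[OF gh(3)] unfolding GE_def .
    then show "att g = att h" using main[of g h] main[of h g] nQ[OF gh(1,4)] nQ[OF gh(2,5)] by metis
  next
    fix g s assume gs: "g \<in> GV" "ES g (Qv s)" "g \<notin> Qv ` (Inl ` Q \<union> range Inr)" "s \<in> Inl ` Q \<union> range Inr"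
    have G: "GE g (Qv s)" by (rule ES(2)[OF gs(2)])
    show "s \<in> att g"
    proof (cases g)
      case (Qv s')
      then show ?thesis using gs(3) G unfolding Qv GE_Qv by auto
    next
      case (Cp i w)
      then show ?thesis using G GE_Cp by auto
    next
      case (Sb i E)
      then obtain x y where xy: "EH' x y" "Qv s = loc i x" "E = {x, y}" using G GE_Sb by auto
      then have x: "x \<in> Q" "s = Inl x" using loc_Qv by metis+
      show ?thesis
      proof (cases "y \<in> Q")
        case True
        then show ?thesis using Sb x xy by auto
      next
        case False
        have y: "y \<in> V - Q" using False EV xy(1) unfolding EH'_def by blast
        have "att (Sb i {y, x}) = attC y" by (rule att_Sb[OF EH'_sym[OF xy(1)] False])
        moreover have "s \<in> attC y" unfolding attC_def cmp_def
          using x comp_of_self[OF y, of EH'] EH'_sym[OF xy(1)] by blast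
        ultimately show ?thesis using Sb xy(3) by (simp only: insert_commute)
      qed
    next
      case (Hf i z)
      then have z: "z \<in> {p1, q1, p2, q2}" "Qv s = loc i z \<or> s = Inr (tm z)" using G GE_Hf by auto
      have zV: "z \<in> V" using z endsV by blast
      show ?thesis
      proof (cases "z \<in> Q")
        case True
        then show ?thesis using Hf z loc_Qv[of i z s] by auto
      next
        case False
        then have "s = Inr (tm z)" using z loc_Qv[of i z s] by metis
        moreover have "z \<in> cmp z" unfolding cmp_def by (rule comp_of_self) (use False zV in blast)
        ultimately have "s \<in> attC z" unfolding attC_def using z(1) by blast
        then show ?thesis using Hf False by simp
      qed
    qed
  next
    fix g s s' assume g: "g \<in> GV" "g \<notin> Qv ` (Inl ` Q \<union> range Inr)" and s: "s \<in> att g" "s' \<in> att g" "s \<noteq> s'"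
    show "?G s s'"
    proof (cases g)
      case (Qv s'')
      then show ?thesis using s by simp
    next
      case (Cp i w)
      then have "w \<in> V - Q" using g unfolding GV_def loc_def by (auto split: if_splits)
      then show ?thesis using attC_R s Cp by simp
    next
      case (Sb i B)
      then obtain x y where xy: "EH' x y" "B = {x, y}" using g(1) unfolding GV_def loc_def by (auto split: if_splits)
      have V: "x \<in> V" "y \<in> V" using xy(1) EV unfolding EH'_def by blast+
      show ?thesis
      proof (cases "B \<subseteq> Q")
        case True
        then have Q': "x \<in> Q" "y \<in> Q" using xy by auto
        have ss: "s \<in> {Inl x, Inl y}" "s' \<in> {Inl x, Inl y}" using s True Sb xy by auto
        then have ne: "x \<noteq> y" using s(3) by auto
        have G: "?G (Inl x) (Inl y)" by (rule EK_of_EH'[OF xy(1) own_Q[OF Q'(1)] own_Q[OF Q'(2)] ne])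
        then have "?G (Inl y) (Inl x)" using symG by (rule sympD[rotated])
        then show ?thesis using ss s(3) G by blast
      next
        case False
        have "\<exists>w\<in>V - Q. att g = attC w"
        proof (cases "x \<in> Q")
          case True
          then have y: "y \<notin> Q" using False xy by auto
          have "att (Sb i {y, x}) = attC y" by (rule att_Sb[OF EH'_sym[OF xy(1)] y])
          then show ?thesis using y V Sb xy(2) insert_commute[of x y] by (intro bexI[of _ y]) auto
        next
          case x: False
          then show ?thesis using att_Sb[OF xy(1) x] V Sb xy(2) by (intro bexI[of _ x]) auto
        qed
        then show ?thesis using attC_R s by metis
      qed
    next
      case (Hf i z)
      then have z: "z \<in> {p1, q1, p2, q2}" using g(1) unfolding GV_def loc_def by (auto split: if_splits)
      have zV: "z \<in> V" using z endsV by blast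
      show ?thesis
      proof (cases "z \<in> Q")
        case True
        have "port a b c d r z (tm z)" using port_own[OF z] own_Q[OF True] by simp
        then have "?G (Inl z) (Inr (tm z))" "?G (Inr (tm z)) (Inl z)" by simp_all
        moreover have "s \<in> {Inl z, Inr (tm z)}" "s' \<in> {Inl z, Inr (tm z)}" using s Hf True by auto
        ultimately show ?thesis using s(3) by blast
      next
        case False
        then show ?thesis using attC_R[of z s s'] zV s Hf by simp
      qed
    qed
  next
    fix s s' assume "s \<in> Inl ` Q \<union> range Inr" "s' \<in> Inl ` Q \<union> range Inr" "ES (Qv s) (Qv s')" "s \<noteq> s'"
    moreover obtain w u where "s = Inr w" "s' = Inr u" using ES(2)[OF \<open>ES (Qv s) (Qv s')\<close>] GE_Qv by blast
    ultimately show "?G s s'" by simp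
  qed
  define \<gamma>0 where "\<gamma>0 x = (\<Union>y\<in>fiber x. \<beta> y)" for x
  have fV: "fiber x \<subseteq> V" for x unfolding fiber_def by blast
  have c0: "conn ES (\<gamma>0 x)" if "x \<in> Q" for x
    unfolding \<gamma>0_def by (rule model_conn_UN[OF m fV conn_fiber[OF that]])
  have s0: "\<gamma>0 x \<subseteq> GV" for x unfolding \<gamma>0_def using sub fV by blast
  have d0: "\<gamma>0 x \<inter> \<gamma>0 y = {}" if "x \<noteq> y" for x y
    unfolding \<gamma>0_def by (rule model_UN_disj[OF m fV fV]) (use that in \<open>auto simp: fiber_def\<close>)
  have n0: "T.tr (\<gamma>0 x) \<noteq> {}" if x: "x \<in> Q" for x
  proof -
    have xV: "x \<in> V" using x QV by blast
    have "\<exists>s. Qv s \<in> \<beta> x"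
    proof (rule ccontr)
      assume no: "\<not> ?thesis"
      obtain Y where Y: "Y \<subseteq> {y. EH x y}" "card Y = 3"
        using obtain_subset_with_card_n[of 3 "{y. EH x y}"] x unfolding Q by auto
      then obtain y1 y2 y3 where y: "Y = {y1, y2, y3}" "y1 \<noteq> y2" "y1 \<noteq> y3" "y2 \<noteq> y3" unfolding card_3_iff by auto
      have out: "\<exists>w u. w \<in> \<beta> x \<and> u \<in> \<beta> y \<and> u \<notin> \<beta> x \<and> ES w u" if "EH x y" for y
      proof -
        have yV: "y \<in> V" using EV[OF that] by blast
        have "x \<noteq> y" using that irr by blast
        then show ?thesis using model_adj[OF m xV yV that] model_disj[OF m xV yV] unfolding adj_def by blast
      qed
      have E: "EH x y1" "EH x y2" "EH x y3" using Y(1) y(1) by auto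
      obtain w1 u1 where o1: "w1 \<in> \<beta> x" "u1 \<in> \<beta> y1" "u1 \<notin> \<beta> x" "ES w1 u1" using out[OF E(1)] by blast
      obtain w2 u2 where o2: "w2 \<in> \<beta> x" "u2 \<in> \<beta> y2" "u2 \<notin> \<beta> x" "ES w2 u2" using out[OF E(2)] by blast
      obtain w3 u3 where o3: "w3 \<in> \<beta> x" "u3 \<in> \<beta> y3" "u3 \<notin> \<beta> x" "ES w3 u3" using out[OF E(3)] by blast
      have "u1 \<noteq> u2" "u1 \<noteq> u3" "u2 \<noteq> u3"
        using model_disj[OF m] EV E o1(2) o2(2) o3(2) y(2-4) by metis+
      moreover have "(w1, u1) = (w2, u2) \<or> (w1, u1) = (w3, u3) \<or> (w2, u2) = (w3, u3)"
      proof (rule no_three_out_edges[OF ES(1) model_conn[OF m xV] _ _ o1(1) o2(1) o3(1) o1(3) o2(3) o3(3) o1(4) o2(4) o3(4)])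
        show "finite (\<beta> x)" by (rule finite_subset[OF sub[OF xV] finGV])
        fix g assume g: "g \<in> \<beta> x"
        then have "g \<in> GV" "g \<notin> range Qv" using sub[OF xV] no by blast+
        then have "finite {h. GE g h}" "card {h. GE g h} \<le> 2" using deg_GE by blast+
        moreover have "{h. ES g h} \<subseteq> {h. GE g h}" using ES(2) by blast
        ultimately show "finite {h. ES g h} \<and> card {h. ES g h} \<le> 2"
          by (meson card_mono finite_subset le_trans)
      qed
      ultimately show False by blast
    qed
    then obtain s where s: "Qv s \<in> \<beta> x" by blast
    then have "Qv s \<in> GV" using sub[OF xV] by blast
    then have "s \<in> Inl ` Q \<union> range Inr" unfolding GV_def loc_def by (auto split: if_splits)
    moreover have "x \<in> fiber x" unfolding fiber_def using xV own_Q[OF x] by simp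
    ultimately show ?thesis unfolding T.tr_def \<gamma>0_def using s by blast
  qed
  have "model Q EK ?G (\<lambda>x. T.tr (\<gamma>0 x))"
    unfolding model_def
  proof (intro conjI ballI impI)
    fix x y assume xy: "x \<in> Q" "y \<in> Q"
    show "conn ?G (T.tr (\<gamma>0 x))" by (rule T.tr_conn[OF c0[OF xy(1)] s0 n0[OF xy(1)]])
    show "T.tr (\<gamma>0 x) \<inter> T.tr (\<gamma>0 y) = {}" if "x \<noteq> y" using d0[OF that] unfolding T.tr_def by blast
    assume K: "EK x y"
    then have "x \<noteq> y" unfolding EK_def by blast
    have "adj EH (fiber x) (fiber y)" by (rule model_adj[OF fiber_model xy K])
    then have "adj ES (\<gamma>0 x) (\<gamma>0 y)" unfolding \<gamma>0_def by (rule model_UN_adj[OF m fV fV])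
    then show "adj ?G (T.tr (\<gamma>0 x)) (T.tr (\<gamma>0 y))"
      by (rule T.tr_adj[OF c0[OF xy(1)] s0 n0[OF xy(1)] c0[OF xy(2)] s0 n0[OF xy(2)] d0[OF \<open>x \<noteq> y\<close>]])
  qed
  then show ?thesis unfolding T.tr_def by (intro exI[of _ "\<lambda>x. T.tr (\<gamma>0 x)"] conjI) (auto simp: T.tr_def)
qed

subsection \<open>Models avoiding few edges\<close>

lemma wall_closed:
  assumes "conn E P" "x \<in> P" "x \<in> wallV" "\<And>x y. E x y \<Longrightarrow> wall r x y"
  shows "P \<subseteq> wallV"
proof (rule conn_subset_of[OF assms(1-3)])
  fix p q assume "E p q"
  then have "wall r p q" by (rule assms(4))
  then have "wall r q p" unfolding wall_def by blast
  then show "q \<in> wallV" by (rule wall_wallV)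
qed

text \<open>Every edge outside the wall has exactly one end among the subdividing vertices, and this
  end names its copy. So the edge sets of the copies are disjoint although the copies share
  \<open>Q\<close>.\<close>

lemma intact_copy:
  assumes X: "finite X" "card X < t"
  shows "\<exists>i<t. (\<forall>s h. GE (Sb i s) h \<longrightarrow> {Sb i s, h} \<notin> X) \<and> (\<forall>z h. GE (Hf i z) h \<longrightarrow> {Hf i z, h} \<notin> X)"
proof -
  define C where "C i = range (Sb i) \<union> (range (Hf i) :: 'a gv set)" for i :: nat
  have out: "h \<notin> C j" if "g \<in> C i" "GE g h" for g h i j
    using that unfolding C_def by (auto simp: GE_Sb GE_Hf)
  have same: "i = j" if "g \<in> C i" "g \<in> C j" for g i j
    using that unfolding C_def by auto
  have d: "i = j" if h: "x \<in> {{g, h} |g h. GE g h \<and> g \<in> C i}" "x \<in> {{g, h} |g h. GE g h \<and> g \<in> C j}" for i j x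
  proof -
    obtain g h where 1: "x = {g, h}" "GE g h" "g \<in> C i" using h(1) by blast
    obtain g' h' where 2: "x = {g', h'}" "GE g' h'" "g' \<in> C j" using h(2) by blast
    have "g' = g \<or> g' = h" using 1(1) 2(1) by (auto simp: doubleton_eq_iff)
    then show ?thesis using same[OF 1(3)] 2(3) out[OF 1(3,2)] by blast
  qed
  have "\<exists>i<t. {{g, h} |g h. GE g h \<and> g \<in> C i} \<inter> X = {}"
    by (rule pigeonhole_disjoint[OF X]) (erule (1) d)
  then obtain i where i: "i < t" "{{g, h} |g h. GE g h \<and> g \<in> C i} \<inter> X = {}" by blast
  have "{g, h} \<notin> X" if "g \<in> C i" "GE g h" for g h using i(2) that by blast
  then show ?thesis using i(1) unfolding C_def by (intro exI[of _ i]) auto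
qed

text \<open>Take an intact copy and give the first set of an intact linkage to \<open>p1\<close> and
  the second to \<open>p2\<close>. The half edges at \<open>q1\<close> and \<open>q2\<close> then
  provide the two missing adjacencies.\<close>

lemma embed:
  assumes X: "finite X" "card X < t" "card X < r"
  shows "\<exists>\<beta>. model V EH (\<lambda>g h. GE g h \<and> {g, h} \<notin> X) \<beta> \<and> (\<forall>x\<in>V. \<beta> x \<subseteq> GV)"
proof -
  let ?ES = "\<lambda>g h. GE g h \<and> {g, h} \<notin> X"
  let ?q = "\<lambda>w. Qv (Inr w) :: 'a gv"
  have sES: "symp ?ES" using symGE by (auto simp: symp_def insert_commute)
  obtain i where i: "i < t" "\<And>s h. GE (Sb i s) h \<Longrightarrow> {Sb i s, h} \<notin> X" "\<And>z h. GE (Hf i z) h \<Longrightarrow> {Hf i z, h} \<notin> X"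
    using intact_copy[OF X(1,2)] by metis
  let ?X = "{e. ?q ` e \<in> X}"
  have inj: "inj_on (image ?q) ?X" by (rule inj_onI) (auto simp: inj_image_eq_iff inj_def)
  have sub: "image ?q ` ?X \<subseteq> X" by auto
  have fin: "finite ?X" by (rule inj_on_finite[OF inj sub X(1)])
  have "card ?X \<le> card X" by (rule card_inj_on_le[OF inj sub X(1)])
  then have "card ?X < r" using X(3) by simp
  then obtain P P' where P: "conn (\<lambda>x y. wall r x y \<and> {x, y} \<notin> ?X) P" "conn (\<lambda>x y. wall r x y \<and> {x, y} \<notin> ?X) P'"
    "P \<inter> P' = {}" "TA \<in> P" "TB \<in> P" "Z 0 \<in> P'" "Z r \<in> P'"
    using linkage_robust[OF fin] unfolding linkage_def by blast
  have PW: "P \<subseteq> wallV" by (rule wall_closed[OF P(1,4)]) (auto simp: wallV_def)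
  have PW': "P' \<subseteq> wallV" by (rule wall_closed[OF P(2,6)]) (auto simp: wallV_def)
  have cW: "conn ?ES (?q ` A)" if "conn (\<lambda>x y. wall r x y \<and> {x, y} \<notin> ?X) A" for A
    by (rule conn_image[OF that]) (auto simp: GE_Qv)
  \<comment> \<open>A subdividing vertex must join the branch set of just one end. The choice
    depends on the edge as a set, so both ends agree on it.\<close>
  define hd where "hd e = (SOME z. z \<in> e)" for e :: "'a set"
  have hd: "hd {x, y} = x \<or> hd {x, y} = y" for x y
    using someI[of "\<lambda>z. z \<in> {x, y}" x] unfolding hd_def by auto
  define S where "S x = insert (loc i x) {g. (\<exists>y. EH' x y \<and> hd {x, y} = x \<and> g = Sb i {x, y}) \<or> x \<in> {p1, q1, p2, q2} \<and> g = Hf i x}" for x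
  define W where "W x = ?q ` {w. x = p1 \<and> w \<in> P \<or> x = p2 \<and> w \<in> P'}" for x
  have eSb: "?ES (Sb i {x, y}) (loc i x)" "?ES (Sb i {x, y}) (loc i y)" if "EH' x y" for x y
  proof -
    have "GE (Sb i {x, y}) (loc i x)" unfolding GE_Sb using i(1) that by blast
    moreover have "GE (Sb i {x, y}) (loc i y)" unfolding GE_Sb using i(1) EH'_sym[OF that] by blast
    ultimately show "?ES (Sb i {x, y}) (loc i x)" "?ES (Sb i {x, y}) (loc i y)" using i(2) by blast+
  qed
  have eHf: "?ES (Hf i z) (loc i z)" "?ES (Hf i z) (?q (tm z))" if "z \<in> {p1, q1, p2, q2}" for z
  proof -
    have "GE (Hf i z) (loc i z)" "GE (Hf i z) (?q (tm z))" unfolding GE_Hf using i(1) that by blast+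
    then show "?ES (Hf i z) (loc i z)" "?ES (Hf i z) (?q (tm z))" using i(3) by blast+
  qed
  have HfS: "Hf i z \<in> S z" if "z \<in> {p1, q1, p2, q2}" for z unfolding S_def using that by blast
  have cS: "conn ?ES (S x)" for x
  proof -
    have "conn ?ES ({loc i x} \<union> {g. (\<exists>y. EH' x y \<and> hd {x, y} = x \<and> g = Sb i {x, y}) \<or> x \<in> {p1, q1, p2, q2} \<and> g = Hf i x})"
    proof (rule conn_hub[OF sES conn_singleton])
      fix g assume "g \<in> {g. (\<exists>y. EH' x y \<and> hd {x, y} = x \<and> g = Sb i {x, y}) \<or> x \<in> {p1, q1, p2, q2} \<and> g = Hf i x}"
      then consider y where "EH' x y" "g = Sb i {x, y}" | "x \<in> {p1, q1, p2, q2}" "g = Hf i x" by blast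
      then have "?ES g (loc i x)"
      proof cases
        case (1 y) then show ?thesis using eSb(1)[OF 1(1)] by simp
      next
        case 2 then show ?thesis using eHf(1)[OF 2(1)] by simp
      qed
      then show "\<exists>a\<in>{loc i x}. ?ES a g \<or> ?ES g a" by blast
    qed
    then show ?thesis unfolding S_def by simp
  qed
  have WQ: "W p1 = ?q ` P" "W p2 = ?q ` P'" "W x = {} \<or> x = p1 \<or> x = p2" for x
    unfolding W_def using end_distinct by auto
  have tW: "?q TA \<in> W p1" "?q TB \<in> W p1" "?q (Z 0) \<in> W p2" "?q (Z r) \<in> W p2" unfolding WQ using P by auto
  have conn: "conn ?ES (S x \<union> W x)" for x
  proof -
    have 1: "adj ?ES (S p1) (W p1)" unfolding adj_def
      using HfS[of p1] eHf(2)[of p1] tW(1) unfolding tm_simps by blast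
    have 2: "adj ?ES (S p2) (W p2)" unfolding adj_def
      using HfS[of p2] eHf(2)[of p2] tW(3) unfolding tm_simps by blast
    have 3: "conn ?ES (W p1)" "conn ?ES (W p2)" unfolding WQ by (rule cW[OF P(1)] cW[OF P(2)])+
    consider "W x = {}" | "x = p1" | "x = p2" using WQ(3) by blast
    then show ?thesis
    proof cases
      case 1 then show ?thesis using cS by simp
    next
      case 2 then show ?thesis using conn_Un_adj[OF sES cS 3(1) 1] by simp
    next
      case k: 3 then show ?thesis using conn_Un_adj[OF sES cS 3(2) 2] by simp
    qed
  qed
  have uniq: "x = y" if g: "g \<in> S x \<union> W x" "g \<in> S y \<union> W y" for g x y
  proof (cases g)
    case (Qv s)
    show ?thesis
    proof (cases s)
      case (Inl z)
      have "x = z" "y = z" using g unfolding Qv Inl S_def W_def by (auto simp: loc_def split: if_splits)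
      then show ?thesis by simp
    next
      case (Inr w)
      have "x = p1 \<and> w \<in> P \<or> x = p2 \<and> w \<in> P'" "y = p1 \<and> w \<in> P \<or> y = p2 \<and> w \<in> P'"
        using g unfolding Qv Inr S_def W_def by (auto simp: loc_def split: if_splits)
      then show ?thesis using P(3) by blast
    qed
  next
    case (Cp j z)
    have "x = z" "y = z" using g unfolding Cp S_def W_def by (auto simp: loc_def split: if_splits)
    then show ?thesis by simp
  next
    case (Sb j B)
    have "x = hd B" "y = hd B" using g unfolding Sb S_def W_def by auto
    then show ?thesis by simp
  next
    case (Hf j z)
    have "x = z" "y = z" using g unfolding Hf S_def W_def by auto
    then show ?thesis by simp
  qed
  have ad: "adj ?ES (S x \<union> W x) (S y \<union> W y)" if xy: "EH x y" for x y
  proof (cases "EH' x y")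
    case True
    have l: "loc i z \<in> S z" for z unfolding S_def by simp
    show ?thesis
    proof (cases "hd {x, y} = x")
      case h: True
      have "Sb i {x, y} \<in> S x" unfolding S_def using True h by blast
      then show ?thesis using eSb(2)[OF True] l[of y] unfolding adj_def by blast
    next
      case False
      then have "hd {y, x} = y" using hd[of x y] by (simp add: insert_commute)
      then have "Sb i {y, x} \<in> S y" unfolding S_def using EH'_sym[OF True] by blast
      moreover have "?ES (loc i x) (Sb i {y, x})" by (rule sympD[OF sES eSb(2)[OF EH'_sym[OF True]]])
      ultimately show ?thesis using l[of x] unfolding adj_def by blast
    qed
  next
    case False
    have 1: "adj ?ES (S q1 \<union> W q1) (S p1 \<union> W p1)" unfolding adj_def
      using HfS[of q1] eHf(2)[of q1] tW(2) unfolding tm_simps by blast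
    have 2: "adj ?ES (S q2 \<union> W q2) (S p2 \<union> W p2)" unfolding adj_def
      using HfS[of q2] eHf(2)[of q2] tW(4) unfolding tm_simps by blast
    have "x = p1 \<and> y = q1 \<or> x = q1 \<and> y = p1 \<or> x = p2 \<and> y = q2 \<or> x = q2 \<and> y = p2"
      using False xy unfolding EH'_def by (auto simp: doubleton_eq_iff)
    then show ?thesis
      using 1 2 adj_sym[OF sES 1] adj_sym[OF sES 2] by (elim disjE conjE) simp_all
  qed
  have "S x \<union> W x \<subseteq> GV" if x: "x \<in> V" for x
  proof
    fix g assume "g \<in> S x \<union> W x"
    then consider "g = loc i x" | y where "EH' x y" "g = Sb i {x, y}" | "x \<in> {p1, q1, p2, q2}" "g = Hf i x"
      | w where "w \<in> P \<union> P'" "g = ?q w" unfolding S_def W_def by blast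
    then show "g \<in> GV"
    proof cases
      case 1 then show ?thesis using locV[OF i(1) x] by simp
    next
      case 2 then show ?thesis using SbV[OF i(1)] by simp
    next
      case 3 then show ?thesis using HfV[OF i(1)] by simp
    next
      case 4 then show ?thesis using wV PW PW' by blast
    qed
  qed
  moreover have "model V EH ?ES (\<lambda>x. S x \<union> W x)"
    unfolding model_def using conn uniq ad by blast
  ultimately show ?thesis by blast
qed

end

section \<open>Path decompositions of trees\<close>

text \<open>The interval condition in recursive form: whatever \<open>b\<close> shares with a later
  bag is already in the next one. \<open>cvx_nth\<close> recovers the condition on indices.\<close>

fun cvx :: "'v set list \<Rightarrow> bool" where
  "cvx [] = True"
| "cvx (b # bs) = (cvx bs \<and> (bs = [] \<or> b \<inter> \<Union> (set bs) \<subseteq> hd bs))"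

lemma cvx_append:
  "cvx xs \<Longrightarrow> cvx ys \<Longrightarrow> xs \<noteq> [] \<Longrightarrow> ys \<noteq> [] \<Longrightarrow> \<Union> (set xs) \<inter> \<Union> (set ys) \<subseteq> last xs \<inter> hd ys \<Longrightarrow> cvx (xs @ ys)"
proof (induction xs)
  case (Cons b xs)
  show ?case
  proof (cases "xs = []")
    case True
    then show ?thesis using Cons by auto
  next
    case False
    have "\<Union> (set xs) \<inter> \<Union> (set ys) \<subseteq> last xs \<inter> hd ys" using Cons.prems(5) False by auto
    then have 1: "cvx (xs @ ys)" using Cons.IH Cons.prems False by auto
    have 2: "b \<inter> \<Union> (set xs) \<subseteq> hd xs" using Cons.prems(1) False by auto
    have "b \<inter> \<Union> (set ys) \<subseteq> last xs" using Cons.prems(5) False by auto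
    moreover have "last xs \<subseteq> \<Union> (set xs)" using False by (meson Union_upper last_in_set)
    ultimately have "b \<inter> \<Union> (set ys) \<subseteq> hd xs" using 2 by blast
    then have "b \<inter> \<Union> (set (xs @ ys)) \<subseteq> hd (xs @ ys)" using 2 False by auto
    then show ?thesis using 1 by simp
  qed
qed simp

lemma cvx_rev: "cvx xs \<Longrightarrow> cvx (rev xs)"
proof (induction xs)
  case (Cons b xs)
  show ?case
  proof (cases "xs = []")
    case False
    have "cvx (rev xs @ [b])" by (rule cvx_append) (use Cons False in \<open>auto simp: last_rev\<close>)
    then show ?thesis by simp
  qed simp
qed simp

lemma cvx_add: "cvx xs \<Longrightarrow> cvx (map (\<lambda>b. b \<union> X) xs)"
proof (induction xs)
  case (Cons b xs)
  then show ?case by (cases "xs = []") (auto simp: hd_map)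
qed simp

lemma cvx_nth: "cvx xs \<Longrightarrow> i \<le> j \<Longrightarrow> j \<le> k \<Longrightarrow> k < length xs \<Longrightarrow> xs ! i \<inter> xs ! k \<subseteq> xs ! j"
proof (induction xs arbitrary: i j k)
  case (Cons b xs)
  show ?case
  proof (cases j)
    case 0
    then show ?thesis using Cons.prems by simp
  next
    case (Suc j')
    then obtain k' where k: "k = Suc k'" using Cons.prems(3) by (cases k) auto
    then have k': "j' \<le> k'" "k' < length xs" using Cons.prems Suc by auto
    show ?thesis
    proof (cases i)
      case (Suc i')
      then show ?thesis using Cons.IH[of i' j' k'] Cons.prems k k' \<open>j = Suc j'\<close> by simp
    next
      case 0
      have ne: "xs \<noteq> []" using k' by auto
      then have "b \<inter> \<Union> (set xs) \<subseteq> xs ! 0" using Cons.prems(1) by (simp add: hd_conv_nth)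
      moreover have "xs ! k' \<in> set xs" using k' by simp
      moreover have "xs ! 0 \<inter> xs ! k' \<subseteq> xs ! j'" using Cons.IH[of 0 j' k'] Cons.prems k' by simp
      ultimately have "b \<inter> xs ! k' \<subseteq> xs ! j'" by blast
      then show ?thesis using 0 Suc k by simp
    qed
  qed
qed simp

text \<open>\<open>A\<close> and \<open>B\<close> are interfaces at which decompositions are glued
  together. Bags of size \<open>s\<close> correspond to width \<open>s - 1\<close>.\<close>

definition pd :: "('v \<Rightarrow> 'v \<Rightarrow> bool) \<Rightarrow> nat \<Rightarrow> 'v set \<Rightarrow> 'v set \<Rightarrow> 'v set \<Rightarrow> bool" where
  "pd E s A U B \<longleftrightarrow> (\<exists>bs. bs \<noteq> [] \<and> \<Union> (set bs) = U \<and> A \<subseteq> hd bs \<and> B \<subseteq> last bs \<and>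
     (\<forall>b\<in>set bs. finite b \<and> card b \<le> s) \<and> (\<forall>x\<in>U. \<forall>y\<in>U. E x y \<longrightarrow> (\<exists>b\<in>set bs. x \<in> b \<and> y \<in> b)) \<and> cvx bs)"

lemma pd_mono: "pd E s A U B \<Longrightarrow> s \<le> s' \<Longrightarrow> A' \<subseteq> A \<Longrightarrow> B' \<subseteq> B \<Longrightarrow> pd E s' A' U B'"
proof -
  assume a: "pd E s A U B" "s \<le> s'" "A' \<subseteq> A" "B' \<subseteq> B"
  then obtain bs where b: "bs \<noteq> []" "\<Union> (set bs) = U" "A \<subseteq> hd bs" "B \<subseteq> last bs" "\<forall>b\<in>set bs. finite b \<and> card b \<le> s"
    "\<forall>x\<in>U. \<forall>y\<in>U. E x y \<longrightarrow> (\<exists>b\<in>set bs. x \<in> b \<and> y \<in> b)" "cvx bs" unfolding pd_def by blast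
  have "\<forall>b\<in>set bs. finite b \<and> card b \<le> s'" using b(5) a(2) by (meson le_trans)
  moreover have "A' \<subseteq> hd bs" "B' \<subseteq> last bs" using a b(3,4) by (meson subset_trans)+
  ultimately show ?thesis unfolding pd_def using b(1,2,6,7) by (intro exI[of _ bs] conjI)
qed

lemma pd_rev: "pd E s A U B \<Longrightarrow> pd E s B U A"
proof -
  assume "pd E s A U B"
  then obtain bs where "bs \<noteq> []" "\<Union> (set bs) = U" "A \<subseteq> hd bs" "B \<subseteq> last bs" "\<forall>b\<in>set bs. finite b \<and> card b \<le> s"
    "\<forall>x\<in>U. \<forall>y\<in>U. E x y \<longrightarrow> (\<exists>b\<in>set bs. x \<in> b \<and> y \<in> b)" "cvx bs" unfolding pd_def by blast
  then show ?thesis unfolding pd_def by (intro exI[of _ "rev bs"]) (simp add: hd_rev last_rev cvx_rev)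
qed

lemma pd_single: "finite U \<Longrightarrow> card U \<le> s \<Longrightarrow> pd E s U U U"
  unfolding pd_def by (rule exI[of _ "[U]"]) auto

lemma pd_add:
  assumes "pd E s A U B" "symp E"
  shows "pd E (Suc s) (insert x A) (insert x U) (insert x B)"
proof -
  obtain bs where b: "bs \<noteq> []" "\<Union> (set bs) = U" "A \<subseteq> hd bs" "B \<subseteq> last bs" "\<forall>b\<in>set bs. finite b \<and> card b \<le> s"
    "\<forall>x\<in>U. \<forall>y\<in>U. E x y \<longrightarrow> (\<exists>b\<in>set bs. x \<in> b \<and> y \<in> b)" "cvx bs" using assms(1) unfolding pd_def by blast
  let ?cs = "map (\<lambda>b. b \<union> {x}) bs"
  have "\<exists>c\<in>set ?cs. p \<in> c \<and> q \<in> c" if pq: "p \<in> insert x U" "q \<in> insert x U" "E p q" for p q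
  proof (cases "p \<in> U \<and> q \<in> U")
    case True
    then obtain b0 where "b0 \<in> set bs" "p \<in> b0" "q \<in> b0" using b(6) pq(3) by blast
    then show ?thesis by (intro bexI[of _ "b0 \<union> {x}"]) auto
  next
    case False
    then have "p = x \<or> q = x" using pq by blast
    moreover have "\<exists>c\<in>set ?cs. u \<in> c \<and> x \<in> c" if "u \<in> insert x U" for u
    proof (cases "u = x")
      case True
      then show ?thesis using b(1) by (cases bs) auto
    next
      case False
      then show ?thesis using that b(2) by auto
    qed
    ultimately show ?thesis using pq(1,2) by blast
  qed
  moreover have "finite c \<and> card c \<le> Suc s" if "c \<in> set ?cs" for c
    using that b(5) by (auto simp: card_insert_if intro: le_SucI)
  moreover have "\<Union> (set ?cs) = insert x U" using b(1,2) by (cases bs) auto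
  moreover have "insert x A \<subseteq> hd ?cs" "insert x B \<subseteq> last ?cs" using b(1,3,4) by (auto simp: hd_map last_map)
  moreover have "?cs \<noteq> []" using b(1) by simp
  moreover have "cvx ?cs" by (rule cvx_add[OF b(7)])
  ultimately show ?thesis unfolding pd_def by (intro exI[of _ ?cs] conjI ballI impI) blast+
qed

lemma pd_concat:
  assumes p: "pd E s A U X" "pd E s X W C" and i: "U \<inter> W \<subseteq> X" and E: "symp E"
    and sep: "\<And>p q. p \<in> U \<Longrightarrow> p \<notin> W \<Longrightarrow> q \<in> W \<Longrightarrow> q \<notin> U \<Longrightarrow> \<not> E p q"
  shows "pd E s A (U \<union> W) C"
proof -
  obtain bs where b: "bs \<noteq> []" "\<Union> (set bs) = U" "A \<subseteq> hd bs" "X \<subseteq> last bs" "\<forall>b\<in>set bs. finite b \<and> card b \<le> s"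
    "\<forall>x\<in>U. \<forall>y\<in>U. E x y \<longrightarrow> (\<exists>b\<in>set bs. x \<in> b \<and> y \<in> b)" "cvx bs" using p(1) unfolding pd_def by blast
  obtain cs where c: "cs \<noteq> []" "\<Union> (set cs) = W" "X \<subseteq> hd cs" "C \<subseteq> last cs" "\<forall>b\<in>set cs. finite b \<and> card b \<le> s"
    "\<forall>x\<in>W. \<forall>y\<in>W. E x y \<longrightarrow> (\<exists>b\<in>set cs. x \<in> b \<and> y \<in> b)" "cvx cs" using p(2) unfolding pd_def by blast
  have "cvx (bs @ cs)" by (rule cvx_append[OF b(7) c(7) b(1) c(1)]) (use b c i in blast)
  moreover have "\<exists>d\<in>set (bs @ cs). p \<in> d \<and> q \<in> d" if pq: "p \<in> U \<union> W" "q \<in> U \<union> W" "E p q" for p q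
  proof -
    have "E q p" using pq(3) E by (auto dest: sympD)
    then have "p \<in> U \<and> q \<in> U \<or> p \<in> W \<and> q \<in> W" using sep[of p q] sep[of q p] pq by blast
    then show ?thesis
    proof (elim disjE conjE)
      assume "p \<in> U" "q \<in> U"
      then obtain d where "d \<in> set bs" "p \<in> d" "q \<in> d" using b(6) pq(3) by blast
      then show ?thesis by (intro bexI[of _ d]) simp_all
    next
      assume "p \<in> W" "q \<in> W"
      then obtain d where "d \<in> set cs" "p \<in> d" "q \<in> d" using c(6) pq(3) by blast
      then show ?thesis by (intro bexI[of _ d]) simp_all
    qed
  qed
  moreover have "\<forall>d\<in>set (bs @ cs). finite d \<and> card d \<le> s" using b(5) c(5) by auto
  moreover have "\<Union> (set (bs @ cs)) = U \<union> W" "A \<subseteq> hd (bs @ cs)" "C \<subseteq> last (bs @ cs)" "bs @ cs \<noteq> []"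
    using b(1-3) c(1,2,4) by simp_all
  ultimately show ?thesis unfolding pd_def by (intro exI[of _ "bs @ cs"] conjI ballI impI) simp_all
qed

text \<open>Acyclicity is stated as \<open>bridge\<close>, in terms of connected sets. This form
  avoids paths and cycles and carries over to the contracted tree.\<close>

locale forest =
  fixes V :: "'v set" and E :: "'v \<Rightarrow> 'v \<Rightarrow> bool"
  assumes finV: "finite V" and symE: "symp E" and EV: "E x y \<Longrightarrow> x \<in> V \<and> y \<in> V"
    and bridge: "conn E A \<Longrightarrow> conn E B \<Longrightarrow> A \<inter> B = {} \<Longrightarrow> x \<in> A \<Longrightarrow> x' \<in> A \<Longrightarrow> y \<in> B \<Longrightarrow> y' \<in> B \<Longrightarrow>
      E x y \<Longrightarrow> E x' y' \<Longrightarrow> x = x' \<and> y = y'"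
begin

abbreviation "br U v p \<equiv> comp_of E (U - {v}) p"

lemma br_neighbour:
  assumes "conn E U" "v \<in> U" "p \<in> U - {v}"
  shows "\<exists>z\<in>br U v p. E v z"
proof -
  have 1: "p \<in> br U v p" "v \<notin> br U v p" using comp_of_self[OF assms(3)] comp_of_subset[of E "U - {v}" p] by auto
  obtain x y where xy: "x \<in> U" "x \<in> br U v p" "y \<in> U" "y \<notin> br U v p" "E x y"
    by (rule conn_cut[OF assms(1) _ 1(1) assms(2) 1(2)]) (use assms(3) in auto)
  have "y = v" using comp_of_closed[OF symE assms(3) xy(2) _ xy(5)] xy by blast
  then show ?thesis using xy symE by (auto dest: sympD)
qed

lemma br_disjoint:
  assumes "p \<in> U - {v}" "q \<in> U - {v}" "br U v p \<noteq> br U v q"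
  shows "br U v p \<inter> br U v q = {}"
  using comp_of_eq[OF symE assms(1)] comp_of_eq[OF symE assms(2)] assms(3) by blast

lemma conn_br: "p \<in> U - {v} \<Longrightarrow> conn E (br U v p)"
  by (rule conn_comp_of[OF symE])

lemma br_edge:
  assumes "p \<in> U - {v}" "x \<in> br U v p" "y \<in> U" "y \<notin> br U v p" "E x y"
  shows "y = v"
  using comp_of_closed[OF symE assms(1,2) _ assms(5)] assms(3,4) by blast

lemma br_root:
  assumes "p \<in> U - {v}" "x \<in> br U v p" "y \<in> br U v p" "E x v" "E y v"
  shows "x = y"
  using bridge[OF conn_br[OF assms(1)] conn_singleton[of E v] _ assms(2,3) _ _ assms(4,5)]
    comp_of_subset[of E "U - {v}" p] by blast

text \<open>\<open>br U x w\<close> is joined to the rest of \<open>U\<close> by the edge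
  \<open>y x\<close> only. So a component of it that avoids \<open>y\<close> after the removal of
  \<open>v\<close> does not grow when the rest of \<open>U\<close> is added.\<close>

lemma br_away:
  assumes U: "x \<in> U" and w: "w \<in> U - {x}" and y: "y \<in> br U x w" "E x y" and p: "p \<in> br U x w - {v}"
    and no: "y \<notin> br (br U x w) v p"
  shows "x \<notin> br U v p" "br (br U x w) v p = br U v p"
proof -
  let ?W = "br U x w" and ?D = "br (br U x w) v p" and ?C = "br U v p"
  have WU: "?W \<subseteq> U - {x}" by (rule comp_of_subset)
  have DW: "?D \<subseteq> ?W - {v}" by (rule comp_of_subset)
  have pU: "p \<in> U - {v}" using p WU by blast
  have DC: "?D \<subseteq> ?C" by (rule comp_of_max[OF conn_br[OF p] _ comp_of_self[OF p]]) (use DW WU in blast)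
  show xC: "x \<notin> ?C"
  proof
    assume x: "x \<in> ?C"
    have pD: "p \<in> ?D" by (rule comp_of_self[OF p])
    have xD: "x \<notin> ?D" using DW WU by blast
    obtain d z where dz: "d \<in> ?C" "d \<in> ?D" "z \<in> ?C" "z \<notin> ?D" "E d z"
      by (rule conn_cut[OF conn_br[OF pU] comp_of_self[OF pU] pD x xD])
    have z: "z \<in> U - {v}" using dz(3) comp_of_subset[of E "U - {v}" p] by blast
    have "z \<notin> ?W" using comp_of_closed[OF symE p dz(2) _ dz(5)] dz(4) z by blast
    moreover have dW: "d \<in> ?W" using dz(2) DW by blast
    ultimately have "z = x" using br_edge[OF w dW _ _ dz(5)] z by blast
    moreover have "E y x" using y(2) symE by (auto dest: sympD)
    ultimately have "d = y" using br_root[OF w dW y(1)] dz(5) by blast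
    then show False using dz(2) no by blast
  qed
  have "?C \<subseteq> ?W"
  proof (rule conn_subset_of[OF conn_br[OF pU] comp_of_self[OF pU]])
    show "p \<in> ?W" using p by blast
    fix i j assume ij: "i \<in> ?C" "i \<in> ?W" "j \<in> ?C" "E i j"
    then have "j \<in> U" using comp_of_subset[of E "U - {v}" p] by blast
    then show "j \<in> ?W" using br_edge[OF w ij(2) _ _ ij(4)] ij(3) xC by blast
  qed
  then have "?C \<subseteq> ?W - {v}" using comp_of_subset[of E "U - {v}" p] by blast
  then have "?C \<subseteq> ?D" by (rule comp_of_max[OF conn_br[OF pU] _ comp_of_self[OF pU]])
  then show "?D = ?C" using DC by blast
qed

text \<open>Decompose the branches one after another and add \<open>x\<close> to every bag;
  different branches have no edges between them.\<close>

lemma pd_star: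
  assumes "x \<in> U" "finite \<L>" "\<L> \<subseteq> br U x ` (U - {x})" "\<And>L. L \<in> \<L> \<Longrightarrow> pd E s {} L {}"
  shows "pd E (Suc s) {x} ({x} \<union> \<Union> \<L>) {x}"
  using assms(2-)
proof (induction \<L> rule: finite_induct)
  case empty
  show ?case using pd_single[of "{x}" "Suc s" E] by simp
next
  case (insert L \<L>)
  obtain w where w: "w \<in> U - {x}" "L = br U x w" using insert.prems(1) by blast
  have "pd E (Suc s) (insert x {}) (insert x L) (insert x {})" by (rule pd_add[OF _ symE]) (simp add: insert.prems(2))
  then have L: "pd E (Suc s) {x} (insert x L) {x}" by simp
  have IH: "pd E (Suc s) {x} ({x} \<union> \<Union> \<L>) {x}" using insert by simp
  have dis: "\<Union> \<L> \<inter> L = {}"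
  proof -
    have "M \<inter> L = {}" if M: "M \<in> \<L>" for M
    proof -
      obtain u where u: "u \<in> U - {x}" "M = br U x u" using insert.prems(1) M by blast
      have "M \<noteq> L" using M insert.hyps by blast
      then show ?thesis using br_disjoint[OF u(1) w(1)] u w by blast
    qed
    then show ?thesis by blast
  qed
  have "pd E (Suc s) {x} (({x} \<union> \<Union> \<L>) \<union> insert x L) {x}"
  proof (rule pd_concat[OF IH L _ symE])
    show "({x} \<union> \<Union> \<L>) \<inter> insert x L \<subseteq> {x}" using dis by blast
    fix p q assume pq: "p \<in> {x} \<union> \<Union> \<L>" "p \<notin> insert x L" "q \<in> insert x L" "q \<notin> {x} \<union> \<Union> \<L>"
    have "\<Union> \<L> \<subseteq> U"
    proof
      fix u assume "u \<in> \<Union> \<L>"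
      then obtain M where "M \<in> \<L>" "u \<in> M" by (rule UnionE)
      moreover then obtain v where "M = br U x v" using insert.prems(1) by auto
      ultimately show "u \<in> U" using comp_of_subset[of E "U - {x}" v] by blast
    qed
    then have "p \<in> U" using pq(1,2) by blast
    then show "\<not> E p q" using br_edge[OF w(1), of q p] pq w(2) symE by (auto dest: sympD)
  qed
  then show ?case by (simp add: insert_commute Un_commute Un_left_commute)
qed

text \<open>Branches that point away from \<open>x\<close> and contain a high tree line up along one
  path that starts at \<open>x\<close>.\<close>

definition rooted :: "nat \<Rightarrow> 'v set \<Rightarrow> 'v \<Rightarrow> bool" where
  "rooted k U x \<longleftrightarrow> conn E U \<and> x \<in> U \<and> (\<forall>v\<in>U. \<forall>p\<in>U - {v}. \<forall>q\<in>U - {v}.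
     tern E k (br U v p) \<and> tern E k (br U v q) \<and> x \<notin> br U v p \<and> x \<notin> br U v q \<longrightarrow> br U v p = br U v q)"

definition thin :: "nat \<Rightarrow> 'v set \<Rightarrow> bool" where
  "thin k U \<longleftrightarrow> (\<forall>v\<in>U. \<forall>p\<in>U - {v}. \<forall>q\<in>U - {v}. \<forall>u\<in>U - {v}.
     tern E k (br U v p) \<and> tern E k (br U v q) \<and> tern E k (br U v u) \<longrightarrow>
     br U v p = br U v q \<or> br U v p = br U v u \<or> br U v q = br U v u)"

lemma pd_attach:
  assumes w: "w \<in> U - {x}" and y: "y \<in> br U x w" "E x y"
    and p: "pd E s A D {x}" "pd E s {y} (br U x w) B" "2 \<le> s" and D: "x \<in> D" "D \<subseteq> U - br U x w"
  shows "pd E s A (D \<union> br U x w) B"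
proof -
  let ?W = "br U x w"
  have xW: "x \<notin> ?W" using comp_of_subset[of E "U - {x}" w] by blast
  have "card {x, y} \<le> 2" by (simp add: card_insert_if)
  then have "pd E s {x, y} {x, y} {x, y}" using p(3) by (intro pd_single) auto
  then have 1: "pd E s {x} {x, y} {y}" by (rule pd_mono) auto
  have sep: "\<not> E u q" if "u \<in> D" "u \<noteq> x" "q \<in> ?W" for u q
  proof
    assume "E u q"
    then have "E q u" using symE by (auto dest: sympD)
    then show False using br_edge[OF w that(3) _ _] that D(2) by blast
  qed
  have 2: "pd E s A (D \<union> {x, y}) {y}"
    by (rule pd_concat[OF p(1) 1 _ symE]) (use D y sep in auto)
  have "pd E s A (D \<union> {x, y} \<union> ?W) B"
  proof (rule pd_concat[OF 2 p(2) _ symE])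
    show "(D \<union> {x, y}) \<inter> ?W \<subseteq> {y}" using D xW by blast
    fix u q assume u: "u \<in> D \<union> {x, y}" "u \<notin> ?W" "q \<in> ?W" "q \<notin> D \<union> {x, y}"
    show "\<not> E u q"
    proof (cases "u = x")
      case True
      then show ?thesis using br_root[OF w u(3) y(1)] y(2) u(4) symE by (auto dest: sympD)
    next
      case False
      then show ?thesis using sep[of u q] u y by blast
    qed
  qed
  then show ?thesis using D(1) y(1) by (simp add: insert_absorb Un_commute)
qed

text \<open>Keep \<open>x\<close> in all bags while its light branches are decomposed. Then pass
  along an edge to the root of the only heavy branch, which is rooted again and smaller.\<close>

lemma pd_rooted:
  assumes light: "\<And>W. conn E W \<Longrightarrow> W \<subseteq> V \<Longrightarrow> \<not> tern E k W \<Longrightarrow> pd E s {} W {}" and s: "1 \<le> s"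
  shows "rooted k U x \<Longrightarrow> U \<subseteq> V \<Longrightarrow> pd E (Suc s) {x} U {}"
proof (induction "card U" arbitrary: U x rule: less_induct)
  case less
  have U: "conn E U" "x \<in> U" using less.prems(1) unfolding rooted_def by blast+
  have fin: "finite U" using less.prems(2) finV by (rule finite_subset)
  define \<L> where "\<L> = {L \<in> br U x ` (U - {x}). \<not> tern E k L}"
  have brU: "br U x p \<subseteq> U - {x}" for p by (rule comp_of_subset)
  have star: "pd E (Suc s) {x} ({x} \<union> \<Union> \<L>) {x}"
  proof (rule pd_star[OF U(2)])
    show "finite \<L>" "\<L> \<subseteq> br U x ` (U - {x})" unfolding \<L>_def using fin by auto
    fix L assume "L \<in> \<L>"
    then obtain p where p: "p \<in> U - {x}" "L = br U x p" "\<not> tern E k L" unfolding \<L>_def by blast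
    show "pd E s {} L {}" by (rule light[OF _ _ p(3)]) (use conn_br[OF p(1)] p(2) brU less.prems(2) in auto)
  qed
  show ?case
  proof (cases "\<exists>w\<in>U - {x}. tern E k (br U x w)")
    case False
    have "U \<subseteq> {x} \<union> \<Union> \<L>"
    proof
      fix u assume "u \<in> U"
      then show "u \<in> {x} \<union> \<Union> \<L>" using False comp_of_self[of u "U - {x}" E] unfolding \<L>_def by (cases "u = x") auto
    qed
    moreover have "{x} \<union> \<Union> \<L> \<subseteq> U" using U brU unfolding \<L>_def by auto
    ultimately have "{x} \<union> \<Union> \<L> = U" by blast
    then show ?thesis using pd_mono[OF star, of "Suc s" "{x}" "{}"] by simp
  next
    case True
    then obtain w where w: "w \<in> U - {x}" "tern E k (br U x w)" by blast
    let ?W = "br U x w"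
    have xbr: "x \<notin> br U x p" for p using brU by blast
    have only: "br U x p = ?W" if "p \<in> U - {x}" "tern E k (br U x p)" for p
      using less.prems(1) U(2) that w xbr unfolding rooted_def by metis
    obtain y where y: "y \<in> ?W" "E x y" using br_neighbour[OF U w(1)] by blast
    have "?W \<subset> U" using brU[of w] U(2) by blast
    then have card: "card ?W < card U" using fin by (rule psubset_card_mono[rotated])
    have "rooted k ?W y"
      unfolding rooted_def
    proof (intro conjI ballI impI)
      show "conn E ?W" "y \<in> ?W" using conn_br[OF w(1)] y(1) by blast+
      fix v p q assume v: "v \<in> ?W" and p: "p \<in> ?W - {v}" and q: "q \<in> ?W - {v}"
        and h: "tern E k (br ?W v p) \<and> tern E k (br ?W v q) \<and> y \<notin> br ?W v p \<and> y \<notin> br ?W v q"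
      have vU: "v \<in> U" and pU: "p \<in> U - {v}" and qU: "q \<in> U - {v}" using v p q brU[of w] by blast+
      have a1: "x \<notin> br U v p" "br ?W v p = br U v p" by (rule br_away[OF U(2) w(1) y p], use h in blast)+
      have a2: "x \<notin> br U v q" "br ?W v q = br U v q" by (rule br_away[OF U(2) w(1) y q], use h in blast)+
      show "br ?W v p = br ?W v q"
        using less.prems(1) vU pU qU h a1 a2 unfolding rooted_def by metis
    qed
    then have IH: "pd E (Suc s) {y} ?W {}" using less.hyps[OF card] brU less.prems(2) by blast
    have "pd E (Suc s) {x} ({x} \<union> \<Union> \<L> \<union> ?W) {}"
    proof (rule pd_attach[OF w(1) y star IH])
      show "{x} \<union> \<Union> \<L> \<subseteq> U - ?W"
      proof -
        have "L \<inter> ?W = {}" if L: "L \<in> \<L>" for L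
        proof -
          obtain p where p: "p \<in> U - {x}" "L = br U x p" "\<not> tern E k L" using L unfolding \<L>_def by blast
          then have "br U x p \<noteq> ?W" using w(2) by auto
          then show ?thesis using br_disjoint[OF p(1) w(1)] p(2) by blast
        qed
        moreover have "{x} \<union> \<Union> \<L> \<subseteq> U" using U brU unfolding \<L>_def by auto
        ultimately show ?thesis using xbr[of w] by blast
      qed
    qed (use s in auto)
    moreover have "{x} \<union> \<Union> \<L> \<union> ?W = U"
    proof -
      have "u \<in> {x} \<union> \<Union> \<L> \<union> ?W" if "u \<in> U" for u
        using that only[of u] comp_of_self[of u "U - {x}" E] unfolding \<L>_def by (cases "u = x") auto
      moreover have "{x} \<union> \<Union> \<L> \<union> ?W \<subseteq> U" using U(2) brU unfolding \<L>_def by auto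
      ultimately show ?thesis by blast
    qed
    ultimately show ?thesis by simp
  qed
qed

text \<open>Seen from a vertex \<open>v\<close> in the branch of \<open>p\<close>, the heavy branch
  of \<open>q\<close> lies on the side of \<open>x\<close>. It already accounts for one of the two
  heavy branches that \<open>thin\<close> allows at \<open>v\<close>.\<close>

lemma thin_rooted:
  assumes U: "conn E U" "thin k U" "x \<in> U" and p: "p \<in> U - {x}" and q: "q \<in> U - {x}"
    and d: "br U x p \<noteq> br U x q" and t: "tern E k (br U x q)" and y: "y \<in> br U x p" "E x y"
  shows "rooted k (br U x p) y"
  unfolding rooted_def
proof (intro conjI ballI impI)
  let ?W = "br U x p"
  have WU: "?W \<subseteq> U - {x}" by (rule comp_of_subset)
  show "conn E ?W" "y \<in> ?W" using conn_br[OF p] y(1) by blast+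
  fix v i j assume v: "v \<in> ?W" and i: "i \<in> ?W - {v}" and j: "j \<in> ?W - {v}"
    and h: "tern E k (br ?W v i) \<and> tern E k (br ?W v j) \<and> y \<notin> br ?W v i \<and> y \<notin> br ?W v j"
  have vU: "v \<in> U" "v \<noteq> x" and iU: "i \<in> U - {v}" and jU: "j \<in> U - {v}" using v i j WU by blast+
  have xU: "x \<in> U - {v}" using vU U(3) by blast
  have a1: "x \<notin> br U v i" "br ?W v i = br U v i" by (rule br_away[OF U(3) p y i], use h in blast)+
  have a2: "x \<notin> br U v j" "br ?W v j = br U v j" by (rule br_away[OF U(3) p y j], use h in blast)+
  obtain z where z: "z \<in> br U x q" "E x z" using br_neighbour[OF U(1,3) q] by blast
  have "conn E (insert x (br U x q))" by (rule conn_insert[OF symE conn_br[OF q] z(1)]) (use z(2) in blast)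
  moreover have "insert x (br U x q) \<subseteq> U - {v}"
    using br_disjoint[OF p q d] v vU U(3) comp_of_subset[of E "U - {x}" q] by blast
  ultimately have "insert x (br U x q) \<subseteq> br U v x" by (rule comp_of_max) simp
  then have t': "tern E k (br U v x)" by (intro tern_superset[OF t _ conn_br[OF xU]]) blast
  have "br U v i = br U v j \<or> br U v i = br U v x \<or> br U v j = br U v x"
    using U(2) vU(1) iU jU xU t' h a1(2) a2(2) unfolding thin_def by metis
  moreover have "x \<in> br U v x" by (rule comp_of_self[OF xU])
  ultimately show "br ?W v i = br ?W v j" using a1 a2 by metis
qed

text \<open>At a vertex with two heavy branches, both are rooted; the decomposition comes in through
  one, treats the light branches in the middle and goes out through the other. Without such a vertex
  every vertex is a root.\<close>

lemma pd_thin: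
  assumes light: "\<And>W. conn E W \<Longrightarrow> W \<subseteq> V \<Longrightarrow> \<not> tern E k W \<Longrightarrow> pd E s {} W {}" and s: "1 \<le> s"
    and U: "conn E U" "U \<subseteq> V" "thin k U"
  shows "pd E (Suc s) {} U {}"
proof -
  have root: "pd E (Suc s) {z} W {}" if "rooted k W z" "W \<subseteq> V" for W z
    by (rule pd_rooted[OF _ s that]) (rule light)
  show ?thesis
  proof (cases "\<exists>x\<in>U. \<exists>p\<in>U - {x}. \<exists>q\<in>U - {x}. tern E k (br U x p) \<and> tern E k (br U x q) \<and> br U x p \<noteq> br U x q")
    case False
    obtain x where x: "x \<in> U" using conn_nonempty[OF U(1)] by blast
    have "rooted k U x" unfolding rooted_def using U(1) x False by blast
    then have "pd E (Suc s) {x} U {}" by (rule root) (rule U(2))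
    then show ?thesis by (rule pd_mono) auto
  next
    case True
    then obtain x p q where x: "x \<in> U" and p: "p \<in> U - {x}" "tern E k (br U x p)" and q: "q \<in> U - {x}" "tern E k (br U x q)"
      and d: "br U x p \<noteq> br U x q" by blast
    let ?P = "br U x p" and ?Q = "br U x q"
    have brU: "br U x p \<subseteq> U - {x}" for p by (rule comp_of_subset)
    have xbr: "x \<notin> br U x p" for p using brU by blast
    obtain y where y: "y \<in> ?P" "E x y" using br_neighbour[OF U(1) x p(1)] by blast
    obtain z where z: "z \<in> ?Q" "E x z" using br_neighbour[OF U(1) x q(1)] by blast
    have "rooted k ?P y" by (rule thin_rooted[OF U(1,3) x p(1) q(1) d q(2) y])
    then have pP: "pd E (Suc s) {y} ?P {}" by (rule root) (use brU U(2) in blast)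
    have "rooted k ?Q z" by (rule thin_rooted[OF U(1,3) x q(1) p(1) d[symmetric] p(2) z])
    then have pQ: "pd E (Suc s) {z} ?Q {}" by (rule root) (use brU U(2) in blast)
    define \<L> where "\<L> = {L \<in> br U x ` (U - {x}). \<not> tern E k L}"
    have fin: "finite U" using U(2) finV by (rule finite_subset)
    have star: "pd E (Suc s) {x} ({x} \<union> \<Union> \<L>) {x}"
    proof (rule pd_star[OF x])
      show "finite \<L>" "\<L> \<subseteq> br U x ` (U - {x})" unfolding \<L>_def using fin by auto
      fix L assume "L \<in> \<L>"
      then obtain i where i: "i \<in> U - {x}" "L = br U x i" "\<not> tern E k L" unfolding \<L>_def by blast
      show "pd E s {} L {}" by (rule light[OF _ _ i(3)]) (use conn_br[OF i(1)] i(2) brU U(2) in auto)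
    qed
    have sub: "{x} \<union> \<Union> \<L> \<subseteq> U - br U x i" if i: "i \<in> U - {x}" "tern E k (br U x i)" for i
    proof -
      have "L \<inter> br U x i = {}" if L: "L \<in> \<L>" for L
      proof -
        obtain j where j: "j \<in> U - {x}" "L = br U x j" "\<not> tern E k L" using L unfolding \<L>_def by blast
        then have "br U x j \<noteq> br U x i" using i(2) by auto
        then show ?thesis using br_disjoint[OF j(1) i(1)] j(2) by blast
      qed
      moreover have "{x} \<union> \<Union> \<L> \<subseteq> U" using x brU unfolding \<L>_def by auto
      ultimately show ?thesis using xbr[of i] by blast
    qed
    have 2: "2 \<le> Suc s" using s by simp
    have "pd E (Suc s) {x} ({x} \<union> \<Union> \<L> \<union> ?P) {}"
      by (rule pd_attach[OF p(1) y star pP 2]) (use sub[OF p] in auto)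
    then have "pd E (Suc s) {} ({x} \<union> \<Union> \<L> \<union> ?P) {x}" by (rule pd_rev)
    then have "pd E (Suc s) {} ({x} \<union> \<Union> \<L> \<union> ?P \<union> ?Q) {}"
    proof (rule pd_attach[OF q(1) z _ pQ 2])
      show "{x} \<union> \<Union> \<L> \<union> ?P \<subseteq> U - ?Q" using sub[OF q] br_disjoint[OF p(1) q(1) d] brU[of p] by blast
    qed auto
    moreover have "{x} \<union> \<Union> \<L> \<union> ?P \<union> ?Q = U"
    proof -
      have "u \<in> {x} \<union> \<Union> \<L> \<union> ?P \<union> ?Q" if u: "u \<in> U" for u
      proof (cases "u = x")
        case False
        then have u': "u \<in> U - {x}" "u \<in> br U x u" using u comp_of_self[of u "U - {x}" E] by auto
        show ?thesis
        proof (cases "tern E k (br U x u)")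
          case True
          then have "br U x u = ?P \<or> br U x u = ?Q" using U(3) x p q u' d unfolding thin_def by metis
          then show ?thesis using u' by blast
        next
          case False
          then have "br U x u \<in> \<L>" unfolding \<L>_def using u' by blast
          then show ?thesis using u' by blast
        qed
      qed simp
      moreover have "{x} \<union> \<Union> \<L> \<union> ?P \<union> ?Q \<subseteq> U" using x brU unfolding \<L>_def by auto
      ultimately show ?thesis by blast
    qed
    ultimately show ?thesis by simp
  qed
qed

text \<open>A counterpart of \<open>tern_bag\<close>: three different branches of height
  \<open>k\<close> at one vertex would form a tree of height \<open>Suc k\<close>, so their absence
  makes the set thin.\<close>

lemma pd_light: "\<not> tern E k W \<Longrightarrow> conn E W \<Longrightarrow> W \<subseteq> V \<Longrightarrow> pd E (Suc k) {} W {}"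
proof (induction k arbitrary: W)
  case (Suc k)
  have "thin k W"
    unfolding thin_def
  proof (intro ballI impI, rule ccontr)
    fix v p q u assume v: "v \<in> W" and p: "p \<in> W - {v}" and q: "q \<in> W - {v}" and u: "u \<in> W - {v}"
      and t: "tern E k (br W v p) \<and> tern E k (br W v q) \<and> tern E k (br W v u)"
      and n: "\<not> (br W v p = br W v q \<or> br W v p = br W v u \<or> br W v q = br W v u)"
    have sub: "br W v i \<subseteq> W - {v}" for i by (rule comp_of_subset)
    have ad: "adj E {v} (br W v i)" if "i \<in> W - {v}" for i
      using br_neighbour[OF Suc.prems(2) v that] unfolding adj_def by blast
    have di: "{v} \<inter> br W v i = {}" for i using sub by blast
    have "tern E (Suc k) W"
      by (rule tern_SucI[OF Suc.prems(2) _ conn_singleton[of E v], of "br W v p" "br W v q" "br W v u"])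
        (use sub v t ad p q u di n br_disjoint in blast)+
    then show False using Suc.prems(1) by simp
  qed
  then show ?case by (intro pd_thin[OF Suc.IH]) (use Suc.prems in auto)
qed simp

end

lemma pathwidth_le:
  assumes "graph H" "pd (\<lambda>x y. {x, y} \<in> edges H) s A (verts H) B"
  shows "pathwidth H \<le> s - 1"
proof -
  obtain bs where b: "bs \<noteq> []" "\<Union> (set bs) = verts H" "\<forall>b\<in>set bs. finite b \<and> card b \<le> s"
    "\<forall>x\<in>verts H. \<forall>y\<in>verts H. {x, y} \<in> edges H \<longrightarrow> (\<exists>b\<in>set bs. x \<in> b \<and> y \<in> b)" "cvx bs"
    using assms(2) unfolding pd_def by blast
  have "\<exists>i<length bs. e \<subseteq> bs ! i" if e: "e \<in> edges H" for e
  proof -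
    obtain x y where xy: "e = {x, y}" "x \<in> verts H" "y \<in> verts H"
      using assms(1) e unfolding graph_def by (metis card_2_iff insert_subset)
    then obtain c where "c \<in> set bs" "e \<subseteq> c" using b(4) e by blast
    then show ?thesis by (metis in_set_conv_nth)
  qed
  then have "path_decomposition H bs" unfolding path_decomposition_def using b(1,2) cvx_nth[OF b(5)] by blast
  then have "pathwidth H \<le> decomposition_width bs" unfolding pathwidth_def by (intro Least_le) blast
  also have "Max (card ` set bs) \<le> s" using b(1,3) by simp
  then have "decomposition_width bs \<le> s - 1" unfolding decomposition_width_def by simp
  finally show ?thesis .
qed

section \<open>Subcubic trees\<close>

text \<open>What remains to be shown about \<open>H\<close>: every model of \<open>EK\<close> in the host graph without
  multiplicities uses a linkage of the wall.\<close>

definition obstruction :: "'a set \<Rightarrow> ('a \<Rightarrow> 'a \<Rightarrow> bool) \<Rightarrow> bool" where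
  "obstruction V EH \<longleftrightarrow> (\<exists>Q own p1 q1 p2 q2 a b c d.
     (\<forall>r>0. host V EH Q own p1 q1 p2 q2 a b c d r) \<and>
     (\<forall>r EW \<gamma>. 0 < r \<longrightarrow> symp EW \<longrightarrow> (\<forall>x y. EW x y \<longrightarrow> wall r x y) \<longrightarrow>
        model Q (contraction.EK EH own) (gam (contraction.EK EH own) a b c d r EW) \<gamma> \<longrightarrow>
        (\<forall>x\<in>Q. \<gamma> x \<subseteq> Inl ` Q \<union> range Inr) \<longrightarrow> linkage r EW))"

lemma pack_le_card:
  assumes "pack E U n" "finite U"
  shows "n \<le> card U"
proof -
  obtain f where f: "\<And>i. i < n \<Longrightarrow> tern E 6 (f i) \<and> f i \<subseteq> U" "\<And>i j. i < n \<Longrightarrow> j < n \<Longrightarrow> i \<noteq> j \<Longrightarrow> f i \<inter> f j = {}"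
    using assms(1) unfolding pack_def by metis
  have z: "(SOME z. z \<in> f i) \<in> f i" if "i < n" for i
    using f(1)[OF that] tern_conn conn_nonempty by (metis all_not_in_conv someI_ex)
  have "inj_on (\<lambda>i. SOME z. z \<in> f i) {..<n}"
  proof (rule inj_onI)
    fix i j assume ij: "i \<in> {..<n}" "j \<in> {..<n}" "(SOME z. z \<in> f i) = (SOME z. z \<in> f j)"
    then have "(SOME z. z \<in> f i) \<in> f i \<inter> f j" using z[of i] z[of j] by simp
    then show "i = j" using f(2)[of i j] ij(1,2) by auto
  qed
  moreover have "(\<lambda>i. SOME z. z \<in> f i) ` {..<n} \<subseteq> U" using z f(1) by blast
  ultimately show ?thesis using card_inj_on_le[of _ "{..<n}" U] assms(2) by simp
qed

locale cubic_tree = forest V EH for V :: "'a set" and EH :: "'a \<Rightarrow> 'a \<Rightarrow> bool" +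
  assumes irr: "\<not> EH x x" and connV: "conn EH V" and deg: "card {y. EH x y} \<le> 3"
    and branching: "\<exists>x\<in>V. 3 \<le> card {y. EH x y}"
begin

definition "Q = {x \<in> V. 3 \<le> card {y. EH x y}}"

definition own :: "'a \<Rightarrow> 'a" where
  "own w = (if w \<in> Q then w else SOME x. x \<in> Q \<and> (\<exists>w'\<in>comp_of EH (V - Q) w. EH w' x))"

lemma own_ex:
  assumes w: "w \<in> V - Q"
  shows "own w \<in> Q \<and> (\<exists>w'\<in>comp_of EH (V - Q) w. EH w' (own w))"
proof -
  let ?C = "comp_of EH (V - Q) w"
  obtain x where x: "x \<in> V" "x \<in> Q" using branching unfolding Q_def by blast
  have CV: "?C \<subseteq> V - Q" by (rule comp_of_subset)
  have wV: "w \<in> V" and xC: "x \<notin> ?C" using w x CV by auto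
  obtain p q where pq: "p \<in> V" "p \<in> ?C" "q \<in> V" "q \<notin> ?C" "EH p q"
    by (rule conn_cut[OF connV wV comp_of_self[OF w] x(1) xC])
  have "q \<in> Q" using comp_of_closed[OF symE w pq(2) _ pq(5)] pq(3,4) by blast
  then have "q \<in> Q \<and> (\<exists>w'\<in>?C. EH w' q)" using pq by blast
  then have "(SOME x. x \<in> Q \<and> (\<exists>w'\<in>?C. EH w' x)) \<in> Q \<and> (\<exists>w'\<in>?C. EH w' (SOME x. x \<in> Q \<and> (\<exists>w'\<in>?C. EH w' x)))"
    by (rule someI)
  then show ?thesis unfolding own_def using w by simp
qed

sublocale C: contraction V EH Q own
proof
  show "finite V" "symp EH" by (rule finV symE)+
  show "\<not> EH x x" for x by (rule irr)
  show "EH x y \<Longrightarrow> x \<in> V \<and> y \<in> V" for x y by (rule EV)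
  show "Q = {x \<in> V. 3 \<le> card {y. EH x y}}" by (rule Q_def)
  show "x \<in> Q \<Longrightarrow> own x = x" for x unfolding own_def by simp
  then show "x \<in> V \<Longrightarrow> own x \<in> Q" for x using own_ex[of x] by (cases "x \<in> Q") auto
  show "w \<in> V - Q \<Longrightarrow> \<exists>w'\<in>comp_of EH (V - Q) w. EH w' (own w)" for w using own_ex by blast
  fix x y assume h: "EH x y" "x \<notin> Q" "y \<notin> Q"
  then have V: "x \<in> V - Q" "y \<in> V - Q" using EV[OF h(1)] by blast+
  have "comp_of EH (V - Q) y = comp_of EH (V - Q) x"
    by (rule comp_of_eq[OF symE V(1)]) (rule comp_of_closed[OF symE V(1) comp_of_self[OF V(1)] V(2) h(1)])
  then show "own x = own y" unfolding own_def using h by simp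
qed

abbreviation "EK \<equiv> C.EK"

text \<open>Unions of fibers over connected sets are connected in \<open>H\<close>, so
  \<open>bridge\<close> still applies after the contraction.\<close>

lemma uniq_cross:
  assumes X: "conn EK X" "X \<subseteq> Q" and Y: "conn EK Y" "Y \<subseteq> Q" "X \<inter> Y = {}"
    and p: "EH p q" "own p \<in> X" "own q \<in> Y" and p': "EH p' q'" "own p' \<in> X" "own q' \<in> Y"
  shows "p = p' \<and> q = q'"
proof (rule bridge[OF _ _ _ _ _ _ _ p(1) p'(1)])
  show "conn EH (\<Union>x\<in>X. C.fiber x)" by (rule model_conn_UN[OF C.fiber_model X(2,1)])
  show "conn EH (\<Union>x\<in>Y. C.fiber x)" by (rule model_conn_UN[OF C.fiber_model Y(2,1)])
  show "(\<Union>x\<in>X. C.fiber x) \<inter> (\<Union>x\<in>Y. C.fiber x) = {}" by (rule model_UN_disj[OF C.fiber_model X(2) Y(2,3)])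
qed (use p p' EV in \<open>auto simp: C.fiber_def\<close>)

lemma uniq_edge:
  assumes X: "conn EK X" "X \<subseteq> Q" and Y: "conn EK Y" "Y \<subseteq> Q" "X \<inter> Y = {}"
    and "EK x y" "x \<in> X" "y \<in> Y" and "EK x' y'" "x' \<in> X" "y' \<in> Y"
  shows "x = x' \<and> y = y'"
proof -
  obtain p q where p: "EH p q" "own p = x" "own q = y" using assms(6) unfolding C.EK_def by blast
  obtain p' q' where p': "EH p' q'" "own p' = x'" "own q' = y'" using assms(9) unfolding C.EK_def by blast
  have "p = p' \<and> q = q'" by (rule uniq_cross[OF X Y p(1) _ _ p'(1)]) (use p p' assms in auto)
  then show ?thesis using p p' by auto
qed

lemma conn_trace: "conn EH U \<Longrightarrow> U \<subseteq> V \<Longrightarrow> U \<inter> Q \<noteq> {} \<Longrightarrow> conn EK (U \<inter> Q)"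
  using C.TH.tr_conn[of U] unfolding C.TH.tr_def by (auto simp: Int_def conj_commute)

lemma adj_trace:
  "conn EH U \<Longrightarrow> U \<subseteq> V \<Longrightarrow> U \<inter> Q \<noteq> {} \<Longrightarrow> conn EH W \<Longrightarrow> W \<subseteq> V \<Longrightarrow> W \<inter> Q \<noteq> {} \<Longrightarrow> U \<inter> W = {} \<Longrightarrow> adj EH U W \<Longrightarrow>
    adj EK (U \<inter> Q) (W \<inter> Q)"
  using C.TH.tr_adj[of U W] unfolding C.TH.tr_def by (auto simp: Int_def conj_commute)

text \<open>Three disjoint neighbouring sets give three edges out of \<open>Y\<close>, too many for
  vertices of degree at most two.\<close>

lemma branching_meets:
  assumes Y: "conn EH Y" "Y \<subseteq> V" and a: "adj EH Y Y1" "adj EH Y Y2" "adj EH Y Y3"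
    and d: "Y \<inter> Y1 = {}" "Y \<inter> Y2 = {}" "Y \<inter> Y3 = {}" "Y1 \<inter> Y2 = {}" "Y1 \<inter> Y3 = {}" "Y2 \<inter> Y3 = {}"
  shows "Y \<inter> Q \<noteq> {}"
proof
  assume n: "Y \<inter> Q = {}"
  obtain w1 x1 where 1: "w1 \<in> Y" "x1 \<in> Y1" "EH w1 x1" using a(1) unfolding adj_def by blast
  obtain w2 x2 where 2: "w2 \<in> Y" "x2 \<in> Y2" "EH w2 x2" using a(2) unfolding adj_def by blast
  obtain w3 x3 where 3: "w3 \<in> Y" "x3 \<in> Y3" "EH w3 x3" using a(3) unfolding adj_def by blast
  have "x1 \<notin> Y" "x2 \<notin> Y" "x3 \<notin> Y" "x1 \<noteq> x2" "x1 \<noteq> x3" "x2 \<noteq> x3" using 1 2 3 d by blast+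
  moreover have "Y \<subseteq> V - Q" using Y(2) n by blast
  ultimately show False using C.comp_out[OF Y(1) _ 1(1) 2(1) 3(1) _ _ _ 1(3) 2(3) 3(3)] by blast
qed

text \<open>One level is lost: the leaves of the tree may avoid \<open>Q\<close>, whereas the
  centres meet it by \<open>branching_meets\<close>.\<close>

lemma tern_trace: "tern EH (Suc k) U \<Longrightarrow> U \<subseteq> V \<Longrightarrow> tern EK k (U \<inter> Q)"
proof (induction k arbitrary: U)
  case 0
  from 0(1) show ?case
  proof (rule tern_SucE)
    fix Y0 Y1 Y2 Y3 assume Y: "conn EH U" "Y0 \<subseteq> U" "conn EH Y0" "Y0 \<inter> Y1 = {}" "Y0 \<inter> Y2 = {}" "Y0 \<inter> Y3 = {}"
      "Y1 \<inter> Y2 = {}" "Y1 \<inter> Y3 = {}" "Y2 \<inter> Y3 = {}" "adj EH Y0 Y1" "adj EH Y0 Y2" "adj EH Y0 Y3"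
    have "Y0 \<subseteq> V" using Y(2) 0(2) by blast
    then have "Y0 \<inter> Q \<noteq> {}" by (rule branching_meets[OF Y(3) _ Y(10-12) Y(4-9)])
    then have "conn EK (U \<inter> Q)" using Y(2) by (intro conn_trace[OF Y(1) 0(2)]) blast
    then show ?thesis by simp
  qed
next
  case (Suc k)
  from Suc.prems(1) show ?case
  proof (rule tern_SucE)
    fix Y0 Y1 Y2 Y3 assume Y: "conn EH U" "Y0 \<subseteq> U" "Y1 \<subseteq> U" "Y2 \<subseteq> U" "Y3 \<subseteq> U" "conn EH Y0"
      "tern EH (Suc k) Y1" "tern EH (Suc k) Y2" "tern EH (Suc k) Y3"
      "Y0 \<inter> Y1 = {}" "Y0 \<inter> Y2 = {}" "Y0 \<inter> Y3 = {}" "Y1 \<inter> Y2 = {}" "Y1 \<inter> Y3 = {}" "Y2 \<inter> Y3 = {}"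
      "adj EH Y0 Y1" "adj EH Y0 Y2" "adj EH Y0 Y3"
    have V: "Y0 \<subseteq> V" "Y1 \<subseteq> V" "Y2 \<subseteq> V" "Y3 \<subseteq> V" using Y(2-5) Suc.prems(2) by auto
    have n0: "Y0 \<inter> Q \<noteq> {}" by (rule branching_meets[OF Y(6) V(1) Y(16-18) Y(10-15)])
    note t = Suc.IH[OF Y(7) V(2)] Suc.IH[OF Y(8) V(3)] Suc.IH[OF Y(9) V(4)]
    note n = conn_nonempty[OF tern_conn[OF t(1)]] conn_nonempty[OF tern_conn[OF t(2)]] conn_nonempty[OF tern_conn[OF t(3)]]
    have "conn EK (U \<inter> Q)" using n0 Y(2) by (intro conn_trace[OF Y(1) Suc.prems(2)]) blast
    then show ?thesis
    proof (rule tern_SucI[OF _ _ conn_trace[OF Y(6) V(1) n0] t])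
      show "adj EK (Y0 \<inter> Q) (Y1 \<inter> Q)" by (rule adj_trace[OF Y(6) V(1) n0 tern_conn[OF Y(7)] V(2) n(1) Y(10) Y(16)])
      show "adj EK (Y0 \<inter> Q) (Y2 \<inter> Q)" by (rule adj_trace[OF Y(6) V(1) n0 tern_conn[OF Y(8)] V(3) n(2) Y(11) Y(17)])
      show "adj EK (Y0 \<inter> Q) (Y3 \<inter> Q)" by (rule adj_trace[OF Y(6) V(1) n0 tern_conn[OF Y(9)] V(4) n(3) Y(12) Y(18)])
    qed (use Y in blast)+
  qed
qed

lemma no_four_branches:
  assumes x: "x \<in> V" and z: "z1 \<in> V - {x}" "z2 \<in> V - {x}" "z3 \<in> V - {x}" "z4 \<in> V - {x}"
  shows "br V x z1 = br V x z2 \<or> br V x z1 = br V x z3 \<or> br V x z1 = br V x z4 \<or>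
    br V x z2 = br V x z3 \<or> br V x z2 = br V x z4 \<or> br V x z3 = br V x z4"
proof (rule ccontr)
  assume n: "\<not> ?thesis"
  note nb = br_neighbour[OF connV x]
  obtain n1 where 1: "n1 \<in> br V x z1" "EH x n1" using nb[OF z(1)] by blast
  obtain n2 where 2: "n2 \<in> br V x z2" "EH x n2" using nb[OF z(2)] by blast
  obtain n3 where 3: "n3 \<in> br V x z3" "EH x n3" using nb[OF z(3)] by blast
  obtain n4 where 4: "n4 \<in> br V x z4" "EH x n4" using nb[OF z(4)] by blast
  have d: "u \<noteq> v" if "br V x i \<noteq> br V x j" "i \<in> V - {x}" "j \<in> V - {x}" "u \<in> br V x i" "v \<in> br V x j" for i j u v
    using br_disjoint[OF that(2,3,1)] that(4,5) by blast
  have "n1 \<noteq> n2" "n1 \<noteq> n3" "n1 \<noteq> n4" "n2 \<noteq> n3" "n2 \<noteq> n4" "n3 \<noteq> n4"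
    using d[OF _ z(1,2) 1(1) 2(1)] d[OF _ z(1,3) 1(1) 3(1)] d[OF _ z(1,4) 1(1) 4(1)]
      d[OF _ z(2,3) 2(1) 3(1)] d[OF _ z(2,4) 2(1) 4(1)] d[OF _ z(3,4) 3(1) 4(1)] n by blast+
  then have "card {n1, n2, n3, n4} = 4" by simp
  moreover have "card {n1, n2, n3, n4} \<le> card {y. EH x y}" using C.finN 1 2 3 4 by (intro card_mono) auto
  ultimately show False using deg[of x] by simp
qed

text \<open>The branches at \<open>h\<close> survive the contraction: the traces of a branch and of
  its complement are connected, so by \<open>uniq_edge\<close> they are joined by one edge
  only.\<close>

lemma branch_trace:
  assumes h: "h \<in> Q" and z: "z \<in> V - {h}" and ne: "br V h z \<inter> Q \<noteq> {}"
  shows "conn EK (br V h z \<inter> Q)" "conn EK (Q - br V h z \<inter> Q)"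
    "\<exists>b\<in>br V h z \<inter> Q. EK b h \<and> (\<forall>x\<in>br V h z \<inter> Q. \<forall>y. y \<notin> br V h z \<inter> Q \<longrightarrow> EK x y \<longrightarrow> x = b \<and> y = h)"
proof -
  let ?B = "br V h z"
  have hV: "h \<in> V" using h C.QV by blast
  have BV: "br V h u \<subseteq> V - {h}" for u by (rule comp_of_subset)
  have hB: "h \<notin> br V h u" for u using BV by blast
  show c1: "conn EK (?B \<inter> Q)" by (rule conn_trace[OF conn_br[OF z] _ ne]) (use BV in blast)
  have ins: "conn EH (insert h (br V h u))" if u: "u \<in> V - {h}" for u
  proof -
    obtain n where "n \<in> br V h u" "EH h n" using br_neighbour[OF connV hV u] by blast
    then show ?thesis by (intro conn_insert[OF symE conn_br[OF u]]) auto
  qed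
  have "conn EH (V - ?B)"
  proof (rule conn_star[OF symE, of h])
    fix w assume w: "w \<in> V - ?B"
    show "\<exists>D\<subseteq>V - ?B. conn EH D \<and> h \<in> D \<and> w \<in> D"
    proof (cases "w = h")
      case True
      then show ?thesis using w by (intro exI[of _ "{h}"]) auto
    next
      case False
      then have w': "w \<in> V - {h}" using w by blast
      have ws: "w \<in> br V h w" by (rule comp_of_self[OF w'])
      then have "br V h w \<noteq> ?B" using w by auto
      then have "br V h w \<inter> ?B = {}" by (rule br_disjoint[OF w' z])
      then show ?thesis using ins[OF w'] ws hB hV BV[of w] by (intro exI[of _ "insert h (br V h w)"]) blast
    qed
  qed (use hV hB in blast)
  then have "conn EK ((V - ?B) \<inter> Q)" by (rule conn_trace) (use h hV hB in auto)
  moreover have "(V - ?B) \<inter> Q = Q - ?B \<inter> Q" using C.QV by blast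
  ultimately show c2: "conn EK (Q - ?B \<inter> Q)" by simp
  obtain s where s: "s \<in> ?B \<inter> Q" using ne by blast
  have "conn EK (insert h ?B \<inter> Q)" by (rule conn_trace[OF ins[OF z]]) (use h hV BV in auto)
  then obtain b y where b: "b \<in> insert h ?B \<inter> Q" "b \<in> ?B \<inter> Q" "y \<in> insert h ?B \<inter> Q" "y \<notin> ?B \<inter> Q" "EK b y"
    using conn_cut[of EK "insert h ?B \<inter> Q" s "?B \<inter> Q" h] s h hB by (metis Int_iff insertCI)
  have yh: "y = h" using b(3,4) by blast
  have "x = b \<and> y = h" if "x \<in> ?B \<inter> Q" "y \<notin> ?B \<inter> Q" "EK x y" for x y
    by (rule uniq_edge[OF c1 _ c2 _ _ that(3,1) _ b(5)[unfolded yh] b(2)]) (use that C.EK_Q h hB in blast)+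
  then show "\<exists>b\<in>?B \<inter> Q. EK b h \<and> (\<forall>x\<in>?B \<inter> Q. \<forall>y. y \<notin> ?B \<inter> Q \<longrightarrow> EK x y \<longrightarrow> x = b \<and> y = h)"
    using b(2,5) yh by blast
qed

text \<open>A minimal connected part with connected complement that packs two ternary trees does not
  pack four, since it splits into at most two such parts when its end vertex is removed.\<close>

lemma light_part:
  assumes R: "R \<subseteq> Q" "conn EK R" "conn EK (Q - R)" "pack EK R 5"
  obtains T c d where "T \<subseteq> R" "d \<in> T" "c \<in> R - T" "EK c d" "pack EK T 2" "\<not> pack EK T 4"
    "\<And>x y. x \<in> T \<Longrightarrow> y \<notin> T \<Longrightarrow> EK x y \<Longrightarrow> x = d \<and> y = c"
proof -
  have finQ: "finite Q" using finV C.QV by (rule finite_subset[rotated])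
  let ?P = "\<lambda>T. T \<subseteq> R \<and> conn EK T \<and> conn EK (Q - T) \<and> pack EK T 2"
  have "?P R" using R pack_mono[OF R(4) subset_refl, of 2] by simp
  then obtain T where T: "?P T" and min: "\<And>S. ?P S \<Longrightarrow> card T \<le> card S"
    using ex_has_least_nat[of ?P R card] by blast
  have TQ: "T \<subseteq> Q" using T R(1) by blast
  obtain t where t: "t \<in> T" using T conn_nonempty by blast
  obtain u where u: "u \<in> Q" "u \<notin> T" using T conn_nonempty[of EK "Q - T"] by blast
  have connQ: "conn EK Q" using conn_trace[OF connV subset_refl] t TQ C.QV by (metis Int_absorb1 empty_iff subset_empty)
  obtain d c where dc: "d \<in> Q" "d \<in> T" "c \<in> Q" "c \<notin> T" "EK d c"
    by (rule conn_cut[OF connQ _ t u(1,2)]) (use t TQ in auto)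
  have out: "x = d \<and> y = c" if "x \<in> T" "y \<notin> T" "EK x y" for x y
    by (rule uniq_edge[of T "Q - T", OF _ _ _ _ _ that(3,1) _ dc(5,2)]) (use T TQ that dc C.EK_Q in blast)+
  have no4: "\<not> pack EK T 4"
  proof
    assume "pack EK T 4"
    then have "pack EK (T - {d}) 3" using pack_remove[of EK T 3 d] by simp
    then obtain f :: "nat \<Rightarrow> 'a set" where
      f: "\<And>i. i < 3 \<Longrightarrow> tern EK 6 (f i) \<and> f i \<subseteq> T - {d}" "\<And>i j. i < 3 \<Longrightarrow> j < 3 \<Longrightarrow> i \<noteq> j \<Longrightarrow> f i \<inter> f j = {}"
      unfolding pack_def by metis
    have dQ: "d \<in> Q" by (rule dc(1))
    have dV: "d \<in> V" using dQ C.QV by blast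
    have inbr: "F \<subseteq> br V d z" if "conn EK F" "F \<subseteq> Q - {d}" "z \<in> F" for F z
    proof -
      have z: "z \<in> V - {d}" using that C.QV by blast
      have zb: "z \<in> br V d z" by (rule comp_of_self[OF z])
      then have "br V d z \<inter> Q \<noteq> {}" using that by blast
      then obtain b where b: "\<And>x y. x \<in> br V d z \<inter> Q \<Longrightarrow> y \<notin> br V d z \<inter> Q \<Longrightarrow> EK x y \<Longrightarrow> x = b \<and> y = d"
        using branch_trace(3)[OF dQ z] by metis
      have "F \<subseteq> br V d z \<inter> Q"
      proof (rule conn_subset_of[OF that(1,3)])
        show "z \<in> br V d z \<inter> Q" using zb that by blast
        fix p q assume pq: "p \<in> F" "p \<in> br V d z \<inter> Q" "q \<in> F" "EK p q"
        show "q \<in> br V d z \<inter> Q"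
        proof (rule ccontr)
          assume "q \<notin> br V d z \<inter> Q"
          then have "q = d" using b[OF pq(2) _ pq(4)] by blast
          then show False using pq(3) that(2) by blast
        qed
      qed
      then show ?thesis by blast
    qed
    have c: "c \<in> V - {d}" using dc C.QV by blast
    \<comment> \<open>The branch of \<open>c\<close> at \<open>d\<close> contains
      \<open>Q - T\<close> and avoids \<open>T\<close>. As \<open>d\<close> has degree at most
      three, two branches remain for three trees, and the one that contains two of them would be a
      smaller choice than \<open>T\<close>.\<close>
    have QT: "Q - T \<subseteq> br V d c" by (rule inbr) (use T dc in blast)+
    have brc: "br V d c \<inter> T = {}"
    proof (rule ccontr)
      assume ne: "br V d c \<inter> T \<noteq> {}"
      then obtain s where s: "s \<in> T" "s \<in> br V d c" by blast
      have "br V d c \<inter> Q \<noteq> {}" using s TQ by blast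
      then obtain b where b: "\<And>x y. x \<in> br V d c \<inter> Q \<Longrightarrow> y \<notin> br V d c \<inter> Q \<Longrightarrow> EK x y \<Longrightarrow> x = b \<and> y = d"
        using branch_trace(3)[OF dQ c] by metis
      have db: "d \<notin> br V d c" using comp_of_subset[of EH "V - {d}" c] by blast
      obtain x y where xy: "x \<in> T" "x \<in> br V d c" "y \<in> T" "y \<notin> br V d c" "EK x y"
        by (rule conn_cut[of EK T s "br V d c" d]) (use T s dc db in auto)
      have "x = b" using b[of x y] xy TQ by blast
      moreover have "EK c d" using dc(5) C.symK by (auto dest: sympD)
      then have "c = b" using b[of c d] db dc(3) comp_of_self[OF c] by blast
      ultimately show False using xy(1) dc(4) by blast
    qed
    have "\<exists>z. z \<in> f i" if "i < 3" for i using f(1)[OF that] tern_conn conn_nonempty by blast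
    then obtain z where z: "\<And>i. i < 3 \<Longrightarrow> z i \<in> f i" by metis
    have zV: "z i \<in> V - {d}" if "i < 3" for i using z[OF that] f(1)[OF that] TQ C.QV by blast
    have fbr: "f i \<subseteq> br V d (z i)" if "i < 3" for i
      using inbr[OF tern_conn _ z[OF that]] f(1)[OF that] TQ by blast
    have nc: "br V d (z i) \<noteq> br V d c" if "i < 3" for i
      using brc z[OF that] f(1)[OF that] comp_of_self[OF zV[OF that], of EH] by blast
    have one: False if ij: "i < 3" "j < 3" "i \<noteq> j" "br V d (z i) = br V d (z j)" for i j
    proof -
      let ?S = "br V d (z i) \<inter> Q"
      have zi: "z i \<in> ?S" using comp_of_self[OF zV[OF ij(1)], of EH] z[OF ij(1)] f(1)[OF ij(1)] TQ by blast
      have ne: "?S \<noteq> {}" using zi by blast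
      have ST: "?S \<subseteq> T" using QT br_disjoint[OF zV[OF ij(1)] c nc[OF ij(1)]] by blast
      have "d \<notin> ?S" using comp_of_subset[of EH "V - {d}" "z i"] by blast
      then have "?S \<subset> T" using ST dc(2) by blast
      then have "card ?S < card T" using finite_subset[OF TQ finQ] by (rule psubset_card_mono[rotated])
      moreover have "pack EK ?S 2"
        unfolding pack_def
      proof (rule exI[of _ "\<lambda>k. if k = 0 then f i else f j"], intro conjI allI impI)
        fix k :: nat assume "k < 2"
        have "f i \<subseteq> ?S" "f j \<subseteq> ?S" using fbr[OF ij(1)] fbr[OF ij(2)] ij(4) f(1)[OF ij(1)] f(1)[OF ij(2)] TQ by blast+
        then show "tern EK 6 (if k = 0 then f i else f j)" "(if k = 0 then f i else f j) \<subseteq> ?S"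
          using f(1)[OF ij(1)] f(1)[OF ij(2)] by auto
      next
        fix k l :: nat assume kl: "k < 2" "l < 2" "k \<noteq> l"
        have "f i \<inter> f j = {}" "f j \<inter> f i = {}" using f(2)[OF ij(1-3)] by blast+
        then show "(if k = 0 then f i else f j) \<inter> (if l = 0 then f i else f j) = {}" using kl by auto
      qed
      ultimately show False
        using min[of ?S] branch_trace(1,2)[OF dQ zV[OF ij(1)] ne] ST T by auto
    qed
    have "br V d (z 0) = br V d (z 1) \<or> br V d (z 0) = br V d (z 2) \<or> br V d (z 1) = br V d (z 2)"
      using no_four_branches[OF dV zV[of 0] zV[of 1] zV[of 2] c] nc[of 0] nc[of 1] nc[of 2] by simp
    moreover have "br V d (z 0) \<noteq> br V d (z 1)" by (rule notI, rule one[of 0 1]) simp_all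
    moreover have "br V d (z 0) \<noteq> br V d (z 2)" by (rule notI, rule one[of 0 2]) simp_all
    moreover have "br V d (z 1) \<noteq> br V d (z 2)" by (rule notI, rule one[of 1 2]) simp_all
    ultimately show False by blast
  qed
  have "T \<noteq> R" using no4 pack_mono[OF R(4) subset_refl, of 4] by auto
  then obtain s where s: "s \<in> R" "s \<notin> T" using T by blast
  obtain x y where xy: "x \<in> R" "x \<in> T" "y \<in> R" "y \<notin> T" "EK x y"
    by (rule conn_cut[OF R(2) _ t s]) (use t T in blast)
  have "c \<in> R - T" using out[OF xy(2,4,5)] xy by blast
  moreover have "EK c d" using dc(5) C.symK by (auto dest: sympD)
  ultimately show ?thesis using that[of T d c] T dc(2) no4 out by blast
qed

text \<open>The rerouted edges come from the edge of \<open>EK\<close> that joins \<open>h\<close>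
  to the first branch and from the edge \<open>c d\<close> that cuts the light part off the third
  one. The third branch must be the one whose packing number is exactly \<open>m\<close>.\<close>

lemma obstruction_aux:
  assumes h: "h \<in> Q" and p: "p1 \<in> V - {h}" "p2 \<in> V - {h}" "p3 \<in> V - {h}"
    and ne: "br V h p1 \<noteq> br V h p2" "br V h p1 \<noteq> br V h p3" "br V h p2 \<noteq> br V h p3"
    and m: "pack EK (br V h p1 \<inter> Q) m" "pack EK (br V h p2 \<inter> Q) m" "pack EK (br V h p3 \<inter> Q) m"
      "\<not> pack EK (br V h p3 \<inter> Q) (Suc m)" "5 \<le> m"
  shows "obstruction V EH"
proof -
  define R1 where "R1 = br V h p1 \<inter> Q"
  define R2 where "R2 = br V h p2 \<inter> Q"
  define R3 where "R3 = br V h p3 \<inter> Q"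
  have hV: "h \<in> V" using h C.QV by blast
  have finQ: "finite Q" using finV C.QV by (rule finite_subset[rotated])
  note m = m[folded R1_def R2_def R3_def]
  have R_ne: "R1 \<noteq> {}" "R2 \<noteq> {}" "R3 \<noteq> {}"
  proof -
    have "U \<noteq> {}" if "pack EK U m" for U
    proof -
      obtain f where f: "\<And>i. i < m \<Longrightarrow> tern EK 6 (f i) \<and> f i \<subseteq> U" using \<open>pack EK U m\<close> unfolding pack_def by metis
      have "0 < m" using m(5) by simp
      then show ?thesis using f[of 0] tern_conn conn_nonempty by blast
    qed
    then show "R1 \<noteq> {}" "R2 \<noteq> {}" "R3 \<noteq> {}" using m by blast+
  qed
  note b1 = branch_trace[OF h p(1) R_ne(1)[unfolded R1_def], folded R1_def]
  note b2 = branch_trace[OF h p(2) R_ne(2)[unfolded R2_def], folded R2_def]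
  note b3 = branch_trace[OF h p(3) R_ne(3)[unfolded R3_def], folded R3_def]
  have RQ: "R1 \<subseteq> Q" "R2 \<subseteq> Q" "R3 \<subseteq> Q" unfolding R1_def R2_def R3_def by blast+
  have hR: "h \<notin> R1" "h \<notin> R2" "h \<notin> R3" unfolding R1_def R2_def R3_def using comp_of_subset[of EH "V - {h}"] by blast+
  have dis: "R1 \<inter> R2 = {}" "R1 \<inter> R3 = {}" "R2 \<inter> R3 = {}" unfolding R1_def R2_def R3_def
    using br_disjoint[OF p(1,2) ne(1)] br_disjoint[OF p(1,3) ne(2)] br_disjoint[OF p(2,3) ne(3)] by blast+
  have cover: "Q = {h} \<union> R1 \<union> R2 \<union> R3"
  proof -
    have "x \<in> {h} \<union> R1 \<union> R2 \<union> R3" if x: "x \<in> Q" for x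
    proof (cases "x = h")
      case False
      then have x': "x \<in> V - {h}" using x C.QV by blast
      have "br V h x = br V h p1 \<or> br V h x = br V h p2 \<or> br V h x = br V h p3"
        using no_four_branches[OF hV p x'] ne by metis
      then show ?thesis unfolding R1_def R2_def R3_def using comp_of_self[OF x', of EH] x by blast
    qed simp
    then show ?thesis using RQ h by blast
  qed
  obtain b where b: "b \<in> R1" "EK b h" "\<And>x y. x \<in> R1 \<Longrightarrow> y \<notin> R1 \<Longrightarrow> EK x y \<Longrightarrow> x = b \<and> y = h" using b1(3) by metis
  obtain b' where b': "b' \<in> R2" "EK b' h" "\<And>x y. x \<in> R2 \<Longrightarrow> y \<notin> R2 \<Longrightarrow> EK x y \<Longrightarrow> x = b' \<and> y = h" using b2(3) by metis
  have out3: "\<And>x y. x \<in> R3 \<Longrightarrow> y \<notin> R3 \<Longrightarrow> EK x y \<Longrightarrow> y = h" using b3(3) by metis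
  have "pack EK R3 5" by (rule pack_mono[OF m(3) subset_refl m(5)])
  from RQ(3) b3(1,2) this obtain T c d where T: "T \<subseteq> R3" "d \<in> T" "c \<in> R3 - T" "EK c d" "pack EK T 2" "\<not> pack EK T 4"
    "\<And>x y. x \<in> T \<Longrightarrow> y \<notin> T \<Longrightarrow> EK x y \<Longrightarrow> x = d \<and> y = c"
    by (rule light_part) (rule that; assumption?)
  have "EK h b" using b(2) C.symK by (auto dest: sympD)
  then obtain x1 y1 where e1: "EH x1 y1" "own x1 = h" "own y1 = b" unfolding C.EK_def by blast
  obtain x2 y2 where e2: "EH x2 y2" "own x2 = c" "own y2 = d" using T(4) unfolding C.EK_def by blast
  have Qm: "b \<in> Q" "c \<in> Q" "d \<in> Q" using b(1) T(1-3) RQ by blast+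
  have dist: "h \<noteq> b" "h \<noteq> c" "h \<noteq> d" "b \<noteq> c" "b \<noteq> d" "c \<noteq> d" using b(1) T(1-3) hR dis by blast+
  have host: "host V EH Q own x1 y1 x2 y2 h b c d r" if "0 < r" for r
  proof (intro host.intro C.contraction_axioms host_axioms.intro)
    show "p = x1 \<and> q = y1" if "EH p q" "own p = h" "own q = b" for p q
      by (rule uniq_cross[of "{h}" "{b}", OF _ _ _ _ _ that(1) _ _ e1(1)]) (use that e1 h Qm dist in auto)
    show "p = x2 \<and> q = y2" if "EH p q" "own p = c" "own q = d" for p q
      by (rule uniq_cross[of "{c}" "{d}", OF _ _ _ _ _ that(1) _ _ e2(1)]) (use that e2 h Qm dist in auto)
  qed (use e1 e2 dist that in auto)
  have link: "linkage r EW"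
    if r: "0 < r" and EW: "symp EW" "\<And>x y. EW x y \<Longrightarrow> wall r x y" and g: "model Q EK (gam EK h b c d r EW) \<gamma>"
      and sub: "\<And>x. x \<in> Q \<Longrightarrow> \<gamma> x \<subseteq> Inl ` Q \<union> range Inr" for r EW \<gamma>
  proof (rule tree_linkage[where R=EK and V=Q and v=h and ?R1.0=R1 and ?R2.0=R2 and ?R3.0=R3 and b=b and ?b2.0=b' and T=T
        and c=c and d=d and m=m and \<gamma>=\<gamma>])
    show "symp EK" "symp EW" "0 < r" "finite Q" by (rule C.symK EW(1) r finQ)+
    show "EW x y \<Longrightarrow> wall r x y" for x y by (rule EW(2))
    show "EK x y \<Longrightarrow> x \<in> Q \<and> y \<in> Q" for x y by (rule C.EK_Q)
    show "Q = {h} \<union> R1 \<union> R2 \<union> R3" by (rule cover)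
    show "h \<notin> R1 \<union> R2 \<union> R3" using hR by blast
    show "R1 \<inter> R2 = {}" "R1 \<inter> R3 = {}" "R2 \<inter> R3 = {}" by (rule dis)+
    show "b \<in> R1" "EK b h" "b' \<in> R2" "EK b' h" by (rule b b')+
    show "x = b \<and> y = h" if "x \<in> R1" "y \<notin> R1" "EK x y" for x y by (rule b(3)[OF that])
    show "x = b' \<and> y = h" if "x \<in> R2" "y \<notin> R2" "EK x y" for x y by (rule b'(3)[OF that])
    show "y = h" if "x \<in> R3" "y \<notin> R3" "EK x y" for x y by (rule out3[OF that])
    show "T \<subseteq> R3" "d \<in> T" "c \<in> R3 - T" by (rule T)+
    show "x = d \<and> y = c" if "x \<in> T" "y \<notin> T" "EK x y" for x y by (rule T(7)[OF that])
    show "conn EK R1" "conn EK R2" "conn EK R3" "conn EK (Q - R1)" "conn EK (Q - R2)" "conn EK (Q - R3)"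
      by (rule b1(1,2) b2(1,2) b3(1,2))+
    show "pack EK R1 m" "pack EK R2 m" "pack EK R3 m" "\<not> pack EK R3 (Suc m)" "5 \<le> m" by (rule m)+
    show "pack EK T 2" "\<not> pack EK T 4" by (rule T)+
    show "model Q EK (gam EK h b c d r EW) \<gamma>" by (rule g)
    show "\<gamma> x \<subseteq> Inl ` Q \<union> range Inr" if "x \<in> Q" for x by (rule sub[OF that])
  qed
  show ?thesis unfolding obstruction_def
    by (rule exI[of _ Q], rule exI[of _ own], rule exI[of _ x1], rule exI[of _ y1], rule exI[of _ x2], rule exI[of _ y2],
        rule exI[of _ h], rule exI[of _ b], rule exI[of _ c], rule exI[of _ d]) (use host link in blast)
qed

text \<open>Take a number \<open>m\<close> that all three branches can pack although not all of them
  can pack \<open>m + 1\<close>. A branch that fails takes the role of the third one. Nine disjoint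
  trees in each branch allow \<open>m \<ge> 9\<close>.\<close>

lemma obstruction_tree:
  assumes h: "h \<in> V" and p: "p1 \<in> V - {h}" "p2 \<in> V - {h}" "p3 \<in> V - {h}"
    and ne: "br V h p1 \<noteq> br V h p2" "br V h p1 \<noteq> br V h p3" "br V h p2 \<noteq> br V h p3"
    and t: "tern EH 9 (br V h p1)" "tern EH 9 (br V h p2)" "tern EH 9 (br V h p3)" and hQ: "h \<in> Q"
  shows "obstruction V EH"
proof -
  have finQ: "finite Q" using finV C.QV by (rule finite_subset[rotated])
  let ?P = "\<lambda>m. pack EK (br V h p1 \<inter> Q) m \<and> pack EK (br V h p2 \<inter> Q) m \<and> pack EK (br V h p3 \<inter> Q) m"
  have "pack EK (br V h i \<inter> Q) 9" if "tern EH 9 (br V h i)" for i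
  proof -
    have "br V h i \<subseteq> V" using comp_of_subset[of EH "V - {h}" i] by blast
    moreover have "tern EH (Suc 8) (br V h i)" using that by simp
    ultimately have "tern EK 8 (br V h i \<inter> Q)" by (intro tern_trace)
    then show ?thesis by (rule pack_tern8)
  qed
  then have 9: "?P 9" using t by blast
  have "\<exists>m\<ge>9. ?P m \<and> \<not> ?P (Suc m)"
  proof (rule ccontr)
    assume n: "\<not> ?thesis"
    have "?P (9 + k)" for k
    proof (induction k)
      case (Suc k)
      then show ?case using n by (metis add_Suc_right le_add1)
    qed (use 9 in simp)
    then have "pack EK (br V h p1 \<inter> Q) (9 + card Q)" by blast
    then have "9 + card Q \<le> card (br V h p1 \<inter> Q)" by (rule pack_le_card) (use finQ in simp)
    moreover have "card (br V h p1 \<inter> Q) \<le> card Q" using finQ by (intro card_mono) auto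
    ultimately show False by simp
  qed
  then obtain m where m: "9 \<le> m" "?P m" "\<not> ?P (Suc m)" by blast
  have 5: "5 \<le> m" using m(1) by simp
  consider "\<not> pack EK (br V h p3 \<inter> Q) (Suc m)" | "\<not> pack EK (br V h p2 \<inter> Q) (Suc m)" | "\<not> pack EK (br V h p1 \<inter> Q) (Suc m)"
    using m(3) by blast
  then show ?thesis
  proof cases
    case 1
    show ?thesis by (rule obstruction_aux[OF hQ p ne _ _ _ 1 5]) (use m(2) in blast)+
  next
    case 2
    show ?thesis by (rule obstruction_aux[OF hQ p(1,3,2) ne(2,1) ne(3)[symmetric] _ _ _ 2 5]) (use m(2) in blast)+
  next
    case 3
    show ?thesis by (rule obstruction_aux[OF hQ p(2,3,1) ne(3) ne(1,2)[symmetric] _ _ _ 3 5]) (use m(2) in blast)+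
  qed
qed

end

lemma (in forest) three_neighbours:
  assumes V: "conn E V" "h \<in> V" and p: "p1 \<in> V - {h}" "p2 \<in> V - {h}" "p3 \<in> V - {h}"
    and ne: "br V h p1 \<noteq> br V h p2" "br V h p1 \<noteq> br V h p3" "br V h p2 \<noteq> br V h p3"
  shows "3 \<le> card {y. E h y}"
proof -
  obtain n1 where 1: "n1 \<in> br V h p1" "E h n1" using br_neighbour[OF V p(1)] by blast
  obtain n2 where 2: "n2 \<in> br V h p2" "E h n2" using br_neighbour[OF V p(2)] by blast
  obtain n3 where 3: "n3 \<in> br V h p3" "E h n3" using br_neighbour[OF V p(3)] by blast
  have "n1 \<noteq> n2" "n1 \<noteq> n3" "n2 \<noteq> n3"
    using br_disjoint[OF p(1,2) ne(1)] br_disjoint[OF p(1,3) ne(2)] br_disjoint[OF p(2,3) ne(3)] 1(1) 2(1) 3(1) by blast+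
  then have "card {n1, n2, n3} = 3" by simp
  moreover have "finite {y. E h y}" by (rule finite_subset[OF _ finV]) (use EV in blast)
  then have "card {n1, n2, n3} \<le> card {y. E h y}" using 1 2 3 by (intro card_mono) auto
  ultimately show ?thesis by simp
qed

lemma simple_path:
  assumes "conn E U" "x \<in> U" "y \<in> U"
  shows "\<exists>xs. xs \<noteq> [] \<and> hd xs = x \<and> last xs = y \<and> set xs \<subseteq> U \<and> distinct xs \<and> successively E xs"
proof -
  let ?W = "{w. \<exists>xs. xs \<noteq> [] \<and> hd xs = x \<and> last xs = w \<and> set xs \<subseteq> U \<and> distinct xs \<and> successively E xs}"
  have "U \<subseteq> ?W"
  proof (rule conn_subset_of[OF assms(1,2)])
    show "x \<in> ?W" using assms(2) by (intro CollectI exI[of _ "[x]"]) simp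
    fix p q assume "p \<in> U" "p \<in> ?W" and q: "q \<in> U" "E p q"
    then obtain xs where xs: "xs \<noteq> []" "hd xs = x" "last xs = p" "set xs \<subseteq> U" "distinct xs" "successively E xs" by blast
    show "q \<in> ?W"
    proof (cases "q \<in> set xs")
      case False
      then show ?thesis using xs q by (intro CollectI exI[of _ "xs @ [q]"]) (simp add: successively_append_iff)
    next
      case True
      then obtain ys zs where yz: "xs = ys @ q # zs" by (meson split_list)
      have "successively E (ys @ [q])" using xs(6) unfolding yz by (auto simp: successively_append_iff)
      moreover have "hd (ys @ [q]) = x" using xs(2) unfolding yz by (cases ys) auto
      ultimately show ?thesis using xs(4,5) unfolding yz by (intro CollectI exI[of _ "ys @ [q]"]) simp
    qed
  qed
  then show ?thesis using assms(3) by blast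
qed

text \<open>Two different edges between \<open>A\<close> and \<open>B\<close> close up with a simple
  path in each set to a cycle. If both paths had only one vertex, the edges would be equal; so the
  cycle has at least three vertices.\<close>

lemma acyclic_bridge:
  fixes H :: "'a ugraph"
  defines "E \<equiv> \<lambda>x y. {x, y} \<in> edges H"
  assumes no: "\<nexists>c. is_cycle H c" and c: "conn E A" "conn E B" "A \<inter> B = {}"
    and x: "x \<in> A" "x' \<in> A" "y \<in> B" "y' \<in> B" "E x y" "E x' y'"
  shows "x = x' \<and> y = y'"
proof (rule ccontr)
  assume n: "\<not> ?thesis"
  obtain xs where xs: "xs \<noteq> []" "hd xs = x" "last xs = x'" "set xs \<subseteq> A" "distinct xs" "successively E xs"
    using simple_path[OF c(1) x(1,2)] by blast
  obtain ys where ys: "ys \<noteq> []" "hd ys = y'" "last ys = y" "set ys \<subseteq> B" "distinct ys" "successively E ys"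
    using simple_path[OF c(2) x(4,3)] by blast
  let ?c = "xs @ ys"
  have len: "3 \<le> length ?c"
  proof (rule ccontr)
    assume "\<not> 3 \<le> length ?c"
    moreover have "0 < length xs" "0 < length ys" using xs(1) ys(1) by auto
    ultimately have "length xs = 1" "length ys = 1" unfolding length_append by linarith+
    then show False using n xs(2,3) ys(2,3) by (auto simp: length_Suc_conv)
  qed
  have suc: "successively E ?c" using xs ys x(6) by (simp add: successively_append_iff)
  have "{?c ! i, ?c ! (Suc i mod length ?c)} \<in> edges H" if i: "i < length ?c" for i
  proof (cases "Suc i < length ?c")
    case True
    then have "E (?c ! i) (?c ! Suc i)" using suc by (simp only: successively_conv_nth)
    then show ?thesis using True unfolding E_def by simp
  next
    case False
    then have i': "Suc i = length ?c" using i by simp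
    then have "?c ! i = last ?c" using last_conv_nth[of ?c] xs(1) by (metis append_is_Nil_conv diff_Suc_1)
    moreover have "Suc i mod length ?c = 0" using i' by simp
    moreover have "?c ! 0 = hd ?c" using hd_conv_nth[of ?c] xs(1) by simp
    ultimately show ?thesis using x(5) xs(1,2) ys(1,3) unfolding E_def by (simp add: insert_commute)
  qed
  moreover have "distinct ?c" using xs ys c(3) by auto
  ultimately have "is_cycle H ?c" unfolding is_cycle_def using len by blast
  then show False using no by blast
qed

lemma connected_graph_iff:
  assumes "graph G"
  shows "connected_graph G \<longleftrightarrow> conn (\<lambda>x y. {x, y} \<in> edges G) (verts G)"
proof
  let ?E = "\<lambda>x y. {x, y} \<in> edges G"
  assume c: "connected_graph G"
  show "conn ?E (verts G)"
  proof (rule connI)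
    show "verts G \<noteq> {}" using c unfolding connected_graph_def by blast
    fix P x y assume h: "x \<in> verts G" "x \<in> P" "y \<in> verts G" "y \<notin> P"
    have "(x, y) \<in> {(x, y). {x, y} \<in> edges G}\<^sup>*" using c h unfolding connected_graph_def by blast
    then have "y \<notin> P \<longrightarrow> (\<exists>p\<in>P. \<exists>q. q \<notin> P \<and> ?E p q)"
      by (induction rule: rtrancl_induct) (use h in auto)
    then obtain p q where pq: "p \<in> P" "q \<notin> P" "?E p q" using h by blast
    then have "p \<in> verts G" "q \<in> verts G" using assms unfolding graph_def by blast+
    then show "\<exists>p\<in>verts G \<inter> P. \<exists>q\<in>verts G - P. ?E p q" using pq by blast
  qed
next
  let ?E = "\<lambda>x y. {x, y} \<in> edges G"
  assume c: "conn ?E (verts G)"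
  have "(u, v) \<in> {(x, y). {x, y} \<in> edges G}\<^sup>*" if uv: "u \<in> verts G" "v \<in> verts G" for u v
  proof -
    have "verts G \<subseteq> {w. (u, w) \<in> {(x, y). {x, y} \<in> edges G}\<^sup>*}"
      by (rule conn_subset_of[OF c uv(1)]) (auto intro: rtrancl_into_rtrancl)
    then show ?thesis using uv by blast
  qed
  then show "connected_graph G" unfolding connected_graph_def using conn_nonempty[OF c] by blast
qed

text \<open>If no vertex had three branches of height nine, bags of size 10 for the light parts and
  one more vertex per bag would give bags of size 11, hence pathwidth at most 10.\<close>

lemma tree_obstruction:
  assumes g: "graph H" and t: "tree H" "subcubic H" and pw: "19 \<le> pathwidth H"
  shows "obstruction (verts H) (\<lambda>x y. {x, y} \<in> edges H)"
proof -
  let ?E = "\<lambda>x y. {x, y} \<in> edges H" and ?V = "verts H"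
  have EV: "x \<in> ?V \<and> y \<in> ?V" "x \<noteq> y" if "{x, y} \<in> edges H" for x y
    using g that unfolding graph_def by force+
  interpret F: forest ?V ?E
  proof
    show "finite ?V" using g unfolding graph_def by blast
    show "symp ?E" by (rule sympI) (simp add: insert_commute)
    show "{x, y} \<in> edges H \<Longrightarrow> x \<in> ?V \<and> y \<in> ?V" for x y using EV by blast
  qed (rule acyclic_bridge, use t(1) in \<open>simp_all add: tree_def\<close>)
  have cV: "conn ?E ?V" using t(1) connected_graph_iff[OF g] unfolding tree_def by blast
  have "\<not> F.thin 9 ?V"
  proof
    assume "F.thin 9 ?V"
    then have "pd ?E (Suc 10) {} ?V {}"
      by (intro F.pd_thin[of 9 10]) (use F.pd_light[of 9] cV in auto)
    then have "pathwidth H \<le> 10" using pathwidth_le[OF g] by fastforce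
    then show False using pw by simp
  qed
  then obtain h p1 p2 p3 where h: "h \<in> ?V" and p: "p1 \<in> ?V - {h}" "p2 \<in> ?V - {h}" "p3 \<in> ?V - {h}"
    and tn: "tern ?E 9 (F.br ?V h p1)" "tern ?E 9 (F.br ?V h p2)" "tern ?E 9 (F.br ?V h p3)"
    and ne: "F.br ?V h p1 \<noteq> F.br ?V h p2" "F.br ?V h p1 \<noteq> F.br ?V h p3" "F.br ?V h p2 \<noteq> F.br ?V h p3"
    unfolding F.thin_def by blast
  have 3: "3 \<le> card {y. ?E h y}" by (rule F.three_neighbours[OF cV h p ne])
  interpret T: cubic_tree ?V ?E
  proof
    show "\<not> {x, x} \<in> edges H" for x using EV(2) by blast
    show "conn ?E ?V" by (rule cV)
    show "\<exists>x\<in>?V. 3 \<le> card {y. ?E x y}" using h 3 by blast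
    show "card {y. {x, y} \<in> edges H} \<le> 3" for x
    proof (cases "x \<in> ?V")
      case True
      have "finite (edges H)" using g unfolding graph_def by (meson Pow_iff finite_Pow_iff finite_subset subsetI)
      then have f: "finite {e \<in> edges H. x \<in> e}" by simp
      have "inj_on (\<lambda>y. {x, y}) {y. {x, y} \<in> edges H}" by (rule inj_onI) (auto simp: doubleton_eq_iff)
      then have "card {y. {x, y} \<in> edges H} \<le> card {e \<in> edges H. x \<in> e}"
        by (rule card_inj_on_le[OF _ _ f]) auto
      then show ?thesis using t(2) True unfolding subcubic_def degree_def by force
    next
      case False
      then have "{y. {x, y} \<in> edges H} = {}" using EV(1) by blast
      then show ?thesis by simp
    qed
  qed
  have "h \<in> T.Q" unfolding T.Q_def using h 3 by blast
  then show ?thesis by (rule T.obstruction_tree[OF h p ne tn])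
qed

section \<open>Long ladders\<close>

text \<open>Only the four corners have degree two. Each end column is contracted onto its neighbour
  on the rail \<open>True\<close>; the remaining edge of the column on the rail \<open>False\<close>
  becomes a rung that is already there. So the ladder loses exactly two columns.\<close>

lemma ladder_obstruction:
  fixes n :: nat
  assumes n: "69 \<le> n"
  defines "EH \<equiv> \<lambda>x y. lad x y \<and> fst x < n + 2 \<and> fst y < n + 2"
  shows "obstruction ({..<n + 2} \<times> UNIV) EH"
proof -
  let ?V = "{..<n + 2} \<times> (UNIV :: bool set)" and ?Q = "{1..n} \<times> (UNIV :: bool set)"
  define own :: "nat \<times> bool \<Rightarrow> nat \<times> bool" where
    "own x = (if fst x = 0 then (1, True) else if fst x = n + 1 then (n, True) else x)" for x
  have symH: "symp EH" unfolding EH_def using symp_lad by (auto simp: symp_def)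
  have inner: "card {y. EH (i, s) y} = 3" if "i \<in> {1..n}" for i s
  proof -
    have "{y. EH (i, s) y} = {(i - 1, s), (i + 1, s), (i, \<not> s)}"
      unfolding EH_def lad_def using that by auto
    then show ?thesis using that by simp
  qed
  have outer: "card {y. EH (i, s) y} \<le> 2" if "i = 0 \<or> i = n + 1" for i s
  proof -
    have "{y. EH (i, s) y} \<subseteq> {(if i = 0 then 1 else n, s), (i, \<not> s)}"
      unfolding EH_def lad_def using that by auto
    then have "card {y. EH (i, s) y} \<le> card {(if i = 0 then 1 else n, s), (i, \<not> s)}" by (intro card_mono) auto
    also have "\<dots> \<le> 2" by (simp add: card_insert_if)
    finally show ?thesis .
  qed
  have Q: "?Q = {x \<in> ?V. 3 \<le> card {y. EH x y}}"
  proof (rule set_eqI)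
    fix x :: "nat \<times> bool"
    obtain i s where x: "x = (i, s)" by (cases x)
    show "x \<in> ?Q \<longleftrightarrow> x \<in> {x \<in> ?V. 3 \<le> card {y. EH x y}}"
    proof (cases "i \<in> {1..n}")
      case True then show ?thesis unfolding x using inner[OF True, of s] by auto
    next
      case False
      then consider "i = 0 \<or> i = n + 1" | "n + 1 < i" by auto linarith
      then show ?thesis
      proof cases
        case 1 then show ?thesis unfolding x using outer[OF 1, of s] False by auto
      next
        case 2 then show ?thesis unfolding x by auto
      qed
    qed
  qed
  interpret K: contraction ?V EH ?Q own
  proof
    show "finite ?V" by simp
    show "symp EH" by (rule symH)
    show "\<not> EH x x" for x unfolding EH_def lad_def by auto
    show "EH x y \<Longrightarrow> x \<in> ?V \<and> y \<in> ?V" for x y unfolding EH_def by (auto simp: mem_Times_iff)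
    show "?Q = {x \<in> ?V. 3 \<le> card {y. EH x y}}" by (rule Q)
    show "x \<in> ?Q \<Longrightarrow> own x = x" for x unfolding own_def by auto
    show "x \<in> ?V \<Longrightarrow> own x \<in> ?Q" for x unfolding own_def using n by auto
    show "EH x y \<Longrightarrow> x \<notin> ?Q \<Longrightarrow> y \<notin> ?Q \<Longrightarrow> own x = own y" for x y
      unfolding own_def EH_def lad_def using n by (auto simp: mem_Times_iff)
    fix w assume w: "w \<in> ?V - ?Q"
    then have fw: "fst w = 0 \<or> fst w = n + 1" by (auto simp: mem_Times_iff)
    let ?z = "(fst w, True)"
    have z: "?z \<in> ?V - ?Q" using fw by auto
    have "?z \<in> comp_of EH (?V - ?Q) w"
    proof (cases "snd w")
      case True
      then have "?z = w" by (simp add: prod_eq_iff)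
      then show ?thesis using comp_of_self[OF w] by simp
    next
      case False
      have "EH w ?z" unfolding EH_def lad_def using False fw by auto
      then show ?thesis by (rule comp_of_closed[OF symH w comp_of_self[OF w] z])
    qed
    moreover have "EH ?z (own w)" unfolding EH_def lad_def own_def using fw n by auto
    ultimately show "\<exists>w'\<in>comp_of EH (?V - ?Q) w. EH w' (own w)" by blast
  qed
  have EK: "K.EK = lads n"
  proof (intro ext iffI)
    fix x y assume "K.EK x y"
    then obtain p q where pq: "x \<noteq> y" "EH p q" "x = own p" "y = own q" unfolding K.EK_def by blast
    obtain i s j s' where p: "p = (i, s)" "q = (j, s')" by (cases p, cases q)
    show "lads n x y" using pq(1,2) n unfolding pq(3,4) p own_def lads_def EH_def lad_def
      by (auto split: if_splits)
  next
    fix x y assume h: "lads n x y"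
    then have "EH x y" "own x = x" "own y = y" "x \<noteq> y" unfolding lads_def EH_def own_def lad_def by auto
    then show "K.EK x y" unfolding K.EK_def by blast
  qed
  have own_fix: "p = (j, True)" if "own p = (j, True)" "j \<noteq> 1" "j \<noteq> n" for p j
    using that unfolding own_def by (auto split: if_splits)
  have own_j: "own (j, True) = (j, True)" if "j \<noteq> 0" "j \<noteq> n + 1" for j unfolding own_def using that by simp
  have host: "host ?V EH ?Q own (27, True) (28, True) (n - 27, True) (n - 26, True)
    (27, True) (28, True) (n - 27, True) (n - 26, True) r" if r: "0 < r" for r
  proof (intro host.intro K.contraction_axioms host_axioms.intro)
    show "EH (27, True) (28, True)" "EH (n - 27, True) (n - 26, True)" unfolding EH_def lad_def using n by auto
    show "p = (27, True) \<and> q = (28, True)" if "own p = (27, True)" "own q = (28, True)" for p q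
      using own_fix[OF that(1)] own_fix[OF that(2)] n by auto
    show "p = (n - 27, True) \<and> q = (n - 26, True)" if "own p = (n - 27, True)" "own q = (n - 26, True)" for p q
      using own_fix[OF that(1)] own_fix[OF that(2)] n by auto
  qed (use n r own_j in auto)
  have link: "linkage r EW"
    if "0 < r" "symp EW" "\<And>x y. EW x y \<Longrightarrow> wall r x y"
      "model ?Q K.EK (gam K.EK (27, True) (28, True) (n - 27, True) (n - 26, True) r EW) \<gamma>"
      "\<And>x. x \<in> ?Q \<Longrightarrow> \<gamma> x \<subseteq> Inl ` ?Q \<union> range Inr" for r EW \<gamma>
    by (rule ladder_linkage, rule ladder_host.intro[OF n that(1-3)]) (use that(4,5) in \<open>simp_all add: EK\<close>)
  show ?thesis unfolding obstruction_def
    by (rule exI[of _ ?Q], rule exI[of _ own], rule exI[of _ "(27, True)"], rule exI[of _ "(28, True)"],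
        rule exI[of _ "(n - 27, True)"], rule exI[of _ "(n - 26, True)"], rule exI[of _ "(27, True)"], rule exI[of _ "(28, True)"],
        rule exI[of _ "(n - 27, True)"], rule exI[of _ "(n - 26, True)"]) (use host link in blast)
qed

section \<open>Expansions\<close>

lemma isomorphic_sym:
  assumes "graph G" "isomorphic G H"
  shows "isomorphic H G"
proof -
  obtain f where f: "bij_betw f (verts G) (verts H)" "edges H = (\<lambda>e. f ` e) ` edges G"
    using assms(2) unfolding isomorphic_def by blast
  let ?g = "inv_into (verts G) f"
  have "?g ` f ` e = e" if "e \<in> edges G" for e
    using inv_into_image_cancel[of f "verts G" e] f(1) that assms(1) unfolding bij_betw_def graph_def by blast
  then have "edges G = (\<lambda>e. ?g ` e) ` edges H" unfolding f(2) image_image by simp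
  then show ?thesis unfolding isomorphic_def using bij_betw_inv_into[OF f(1)] by blast
qed

lemma minor_isomorphic:
  assumes "isomorphic H H'" "minor H' G"
  shows "minor H G"
proof -
  obtain f where f: "bij_betw f (verts H) (verts H')" "edges H' = (\<lambda>e. f ` e) ` edges H"
    using assms(1) unfolding isomorphic_def by blast
  obtain \<beta> where b: "\<forall>x\<in>verts H'. \<beta> x \<subseteq> verts G \<and> connected_graph (induced_subgraph G (\<beta> x))"
    "\<forall>x\<in>verts H'. \<forall>y\<in>verts H'. x \<noteq> y \<longrightarrow> \<beta> x \<inter> \<beta> y = {}"
    "\<forall>x y. {x, y} \<in> edges H' \<longrightarrow> (\<exists>a\<in>\<beta> x. \<exists>b\<in>\<beta> y. {a, b} \<in> edges G)" using assms(2) unfolding minor_def by blast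
  have fV: "f x \<in> verts H'" if "x \<in> verts H" for x using f(1) that unfolding bij_betw_def by blast
  have fne: "f x \<noteq> f y" if "x \<in> verts H" "y \<in> verts H" "x \<noteq> y" for x y
    using f(1) that unfolding bij_betw_def inj_on_def by blast
  have fE: "{f x, f y} \<in> edges H'" if "{x, y} \<in> edges H" for x y
    unfolding f(2) by (rule image_eqI[OF _ that]) simp
  show ?thesis unfolding minor_def
  proof (rule exI[of _ "\<lambda>x. \<beta> (f x)"], intro conjI ballI allI impI)
    show "\<beta> (f x) \<subseteq> verts G" "connected_graph (induced_subgraph G (\<beta> (f x)))" if "x \<in> verts H" for x
      using b(1) fV[OF that] by blast+
    show "\<beta> (f x) \<inter> \<beta> (f y) = {}" if "x \<in> verts H" "y \<in> verts H" "x \<noteq> y" for x y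
      using b(2) fV[OF that(1)] fV[OF that(2)] fne[OF that] by blast
    show "\<exists>a\<in>\<beta> (f x). \<exists>b\<in>\<beta> (f y). {a, b} \<in> edges G" if "{x, y} \<in> edges H" for x y
      using b(3) fE[OF that] by blast
  qed
qed

lemma expansions_isomorphic:
  assumes "graph H" "isomorphic H H'"
  shows "expansions H = expansions H'"
proof -
  have "isomorphic H' H" by (rule isomorphic_sym[OF assms])
  then show ?thesis unfolding expansions_def using minor_isomorphic[OF assms(2)] minor_isomorphic[of H' H] by blast
qed

lemma connected_induced:
  assumes "graph G" "U \<subseteq> verts G"
  shows "connected_graph (induced_subgraph G U) \<longleftrightarrow> conn (\<lambda>x y. {x, y} \<in> edges G) U"
proof -
  let ?I = "induced_subgraph G U"
  have "graph ?I" using assms unfolding graph_def induced_subgraph_def by auto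
  then have "connected_graph ?I \<longleftrightarrow> conn (\<lambda>x y. {x, y} \<in> edges ?I) (verts ?I)" by (rule connected_graph_iff)
  also have "verts ?I = U" using assms(2) unfolding induced_subgraph_def by auto
  also have "conn (\<lambda>x y. {x, y} \<in> edges ?I) U \<longleftrightarrow> conn (\<lambda>x y. {x, y} \<in> edges G) U"
    by (rule iffI; erule conn_mono) (simp_all add: induced_subgraph_def)
  finally show ?thesis .
qed

lemma minor_iff_model:
  assumes "graph H" "graph G"
  shows "minor H G \<longleftrightarrow> (\<exists>\<beta>. model (verts H) (\<lambda>x y. {x, y} \<in> edges H) (\<lambda>x y. {x, y} \<in> edges G) \<beta> \<and>
    (\<forall>x\<in>verts H. \<beta> x \<subseteq> verts G))"
proof -
  have EV: "x \<in> verts H \<and> y \<in> verts H" if "{x, y} \<in> edges H" for x y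
    using assms(1) that unfolding graph_def by blast
  show ?thesis
  proof
    assume "minor H G"
    then obtain \<beta> where b: "\<forall>x\<in>verts H. \<beta> x \<subseteq> verts G \<and> connected_graph (induced_subgraph G (\<beta> x))"
      "\<forall>x\<in>verts H. \<forall>y\<in>verts H. x \<noteq> y \<longrightarrow> \<beta> x \<inter> \<beta> y = {}"
      "\<forall>x y. {x, y} \<in> edges H \<longrightarrow> (\<exists>a\<in>\<beta> x. \<exists>b\<in>\<beta> y. {a, b} \<in> edges G)" unfolding minor_def by blast
    have "conn (\<lambda>x y. {x, y} \<in> edges G) (\<beta> x)" if "x \<in> verts H" for x
      using connected_induced[OF assms(2)] b(1) that by blast
    then show "\<exists>\<beta>. model (verts H) (\<lambda>x y. {x, y} \<in> edges H) (\<lambda>x y. {x, y} \<in> edges G) \<beta> \<and> (\<forall>x\<in>verts H. \<beta> x \<subseteq> verts G)"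
      unfolding model_def adj_def using b by (intro exI[of _ \<beta>]) simp
  next
    assume "\<exists>\<beta>. model (verts H) (\<lambda>x y. {x, y} \<in> edges H) (\<lambda>x y. {x, y} \<in> edges G) \<beta> \<and> (\<forall>x\<in>verts H. \<beta> x \<subseteq> verts G)"
    then obtain \<beta> where b: "model (verts H) (\<lambda>x y. {x, y} \<in> edges H) (\<lambda>x y. {x, y} \<in> edges G) \<beta>"
      "\<forall>x\<in>verts H. \<beta> x \<subseteq> verts G" by blast
    have "connected_graph (induced_subgraph G (\<beta> x))" if "x \<in> verts H" for x
      using connected_induced[OF assms(2)] b(2) model_conn[OF b(1)] that by blast
    moreover have "\<exists>a\<in>\<beta> x. \<exists>b\<in>\<beta> y. {a, b} \<in> edges G" if "{x, y} \<in> edges H" for x y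
      using model_adj[OF b(1), of x y] EV[OF that] that unfolding adj_def by blast
    moreover have "\<beta> x \<inter> \<beta> y = {}" if "x \<in> verts H" "y \<in> verts H" "x \<noteq> y" for x y
      using model_disj[OF b(1) that(1,2)] that(3) by blast
    ultimately show "minor H G" unfolding minor_def using b(2) by (intro exI[of _ \<beta>]) simp
  qed
qed

lemma member_model:
  assumes H: "graph H" and S: "member_subgraph (expansions H) G S"
  shows "\<exists>\<beta>. model (verts H) (\<lambda>x y. {x, y} \<in> edges H) (\<lambda>x y. {x, y} \<in> edges S) \<beta> \<and> (\<forall>x\<in>verts H. \<beta> x \<subseteq> verts S)"
proof -
  obtain F :: "nat ugraph" where F: "graph S" "graph F" "minor H F" "isomorphic S F"
  proof -
    obtain F where "F \<in> expansions H" "isomorphic S F" "subgraph S G" using S unfolding member_subgraph_def by blast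
    then show ?thesis using that[of F] unfolding expansions_def subgraph_def by simp
  qed
  obtain f where f: "bij_betw f (verts S) (verts F)" "edges F = (\<lambda>e. f ` e) ` edges S"
    using F(4) unfolding isomorphic_def by blast
  obtain \<beta> where b: "model (verts H) (\<lambda>x y. {x, y} \<in> edges H) (\<lambda>x y. {x, y} \<in> edges F) \<beta>"
    "\<And>x. x \<in> verts H \<Longrightarrow> \<beta> x \<subseteq> verts F" using F(3) minor_iff_model[OF H F(2)] by blast
  have inj: "inj_on f (verts S)" and im: "f ` verts S = verts F" using f(1) unfolding bij_betw_def by blast+
  have "{x, y} \<in> edges S" if h: "x \<in> verts S" "y \<in> verts S" "{f x, f y} \<in> edges F" for x y
  proof -
    obtain e where e: "e \<in> edges S" "f ` {x, y} = f ` e" using h(3) unfolding f(2) by auto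
    have "e \<subseteq> verts S" using F(1) e(1) unfolding graph_def by blast
    then have "{x, y} = e" using inj_on_image_eq_iff[OF inj, of "{x, y}" e] h e(2) by simp
    then show ?thesis using e(1) by simp
  qed
  then have "model (verts H) (\<lambda>x y. {x, y} \<in> edges H) (\<lambda>x y. {x, y} \<in> edges S) (\<lambda>x. {g \<in> verts S. f g \<in> \<beta> x})"
    by (intro model_pull[OF b(1) inj]) (use b(2) im in auto)
  then show ?thesis by blast
qed

lemma (in host) counterexample:
  fixes H :: "'a ugraph"
  assumes H: "graph H" and V: "V = verts H" and EH: "EH = (\<lambda>x y. {x, y} \<in> edges H)"
    and link: "\<And>EW \<gamma>. symp EW \<Longrightarrow> (\<And>x y. EW x y \<Longrightarrow> wall r x y) \<Longrightarrow> model Q EK (gam EK a b c d r EW) \<gamma> \<Longrightarrow>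
      (\<And>x. x \<in> Q \<Longrightarrow> \<gamma> x \<subseteq> Inl ` Q \<union> range Inr) \<Longrightarrow> linkage r EW"
  obtains G where "graph G"
    "\<And>S S'. member_subgraph (expansions H) G S \<Longrightarrow> member_subgraph (expansions H) G S' \<Longrightarrow> edges S \<inter> edges S' \<noteq> {}"
    "\<And>X. X \<subseteq> edges G \<Longrightarrow> card X < t \<Longrightarrow> card X < r \<Longrightarrow> \<exists>S. member_subgraph (expansions H) G S \<and> X \<inter> edges S = {}"
proof -
  obtain f :: "'a gv \<Rightarrow> nat" where f: "inj_on f GV" using finite_imp_inj_to_nat_seg[OF finGV] by blast
  define G where "G = \<lparr>verts = f ` GV, edges = {{f g, f h} |g h. GE g h}\<rparr>"
  have fe: "{f g, f h} = {f g', f h'} \<longleftrightarrow> {g, h} = {g', h'}" if "g \<in> GV" "h \<in> GV" "g' \<in> GV" "h' \<in> GV" for g h g' h'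
    using inj_on_image_eq_iff[OF f, of "{g, h}" "{g', h'}"] that by simp
  have graphG: "graph G" unfolding graph_def
  proof (intro conjI ballI)
    show "finite (verts G)" unfolding G_def using finGV by simp
    fix e assume "e \<in> edges G"
    then obtain g h where gh: "e = {f g, f h}" "GE g h" unfolding G_def by auto
    then have "g \<in> GV" "h \<in> GV" "g \<noteq> h" using GE_GV GE_irrefl by blast+
    then have "f g \<noteq> f h" using f by (auto dest: inj_onD)
    then show "e \<subseteq> verts G" "card e = 2" using gh(1) \<open>g \<in> GV\<close> \<open>h \<in> GV\<close> unfolding G_def by simp_all
  qed
  have finE: "finite (edges G)"
    using graphG unfolding graph_def by (meson Pow_iff finite_Pow_iff finite_subset subsetI)
  define W where "W S w u \<longleftrightarrow> Qv (Inr w) \<in> GV \<and> Qv (Inr u) \<in> GV \<and> {f (Qv (Inr w)), f (Qv (Inr u))} \<in> edges S"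
    for S :: "nat ugraph" and w u
  have link_member: "linkage r (W S)" "\<And>x y. W S x y \<Longrightarrow> wall r x y" "symp (W S)"
    if S: "member_subgraph (expansions H) G S" for S
  proof -
    \<comment> \<open>The member read back in the host graph before its vertices were numbered by
      \<open>f\<close>; \<open>W S\<close> is its part in the wall.\<close>
    define ES where "ES g h \<longleftrightarrow> g \<in> GV \<and> h \<in> GV \<and> {f g, f h} \<in> edges S" for g h
    have symES: "symp ES" unfolding ES_def by (auto simp: symp_def insert_commute)
    have sub: "edges S \<subseteq> edges G" "verts S \<subseteq> verts G" using S unfolding member_subgraph_def subgraph_def by blast+
    have ESG: "GE g h" if gh: "ES g h" for g h
    proof -
      have "{f g, f h} \<in> edges G" using gh sub(1) unfolding ES_def by blast
      then obtain g' h' where gh': "{f g, f h} = {f g', f h'}" "GE g' h'" unfolding G_def by auto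
      then have "{g, h} = {g', h'}" using fe[of g h g' h'] gh GE_GV unfolding ES_def by blast
      then have "g = g' \<and> h = h' \<or> g = h' \<and> h = g'" by (simp add: doubleton_eq_iff)
      moreover have "GE h' g'" using gh'(2) symGE by (auto dest: sympD)
      ultimately show ?thesis using gh'(2) by blast
    qed
    obtain \<beta> where b: "model V EH (\<lambda>x y. {x, y} \<in> edges S) \<beta>" "\<And>x. x \<in> V \<Longrightarrow> \<beta> x \<subseteq> verts S"
      using member_model[OF H S] unfolding V EH by blast
    have m: "model V EH ES (\<lambda>x. {g \<in> GV. f g \<in> \<beta> x})"
      by (rule model_pull[OF b(1) f]) (use b(2) sub(2) in \<open>auto simp: G_def ES_def\<close>)
    obtain \<gamma> where g: "model Q EK (gam EK a b c d r (\<lambda>w u. ES (Qv (Inr w)) (Qv (Inr u)))) \<gamma>"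
      "\<And>x. x \<in> Q \<Longrightarrow> \<gamma> x \<subseteq> Inl ` Q \<union> range Inr" using project[OF symES ESG m] by blast
    have WS: "W S = (\<lambda>w u. ES (Qv (Inr w)) (Qv (Inr u)))" unfolding W_def ES_def by blast
    show 1: "symp (W S)" using symES unfolding WS by (auto simp: symp_def)
    show 2: "wall r x y" if "W S x y" for x y using ESG[of "Qv (Inr x)" "Qv (Inr y)"] that unfolding WS GE_Qv by simp
    show "linkage r (W S)" by (rule link[OF 1 2]) (use g in \<open>simp_all add: WS\<close>)
  qed
  show ?thesis
  proof (rule that[OF graphG])
    fix S S' assume S: "member_subgraph (expansions H) G S" "member_subgraph (expansions H) G S'"
    have "\<exists>x y. W S x y \<and> W S' x y"
      by (rule linkages_share_edge[OF link_member(1)[OF S(1)] link_member(1)[OF S(2)]])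
        (use link_member(2,3) S in blast)+
    then show "edges S \<inter> edges S' \<noteq> {}" unfolding W_def by blast
  next
    fix X assume X: "X \<subseteq> edges G" "card X < t" "card X < r"
    have finX: "finite X" using X(1) finE by (rule finite_subset)
    let ?X = "{e. e \<subseteq> GV \<and> f ` e \<in> X}"
    have inj: "inj_on (image f) ?X"
      by (rule inj_onI) (metis (no_types, lifting) f inj_on_image_eq_iff mem_Collect_eq)
    have im: "image f ` ?X \<subseteq> X" by blast
    have "finite ?X" by (rule inj_on_finite[OF inj im finX])
    moreover have "card ?X \<le> card X" by (rule card_inj_on_le[OF inj im finX])
    ultimately obtain \<beta> where b: "model V EH (\<lambda>g h. GE g h \<and> {g, h} \<notin> ?X) \<beta>" "\<And>x. x \<in> V \<Longrightarrow> \<beta> x \<subseteq> GV"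
      using embed[of ?X] X(2,3) by force
    \<comment> \<open>Adding vertices and edges to an expansion gives an expansion, so all of
      \<open>G\<close> without \<open>X\<close> can serve as the member.\<close>
    define S where "S = \<lparr>verts = verts G, edges = edges G - X\<rparr>"
    have graphS: "graph S" using graphG unfolding graph_def S_def by simp
    have edge: "{f g, f h} \<in> edges S" if "GE g h" "{g, h} \<notin> ?X" for g h
    proof -
      have "{f g, f h} \<in> edges G" unfolding G_def using that(1) by auto
      moreover have "{f g, f h} \<notin> X" using that GE_GV[OF that(1)] by auto
      ultimately show ?thesis unfolding S_def by simp
    qed
    have "model V EH (\<lambda>x y. {x, y} \<in> edges S) (\<lambda>x. f ` \<beta> x)"
      unfolding model_def
    proof (intro conjI ballI impI)
      fix x y assume xy: "x \<in> V" "y \<in> V"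
      show "conn (\<lambda>x y. {x, y} \<in> edges S) (f ` \<beta> x)"
        by (rule conn_image[OF model_conn[OF b(1) xy(1)]]) (use edge in blast)
      show "f ` \<beta> x \<inter> f ` \<beta> y = {}" if "x \<noteq> y"
      proof -
        have "\<beta> x \<inter> \<beta> y = {}" using model_disj[OF b(1) xy] that by blast
        then show ?thesis using inj_on_image_Int[OF f b(2)[OF xy(1)] b(2)[OF xy(2)]] by simp
      qed
      show "adj (\<lambda>x y. {x, y} \<in> edges S) (f ` \<beta> x) (f ` \<beta> y)" if "EH x y"
        using model_adj[OF b(1) xy that] edge unfolding adj_def by blast
    qed
    moreover have "f ` \<beta> x \<subseteq> verts S" if "x \<in> V" for x using b(2)[OF that] unfolding S_def G_def by auto
    ultimately have "minor H S" using minor_iff_model[OF H graphS] unfolding V EH by blast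
    then have "S \<in> expansions H" unfolding expansions_def using graphS by blast
    moreover have "isomorphic S S" unfolding isomorphic_def by (rule exI[of _ id]) simp
    moreover have "subgraph S G" unfolding subgraph_def using graphS by (simp add: S_def)
    ultimately have "member_subgraph (expansions H) G S" unfolding member_subgraph_def by blast
    moreover have "X \<inter> edges S = {}" unfolding S_def by auto
    ultimately show "\<exists>S. member_subgraph (expansions H) G S \<and> X \<inter> edges S = {}" by blast
  qed
qed

lemma obstruction_not_edge_erdos_posa:
  assumes H: "graph H" and o: "obstruction (verts H) (\<lambda>x y. {x, y} \<in> edges H)"
  shows "\<not> edge_erdos_posa (expansions H)"
proof
  let ?E = "\<lambda>x y. {x, y} \<in> edges H"
  assume "edge_erdos_posa (expansions H)"
  then obtain f :: "nat \<Rightarrow> real" where f: "\<And>G k. graph G \<Longrightarrow>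
        (\<exists>\<S>. finite \<S> \<and> card \<S> = k \<and> (\<forall>S\<in>\<S>. member_subgraph (expansions H) G S) \<and>
             (\<forall>S\<in>\<S>. \<forall>T\<in>\<S>. S \<noteq> T \<longrightarrow> edges S \<inter> edges T = {})) \<or>
        (\<exists>X. X \<subseteq> edges G \<and> real (card X) \<le> f k \<and>
             (\<forall>S. member_subgraph (expansions H) G S \<longrightarrow> X \<inter> edges S \<noteq> {}))"
    unfolding edge_erdos_posa_def by blast
  \<comment> \<open>The size of the wall and the number of copies exceed every edge set of at most
    \<open>f 2\<close> elements. If \<open>f 2\<close> is negative, the value is 1.\<close>
  define r where "r = Suc (nat \<lceil>f 2\<rceil>)"
  have r: "0 < r" "\<And>m. real m \<le> f 2 \<Longrightarrow> m < r" unfolding r_def by (auto simp: less_Suc_eq_le) linarith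
  obtain Q own p1 q1 p2 q2 a b c d where host: "host (verts H) ?E Q own p1 q1 p2 q2 a b c d r"
    and link: "\<And>EW \<gamma>. symp EW \<Longrightarrow> (\<And>x y. EW x y \<Longrightarrow> wall r x y) \<Longrightarrow>
        model Q (contraction.EK ?E own) (gam (contraction.EK ?E own) a b c d r EW) \<gamma> \<Longrightarrow>
        (\<And>x. x \<in> Q \<Longrightarrow> \<gamma> x \<subseteq> Inl ` Q \<union> range Inr) \<Longrightarrow> linkage r EW"
    using o r(1) unfolding obstruction_def by metis
  obtain G where G: "graph G"
    "\<And>S S'. member_subgraph (expansions H) G S \<Longrightarrow> member_subgraph (expansions H) G S' \<Longrightarrow> edges S \<inter> edges S' \<noteq> {}"
    "\<And>X. X \<subseteq> edges G \<Longrightarrow> card X < r \<Longrightarrow> card X < r \<Longrightarrow> \<exists>S. member_subgraph (expansions H) G S \<and> X \<inter> edges S = {}"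
    by (rule host.counterexample[OF host H refl refl, of r, OF link]) blast+
  from f[OF G(1), of 2] show False
  proof (elim disjE exE conjE)
    fix \<S> assume "card \<S> = 2" and mem: "\<forall>S\<in>\<S>. member_subgraph (expansions H) G S"
      and dis: "\<forall>S\<in>\<S>. \<forall>T\<in>\<S>. S \<noteq> T \<longrightarrow> edges S \<inter> edges T = {}"
    then obtain S T where "S \<in> \<S>" "T \<in> \<S>" "S \<noteq> T" unfolding card_2_iff by auto
    then show False using mem dis G(2) by blast
  next
    fix X assume X: "X \<subseteq> edges G" "real (card X) \<le> f 2"
      and hit: "\<forall>S. member_subgraph (expansions H) G S \<longrightarrow> X \<inter> edges S \<noteq> {}"
    show False using G(3)[OF X(1) r(2)[OF X(2)] r(2)[OF X(2)]] hit by blast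
  qed
qed

lemma ladder_not_edge_erdos_posa:
  fixes H :: "'a ugraph"
  assumes l: "71 \<le> l" and L: "is_ladder l H"
  shows "\<not> edge_erdos_posa (expansions H)"
proof -
  obtain u v where uv: "inj_on u {1..l}" "inj_on v {1..l}" "u ` {1..l} \<inter> v ` {1..l} = {}"
    "verts H = u ` {1..l} \<union> v ` {1..l}"
    "edges H = {{u i, u (i + 1)} | i. i \<in> {1..<l}} \<union> {{v i, v (i + 1)} | i. i \<in> {1..<l}} \<union> {{u i, v i} | i. i \<in> {1..l}}"
    using L unfolding is_ladder_def by (elim exE conjE) (rule that; assumption)
  define n where "n = l - 2"
  have n: "69 \<le> n" "n + 2 = l" unfolding n_def using l by auto
  define E where "E x y \<longleftrightarrow> lad x y \<and> fst x < l \<and> fst y < l" for x y :: "nat \<times> bool"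
  define H0 where "H0 = \<lparr>verts = {..<l} \<times> (UNIV :: bool set), edges = {{x, y} |x y. E x y}\<rparr>"
  have symE: "E y x" if "E x y" for x y using that symp_lad unfolding E_def by (auto dest: sympD)
  have E0: "(\<lambda>x y. {x, y} \<in> edges H0) = E"
    unfolding H0_def using symE by (intro ext) (auto simp: doubleton_eq_iff)
  have EV: "x \<in> {..<l} \<times> UNIV \<and> y \<in> {..<l} \<times> UNIV \<and> x \<noteq> y" if "E x y" for x y
    using that unfolding E_def lad_def by (auto simp: mem_Times_iff)
  have g0: "graph H0" unfolding graph_def
  proof (intro conjI ballI)
    show "finite (verts H0)" unfolding H0_def by simp
    fix e assume "e \<in> edges H0"
    then obtain x y where "e = {x, y}" "E x y" unfolding H0_def by auto
    then show "e \<subseteq> verts H0" "card e = 2" using EV[of x y] unfolding H0_def by auto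
  qed
  have "obstruction (verts H0) (\<lambda>x y. {x, y} \<in> edges H0)"
  proof -
    have "E = (\<lambda>x y. lad x y \<and> fst x < l \<and> fst y < l)" by (intro ext) (simp add: E_def)
    moreover have "verts H0 = {..<l} \<times> UNIV" unfolding H0_def by simp
    ultimately show ?thesis using ladder_obstruction[OF n(1)] unfolding E0 n(2) by simp
  qed
  then have H0: "\<not> edge_erdos_posa (expansions H0)" by (rule obstruction_not_edge_erdos_posa[OF g0])
  have "isomorphic H0 H"
  proof -
    \<comment> \<open>The columns of \<open>is_ladder\<close> start at 1, those of \<open>H0\<close>
      at 0.\<close>
    define \<phi> where "\<phi> x = (if snd x then u (Suc (fst x)) else v (Suc (fst x)))" for x :: "nat \<times> bool"
    have sub: "i \<in> {1..l} \<Longrightarrow> \<exists>j<l. i = Suc j" for i by (cases i) auto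
    have "inj_on \<phi> ({..<l} \<times> UNIV)"
    proof (rule inj_onI)
      fix x y assume xy: "x \<in> {..<l} \<times> (UNIV :: bool set)" "y \<in> {..<l} \<times> (UNIV :: bool set)" "\<phi> x = \<phi> y"
      have m: "Suc (fst x) \<in> {1..l}" "Suc (fst y) \<in> {1..l}" using xy(1,2) by (auto simp: mem_Times_iff)
      have "u (Suc (fst x)) \<noteq> v (Suc (fst y))" "u (Suc (fst y)) \<noteq> v (Suc (fst x))" using uv(3) m by blast+
      then have "snd x = snd y" using xy(3) unfolding \<phi>_def by (auto split: if_splits)
      moreover have "fst x = fst y"
        using inj_onD[OF uv(1) _ m] inj_onD[OF uv(2) _ m] xy(3) calculation unfolding \<phi>_def by (auto split: if_splits)
      ultimately show "x = y" by (simp add: prod_eq_iff)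
    qed
    moreover have "\<phi> ` ({..<l} \<times> UNIV) = verts H"
    proof
      show "\<phi> ` ({..<l} \<times> UNIV) \<subseteq> verts H" unfolding uv(4) \<phi>_def by auto
      show "verts H \<subseteq> \<phi> ` ({..<l} \<times> UNIV)"
      proof
        fix w assume "w \<in> verts H"
        then consider i where "i \<in> {1..l}" "w = u i" | i where "i \<in> {1..l}" "w = v i" unfolding uv(4) by blast
        then show "w \<in> \<phi> ` ({..<l} \<times> UNIV)"
        proof cases
          case (1 i)
          then obtain j where "j < l" "i = Suc j" using sub by blast
          then show ?thesis using 1 by (intro image_eqI[of _ _ "(j, True)"]) (simp_all add: \<phi>_def)
        next
          case (2 i)
          then obtain j where "j < l" "i = Suc j" using sub by blast
          then show ?thesis using 2 by (intro image_eqI[of _ _ "(j, False)"]) (simp_all add: \<phi>_def)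
        qed
      qed
    qed
    moreover have "edges H = (\<lambda>e. \<phi> ` e) ` edges H0"
    proof
      have im: "{\<phi> x, \<phi> y} \<in> (\<lambda>e. \<phi> ` e) ` edges H0" if "E x y" for x y
      proof (rule image_eqI[of _ _ "{x, y}"])
        have "E x y = ({x, y} \<in> edges H0)" unfolding E0[symmetric] ..
        then show "{x, y} \<in> edges H0" using that by simp
      qed simp
      show "edges H \<subseteq> (\<lambda>e. \<phi> ` e) ` edges H0"
      proof
        fix e assume "e \<in> edges H"
        then consider i where "i \<in> {1..<l}" "e = {u i, u (i + 1)}" | i where "i \<in> {1..<l}" "e = {v i, v (i + 1)}"
          | i where "i \<in> {1..l}" "e = {u i, v i}" unfolding uv(5) by blast
        then show "e \<in> (\<lambda>e. \<phi> ` e) ` edges H0"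
        proof cases
          case (1 i)
          then have "E (i - 1, True) (i, True)" unfolding E_def lad_def by auto
          then show ?thesis using im[of "(i - 1, True)" "(i, True)"] 1 unfolding \<phi>_def by simp
        next
          case (2 i)
          then have "E (i - 1, False) (i, False)" unfolding E_def lad_def by auto
          then show ?thesis using im[of "(i - 1, False)" "(i, False)"] 2 unfolding \<phi>_def by simp
        next
          case (3 i)
          then have "E (i - 1, True) (i - 1, False)" unfolding E_def lad_def by auto
          then show ?thesis using im[of "(i - 1, True)" "(i - 1, False)"] 3 unfolding \<phi>_def by simp
        qed
      qed
      have rail: "{\<phi> (i, s), \<phi> (Suc i, s)} \<in> edges H" if "Suc i < l" for i s
      proof (cases s)
        case True
        then have "\<exists>k. {\<phi> (i, s), \<phi> (Suc i, s)} = {u k, u (k + 1)} \<and> k \<in> {1..<l}"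
          using that by (intro exI[of _ "Suc i"]) (simp add: \<phi>_def)
        then show ?thesis unfolding uv(5) by blast
      next
        case False
        then have "\<exists>k. {\<phi> (i, s), \<phi> (Suc i, s)} = {v k, v (k + 1)} \<and> k \<in> {1..<l}"
          using that by (intro exI[of _ "Suc i"]) (simp add: \<phi>_def)
        then show ?thesis unfolding uv(5) by blast
      qed
      have rung: "{\<phi> (i, True), \<phi> (i, False)} \<in> edges H" if "i < l" for i
      proof -
        have "\<exists>k. {\<phi> (i, True), \<phi> (i, False)} = {u k, v k} \<and> k \<in> {1..l}"
          using that by (intro exI[of _ "Suc i"]) (simp add: \<phi>_def)
        then show ?thesis unfolding uv(5) by blast
      qed
      show "(\<lambda>e. \<phi> ` e) ` edges H0 \<subseteq> edges H"
      proof
        fix e assume "e \<in> (\<lambda>e. \<phi> ` e) ` edges H0"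
        then obtain x y where e: "e = {\<phi> x, \<phi> y}" "E x y" unfolding H0_def by auto
        obtain i s j s' where x: "x = (i, s)" "y = (j, s')" by (cases x, cases y)
        have b: "i < l" "j < l" using e(2) unfolding x E_def by auto
        from e(2) consider "s' = s" "j = Suc i" | "s' = s" "i = Suc j" | "i = j" "s = True" "s' = False" | "i = j" "s = False" "s' = True"
          unfolding x E_def lad_def by fastforce
        then show "e \<in> edges H"
        proof cases
          case 1 then show ?thesis using rail[of i s] b unfolding e x by simp
        next
          case 2 then show ?thesis using rail[of j s] b unfolding e x by (simp add: insert_commute)
        next
          case 3 then show ?thesis using rung[of i] b unfolding e x by simp
        next
          case 4 then show ?thesis using rung[of i] b unfolding e x by (simp add: insert_commute)
        qed
      qed
    qed
    ultimately show ?thesis unfolding isomorphic_def bij_betw_def by (intro exI[of _ \<phi>]) (simp add: H0_def)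
  qed
  then have "expansions H0 = expansions H" by (rule expansions_isomorphic[OF g0])
  then show ?thesis using H0 by simp
qed

theorem theorem3:
  fixes H :: "'a ugraph"
  assumes "graph H"
    and "(\<exists>l\<ge>71. is_ladder l H) \<or> (tree H \<and> subcubic H \<and> pathwidth H \<ge> 19)"
  shows "\<not> edge_erdos_posa (expansions H)"
  using assms ladder_not_edge_erdos_posa obstruction_not_edge_erdos_posa tree_obstruction by blast

end
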